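(* Let $\mathbb{K}$ be a field, $n\ge1$, $A_i$ an $n\times n$ matrix over $\mathbb{K}$, and $R_i=R_{A_i}$ the associated rank function on $\mathcal{L}\times\mathcal{M}$. The resolvent of $f_i=(2n+1)\overline{R_i}$ on $K(\mathcal{L})\times K(\mathcal{M})$ can be computed in polynomial time; that is, there is a polynomial time algorithm which, given $A_i$, $\lambda>0$, $x^0\in K(\mathcal{L})$ and $y^0\in K(\mathcal{M})$, outputs the unique minimizer of $$(2n+1)\,\overline{R_i}(x,y)+\frac{1}{2\lambda}\bigl(d(x,x^0)^2+d(y,y^0)^2\bigr)$$ over $(x,y)\in K(\mathcal{L})\times K(\mathcal{M})$.
   Context: Lattices: $\mathcal{L}$ is the lattice of all vector subspaces of $\mathbb{K}^n$ ordered by inclusion, and $\mathcal{M}$ is the lattice of all vector subspaces of $\mathbb{K}^n$ ordered by reverse inclusion. Both are modular lattices of rank $n$. Products carry the componentwise order. $R_i:\mathcal{L}\times\mathcal{M}\to\mathbb{Z}$ is defined by $R_i(X,Y):=$ the rank of the bilinear form $(x,y)\mapsto x^\top A_i y$ restricted to $X\times Y$. Orthoscheme complex: for a modular lattice $\mathcal{N}$ of finite rank $N$, $K(\mathcal{N})$ is the set of formal convex combinations $\sum_{p}\lambda(p)p$ of elements of $\mathcal{N}$ whose support $\{p:\lambda(p)\ne 0\}$ is a (finite) chain. A simplex is the set of points whose support lies in a given chain. For a maximal chain $p_0\prec p_1\prec\cdots\prec p_N$, the corresponding maximal simplex $\sigma$ gets the metric $d_\sigma(x,y)=\|\varphi_\sigma(x)-\varphi_\sigma(y)\|_2$,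 where $\varphi_\sigma(\sum_{i=0}^N\lambda_ip_i)=\sum_{i=1}^N\lambda_i 1_{[i]}\in\mathbb{R}^N$ and $1_{[i]}$ is the 0/1 indicator vector of $\{1,\dots,i\}$. The distance $d$ on $K(\mathcal{N})$ is the induced length metric: the infimum of lengths of connecting paths, where path lengths are measured by summing $d_\sigma$ over subdivisions whose pieces lie in simplices. It is known that $K(\mathcal{N})$ is a complete CAT(0) space, and that $K(\mathcal{L}\times\mathcal{M})$ is isometric to $K(\mathcal{L})\times K(\mathcal{M})$ (with $\ell_2$-product metric) via $\sum_i\lambda_i(p_i,q_i)\mapsto(\sum_i\lambda_ip_i,\sum_i\lambda_iq_i)$; the two spaces are identified by this map. Lovász extension: for $f:\mathcal{N}\to\mathbb{R}$, $\overline f:K(\mathcal{N})\to\mathbb{R}$ is $\overline f(\sum_i\lambda_ip_i):=\sum_i\lambda_if(p_i)$. Resolvent: for a continuous convex $f$ on a complete CAT(0) space $K$ and $\lambda>0$, $J^f_\lambda(x)$ is the unique minimizer over $y\in K$ of $f(y)+\frac{1}{2\lambda}d(x,y)^2$. Computational conventions: a point is given by (rational) coefficients together with a chain of subspaces, each given by a matrix over $\mathbb{K}$ whose image (or kernel) is the subspace; "polynomial time" means a number of arithmetic operations and comparisons (in $\mathbb{K}$ and on coefficients) polynomial in $n$. *)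

theory Defs
  imports
    "HOL-Analysis.L2_Norm"
    "HOL-Library.Extended_Nonnegative_Real"
    "HOL-Computational_Algebra.Polynomial"
    "Jordan_Normal_Form.DL_Rank"
    "Jordan_Normal_Form.Matrix_Kernel"
begin

section \<open>Orthoscheme complexes\<close>

text \<open>Lattices are given by their order, as records of HOL-Algebra with an explicit carrier. The
  definitions below are meant for modular lattices of finite rank.\<close>

definition chain_in :: "('p, 'z) gorder_scheme \<Rightarrow> 'p set \<Rightarrow> bool" where
  "chain_in N C \<longleftrightarrow> C \<subseteq> carrier N \<and> (\<forall>p\<in>C. \<forall>q\<in>C. p \<sqsubseteq>\<^bsub>N\<^esub> q \<or> q \<sqsubseteq>\<^bsub>N\<^esub> p)"

text \<open>A maximal chain is given by its ascending enumeration \<open>[p\<^sub>0, \<dots>, p\<^sub>r]\<close>.\<close>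

definition maximal_chain :: "('p, 'z) gorder_scheme \<Rightarrow> 'p list \<Rightarrow> bool" where
  "maximal_chain N ps \<longleftrightarrow> chain_in N (set ps) \<and> sorted_wrt (\<sqsubset>\<^bsub>N\<^esub>) ps \<and>
     (\<forall>C. chain_in N C \<and> set ps \<subseteq> C \<longrightarrow> C = set ps)"

text \<open>A formal convex combination is its coefficient function.\<close>

definition support :: "('p \<Rightarrow> real) \<Rightarrow> 'p set" where
  "support x = {p. x p \<noteq> 0}"

definition orthoscheme_complex :: "('p, 'z) gorder_scheme \<Rightarrow> ('p \<Rightarrow> real) set" where
  "orthoscheme_complex N = {x. finite (support x) \<and> chain_in N (support x) \<and>
     (\<forall>p. 0 \<le> x p) \<and> (\<Sum>p\<in>support x. x p) = 1}"

definition simplex :: "('p, 'z) gorder_scheme \<Rightarrow> 'p list \<Rightarrow> ('p \<Rightarrow> real) set" where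
  "simplex N ps = {x \<in> orthoscheme_complex N. support x \<subseteq> set ps}"

text \<open>A vector of \<open>\<real>\<^sup>r\<close> is a function on \<open>{1..r}\<close>, where \<open>r = length ps - 1\<close>.\<close>

definition orthoscheme_coord :: "'p list \<Rightarrow> ('p \<Rightarrow> real) \<Rightarrow> nat \<Rightarrow> real" where
  "orthoscheme_coord ps x j = (\<Sum>i = 1..length ps - 1. x (ps ! i) * indicat_real {1..i} j)"

definition simplex_dist :: "'p list \<Rightarrow> ('p \<Rightarrow> real) \<Rightarrow> ('p \<Rightarrow> real) \<Rightarrow> real" where
  "simplex_dist ps x y =
     L2_set (\<lambda>j. orthoscheme_coord ps x j - orthoscheme_coord ps y j) {1..length ps - 1}"

text \<open>A subdivision \<open>0 = t\<^sub>0 < \<dots> < t\<^sub>m = 1\<close> of a path together with, for each of its pieces, a maximal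
  simplex containing the piece.\<close>

definition subdivision ::
  "('p, 'z) gorder_scheme \<Rightarrow> (real \<Rightarrow> 'p \<Rightarrow> real) \<Rightarrow> real list \<times> 'p list list \<Rightarrow> bool" where
  "subdivision N \<gamma> = (\<lambda>(ts, \<sigma>s). length ts = Suc (length \<sigma>s) \<and> sorted_wrt (<) ts \<and>
     hd ts = 0 \<and> last ts = 1 \<and>
     (\<forall>i<length \<sigma>s. maximal_chain N (\<sigma>s ! i) \<and> \<gamma> ` {ts ! i .. ts ! Suc i} \<subseteq> simplex N (\<sigma>s ! i)))"

definition subdivision_length ::
  "(real \<Rightarrow> 'p \<Rightarrow> real) \<Rightarrow> real list \<times> 'p list list \<Rightarrow> real" where
  "subdivision_length \<gamma> = (\<lambda>(ts, \<sigma>s).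
     \<Sum>i<length \<sigma>s. simplex_dist (\<sigma>s ! i) (\<gamma> (ts ! i)) (\<gamma> (ts ! Suc i)))"

definition path_length :: "('p, 'z) gorder_scheme \<Rightarrow> (real \<Rightarrow> 'p \<Rightarrow> real) \<Rightarrow> ennreal" where
  "path_length N \<gamma> = (SUP D \<in> Collect (subdivision N \<gamma>). ennreal (subdivision_length \<gamma> D))"

text \<open>Paths must admit a subdivision into pieces inside simplices, as otherwise the supremum above
  would be over the empty set and hence \<open>0\<close>. Within a simplex, continuity of all coefficients is
  continuity with respect to the metric of the simplex.\<close>

definition paths ::
  "('p, 'z) gorder_scheme \<Rightarrow> ('p \<Rightarrow> real) \<Rightarrow> ('p \<Rightarrow> real) \<Rightarrow> (real \<Rightarrow> 'p \<Rightarrow> real) set" where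
  "paths N x y = {\<gamma>. \<gamma> 0 = x \<and> \<gamma> 1 = y \<and> (\<forall>p. continuous_on {0..1} (\<lambda>t. \<gamma> t p)) \<and>
     (\<exists>D. subdivision N \<gamma> D)}"

definition complex_dist ::
  "('p, 'z) gorder_scheme \<Rightarrow> ('p \<Rightarrow> real) \<Rightarrow> ('p \<Rightarrow> real) \<Rightarrow> real" where
  "complex_dist N x y = enn2real (INF \<gamma> \<in> paths N x y. path_length N \<gamma>)"

definition lovasz_extension :: "('p \<Rightarrow> real) \<Rightarrow> ('p \<Rightarrow> real) \<Rightarrow> real" where
  "lovasz_extension f x = (\<Sum>p\<in>support x. x p * f p)"

subsection \<open>Products\<close>

definition prod_gorder :: "'p gorder \<Rightarrow> 'q gorder \<Rightarrow> ('p \<times> 'q) gorder" where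
  "prod_gorder L M = \<lparr>carrier = carrier L \<times> carrier M,
     eq = (\<lambda>(p, q) (p', q'). p .=\<^bsub>L\<^esub> p' \<and> q .=\<^bsub>M\<^esub> q'),
     le = (\<lambda>(p, q) (p', q'). p \<sqsubseteq>\<^bsub>L\<^esub> p' \<and> q \<sqsubseteq>\<^bsub>M\<^esub> q')\<rparr>"

text \<open>The identification of \<open>K(\<L> \<times> \<M>)\<close> with \<open>K(\<L>) \<times> K(\<M>)\<close>, sending \<open>\<Sum>\<^sub>i \<lambda>\<^sub>i (p\<^sub>i, q\<^sub>i)\<close> to
  \<open>(\<Sum>\<^sub>i \<lambda>\<^sub>i p\<^sub>i, \<Sum>\<^sub>i \<lambda>\<^sub>i q\<^sub>i)\<close>.\<close>

definition marginals :: "('p \<times> 'q \<Rightarrow> real) \<Rightarrow> ('p \<Rightarrow> real) \<times> ('q \<Rightarrow> real)" where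
  "marginals z = ((\<lambda>p. \<Sum>q | z (p, q) \<noteq> 0. z (p, q)), (\<lambda>q. \<Sum>p | z (p, q) \<noteq> 0. z (p, q)))"

definition lovasz_extension_prod ::
  "'p gorder \<Rightarrow> 'q gorder \<Rightarrow> ('p \<times> 'q \<Rightarrow> real) \<Rightarrow> ('p \<Rightarrow> real) \<times> ('q \<Rightarrow> real) \<Rightarrow> real" where
  "lovasz_extension_prod L M f xy =
     lovasz_extension f (inv_into (orthoscheme_complex (prod_gorder L M)) marginals xy)"

definition prod_dist ::
  "('a \<Rightarrow> 'a \<Rightarrow> real) \<Rightarrow> ('b \<Rightarrow> 'b \<Rightarrow> real) \<Rightarrow> 'a \<times> 'b \<Rightarrow> 'a \<times> 'b \<Rightarrow> real" where
  "prod_dist d d' = (\<lambda>(x, y) (x', y'). sqrt ((d x x')\<^sup>2 + (d' y y')\<^sup>2))"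

subsection \<open>Resolvents\<close>

text \<open>The resolvent of \<open>f\<close> with parameter \<open>lam\<close> at \<open>x\<close>, on a metric space with carrier \<open>K\<close> and
  distance \<open>d\<close>, exists and is \<open>y\<close>.\<close>

definition is_resolvent ::
  "'a set \<Rightarrow> ('a \<Rightarrow> 'a \<Rightarrow> real) \<Rightarrow> ('a \<Rightarrow> real) \<Rightarrow> real \<Rightarrow> 'a \<Rightarrow> 'a \<Rightarrow> bool" where
  "is_resolvent K d f lam x y \<longleftrightarrow>
     (let F = (\<lambda>z. f z + 1 / (2 * lam) * (d x z)\<^sup>2)
      in is_arg_min F (\<lambda>z. z \<in> K) y \<and> (\<forall>z. is_arg_min F (\<lambda>z. z \<in> K) z \<longrightarrow> z = y))"


section \<open>Subspace lattices and rank functions\<close>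

definition subspace_lattice :: "nat \<Rightarrow> 'k::field vec set gorder" where
  "subspace_lattice n = \<lparr>carrier = {X. VectorSpace.subspace class_ring X (module_vec TYPE('k) n)},
     eq = (=), le = (\<subseteq>)\<rparr>"

definition reverse_subspace_lattice :: "nat \<Rightarrow> 'k::field vec set gorder" where
  "reverse_subspace_lattice n = inv_gorder (subspace_lattice n)"

definition subspace_basis :: "nat \<Rightarrow> 'k::field vec set \<Rightarrow> 'k vec list \<Rightarrow> bool" where
  "subspace_basis n X bs \<longleftrightarrow> distinct bs \<and>
     vectorspace.basis class_ring (module_vec TYPE('k) n \<lparr>carrier := X\<rparr>) (set bs)"

definition gram_matrix :: "'k::field mat \<Rightarrow> 'k vec list \<Rightarrow> 'k vec list \<Rightarrow> 'k mat" where
  "gram_matrix A bs cs = mat (length bs) (length cs) (\<lambda>(i, j). bs ! i \<bullet> (A *\<^sub>v (cs ! j)))"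

text \<open>The rank of the bilinear form \<open>(x, y) \<mapsto> x\<^sup>T A y\<close> restricted to \<open>X \<times> Y\<close> is the rank of the matrix
  representing it in any bases of \<open>X\<close> and \<open>Y\<close>.\<close>

definition rank_function :: "nat \<Rightarrow> 'k::field mat \<Rightarrow> 'k vec set \<times> 'k vec set \<Rightarrow> int" where
  "rank_function n A = (\<lambda>(X, Y). THE r. \<exists>bs cs. subspace_basis n X bs \<and> subspace_basis n Y cs \<and>
     r = int (vec_space.rank (length bs) (gram_matrix A bs cs)))"


section \<open>Arithmetic programs\<close>

text \<open>An arithmetic random access machine, programmed in a while language. Its memory consists of
  arrays (named by strings, with any number of indices) of three kinds: naturals for addressing and
  control, elements of the field, and coefficients. The only primitives are field operations and
  equality tests on field elements, field operations and order comparisons on coefficients, and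
  addition, truncated subtraction and comparison of naturals; multiplication of naturals is omitted
  because at unit cost it would not be a realistic addressing operation. Coefficients are real
  numbers, but the only constants are \<open>0\<close> and \<open>1\<close>, so that computations on rational coefficients
  stay rational (see \<open>runs_rational\<close> below). As usual \<open>a / 0 = 0\<close>.\<close>

record 'k state =
  imem :: "string \<Rightarrow> nat list \<Rightarrow> nat"
  kmem :: "string \<Rightarrow> nat list \<Rightarrow> 'k"
  cmem :: "string \<Rightarrow> nat list \<Rightarrow> real"

datatype iexp = INum nat | IRead string "iexp list" | IAdd iexp iexp | ISub iexp iexp

datatype kexp = KZero | KOne | KRead string "iexp list"
  | KAdd kexp kexp | KSub kexp kexp | KMul kexp kexp | KDiv kexp kexp

datatype cexp = CZero | COne | CRead string "iexp list"
  | CAdd cexp cexp | CSub cexp cexp | CMul cexp cexp | CDiv cexp cexp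

datatype bexp = ILess iexp iexp | KEq kexp kexp | CLess cexp cexp | BNot bexp | BAnd bexp bexp

datatype com = Skip
  | IAssign string "iexp list" iexp
  | KAssign string "iexp list" kexp
  | CAssign string "iexp list" cexp
  | Seq com com
  | Cond bexp com com
  | While bexp com

fun ival :: "'k state \<Rightarrow> iexp \<Rightarrow> nat" where
  "ival s (INum m) = m"
| "ival s (IRead a es) = imem s a (map (ival s) es)"
| "ival s (IAdd e e') = ival s e + ival s e'"
| "ival s (ISub e e') = ival s e - ival s e'"

fun kval :: "'k::field state \<Rightarrow> kexp \<Rightarrow> 'k" where
  "kval s KZero = 0"
| "kval s KOne = 1"
| "kval s (KRead a es) = kmem s a (map (ival s) es)"
| "kval s (KAdd e e') = kval s e + kval s e'"
| "kval s (KSub e e') = kval s e - kval s e'"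
| "kval s (KMul e e') = kval s e * kval s e'"
| "kval s (KDiv e e') = kval s e / kval s e'"

fun cval :: "'k state \<Rightarrow> cexp \<Rightarrow> real" where
  "cval s CZero = 0"
| "cval s COne = 1"
| "cval s (CRead a es) = cmem s a (map (ival s) es)"
| "cval s (CAdd e e') = cval s e + cval s e'"
| "cval s (CSub e e') = cval s e - cval s e'"
| "cval s (CMul e e') = cval s e * cval s e'"
| "cval s (CDiv e e') = cval s e / cval s e'"

fun bval :: "'k::field state \<Rightarrow> bexp \<Rightarrow> bool" where
  "bval s (ILess e e') \<longleftrightarrow> ival s e < ival s e'"
| "bval s (KEq e e') \<longleftrightarrow> kval s e = kval s e'"
| "bval s (CLess e e') \<longleftrightarrow> cval s e < cval s e'"
| "bval s (BNot b) \<longleftrightarrow> \<not> bval s b"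
| "bval s (BAnd b b') \<longleftrightarrow> bval s b \<and> bval s b'"

text \<open>Every constant, memory access, operation, comparison and connective costs 1.\<close>

fun icost :: "iexp \<Rightarrow> nat" where
  "icost (INum m) = 1"
| "icost (IRead a es) = 1 + sum_list (map icost es)"
| "icost (IAdd e e') = 1 + icost e + icost e'"
| "icost (ISub e e') = 1 + icost e + icost e'"

definition access_cost :: "iexp list \<Rightarrow> nat" where
  "access_cost es = 1 + sum_list (map icost es)"

fun kcost :: "kexp \<Rightarrow> nat" where
  "kcost KZero = 1"
| "kcost KOne = 1"
| "kcost (KRead a es) = access_cost es"
| "kcost (KAdd e e') = 1 + kcost e + kcost e'"
| "kcost (KSub e e') = 1 + kcost e + kcost e'"
| "kcost (KMul e e') = 1 + kcost e + kcost e'"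
| "kcost (KDiv e e') = 1 + kcost e + kcost e'"

fun ccost :: "cexp \<Rightarrow> nat" where
  "ccost CZero = 1"
| "ccost COne = 1"
| "ccost (CRead a es) = access_cost es"
| "ccost (CAdd e e') = 1 + ccost e + ccost e'"
| "ccost (CSub e e') = 1 + ccost e + ccost e'"
| "ccost (CMul e e') = 1 + ccost e + ccost e'"
| "ccost (CDiv e e') = 1 + ccost e + ccost e'"

fun bcost :: "bexp \<Rightarrow> nat" where
  "bcost (ILess e e') = 1 + icost e + icost e'"
| "bcost (KEq e e') = 1 + kcost e + kcost e'"
| "bcost (CLess e e') = 1 + ccost e + ccost e'"
| "bcost (BNot b) = 1 + bcost b"
| "bcost (BAnd b b') = 1 + bcost b + bcost b'"

definition store :: "(string \<Rightarrow> nat list \<Rightarrow> 'v) \<Rightarrow> string \<Rightarrow> nat list \<Rightarrow> 'v \<Rightarrow> string \<Rightarrow> nat list \<Rightarrow> 'v"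
  where "store m a is v = m(a := (m a)(is := v))"

text \<open>\<open>runs c s t s'\<close>: started in state \<open>s\<close>, the program \<open>c\<close> terminates in state \<open>s'\<close> at total
  cost \<open>t\<close>.\<close>

inductive runs :: "com \<Rightarrow> 'k::field state \<Rightarrow> nat \<Rightarrow> 'k state \<Rightarrow> bool" where
  runs_Skip: "runs Skip s 1 s"
| runs_IAssign: "runs (IAssign a es e) s (access_cost es + icost e)
    (s\<lparr>imem := store (imem s) a (map (ival s) es) (ival s e)\<rparr>)"
| runs_KAssign: "runs (KAssign a es e) s (access_cost es + kcost e)
    (s\<lparr>kmem := store (kmem s) a (map (ival s) es) (kval s e)\<rparr>)"
| runs_CAssign: "runs (CAssign a es e) s (access_cost es + ccost e)
    (s\<lparr>cmem := store (cmem s) a (map (ival s) es) (cval s e)\<rparr>)"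
| runs_Seq: "runs c1 s t1 s' \<Longrightarrow> runs c2 s' t2 s'' \<Longrightarrow> runs (Seq c1 c2) s (t1 + t2) s''"
| runs_CondTrue: "bval s b \<Longrightarrow> runs c1 s t s' \<Longrightarrow> runs (Cond b c1 c2) s (bcost b + t) s'"
| runs_CondFalse: "\<not> bval s b \<Longrightarrow> runs c2 s t s' \<Longrightarrow> runs (Cond b c1 c2) s (bcost b + t) s'"
| runs_WhileFalse: "\<not> bval s b \<Longrightarrow> runs (While b c) s (bcost b) s"
| runs_WhileTrue: "bval s b \<Longrightarrow> runs c s t1 s' \<Longrightarrow> runs (While b c) s' t2 s'' \<Longrightarrow>
    runs (While b c) s (bcost b + t1 + t2) s''"

inductive_cases runs_SkipE: "runs Skip s t s'"
inductive_cases runs_IAssignE: "runs (IAssign a es e) s t s'"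
inductive_cases runs_KAssignE: "runs (KAssign a es e) s t s'"
inductive_cases runs_CAssignE: "runs (CAssign a es e) s t s'"
inductive_cases runs_SeqE: "runs (Seq c1 c2) s t s'"
inductive_cases runs_CondE: "runs (Cond b c1 c2) s t s'"
inductive_cases runs_WhileE: "runs (While b c) s t s'"

lemma runs_deterministic:
  "runs c s t s' \<Longrightarrow> runs c s u s'' \<Longrightarrow> u = t \<and> s'' = s'"
proof (induction arbitrary: u s'' rule: runs.induct)
  case (runs_Skip s)
  then show ?case by (elim runs_SkipE) simp
next
  case (runs_IAssign a es e s)
  then show ?case by (elim runs_IAssignE) simp
next
  case (runs_KAssign a es e s)
  then show ?case by (elim runs_KAssignE) simp
next
  case (runs_CAssign a es e s)
  then show ?case by (elim runs_CAssignE) simp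
next
  case (runs_Seq c1 s t1 s' c2 t2 r)
  from runs_Seq.prems show ?case by (rule runs_SeqE) (use runs_Seq.IH in blast)
next
  case (runs_CondTrue s b c1 t s' c2)
  from runs_CondTrue.prems show ?case
    by (rule runs_CondE) (use runs_CondTrue.IH runs_CondTrue.hyps in blast)+
next
  case (runs_CondFalse s b c2 t s' c1)
  from runs_CondFalse.prems show ?case
    by (rule runs_CondE) (use runs_CondFalse.IH runs_CondFalse.hyps in blast)+
next
  case (runs_WhileFalse s b c)
  from runs_WhileFalse.prems show ?case
    by (rule runs_WhileE) (use runs_WhileFalse.hyps in blast)+
next
  case (runs_WhileTrue s b c t1 s' t2 r)
  from runs_WhileTrue.prems show ?case
    by (rule runs_WhileE) (use runs_WhileTrue.IH runs_WhileTrue.hyps in blast)+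
qed

lemma cval_rational: "(\<And>a is. cmem s a is \<in> \<rat>) \<Longrightarrow> cval s e \<in> \<rat>"
  by (induction e) auto

lemma runs_rational:
  "runs c s t s' \<Longrightarrow> (\<And>a is. cmem s a is \<in> \<rat>) \<Longrightarrow> cmem s' b js \<in> \<rat>"
  by (induction arbitrary: b js rule: runs.induct) (auto simp: store_def cval_rational)

subsection \<open>Storage of points\<close>

datatype subspace_format = Image | Kernel

fun subspace_of :: "subspace_format \<Rightarrow> 'k::field mat \<Rightarrow> 'k vec set" where
  "subspace_of Image B = (\<lambda>v. B *\<^sub>v v) ` carrier_vec (dim_col B)"
| "subspace_of Kernel B = mat_kernel B"

text \<open>The point \<open>\<Sum>\<^sub>t c\<^sub>t p\<^sub>t\<close> of the complex of \<open>N\<close>, for a chain \<open>p\<^sub>0 \<sqsubset> p\<^sub>1 \<sqsubset> \<dots>\<close> of subspaces in the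
  order of \<open>N\<close>, is stored under the name \<open>a\<close> in the three memories: the length of the chain in
  \<open>a[]\<close>, the coefficients in \<open>a[t]\<close>, and \<open>n \<times> n\<close> matrices for the subspaces in \<open>a[t, i, j]\<close>. The
  coefficients may vanish. All other cells are unconstrained.\<close>

definition stored_point ::
  "'k::field vec set gorder \<Rightarrow> subspace_format \<Rightarrow> nat \<Rightarrow> string \<Rightarrow> 'k state \<Rightarrow> ('k vec set \<Rightarrow> real) \<Rightarrow> bool"
  where
  "stored_point N fmt n a s x \<longleftrightarrow>
     (let m = imem s a [];
          c = (\<lambda>t. cmem s a [t]);
          p = (\<lambda>t. subspace_of fmt (mat n n (\<lambda>(i, j). kmem s a [t, i, j])))
      in (\<forall>t<m. p t \<in> carrier N) \<and> (\<forall>t u. t < u \<and> u < m \<longrightarrow> p t \<sqsubset>\<^bsub>N\<^esub> p u) \<and>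
         (\<forall>t<m. 0 \<le> c t) \<and> (\<Sum>t<m. c t) = 1 \<and>
         x = (\<lambda>q. \<Sum>t<m. if p t = q then c t else 0))"

definition stored_input ::
  "subspace_format \<Rightarrow> subspace_format \<Rightarrow> nat \<Rightarrow> 'k::field mat \<Rightarrow> real \<Rightarrow>
   ('k vec set \<Rightarrow> real) \<Rightarrow> ('k vec set \<Rightarrow> real) \<Rightarrow> 'k state \<Rightarrow> bool" where
  "stored_input fmtL fmtM n A lam x0 y0 s \<longleftrightarrow>
     imem s ''n'' [] = n \<and> (\<forall>i<n. \<forall>j<n. kmem s ''A'' [i, j] = A $$ (i, j)) \<and>
     cmem s ''lambda'' [] = lam \<and>
     stored_point (subspace_lattice n) fmtL n ''x0'' s x0 \<and>
     stored_point (reverse_subspace_lattice n) fmtM n ''y0'' s y0"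

definition stored_output ::
  "subspace_format \<Rightarrow> subspace_format \<Rightarrow> nat \<Rightarrow>
   ('k::field vec set \<Rightarrow> real) \<times> ('k vec set \<Rightarrow> real) \<Rightarrow> 'k state \<Rightarrow> bool" where
  "stored_output fmtL fmtM n = (\<lambda>(x, y) s.
     stored_point (subspace_lattice n) fmtL n ''x'' s x \<and>
     stored_point (reverse_subspace_lattice n) fmtM n ''y'' s y)"

end

theory Submission
  imports Defs
begin

text \<open>Fix bases of the two copies of \<open>K\<^sup>n\<close>. Sending a subspace to the coordinate subspace of its pivot
  positions preserves inclusion and dimension, so it is isometric on every simplex and retracts the
  orthoscheme complex onto an apartment, a cube with coordinates \<open>rho\<close>, without increasing distances.
  As in the Bruhat decomposition, exchange steps turn bases adapted to the chains of \<open>x0\<close> and \<open>y0\<close>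
  into adapted bases for which the bilinear form is a partial permutation matrix. If the pivots on
  the two sides are taken in opposite orders, Gram matrices become triangular, so retracting does not
  increase the rank either. Hence the objective can be minimised on the product of the two
  apartments, where it splits into the problems of minimising
  \<open>\<kappa> * max 0 (a - b) + ((a - a0)\<^sup>2 + (b - b0)\<^sup>2) / (2 * lam)\<close> over matched coordinates, solved by
  moving \<open>a\<close> and \<open>b\<close> towards each other by \<open>min (\<kappa> * lam) ((a0 - b0) / 2)\<close> if \<open>b0 < a0\<close>. By strong
  convexity, every minimiser retracts to this one, for all orders of the basis vectors, and this
  forces it to lie in the apartment.\<close>

section \<open>Retractions of an orthoscheme complex onto an apartment\<close>

text \<open>Coordinates replace the CAT(0) theory: existence of the minimiser comes from an explicit
  candidate, uniqueness from a quadratic lower bound on the objective. A single retraction cannot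
  give uniqueness, because it folds points outside the apartment into it; hence pivots are taken for
  an arbitrary order of the basis. The rank becomes separable because, with pivot sets replaced by
  their complements on the reversed lattice, it counts matched indices that lie in one set and whose
  partner is missing from the other; along a chain both conditions are upward closed, and such
  counts extend to sums of positive parts of differences. Since the machine only offers field
  operations and comparisons of coefficients, the minimiser has to be found exactly, in closed form.
  Polynomial time is obtained structurally: the program consists of counted loops of length
  \<open>n\<close> plus a constant, and guards let surplus rounds idle when a chain is shorter.
  Kernels are treated as flags of equations in the dual space, so one elimination serves both
  storage formats.\<close>

definition euclid :: "nat \<Rightarrow> (nat \<Rightarrow> real) \<Rightarrow> (nat \<Rightarrow> real) \<Rightarrow> real" where
  "euclid n a b = L2_set (\<lambda>i. a i - b i) {..<n}"

lemma euclid_nonneg [simp]: "0 \<le> euclid n a b"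
  by (simp add: euclid_def)

lemma euclid_triangle: "euclid n a c \<le> euclid n a b + euclid n b c"
proof -
  have "L2_set (\<lambda>i. (a i - b i) + (b i - c i)) {..<n} \<le> euclid n a b + euclid n b c"
    unfolding euclid_def by (rule L2_set_triangle_ineq)
  then show ?thesis by (simp add: euclid_def)
qed

lemma euclid_square: "(euclid n a b)\<^sup>2 = (\<Sum>i<n. (a i - b i)\<^sup>2)"
  by (simp add: euclid_def L2_set_def sum_nonneg)

lemma euclid_cong:
  "(\<And>i. i < n \<Longrightarrow> a i = a' i) \<Longrightarrow> (\<And>i. i < n \<Longrightarrow> b i = b' i) \<Longrightarrow> euclid n a b = euclid n a' b'"
  by (auto simp: euclid_def intro!: L2_set_cong)

lemma euclid_polygon: "euclid n (g 0) (g m) \<le> (\<Sum>i<m. euclid n (g i) (g (Suc i)))"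
proof (induction m)
  case 0
  then show ?case by (simp add: euclid_def L2_set_0')
next
  case (Suc m)
  then show ?case using euclid_triangle[of n "g 0" "g (Suc m)" "g m"] by simp
qed

lemma chain_in_subset: "chain_in N C \<Longrightarrow> D \<subseteq> C \<Longrightarrow> chain_in N D"
  by (auto simp: chain_in_def)

lemma simplex_iff:
  assumes "chain_in N (set ps)"
  shows "x \<in> simplex N ps \<longleftrightarrow>
    (\<forall>p. 0 \<le> x p) \<and> (\<forall>p. p \<notin> set ps \<longrightarrow> x p = 0) \<and> (\<Sum>p\<in>set ps. x p) = 1"
proof -
  have "(\<Sum>p\<in>support x. x p) = (\<Sum>p\<in>set ps. x p)" if "support x \<subseteq> set ps"
    by (rule sum.mono_neutral_left) (use that in \<open>auto simp: support_def\<close>)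
  moreover have "support x \<subseteq> set ps \<longleftrightarrow> (\<forall>p. p \<notin> set ps \<longrightarrow> x p = 0)"
    by (auto simp: support_def)
  moreover have "support x \<subseteq> set ps \<Longrightarrow> finite (support x)"
    by (meson finite_set finite_subset)
  ultimately show ?thesis
    using assms by (auto simp: simplex_def orthoscheme_complex_def dest: chain_in_subset)
qed

lemma sum_support:
  "finite C \<Longrightarrow> support x \<subseteq> C \<Longrightarrow> (\<Sum>p\<in>support x. if P p then x p else 0) = (\<Sum>p\<in>C. if P p then x p else (0::real))"
  by (rule sum.mono_neutral_left) (auto simp: support_def)

text \<open>An order-theoretic abstraction of pivot sets, so that both lattices share one
  development. \<open>e\<close> embeds the Boolean lattice of subsets of \<open>{..<n}\<close> as an
  apartment, and \<open>J\<close> followed by \<open>e\<close> is the retraction.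
  \<open>J_strict\<close> makes \<open>J\<close> faithful on comparable pairs; \<open>J_gap\<close>
  stands in for the existence of intermediate subspaces and makes maximal chains climb one index at
  a time.\<close>

locale retraction =
  fixes N :: "'p gorder" and n :: nat and J :: "'p \<Rightarrow> nat set" and e :: "nat set \<Rightarrow> 'p"
  assumes eq_N: "eq N = (=)"
    and refl: "p \<in> carrier N \<Longrightarrow> p \<sqsubseteq>\<^bsub>N\<^esub> p"
    and trans: "p \<in> carrier N \<Longrightarrow> q \<in> carrier N \<Longrightarrow> r \<in> carrier N \<Longrightarrow>
      p \<sqsubseteq>\<^bsub>N\<^esub> q \<Longrightarrow> q \<sqsubseteq>\<^bsub>N\<^esub> r \<Longrightarrow> p \<sqsubseteq>\<^bsub>N\<^esub> r"
    and J_sub: "p \<in> carrier N \<Longrightarrow> J p \<subseteq> {..<n}"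
    and J_mono: "p \<in> carrier N \<Longrightarrow> q \<in> carrier N \<Longrightarrow> p \<sqsubseteq>\<^bsub>N\<^esub> q \<Longrightarrow> J p \<subseteq> J q"
    and J_strict: "p \<in> carrier N \<Longrightarrow> q \<in> carrier N \<Longrightarrow> p \<sqsubseteq>\<^bsub>N\<^esub> q \<Longrightarrow> J p = J q \<Longrightarrow> p = q"
    and J_gap: "p \<in> carrier N \<Longrightarrow> q \<in> carrier N \<Longrightarrow> p \<sqsubseteq>\<^bsub>N\<^esub> q \<Longrightarrow> i \<in> J q - J p \<Longrightarrow> j \<in> J q - J p \<Longrightarrow>
      i \<noteq> j \<Longrightarrow> \<exists>w\<in>carrier N. p \<sqsubseteq>\<^bsub>N\<^esub> w \<and> w \<sqsubseteq>\<^bsub>N\<^esub> q \<and> w \<noteq> p \<and> w \<noteq> q"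
    and e_carrier: "S \<subseteq> {..<n} \<Longrightarrow> e S \<in> carrier N"
    and e_mono: "S \<subseteq> T \<Longrightarrow> T \<subseteq> {..<n} \<Longrightarrow> e S \<sqsubseteq>\<^bsub>N\<^esub> e T"
    and J_e: "S \<subseteq> {..<n} \<Longrightarrow> J (e S) = S"
    and bot: "p \<in> carrier N \<Longrightarrow> e {} \<sqsubseteq>\<^bsub>N\<^esub> p"
    and top: "p \<in> carrier N \<Longrightarrow> p \<sqsubseteq>\<^bsub>N\<^esub> e {..<n}"
begin

text \<open>The orthoscheme complex of a Boolean lattice is a cube whose vertices are indicator
  vectors; this is the image of \<open>x\<close> in that cube, each \<open>p\<close> being sent to
  the indicator of \<open>J p\<close>.\<close>

definition rho :: "('p \<Rightarrow> real) \<Rightarrow> nat \<Rightarrow> real" where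
  "rho x i = (\<Sum>p\<in>support x. if i \<in> J p then x p else 0)"

lemma finite_J: "p \<in> carrier N \<Longrightarrow> finite (J p)"
  using J_sub finite_subset by blast

lemma antisym: "p \<in> carrier N \<Longrightarrow> q \<in> carrier N \<Longrightarrow> p \<sqsubseteq>\<^bsub>N\<^esub> q \<Longrightarrow> q \<sqsubseteq>\<^bsub>N\<^esub> p \<Longrightarrow> p = q"
  by (meson J_mono J_strict subset_antisym)

lemma lless_iff: "p \<sqsubset>\<^bsub>N\<^esub> q \<longleftrightarrow> p \<sqsubseteq>\<^bsub>N\<^esub> q \<and> p \<noteq> q"
  by (simp add: lless_def eq_N)

lemma chain_le_iff:
  assumes "chain_in N C" "p \<in> C" "q \<in> C"
  shows "p \<sqsubseteq>\<^bsub>N\<^esub> q \<longleftrightarrow> J p \<subseteq> J q"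
proof
  have c: "p \<in> carrier N" "q \<in> carrier N" and d: "p \<sqsubseteq>\<^bsub>N\<^esub> q \<or> q \<sqsubseteq>\<^bsub>N\<^esub> p"
    using assms by (auto simp: chain_in_def)
  show "p \<sqsubseteq>\<^bsub>N\<^esub> q \<Longrightarrow> J p \<subseteq> J q" using c J_mono by blast
  show "J p \<subseteq> J q \<Longrightarrow> p \<sqsubseteq>\<^bsub>N\<^esub> q" using d c J_mono J_strict refl by (metis subset_antisym)
qed

lemma chain_J_total:
  assumes "chain_in N C" "p \<in> C" "q \<in> C"
  shows "J p \<subseteq> J q \<or> J q \<subseteq> J p"
  using assms J_mono by (meson chain_in_def subsetD)

lemma chain_card_J:
  assumes "chain_in N C" "p \<in> C" "q \<in> C"
  shows "card (J p) \<le> card (J q) \<longleftrightarrow> p \<sqsubseteq>\<^bsub>N\<^esub> q"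
proof -
  have c: "p \<in> carrier N" "q \<in> carrier N"
    using assms by (auto simp: chain_in_def)
  show ?thesis
    using chain_J_total[OF assms] chain_le_iff[OF assms] finite_J c
    by (metis card_mono card_seteq order_refl)
qed

lemma chain_inj_card_J: "chain_in N C \<Longrightarrow> inj_on (\<lambda>p. card (J p)) C"
  by (rule inj_onI) (metis antisym chain_card_J chain_in_def order_refl subsetD)

lemma card_J_le: "p \<in> carrier N \<Longrightarrow> card (J p) \<le> n"
  using card_mono[OF _ J_sub] by fastforce

lemma chain_card:
  assumes "chain_in N C"
  shows "finite C" "card C \<le> Suc n"
proof -
  have s: "(\<lambda>p. card (J p)) ` C \<subseteq> {..n}"
    using assms card_J_le by (auto simp: chain_in_def)
  show "finite C"
    using finite_imageD[OF _ chain_inj_card_J[OF assms]] finite_subset[OF s] by blast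
  have "card C = card ((\<lambda>p. card (J p)) ` C)"
    by (simp add: card_image chain_inj_card_J assms)
  also have "\<dots> \<le> Suc n" using card_mono[OF _ s] by simp
  finally show "card C \<le> Suc n" .
qed

lemma chain_in_insert:
  assumes "chain_in N C" "q \<in> carrier N" "\<And>p. p \<in> C \<Longrightarrow> p \<sqsubseteq>\<^bsub>N\<^esub> q \<or> q \<sqsubseteq>\<^bsub>N\<^esub> p"
  shows "chain_in N (insert q C)"
  using assms refl by (auto simp: chain_in_def)

text \<open>Chains have at most \<open>n + 1\<close> elements, so a chain of largest cardinality
  above \<open>C\<close> exists without Zorn's lemma; sorting it by \<open>card (J p)\<close> gives
  the ascending enumeration.\<close>

lemma extend_chain:
  assumes C: "chain_in N C"
  obtains ps where "maximal_chain N ps" "C \<subseteq> set ps"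
proof -
  let ?P = "\<lambda>D. chain_in N D \<and> C \<subseteq> D"
  obtain D where D: "?P D" and max: "\<And>D'. ?P D' \<Longrightarrow> card D' \<le> card D"
    using ex_has_greatest_nat[of ?P C card "Suc (Suc n)"] C chain_card(2)
    by (metis less_Suc_eq_le order_refl)
  have fD: "finite D" using D chain_card by blast
  then obtain xs where xs: "set xs = D" "distinct xs" using finite_distinct_list by blast
  define ps where "ps = sort_key (\<lambda>p. card (J p)) xs"
  have set: "set ps = D" and sorted: "sorted (map (\<lambda>p. card (J p)) ps)" and dist: "distinct ps"
    unfolding ps_def using xs by simp_all
  have "sorted_wrt (\<lambda>p q. p \<sqsubset>\<^bsub>N\<^esub> q) ps"
    unfolding sorted_wrt_iff_nth_less
  proof (intro allI impI)
    fix i j assume ij: "i < j" "j < length ps"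
    have "card (J (ps ! i)) \<le> card (J (ps ! j))"
      using sorted_nth_mono[OF sorted, of i j] ij by simp
    moreover have "ps ! i \<in> D" "ps ! j \<in> D" using ij set by (auto simp: set_conv_nth)
    moreover have "ps ! i \<noteq> ps ! j" using dist ij by (simp add: nth_eq_iff_index_eq)
    ultimately show "ps ! i \<sqsubset>\<^bsub>N\<^esub> ps ! j" using chain_card_J D by (auto simp: lless_iff)
  qed
  moreover have "E = D" if "chain_in N E" "D \<subseteq> E" for E
    using max[of E] that D chain_card(1)[of E] by (metis card_seteq order_trans)
  ultimately have "maximal_chain N ps"
    using D by (auto simp: maximal_chain_def set)
  then show thesis using D set that by blast
qed

section \<open>Maximal chains and the heights of indices\<close>

context
  fixes ps assumes max: "maximal_chain N ps"
begin

lemma max_chain: "chain_in N (set ps)"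
  using max by (simp add: maximal_chain_def)

lemma max_in: "k < length ps \<Longrightarrow> ps ! k \<in> carrier N"
  using max_chain by (auto simp: chain_in_def)

lemma max_nth_less: "k < l \<Longrightarrow> l < length ps \<Longrightarrow> ps ! k \<sqsubseteq>\<^bsub>N\<^esub> ps ! l \<and> ps ! k \<noteq> ps ! l"
  using max by (simp add: maximal_chain_def sorted_wrt_iff_nth_less lless_iff)

lemma max_nth_le: "k \<le> l \<Longrightarrow> l < length ps \<Longrightarrow> ps ! k \<sqsubseteq>\<^bsub>N\<^esub> ps ! l"
  using max_nth_less refl max_in by (metis le_neq_implies_less)

lemma max_distinct: "distinct ps"
  by (metis linorder_neqE_nat max_nth_less distinct_conv_nth)

lemma max_comparable:
  assumes "q \<in> carrier N" "\<And>p. p \<in> set ps \<Longrightarrow> p \<sqsubseteq>\<^bsub>N\<^esub> q \<or> q \<sqsubseteq>\<^bsub>N\<^esub> p"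
  shows "q \<in> set ps"
proof -
  have "insert q (set ps) = set ps"
    using chain_in_insert[OF max_chain assms] max by (auto simp: maximal_chain_def)
  then show ?thesis by blast
qed

text \<open>Least and greatest elements are comparable with everything, so a maximal chain contains
  \<open>e {}\<close> and \<open>e {..<n}\<close>, where \<open>card (J p)\<close> is
  \<open>0\<close> and \<open>n\<close>. As maximality rules out jumps, this cardinality is the
  position in the chain.\<close>

lemma max_length_card: "length ps = Suc n" "k \<le> n \<Longrightarrow> card (J (ps ! k)) = k"
proof -
  define f where "f k = card (J (ps ! k))" for k
  have lt: "f k < f l" if "k < l" "l < length ps" for k l
  proof -
    have "ps ! k \<in> set ps" "ps ! l \<in> set ps" using that by auto
    then have "f k \<le> f l" "f k \<noteq> f l"
      using chain_card_J[OF max_chain] max_nth_less[OF that] chain_inj_card_J[OF max_chain]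
      by (auto simp: f_def inj_on_def)
    then show ?thesis by simp
  qed
  have "e {} \<in> set ps"
    using max_chain by (intro max_comparable e_carrier) (auto simp: chain_in_def intro: bot)
  then obtain k0 where k0: "k0 < length ps" "ps ! k0 = e {}" by (metis in_set_conv_nth)
  then have "f k0 = 0" by (simp add: f_def J_e)
  then have f0: "f 0 = 0" "0 < length ps" using lt[of 0 k0] k0 by (cases k0; auto)+
  have "e {..<n} \<in> set ps"
    using max_chain by (intro max_comparable e_carrier) (auto simp: chain_in_def intro: top)
  then obtain k1 where k1: "k1 < length ps" "ps ! k1 = e {..<n}" by (metis in_set_conv_nth)
  then have fk1: "f k1 = n" by (simp add: f_def J_e)
  \<comment> \<open>A jump by two or more leaves two indices in the difference of the sets;
    \<open>J_gap\<close> then gives an element strictly between two neighbours, which maximality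
    would force into the chain.\<close>
  have step: "f (Suc k) = Suc (f k)" if k: "Suc k < length ps" for k
  proof (rule ccontr)
    assume ne: "f (Suc k) \<noteq> Suc (f k)"
    have c: "ps ! k \<in> carrier N" "ps ! Suc k \<in> carrier N" using max_in k by auto
    have le: "ps ! k \<sqsubseteq>\<^bsub>N\<^esub> ps ! Suc k" using max_nth_le k by simp
    have "card (J (ps ! Suc k) - J (ps ! k)) = f (Suc k) - f k"
      using card_Diff_subset[OF finite_J J_mono] c le by (simp add: f_def)
    then have "card (J (ps ! Suc k) - J (ps ! k)) \<ge> 2" using ne lt[of k "Suc k"] k by simp
    then obtain i j where "i \<in> J (ps ! Suc k) - J (ps ! k)" "j \<in> J (ps ! Suc k) - J (ps ! k)" "i \<noteq> j"
      by (metis card_2_iff' card_le_Suc0_iff_eq finite_Diff finite_J c(2) numeral_2_eq_2 not_less_eq_eq)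
    then obtain w where w: "w \<in> carrier N" "ps ! k \<sqsubseteq>\<^bsub>N\<^esub> w" "w \<sqsubseteq>\<^bsub>N\<^esub> ps ! Suc k" "w \<noteq> ps ! k" "w \<noteq> ps ! Suc k"
      using J_gap[OF c le] by blast
    have cmp: "(l \<le> k \<longrightarrow> ps ! l \<sqsubseteq>\<^bsub>N\<^esub> w) \<and> (Suc k \<le> l \<longrightarrow> w \<sqsubseteq>\<^bsub>N\<^esub> ps ! l)" if "l < length ps" for l
      using trans[OF _ c(1) w(1) _ w(2)] trans[OF w(1) c(2) _ w(3)] max_nth_le max_in that k by simp
    have "w \<in> set ps"
      by (rule max_comparable[OF w(1)]) (metis cmp in_set_conv_nth not_less_eq_eq)
    then obtain l where l: "l < length ps" "w = ps ! l" by (metis in_set_conv_nth)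
    show False
    proof (cases "l \<le> k")
      case True
      then have "w \<sqsubseteq>\<^bsub>N\<^esub> ps ! k" using max_nth_le[of l k] l k by simp
      then show False using antisym w c by blast
    next
      case False
      then have "ps ! Suc k \<sqsubseteq>\<^bsub>N\<^esub> w" using max_nth_le[of "Suc k" l] l k by simp
      then show False using antisym w c by blast
    qed
  qed
  have fk: "f k = k" if "k < length ps" for k
    using that by (induction k) (use f0 step in auto)
  have "k1 = n" using fk1 fk k1 by simp
  moreover have "length ps - 1 \<le> n"
    using fk[of "length ps - 1"] f0 card_J_le[OF max_in, of "length ps - 1"] by (simp add: f_def)
  ultimately show len: "length ps = Suc n" using k1 by simp
  show "k \<le> n \<Longrightarrow> card (J (ps ! k)) = k" using fk len by (simp add: f_def)
qed

text \<open>The position at which \<open>i\<close> enters \<open>J\<close> along the chain. As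
  exactly one index enters per step, this is a bijection onto \<open>{1..n}\<close>; it translates
  between the orthoscheme coordinates, which depend on the chain, and \<open>rho\<close>, which does
  not.\<close>

definition ht :: "nat \<Rightarrow> nat" where
  "ht i = (LEAST k. k \<le> n \<and> i \<in> J (ps ! k))"

lemma J_nth_mono: "k \<le> l \<Longrightarrow> l \<le> n \<Longrightarrow> J (ps ! k) \<subseteq> J (ps ! l)"
  using J_mono max_nth_le max_in max_length_card(1) by simp

lemma J_last: "J (ps ! n) = {..<n}"
  using max_length_card card_subset_eq[OF _ J_sub] max_in by simp

lemma ht_le: "i < n \<Longrightarrow> k \<le> n \<Longrightarrow> ht i \<le> k \<longleftrightarrow> i \<in> J (ps ! k)"
proof -
  assume a: "i < n" "k \<le> n"
  have "ht i \<le> n \<and> i \<in> J (ps ! ht i)"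
    unfolding ht_def by (rule LeastI[of _ n]) (simp add: J_last a)
  then show ?thesis
    using J_nth_mono[of "ht i" k] a by (auto simp: ht_def intro: Least_le)
qed

lemma ht_bij: "bij_betw ht {..<n} {1..n}"
proof -
  have r: "ht i \<in> {1..n}" if "i < n" for i
  proof -
    have "card (J (ps ! 0)) = 0" using max_length_card(2) by simp
    then have "J (ps ! 0) = {}" using finite_J max_in max_length_card(1) by simp
    then show ?thesis using ht_le[OF that, of 0] ht_le[OF that, of n] that by (simp add: J_last)
  qed
  have "inj_on ht {..<n}"
  proof (rule inj_onI, clarsimp)
    fix i j assume ij: "i < n" "j < n" "ht i = ht j"
    define k where "k = ht i - 1"
    have k: "ht i = Suc k" "Suc k \<le> n" using r[OF ij(1)] by (auto simp: k_def)
    let ?D = "J (ps ! Suc k) - J (ps ! k)"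
    have "card ?D = 1"
      using card_Diff_subset[OF finite_J J_nth_mono[of k "Suc k"]] max_length_card max_in k by simp
    moreover have "i \<in> ?D" "j \<in> ?D"
      using ht_le[OF ij(1)] ht_le[OF ij(2)] ij k
      by (metis DiffI Suc_n_not_le_n le_refl Suc_leD)+
    ultimately show "i = j" by (metis card_1_singletonE singletonD)
  qed
  moreover have "ht ` {..<n} \<subseteq> {1..n}" using r by blast
  ultimately show ?thesis by (simp add: bij_betw_def card_image card_subset_eq)
qed

lemma rho_simplex:
  assumes "x \<in> simplex N ps"
  shows "rho x i = (\<Sum>k\<le>n. if i \<in> J (ps ! k) then x (ps ! k) else 0)"
proof -
  have "rho x i = (\<Sum>p\<in>set ps. if i \<in> J p then x p else 0)"
    unfolding rho_def using assms by (intro sum_support) (auto simp: simplex_def)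
  also have "set ps = (!) ps ` {..n}"
    by (auto simp: set_conv_nth max_length_card less_Suc_eq_le)
  also have "(\<Sum>p\<in>\<dots>. if i \<in> J p then x p else 0) = (\<Sum>k\<le>n. if i \<in> J (ps ! k) then x (ps ! k) else 0)"
    by (subst sum.reindex) (auto simp: inj_on_def max_distinct max_length_card nth_eq_iff_index_eq)
  finally show ?thesis .
qed

text \<open>Coordinate \<open>j\<close> of the orthoscheme sums the weights at positions
  \<open>j\<close> and above; for \<open>j = ht i\<close> these are exactly the members whose
  \<open>J\<close> contains \<open>i\<close>.\<close>

lemma orthoscheme_coord_ht:
  assumes "x \<in> simplex N ps" "i < n"
  shows "orthoscheme_coord ps x (ht i) = rho x i"
proof -
  have h: "1 \<le> ht i" "ht i \<le> n" using bij_betwE[OF ht_bij] assms(2) by auto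
  have "orthoscheme_coord ps x (ht i) = (\<Sum>k = 1..n. if i \<in> J (ps ! k) then x (ps ! k) else 0)"
    unfolding orthoscheme_coord_def max_length_card
    by (rule sum.cong) (use h ht_le[OF assms(2)] in \<open>auto simp: indicator_def\<close>)
  \<comment> \<open>The bottom of the chain is missing from the orthoscheme coordinates, but no
    index enters at position \<open>0\<close>, so it adds nothing.\<close>
  also have "\<dots> = (\<Sum>k\<le>n. if i \<in> J (ps ! k) then x (ps ! k) else 0)"
  proof (rule sum.mono_neutral_left)
    show "\<forall>k\<in>{..n} - {1..n}. (if i \<in> J (ps ! k) then x (ps ! k) else 0) = 0"
    proof
      fix k assume "k \<in> {..n} - {1..n}"
      then have "k = 0" by auto
      then show "(if i \<in> J (ps ! k) then x (ps ! k) else 0) = 0"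
        using ht_le[OF assms(2), of 0] h by simp
    qed
  qed auto
  finally show ?thesis using rho_simplex[OF assms(1)] by simp
qed

text \<open>Heights only permute the coordinates, which leaves the euclidean norm unchanged. Thus
  \<open>rho\<close> is isometric on every maximal simplex, with one common target.\<close>

lemma simplex_dist_rho:
  assumes "x \<in> simplex N ps" "y \<in> simplex N ps"
  shows "simplex_dist ps x y = euclid n (rho x) (rho y)"
proof -
  let ?f = "\<lambda>j. (orthoscheme_coord ps x j - orthoscheme_coord ps y j)\<^sup>2"
  have "sum ?f {1..n} = (\<Sum>i<n. ?f (ht i))"
    by (rule sum.reindex_bij_betw[OF ht_bij, symmetric])
  also have "\<dots> = (\<Sum>i<n. (rho x i - rho y i)\<^sup>2)"
    by (rule sum.cong) (simp_all add: orthoscheme_coord_ht assms)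
  finally show ?thesis
    by (simp add: simplex_dist_def euclid_def L2_set_def max_length_card)
qed

end

section \<open>Path lengths in the coordinates \<open>rho\<close>\<close>

lemma subdivision_length_rho:
  assumes "subdivision N \<gamma> (ts, \<sigma>s)"
  shows "subdivision_length \<gamma> (ts, \<sigma>s) = (\<Sum>i<length \<sigma>s. euclid n (rho (\<gamma> (ts ! i))) (rho (\<gamma> (ts ! Suc i))))"
  unfolding subdivision_length_def prod.case
proof (rule sum.cong, simp)
  fix i assume "i \<in> {..<length \<sigma>s}"
  then have i: "i < length \<sigma>s" by simp
  then have "ts ! i < ts ! Suc i"
    using assms sorted_wrt_nth_less[of "(<)" ts i "Suc i"] by (auto simp: subdivision_def)
  then have "\<gamma> (ts ! i) \<in> simplex N (\<sigma>s ! i)" "\<gamma> (ts ! Suc i) \<in> simplex N (\<sigma>s ! i)"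
    using assms i by (auto simp: subdivision_def image_subset_iff)
  then show "simplex_dist (\<sigma>s ! i) (\<gamma> (ts ! i)) (\<gamma> (ts ! Suc i)) =
      euclid n (rho (\<gamma> (ts ! i))) (rho (\<gamma> (ts ! Suc i)))"
    using simplex_dist_rho assms i by (auto simp: subdivision_def)
qed

text \<open>A subdivision of the path maps to a polygon in coordinate space, at least as long as the
  distance of its ends. One subdivision suffices because the path length is a supremum.\<close>

lemma path_length_ge:
  assumes "\<gamma> \<in> paths N x y"
  shows "ennreal (euclid n (rho x) (rho y)) \<le> path_length N \<gamma>"
proof -
  obtain ts \<sigma>s where D: "subdivision N \<gamma> (ts, \<sigma>s)" using assms by (auto simp: paths_def)
  then have ends: "ts ! 0 = 0" "ts ! length \<sigma>s = 1"
    by (auto simp: subdivision_def hd_conv_nth last_conv_nth simp flip: length_greater_0_conv)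
  have "euclid n (rho x) (rho y) \<le> subdivision_length \<gamma> (ts, \<sigma>s)"
    using euclid_polygon[of n "\<lambda>i. rho (\<gamma> (ts ! i))" "length \<sigma>s"] assms ends
    by (simp add: subdivision_length_rho[OF D] paths_def)
  then have "ennreal (euclid n (rho x) (rho y)) \<le> ennreal (subdivision_length \<gamma> (ts, \<sigma>s))"
    by (rule ennreal_leI)
  also have "\<dots> \<le> path_length N \<gamma>"
    unfolding path_length_def using D by (intro SUP_upper) simp
  finally show ?thesis .
qed

text \<open>The bound must hold for subdivisions with arbitrary breakpoints; a Lipschitz estimate in
  the parameter telescopes over all of them.\<close>

lemma path_length_le:
  assumes "\<And>s t. 0 \<le> s \<Longrightarrow> s \<le> t \<Longrightarrow> t \<le> 1 \<Longrightarrow> euclid n (rho (\<gamma> s)) (rho (\<gamma> t)) \<le> C * (t - s)"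
  shows "path_length N \<gamma> \<le> ennreal C"
  unfolding path_length_def
proof (rule SUP_least, clarsimp)
  fix ts \<sigma>s assume D: "subdivision N \<gamma> (ts, \<sigma>s)"
  then have len: "length ts = Suc (length \<sigma>s)" and srt: "sorted_wrt (<) ts"
    and ends: "ts ! 0 = 0" "ts ! length \<sigma>s = 1"
    by (auto simp: subdivision_def hd_conv_nth last_conv_nth simp flip: length_greater_0_conv)
  have le: "ts ! i \<le> ts ! j" if "i \<le> j" "j \<le> length \<sigma>s" for i j
    using that srt len by (cases "i = j") (auto simp: sorted_wrt_iff_nth_less less_imp_le)
  have "subdivision_length \<gamma> (ts, \<sigma>s) \<le> (\<Sum>i<length \<sigma>s. C * (ts ! Suc i - ts ! i))"
    unfolding subdivision_length_rho[OF D]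
  proof (rule sum_mono)
    fix i assume "i \<in> {..<length \<sigma>s}"
    then show "euclid n (rho (\<gamma> (ts ! i))) (rho (\<gamma> (ts ! Suc i))) \<le> C * (ts ! Suc i - ts ! i)"
      using le[of 0 i] le[of i "Suc i"] le[of "Suc i" "length \<sigma>s"] ends by (intro assms) auto
  qed
  also have "\<dots> = C"
    by (simp add: sum_lessThan_telescope ends flip: sum_distrib_left)
  finally show "ennreal (subdivision_length \<gamma> (ts, \<sigma>s)) \<le> ennreal C" by (rule ennreal_leI)
qed

end

context retraction
begin

lemma K_finite: "x \<in> orthoscheme_complex N \<Longrightarrow> finite (support x)"
  and K_chain: "x \<in> orthoscheme_complex N \<Longrightarrow> chain_in N (support x)"
  and K_nonneg: "x \<in> orthoscheme_complex N \<Longrightarrow> 0 \<le> x p"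
  and K_sum: "x \<in> orthoscheme_complex N \<Longrightarrow> sum x (support x) = 1"
  by (auto simp: orthoscheme_complex_def)

lemma K_carrier: "x \<in> orthoscheme_complex N \<Longrightarrow> p \<in> support x \<Longrightarrow> p \<in> carrier N"
  using K_chain by (auto simp: chain_in_def)

lemma rho_bounds:
  assumes "x \<in> orthoscheme_complex N"
  shows "0 \<le> rho x i" "rho x i \<le> 1"
proof -
  show "0 \<le> rho x i" unfolding rho_def using K_nonneg[OF assms] by (intro sum_nonneg) auto
  have "rho x i \<le> sum x (support x)"
    unfolding rho_def using K_nonneg[OF assms] by (intro sum_mono) auto
  then show "rho x i \<le> 1" using K_sum[OF assms] by simp
qed

lemma rho_eq_sum:
  "finite C \<Longrightarrow> support x \<subseteq> C \<Longrightarrow> rho x i = (\<Sum>p\<in>C. if i \<in> J p then x p else 0)"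
  unfolding rho_def by (rule sum_support)

subsection \<open>Distances are not increased\<close>

text \<open>\<open>complex_dist\<close> reads an infinite infimum as \<open>0\<close>, which would
  break every lower bound; so some path of finite length has to be exhibited between any two
  points.\<close>

lemma finite_length_path:
  assumes x: "x \<in> orthoscheme_complex N" and y: "y \<in> orthoscheme_complex N"
  obtains \<gamma> C where "\<gamma> \<in> paths N x y" "path_length N \<gamma> \<le> ennreal C"
proof -
  let ?o = "e {}"
  \<comment> \<open>The first half moves all weight of \<open>x\<close> to the least element, the
    second half moves it on to \<open>y\<close>. Each half stays in one simplex, since the least
    element extends any chain.\<close>
  define \<gamma> where "\<gamma> t p = max 0 (1 - 2 * t) * x p + max 0 (2 * t - 1) * y p +
    (1 - \<bar>2 * t - 1\<bar>) * (if p = ?o then 1 else 0)" for t p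
  have cone: "\<exists>ps. maximal_chain N ps \<and> support z \<subseteq> set ps \<and> ?o \<in> set ps"
    if z: "z \<in> orthoscheme_complex N" for z
  proof -
    have "chain_in N (insert ?o (support z))"
      using K_chain[OF z] K_carrier[OF z] bot by (intro chain_in_insert e_carrier) auto
    then show ?thesis by (rule extend_chain) auto
  qed
  obtain p1 where p1: "maximal_chain N p1" "support x \<subseteq> set p1" "?o \<in> set p1" using cone[OF x] by blast
  obtain p2 where p2: "maximal_chain N p2" "support y \<subseteq> set p2" "?o \<in> set p2" using cone[OF y] by blast
  have segment: "(\<lambda>p. u * z p + (1 - u) * (if p = ?o then 1 else 0)) \<in> simplex N ps"
    if z: "z \<in> orthoscheme_complex N" and ps: "maximal_chain N ps" "support z \<subseteq> set ps" "?o \<in> set ps"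
      and u: "0 \<le> u" "u \<le> 1" for z ps u
  proof -
    have "z \<in> simplex N ps" using z ps by (simp add: simplex_def)
    then show ?thesis
      using max_chain[OF ps(1)] u ps(3)
      by (auto simp: simplex_iff sum.distrib simp flip: sum_distrib_left)
  qed
  have "\<gamma> t \<in> simplex N p1" if "0 \<le> t" "t \<le> 1 / 2" for t
  proof -
    have "\<gamma> t = (\<lambda>p. (1 - 2 * t) * x p + (1 - (1 - 2 * t)) * (if p = ?o then 1 else 0))"
    proof -
      have "max 0 (1 - 2 * t) = 1 - 2 * t" "max 0 (2 * t - 1) = 0" "\<bar>2 * t - 1\<bar> = 1 - 2 * t"
        using that by auto
      then show ?thesis by (simp add: \<gamma>_def fun_eq_iff)
    qed
    then show ?thesis using segment[OF x p1, of "1 - 2 * t"] that by simp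
  qed
  moreover have "\<gamma> t \<in> simplex N p2" if "1 / 2 \<le> t" "t \<le> 1" for t
  proof -
    have "\<gamma> t = (\<lambda>p. (2 * t - 1) * y p + (1 - (2 * t - 1)) * (if p = ?o then 1 else 0))"
    proof -
      have "max 0 (1 - 2 * t) = 0" "max 0 (2 * t - 1) = 2 * t - 1" "\<bar>2 * t - 1\<bar> = 2 * t - 1"
        using that by auto
      then show ?thesis by (simp add: \<gamma>_def fun_eq_iff)
    qed
    then show ?thesis using segment[OF y p2, of "2 * t - 1"] that by simp
  qed
  ultimately have "subdivision N \<gamma> ([0, 1 / 2, 1], [p1, p2])"
    using p1(1) p2(1) by (auto simp: subdivision_def less_Suc_eq)
  moreover have "continuous_on {0..1} (\<lambda>t. \<gamma> t p)" for p
    unfolding \<gamma>_def by (intro continuous_intros)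
  moreover have "\<gamma> 0 = x" "\<gamma> 1 = y" by (auto simp: \<gamma>_def)
  ultimately have path: "\<gamma> \<in> paths N x y" by (auto simp: paths_def)
  have rho: "rho (\<gamma> t) i = max 0 (1 - 2 * t) * rho x i + max 0 (2 * t - 1) * rho y i" for t i
  proof -
    let ?C = "insert ?o (support x \<union> support y)"
    have C: "finite ?C" using K_finite x y by simp
    have "support (\<gamma> t) \<subseteq> ?C" by (auto simp: support_def \<gamma>_def)
    then have "rho (\<gamma> t) i = (\<Sum>p\<in>?C. if i \<in> J p then \<gamma> t p else 0)"
      by (rule rho_eq_sum[OF C])
    also have "\<dots> = (\<Sum>p\<in>?C. max 0 (1 - 2 * t) * (if i \<in> J p then x p else 0) +
        max 0 (2 * t - 1) * (if i \<in> J p then y p else 0))"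
      by (rule sum.cong) (auto simp: \<gamma>_def J_e)
    also have "\<dots> = max 0 (1 - 2 * t) * rho x i + max 0 (2 * t - 1) * rho y i"
    proof -
      have "support x \<subseteq> ?C" "support y \<subseteq> ?C" by auto
      then show ?thesis
        by (simp only: sum.distrib rho_eq_sum[OF C] flip: sum_distrib_left)
    qed
    finally show ?thesis .
  qed
  \<comment> \<open>Both \<open>max\<close> factors vary with speed at most \<open>2\<close> and
    multiply numbers in \<open>[0, 1]\<close>, giving \<open>4\<close> per coordinate; the sum over
    the \<open>n\<close> coordinates bounds the euclidean norm.\<close>
  have "path_length N \<gamma> \<le> ennreal (4 * real n)"
  proof (rule path_length_le)
    fix s t :: real assume st: "0 \<le> s" "s \<le> t" "t \<le> 1"
    have "\<bar>rho (\<gamma> s) i - rho (\<gamma> t) i\<bar> \<le> 4 * (t - s)" for i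
    proof -
      have "rho (\<gamma> s) i - rho (\<gamma> t) i = (max 0 (1 - 2 * s) - max 0 (1 - 2 * t)) * rho x i
          + (max 0 (2 * s - 1) - max 0 (2 * t - 1)) * rho y i"
        by (simp add: rho algebra_simps)
      also have "\<bar>\<dots>\<bar> \<le> \<bar>max 0 (1 - 2 * s) - max 0 (1 - 2 * t)\<bar> * \<bar>rho x i\<bar>
          + \<bar>max 0 (2 * s - 1) - max 0 (2 * t - 1)\<bar> * \<bar>rho y i\<bar>"
        by (metis abs_mult abs_triangle_ineq)
      also have "\<dots> \<le> 2 * (t - s) * 1 + 2 * (t - s) * 1"
        using rho_bounds[OF x, of i] rho_bounds[OF y, of i] st
        by (intro add_mono mult_mono) auto
      finally show ?thesis by simp
    qed
    then have "(\<Sum>i<n. \<bar>rho (\<gamma> s) i - rho (\<gamma> t) i\<bar>) \<le> (\<Sum>i<n. 4 * (t - s))"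
      by (intro sum_mono)
    then show "euclid n (rho (\<gamma> s)) (rho (\<gamma> t)) \<le> 4 * real n * (t - s)"
      unfolding euclid_def
      using L2_set_le_sum_abs[of "\<lambda>i. rho (\<gamma> s) i - rho (\<gamma> t) i" "{..<n}"] by (simp add: algebra_simps)
  qed
  then show thesis using that path by blast
qed

lemma euclid_le_complex_dist:
  assumes x: "x \<in> orthoscheme_complex N" and y: "y \<in> orthoscheme_complex N"
  shows "euclid n (rho x) (rho y) \<le> complex_dist N x y"
proof -
  let ?I = "INF \<gamma> \<in> paths N x y. path_length N \<gamma>"
  obtain \<gamma> C where \<gamma>: "\<gamma> \<in> paths N x y" "path_length N \<gamma> \<le> ennreal C"
    using finite_length_path[OF assms] by blast
  have "?I \<le> ennreal C" using INF_lower[OF \<gamma>(1)] \<gamma>(2) by (rule order_trans)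
  then have fin: "?I < top_class.top" using ennreal_less_top le_less_trans by blast
  have "ennreal (euclid n (rho x) (rho y)) \<le> ?I"
    by (rule INF_greatest) (rule path_length_ge)
  then have "enn2real (ennreal (euclid n (rho x) (rho y))) \<le> enn2real ?I"
    using fin by (rule enn2real_mono)
  then show ?thesis by (simp add: complex_dist_def)
qed

subsection \<open>Points of the apartment\<close>

definition apartment :: "'p set" where
  "apartment = e ` Pow {..<n}"

lemma apartmentE:
  assumes "p \<in> apartment" obtains "J p \<subseteq> {..<n}" "p = e (J p)"
  using assms by (auto simp: apartment_def J_e)

text \<open>The inverse of \<open>rho\<close> on the apartment: the weight of \<open>e S\<close> is
  the drop from the smallest coordinate inside \<open>S\<close> to the largest outside, cut off at
  \<open>0\<close>. The inserted \<open>1\<close> and \<open>0\<close> are the conventions for an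
  empty inside and an empty outside. A formula visibly continuous in \<open>a\<close> is preferred
  to one that sorts the coordinates, as paths need continuous coefficients.\<close>

definition iota :: "(nat \<Rightarrow> real) \<Rightarrow> 'p \<Rightarrow> real" where
  "iota a p = (if p \<in> apartment
     then max 0 (Min (insert 1 (a ` J p)) - Max (insert 0 (a ` ({..<n} - J p)))) else 0)"

lemma iota_cong: "(\<And>i. i < n \<Longrightarrow> a i = b i) \<Longrightarrow> iota a = iota b"
proof
  fix p assume eq: "\<And>i. i < n \<Longrightarrow> a i = b i"
  show "iota a p = iota b p"
  proof (cases "p \<in> apartment")
    case True
    then have "J p \<subseteq> {..<n}" by (rule apartmentE)
    then have "a ` J p = b ` J p" "a ` ({..<n} - J p) = b ` ({..<n} - J p)"
      using eq by (auto intro!: image_cong)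
    then show ?thesis by (simp add: iota_def)
  qed (simp add: iota_def)
qed

text \<open>Nonnegative weights are monotone along nested sets, so the least weight belongs to the
  least set, which is the intersection. \<open>C\<close> takes part so that an empty family yields
  the full weight.\<close>

lemma Min_nested:
  fixes w :: "'a \<Rightarrow> real"
  assumes "finite I" "finite C" "\<And>p. p \<in> C \<Longrightarrow> 0 \<le> w p"
    and "\<And>i. i \<in> I \<Longrightarrow> A i \<subseteq> C" "\<And>i j. i \<in> I \<Longrightarrow> j \<in> I \<Longrightarrow> A i \<subseteq> A j \<or> A j \<subseteq> A i"
  shows "Min (insert (sum w C) ((\<lambda>i. sum w (A i)) ` I)) = sum w (C \<inter> (\<Inter>i\<in>I. A i))"
  using assms
proof (induction I rule: finite_induct)
  case empty
  then show ?case by simp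
next
  case (insert i I)
  let ?B = "C \<inter> (\<Inter>i\<in>I. A i)"
  have IH: "Min (insert (sum w C) ((\<lambda>i. sum w (A i)) ` I)) = sum w ?B"
    using insert by auto
  have "Min (insert (sum w C) ((\<lambda>i. sum w (A i)) ` insert i I)) = min (sum w (A i)) (sum w ?B)"
    using insert.hyps by (simp add: insert_commute[of "sum w C"] IH)
  also have "\<dots> = sum w (A i \<inter> ?B)"
  proof -
    have Ai: "A i \<subseteq> C" using insert by auto
    then have fin: "finite (A i)" "finite ?B"
      using insert.prems(1) rev_finite_subset by blast+
    have "A i \<subseteq> ?B \<or> ?B \<subseteq> A i" using insert.prems(4)[of i] Ai by fast
    then show ?thesis
    proof
      assume s: "A i \<subseteq> ?B"
      then have "sum w (A i) \<le> sum w ?B" using insert.prems(2) fin by (intro sum_mono2) auto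
      then show ?thesis using s by (simp add: Int_absorb2 min_absorb1)
    next
      assume s: "?B \<subseteq> A i"
      then have "sum w ?B \<le> sum w (A i)" using insert.prems(2) Ai fin by (intro sum_mono2) auto
      then show ?thesis using s by (simp add: Int_absorb1 min_absorb2)
    qed
  qed
  also have "A i \<inter> ?B = C \<inter> (\<Inter>i\<in>insert i I. A i)" by blast
  finally show ?case .
qed

lemma Max_nested:
  fixes w :: "'a \<Rightarrow> real"
  assumes "finite I" "finite C" "\<And>p. p \<in> C \<Longrightarrow> 0 \<le> w p"
    and "\<And>i. i \<in> I \<Longrightarrow> A i \<subseteq> C" "\<And>i j. i \<in> I \<Longrightarrow> j \<in> I \<Longrightarrow> A i \<subseteq> A j \<or> A j \<subseteq> A i"
  shows "Max (insert 0 ((\<lambda>i. sum w (A i)) ` I)) = sum w (\<Union>i\<in>I. A i)"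
  using assms
proof (induction I rule: finite_induct)
  case empty
  then show ?case by simp
next
  case (insert i I)
  let ?B = "\<Union>i\<in>I. A i"
  have IH: "Max (insert 0 ((\<lambda>i. sum w (A i)) ` I)) = sum w ?B"
    using insert by auto
  have "Max (insert 0 ((\<lambda>i. sum w (A i)) ` insert i I)) = max (sum w (A i)) (sum w ?B)"
    using insert.hyps by (simp add: insert_commute[of 0] IH)
  also have "\<dots> = sum w (A i \<union> ?B)"
  proof -
    have Ai: "A i \<subseteq> C" and B: "?B \<subseteq> C" using insert by auto
    then have fin: "finite (A i)" "finite ?B"
      using insert.prems(1) rev_finite_subset by blast+
    have "A i \<subseteq> ?B \<or> ?B \<subseteq> A i" using insert.prems(4)[of i] by fast
    then show ?thesis
    proof
      assume s: "A i \<subseteq> ?B"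
      then have "sum w (A i) \<le> sum w ?B" using insert.prems(2) B fin by (intro sum_mono2) auto
      then show ?thesis using s by (simp add: Un_absorb1 max_absorb2)
    next
      assume s: "?B \<subseteq> A i"
      then have "sum w ?B \<le> sum w (A i)" using insert.prems(2) Ai fin by (intro sum_mono2) auto
      then show ?thesis using s by (simp add: Un_absorb2 max_absorb1)
    qed
  qed
  also have "A i \<union> ?B = (\<Union>i\<in>insert i I. A i)" by blast
  finally show ?case .
qed

text \<open>The minimum over \<open>J p\<close> is the weight of the members \<open>q\<close> whose
  \<open>J q\<close> contains \<open>J p\<close>, the maximum outside is the weight of those whose
  \<open>J q\<close> is not contained in \<open>J p\<close>. In a chain the first family is the
  second plus \<open>p\<close> if \<open>p\<close> carries weight, and is contained in the second
  otherwise.\<close>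

lemma iota_rho:
  assumes x: "x \<in> orthoscheme_complex N" and ap: "support x \<subseteq> apartment"
  shows "iota (rho x) = x"
proof
  fix p
  let ?C = "support x"
  have fin: "finite ?C" and nn: "\<And>p. 0 \<le> x p" and sum1: "sum x ?C = 1" and ch: "chain_in N ?C"
    using K_finite[OF x] K_nonneg[OF x] K_sum[OF x] K_chain[OF x] by auto
  show "iota (rho x) p = x p"
  proof (cases "p \<in> apartment")
    case False
    then show ?thesis using ap by (auto simp: iota_def support_def)
  next
    case True
    then have S: "J p \<subseteq> {..<n}" "p = e (J p)" by (auto elim: apartmentE)
    let ?A = "\<lambda>i. {q \<in> ?C. i \<in> J q}"
    have rho: "rho x i = sum x (?A i)" for i
      unfolding rho_def using fin by (simp add: sum.inter_filter)
    have nested: "?A i \<subseteq> ?A j \<or> ?A j \<subseteq> ?A i" for i j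
      using chain_J_total[OF ch] by blast
    have "Min (insert 1 (rho x ` J p)) = sum x (?C \<inter> (\<Inter>i\<in>J p. ?A i))"
      using Min_nested[of "J p" ?C x ?A] fin nn nested S(1) by (simp add: rho[abs_def] sum1 finite_subset[OF S(1)])
    also have "?C \<inter> (\<Inter>i\<in>J p. ?A i) = {q \<in> ?C. J p \<subseteq> J q}" (is "_ = ?U") by auto
    finally have U: "Min (insert 1 (rho x ` J p)) = sum x ?U" .
    have "Max (insert 0 (rho x ` ({..<n} - J p))) = sum x (\<Union>i\<in>{..<n} - J p. ?A i)"
      using Max_nested[of "{..<n} - J p" ?C x ?A] fin nn nested by (simp add: rho[abs_def])
    also have "(\<Union>i\<in>{..<n} - J p. ?A i) = {q \<in> ?C. \<not> J q \<subseteq> J p}" (is "_ = ?V")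
      using J_sub K_carrier[OF x] by fastforce
    finally have V: "Max (insert 0 (rho x ` ({..<n} - J p))) = sum x ?V" .
    have Jeq: "q = p" if "q \<in> ?C" "J q = J p" for q
      using that ap S by (metis apartmentE subsetD)
    have "max 0 (sum x ?U - sum x ?V) = x p"
    proof (cases "p \<in> ?C")
      case True
      have "?U = insert p ?V"
      proof (intro equalityI subsetI)
        fix q assume "q \<in> ?U"
        then show "q \<in> insert p ?V" using Jeq[of q] by auto
      next
        fix q assume "q \<in> insert p ?V"
        then show "q \<in> ?U" using True chain_J_total[OF ch _ True, of q] by auto
      qed
      moreover have "p \<notin> ?V" by simp
      ultimately have "sum x ?U = x p + sum x ?V" using fin by simp
      then show ?thesis using nn[of p] by simp
    next
      case False
      then have "?U \<subseteq> ?V" using Jeq by blast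
      then have "sum x ?U \<le> sum x ?V" using fin nn by (intro sum_mono2) auto
      then show ?thesis using False by (simp add: support_def)
    qed
    then show ?thesis using True by (simp add: iota_def U V)
  qed
qed

lemma apartment_eqI:
  assumes "x \<in> orthoscheme_complex N" "support x \<subseteq> apartment"
    and "y \<in> orthoscheme_complex N" "support y \<subseteq> apartment"
    and "\<And>i. i < n \<Longrightarrow> rho x i = rho y i"
  shows "x = y"
  using iota_rho assms iota_cong by metis

lemma iota_continuous:
  assumes "\<And>i. i < n \<Longrightarrow> continuous_on T (\<lambda>t. a t i)"
  shows "continuous_on T (\<lambda>t. iota (a t) p)"
proof (cases "p \<in> apartment")
  case True
  have Min: "continuous_on T (\<lambda>t. Min (insert 1 (a t ` S)))"
    and Max: "continuous_on T (\<lambda>t. Max (insert 0 (a t ` S)))" if "S \<subseteq> {..<n}" for S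
  proof -
    have "finite S" using that finite_subset by auto
    then have "S \<subseteq> {..<n} \<longrightarrow> continuous_on T (\<lambda>t. Min (insert 1 (a t ` S))) \<and>
        continuous_on T (\<lambda>t. Max (insert 0 (a t ` S)))"
    proof (induction S rule: finite_induct)
      case (insert i S)
      have "Min (insert 1 (a t ` insert i S)) = min (a t i) (Min (insert 1 (a t ` S)))" for t
        using insert.hyps by (simp add: insert_commute[of 1])
      moreover have "Max (insert 0 (a t ` insert i S)) = max (a t i) (Max (insert 0 (a t ` S)))" for t
        using insert.hyps by (simp add: insert_commute[of 0])
      ultimately show ?case using insert.IH assms
        by (auto intro!: continuous_on_min continuous_on_max)
    qed simp
    then show "continuous_on T (\<lambda>t. Min (insert 1 (a t ` S)))"
      "continuous_on T (\<lambda>t. Max (insert 0 (a t ` S)))" using that by auto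
  qed
  have "J p \<subseteq> {..<n}" using True by (rule apartmentE)
  then show ?thesis using True Min Max by (auto simp: iota_def intro!: continuous_intros)
qed (simp add: iota_def)

end

subsection \<open>Sorting\<close>

text \<open>\<open>pos\<close> lists the coordinates in weakly decreasing order and thus names a
  maximal simplex of the apartment containing the point. Ties are left open on purpose: all points
  of a short segment then share one \<open>pos\<close>.\<close>

definition sorting :: "nat \<Rightarrow> (nat \<Rightarrow> real) \<Rightarrow> (nat \<Rightarrow> nat) \<Rightarrow> bool" where
  "sorting n a pos \<longleftrightarrow> bij_betw pos {..<n} {..<n} \<and> (\<forall>i<n. \<forall>j<n. pos i \<le> pos j \<longrightarrow> a j \<le> a i)"

text \<open>Ties are broken by the index, which makes positions distinct. A count, rather than a
  sorting algorithm, is also what the program will evaluate.\<close>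

definition rank_position :: "nat \<Rightarrow> (nat \<Rightarrow> real) \<Rightarrow> nat \<Rightarrow> nat" where
  "rank_position n a i = card {k. k < n \<and> (a i < a k \<or> a k = a i \<and> k < i)}"

lemma sorting_rank_position: "sorting n a (rank_position n a)"
proof -
  let ?P = "\<lambda>i. {k. k < n \<and> (a i < a k \<or> a k = a i \<and> k < i)}"
  have less: "rank_position n a i < rank_position n a j"
    if "i < n" "a j < a i \<or> a i = a j \<and> i < j" for i j
  proof -
    have "?P i \<subset> ?P j" using that by auto
    then show ?thesis unfolding rank_position_def by (intro psubset_card_mono) auto
  qed
  have "inj_on (rank_position n a) {..<n}"
  proof (rule inj_onI, clarsimp)
    fix i j assume ij: "i < n" "j < n" "rank_position n a i = rank_position n a j"
    then show "i = j" using less[of i j] less[of j i] by (metis linorder_neqE_nat less_irrefl linorder_neqE_linordered_idom)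
  qed
  moreover have "rank_position n a ` {..<n} \<subseteq> {..<n}"
  proof clarsimp
    fix i assume "i < n"
    then have "?P i \<subset> {..<n}" by auto
    then show "rank_position n a i < n"
      unfolding rank_position_def using psubset_card_mono[of "{..<n}" "?P i"] by simp
  qed
  ultimately have "bij_betw (rank_position n a) {..<n} {..<n}"
    by (simp add: bij_betw_def card_image card_subset_eq)
  moreover have "a j \<le> a i" if "i < n" "j < n" "rank_position n a i \<le> rank_position n a j" for i j
    using less[of j i] that by fastforce
  ultimately show ?thesis by (simp add: sorting_def)
qed

context retraction
begin

text \<open>The point with coordinates \<open>a\<close>, written on the chain of prefixes of the
  sorted order: the weights are consecutive differences of the sorted values, padded by
  \<open>1\<close> in front and \<open>0\<close> at the end. The padded list \<open>v\<close> is a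
  parameter so that the array computed by the program can be substituted for it.\<close>

lemma sorted_point:
  assumes pos: "sorting n a pos" and a: "\<And>i. i < n \<Longrightarrow> 0 \<le> a i \<and> a i \<le> 1"
    and v: "v 0 = 1" "v (Suc n) = 0" "\<And>i. i < n \<Longrightarrow> v (Suc (pos i)) = a i"
  defines "L \<equiv> \<lambda>k. {i. i < n \<and> pos i < k}"
  defines "ps \<equiv> map (\<lambda>k. e (L k)) [0..<Suc n]"
  defines "x \<equiv> (\<lambda>q. \<Sum>k<Suc n. if e (L k) = q then v k - v (Suc k) else 0)"
  shows "maximal_chain N ps" "x \<in> simplex N ps" "support x \<subseteq> apartment" "\<And>i. i < n \<Longrightarrow> rho x i = a i"
    and "\<And>k. k < Suc n \<Longrightarrow> 0 \<le> v k - v (Suc k)"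
    and "\<And>k l. k < l \<Longrightarrow> l < Suc n \<Longrightarrow> e (L k) \<sqsubset>\<^bsub>N\<^esub> e (L l)"
proof -
  have bij: "bij_betw pos {..<n} {..<n}" and mono: "\<And>i j. i < n \<Longrightarrow> j < n \<Longrightarrow> pos i \<le> pos j \<Longrightarrow> a j \<le> a i"
    using pos by (auto simp: sorting_def)
  have Lsub: "L k \<subseteq> {..<n}" for k by (auto simp: L_def)
  have Lmono: "k \<le> l \<Longrightarrow> L k \<subseteq> L l" for k l by (auto simp: L_def)
  have cardL: "card (L k) = k" if "k \<le> n" for k
  proof -
    have img: "pos ` {..<n} = {..<n}" and inj: "inj_on pos (L k)"
      using bij inj_on_subset[OF _ Lsub] by (auto simp: bij_betw_def)
    have "pos ` L k = {..<k}"
    proof (intro equalityI subsetI)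
      fix l assume "l \<in> {..<k}"
      then have "l < k" "l \<in> pos ` {..<n}" using that img by auto
      then show "l \<in> pos ` L k" by (auto simp: L_def)
    qed (auto simp: L_def)
    then show ?thesis using card_image[OF inj] by simp
  qed
  have eL: "e (L k) \<in> carrier N" "J (e (L k)) = L k" for k using Lsub e_carrier J_e by auto
  have inj: "k = l" if "k \<le> n" "l \<le> n" "e (L k) = e (L l)" for k l
    using that eL cardL by metis
  show lt: "e (L k) \<sqsubset>\<^bsub>N\<^esub> e (L l)" if "k < l" "l < Suc n" for k l
    using that e_mono[OF Lmono Lsub, of k l] inj[of k l] by (auto simp: lless_iff)
  have set: "set ps = (\<lambda>k. e (L k)) ` {..n}"
    by (auto simp: ps_def less_Suc_eq_le image_iff atLeast0LessThan simp del: upt_Suc)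
  have ch: "chain_in N (set ps)"
    unfolding set chain_in_def
  proof (intro conjI ballI)
    fix p q assume "p \<in> (\<lambda>k. e (L k)) ` {..n}" "q \<in> (\<lambda>k. e (L k)) ` {..n}"
    then obtain k l where "p = e (L k)" "q = e (L l)" by blast
    then show "p \<sqsubseteq>\<^bsub>N\<^esub> q \<or> q \<sqsubseteq>\<^bsub>N\<^esub> p"
      using e_mono[OF Lmono Lsub, of k l] e_mono[OF Lmono Lsub, of l k] nat_le_linear[of k l] by auto
  qed (use eL in auto)
  show max: "maximal_chain N ps"
    unfolding maximal_chain_def
  proof (intro conjI allI impI ch)
    show "sorted_wrt (\<sqsubset>\<^bsub>N\<^esub>) ps"
      by (auto simp: ps_def sorted_wrt_iff_nth_less lt simp del: upt_Suc)
    fix C assume C: "chain_in N C \<and> set ps \<subseteq> C"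
    have "q \<in> set ps" if q: "q \<in> C" for q
    proof -
      have cq: "card (J q) \<le> n" using C q card_J_le by (auto simp: chain_in_def)
      let ?p = "e (L (card (J q)))"
      have "?p \<in> set ps" using cq set by auto
      moreover have "card (J ?p) = card (J q)" using eL cardL cq by simp
      ultimately have "?p = q"
        using chain_inj_card_J[of C] C q by (metis inj_on_def subsetD)
      then show ?thesis using \<open>?p \<in> set ps\<close> by simp
    qed
    then show "C = set ps" using C by blast
  qed
  have v_bounds: "0 \<le> v k \<and> v k \<le> 1" if "k \<le> Suc n" for k
  proof (cases "k = 0 \<or> k = Suc n")
    case False
    then have "k - 1 \<in> pos ` {..<n}" using bij that by (auto simp: bij_betw_def)
    then show ?thesis using False a v(3) by (metis Suc_pred' imageE lessThan_iff neq0_conv)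
  qed (use v in auto)
  show v_dec: "0 \<le> v k - v (Suc k)" if "k < Suc n" for k
  proof (cases "k = 0 \<or> k = n")
    case True
    then show ?thesis using v v_bounds[of "Suc k"] v_bounds[of k] that by auto
  next
    case False
    then have "k - 1 \<in> pos ` {..<n}" "k \<in> pos ` {..<n}" using bij that by (auto simp: bij_betw_def)
    then obtain i j where "i < n" "j < n" "pos i = k - 1" "pos j = k" by auto
    then show ?thesis using v(3)[of i] v(3)[of j] mono[of i j] False by auto
  qed
  have xL: "x (e (L k)) = v k - v (Suc k)" if "k \<le> n" for k
  proof -
    have "x (e (L k)) = (\<Sum>l<Suc n. if l = k then v l - v (Suc l) else 0)"
      unfolding x_def using inj that by (intro sum.cong) auto
    then show ?thesis using that by (simp del: sum.lessThan_Suc)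
  qed
  have x0: "x q = 0" if "q \<notin> set ps" for q
    unfolding x_def using that set by (intro sum.neutral) auto
  have sum: "(\<Sum>q\<in>set ps. f q) = (\<Sum>k<Suc n. f (e (L k)))" for f :: "'p \<Rightarrow> real"
    unfolding set by (subst sum.reindex) (auto simp: inj_on_def inj lessThan_Suc_atMost)
  show xs: "x \<in> simplex N ps"
    unfolding simplex_iff[OF ch]
  proof (intro conjI allI impI x0)
    show "0 \<le> x q" for q unfolding x_def using v_dec by (intro sum_nonneg) auto
    have "(\<Sum>q\<in>set ps. x q) = (\<Sum>k<Suc n. v k - v (Suc k))"
      unfolding sum by (rule sum.cong) (auto simp: xL less_Suc_eq_le)
    also have "\<dots> = 1" unfolding sum_lessThan_telescope' using v by simp
    finally show "(\<Sum>q\<in>set ps. x q) = 1" .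
  qed simp
  have "support x \<subseteq> set ps" using x0 by (auto simp: support_def)
  then show "support x \<subseteq> apartment" using set Lsub by (auto simp: apartment_def)
  fix i assume i: "i < n"
  then have pi: "pos i < n" using bij by (auto simp: bij_betw_def)
  have "rho x i = (\<Sum>k<Suc n. if i \<in> J (e (L k)) then x (e (L k)) else 0)"
    using rho_eq_sum[of "set ps" x i] \<open>support x \<subseteq> set ps\<close> by (simp add: sum del: sum.lessThan_Suc)
  also have "\<dots> = (\<Sum>k<Suc n. if Suc (pos i) \<le> k then v k - v (Suc k) else 0)"
  proof (rule sum.cong, simp)
    fix k assume "k \<in> {..<Suc n}"
    moreover have "i \<in> L k \<longleftrightarrow> Suc (pos i) \<le> k" using i by (auto simp: L_def)
    ultimately show "(if i \<in> J (e (L k)) then x (e (L k)) else 0) =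
        (if Suc (pos i) \<le> k then v k - v (Suc k) else 0)"
      by (simp add: eL xL)
  qed
  \<comment> \<open>Index \<open>i\<close> belongs to the prefixes longer than \<open>pos i\<close>;
    their weights telescope to \<open>v (Suc (pos i))\<close>, the final value being
    \<open>0\<close>.\<close>
  also have "\<dots> = (\<Sum>k = Suc (pos i)..<Suc n. v k - v (Suc k))"
    by (rule sum.mono_neutral_cong_right) auto
  also have "\<dots> = - (\<Sum>k = Suc (pos i)..<Suc n. v (Suc k) - v k)"
    by (simp add: sum_negf[symmetric] del: sum.op_ivl_Suc)
  also have "\<dots> = a i" using v i pi by (subst sum_Suc_diff') auto
  finally show "rho x i = a i" .
qed

text \<open>The maximal chain depends on \<open>pos\<close> alone, so it serves all coordinate
  vectors sorted by \<open>pos\<close> at once; this places a whole piece of a segment in one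
  simplex.\<close>

lemma ex_sorted_point:
  assumes pos: "sorting n a pos" and a: "\<And>i. i < n \<Longrightarrow> 0 \<le> a i \<and> a i \<le> 1"
  obtains ps where "maximal_chain N ps"
    and "\<And>b. sorting n b pos \<Longrightarrow> (\<And>i. i < n \<Longrightarrow> 0 \<le> b i \<and> b i \<le> 1) \<Longrightarrow>
      iota b \<in> simplex N ps \<and> support (iota b) \<subseteq> apartment \<and> (\<forall>i<n. rho (iota b) i = b i)"
proof -
  let ?L = "\<lambda>k. {i. i < n \<and> pos i < k}"
  let ?ps = "map (\<lambda>k. e (?L k)) [0..<Suc n]"
  define v where "v b k = (if k = 0 then 1 else if k = Suc n then 0 else b (inv_into {..<n} pos (k - 1)))"
    for b :: "nat \<Rightarrow> real" and k
  have bij: "bij_betw pos {..<n} {..<n}" using pos by (simp add: sorting_def)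
  have v: "v b 0 = 1" "v b (Suc n) = 0" "i < n \<Longrightarrow> v b (Suc (pos i)) = b i" for b i
    using bij by (auto simp: v_def bij_betw_def inv_into_f_f)
  have "iota b \<in> simplex N ?ps \<and> support (iota b) \<subseteq> apartment \<and> (\<forall>i<n. rho (iota b) i = b i)"
    if b: "sorting n b pos" "\<And>i. i < n \<Longrightarrow> 0 \<le> b i \<and> b i \<le> 1" for b
  proof -
    let ?x = "\<lambda>q. \<Sum>k<Suc n. if e (?L k) = q then v b k - v b (Suc k) else 0"
    note sp = sorted_point[OF b, of "v b", OF _ v]
    have "iota (rho ?x) = ?x" using sp(2,3) v by (intro iota_rho) (auto simp: simplex_def)
    moreover have "iota (rho ?x) = iota b" using sp(4) v by (intro iota_cong) auto
    ultimately show ?thesis using sp v by simp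
  qed
  moreover have "maximal_chain N ?ps" using sorted_point(1)[OF assms, of "v a", OF _ v] v by simp
  ultimately show thesis using that by blast
qed

lemma iota_point:
  assumes a: "\<And>i. i < n \<Longrightarrow> 0 \<le> a i \<and> a i \<le> 1"
  shows "iota a \<in> orthoscheme_complex N" "support (iota a) \<subseteq> apartment" "i < n \<Longrightarrow> rho (iota a) i = a i"
proof -
  obtain ps where "iota a \<in> simplex N ps \<and> support (iota a) \<subseteq> apartment \<and> (\<forall>i<n. rho (iota a) i = a i)"
    by (rule ex_sorted_point[OF sorting_rank_position a]) (use sorting_rank_position a in blast)+
  then show "iota a \<in> orthoscheme_complex N" "support (iota a) \<subseteq> apartment" "i < n \<Longrightarrow> rho (iota a) i = a i"
    by (auto simp: simplex_def)
qed

subsection \<open>Distances within the apartment\<close>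

text \<open>A straight segment of the cube changes simplices only when two coordinates cross.
  Finitely many pairs give finitely many crossing times, and these form the required
  subdivision.\<close>

lemma segment_path:
  assumes a: "\<And>i. i < n \<Longrightarrow> 0 \<le> a i \<and> a i \<le> 1" and b: "\<And>i. i < n \<Longrightarrow> 0 \<le> b i \<and> b i \<le> 1"
  defines "g \<equiv> \<lambda>t i. (1 - t) * a i + t * b i"
  shows "(\<lambda>t. iota (g t)) \<in> paths N (iota a) (iota b)"
proof -
  \<comment> \<open>The time at which coordinates \<open>i\<close> and \<open>j\<close> agree. A
    zero denominator yields the time \<open>0\<close>, which is a breakpoint anyway.\<close>
  define z where "z i j = (a i - a j) / ((a i - a j) - (b i - b j))" for i j
  define B where "B = insert 0 (insert 1 ((\<lambda>(i, j). z i j) ` ({..<n} \<times> {..<n}) \<inter> {0..1}))"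
  have B: "finite B" "B \<noteq> {}" "B \<subseteq> {0..1}" "0 \<in> B" "1 \<in> B" by (auto simp: B_def)
  define ts where "ts = sorted_list_of_set B"
  have ts: "set ts = B" "sorted_wrt (<) ts" "ts \<noteq> []"
    unfolding ts_def using B by (simp_all add: strict_sorted_list_of_set)
  have "hd ts = Min B" using B by (simp add: ts_def sorted_list_of_set_nonempty)
  then have hd: "hd ts = 0" using B by (metis Min_eqI atLeastAtMost_iff subsetD)
  have last: "last ts = 1"
  proof -
    obtain k where k: "k < length ts" "ts ! k = 1" using ts B by (metis in_set_conv_nth)
    have "last ts \<le> 1" using ts B last_in_set by fastforce
    then have "\<not> k < length ts - 1"
      using sorted_wrt_nth_less[OF ts(2), of k "length ts - 1"] k ts(3) by (auto simp: last_conv_nth)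
    then show ?thesis using k ts(3) by (metis last_conv_nth Suc_pred' length_greater_0_conv less_antisym)
  qed
  have g: "0 \<le> g t i \<and> g t i \<le> 1" if "i < n" "0 \<le> t" "t \<le> 1" for t i
    using that a[of i] b[of i] convex_bound_le[of "a i" 1 "b i" "1 - t" t] by (auto simp: g_def)
  have piece: "\<exists>ps. maximal_chain N ps \<and> (\<lambda>t. iota (g t)) ` {ts ! k .. ts ! Suc k} \<subseteq> simplex N ps"
    if k: "k < length ts - 1" for k
  proof -
    let ?s = "ts ! k" and ?u = "ts ! Suc k"
    have su: "?s < ?u" using sorted_wrt_nth_less[OF ts(2), of k "Suc k"] k by simp
    have "?s \<in> B" "?u \<in> B" using ts k by auto
    then have su01: "0 \<le> ?s" "?u \<le> 1" using B by auto
    have gap: "c \<notin> B" if "?s < c" "c < ?u" for c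
    proof
      assume "c \<in> B"
      then obtain l where l: "l < length ts" "ts ! l = c" using ts by (metis in_set_conv_nth)
      consider "l < k" | "l = k" | "l = Suc k" | "Suc k < l" by linarith
      then show False
      proof cases
        case 1
        then show False using sorted_wrt_nth_less[OF ts(2), of l k] l that k by linarith
      next
        case 4
        then show False using sorted_wrt_nth_less[OF ts(2), of "Suc k" l] l that by simp
      qed (use l that in auto)
    qed
    \<comment> \<open>The order of the coordinates at the midpoint is valid on the closed piece: a
      reversal would need a crossing time strictly inside, and there is none.\<close>
    define m where "m = (?s + ?u) / 2"
    have m: "?s < m" "m < ?u" using su by (auto simp: m_def)
    define pos where "pos = rank_position n (g m)"
    have pos: "sorting n (g m) pos" unfolding pos_def by (rule sorting_rank_position)
    have srt: "sorting n (g t) pos" if t: "?s \<le> t" "t \<le> ?u" for t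
    proof -
      have "g t j \<le> g t i" if ij: "i < n" "j < n" "pos i \<le> pos j" for i j
      proof (rule ccontr)
        let ?d = "(a i - a j) - (b i - b j)"
        have D: "g t i - g t j = (a i - a j) - t * ?d" for t by (simp add: g_def algebra_simps)
        assume "\<not> g t j \<le> g t i"
        then have neg: "a i - a j < t * ?d" using D[of t] by simp
        have "g m j \<le> g m i" using pos ij by (simp add: sorting_def)
        then have nonneg: "m * ?d \<le> a i - a j" using D[of m] by simp
        have d: "?d \<noteq> 0" using neg nonneg by (metis less_le_not_le mult_zero_right)
        have zd: "z i j * ?d = a i - a j" using d by (simp add: z_def)
        have "m * ?d \<le> z i j * ?d" "z i j * ?d < t * ?d" using zd neg nonneg by auto
        then have "(m \<le> z i j \<and> z i j < t) \<or> (t < z i j \<and> z i j \<le> m)"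
          using d by (cases "?d > 0") (auto simp: mult_less_cancel_right mult_le_cancel_right)
        then have zij: "?s < z i j" "z i j < ?u" using m t by auto
        then have "z i j \<in> B" using ij su01 by (auto simp: B_def)
        then show False using gap zij by blast
      qed
      then show ?thesis using pos by (auto simp: sorting_def)
    qed
    have "0 \<le> m" "m \<le> 1" using m su01 by auto
    then obtain ps where ps: "maximal_chain N ps"
      and "\<And>b. sorting n b pos \<Longrightarrow> (\<And>i. i < n \<Longrightarrow> 0 \<le> b i \<and> b i \<le> 1) \<Longrightarrow> iota b \<in> simplex N ps"
      using ex_sorted_point[OF pos g] by metis
    then have "(\<lambda>t. iota (g t)) ` {?s..?u} \<subseteq> simplex N ps" using srt g su01 by auto
    then show ?thesis using ps by blast
  qed
  then obtain \<sigma> where \<sigma>: "\<And>k. k < length ts - 1 \<Longrightarrow>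
      maximal_chain N (\<sigma> k) \<and> (\<lambda>t. iota (g t)) ` {ts ! k .. ts ! Suc k} \<subseteq> simplex N (\<sigma> k)"
    by metis
  have "subdivision N (\<lambda>t. iota (g t)) (ts, map \<sigma> [0..<length ts - 1])"
    unfolding subdivision_def prod.case using ts hd last \<sigma> by (auto simp del: upt_Suc)
  moreover have "continuous_on {0..1} (\<lambda>t. iota (g t) p)" for p
    unfolding g_def by (rule iota_continuous) (intro continuous_intros)
  moreover have "iota (g 0) = iota a" "iota (g 1) = iota b" by (auto simp: g_def)
  ultimately show ?thesis by (auto simp: paths_def)
qed

text \<open>The lifted segment has the length of its coordinate image, which meets the lower bound
  given by the retraction; so the apartment is an isometric copy of the cube.\<close>

lemma complex_dist_apartment:
  assumes x: "x \<in> orthoscheme_complex N" "support x \<subseteq> apartment"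
    and y: "y \<in> orthoscheme_complex N" "support y \<subseteq> apartment"
  shows "complex_dist N x y = euclid n (rho x) (rho y)"
proof (rule order.antisym)
  show "euclid n (rho x) (rho y) \<le> complex_dist N x y"
    using x y by (intro euclid_le_complex_dist)
  let ?g = "\<lambda>t i. (1 - t) * rho x i + t * rho y i"
  have b: "0 \<le> rho x i \<and> rho x i \<le> 1" "0 \<le> rho y i \<and> rho y i \<le> 1" for i
    using rho_bounds x y by auto
  have "(\<lambda>t. iota (?g t)) \<in> paths N x y"
    using segment_path[of "rho x" "rho y"] b iota_rho x y by simp
  then have "(INF \<gamma> \<in> paths N x y. path_length N \<gamma>) \<le> path_length N (\<lambda>t. iota (?g t))"
    by (rule INF_lower)
  also have "\<dots> \<le> ennreal (euclid n (rho x) (rho y))"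
  proof (rule path_length_le)
    fix s t :: real assume st: "0 \<le> s" "s \<le> t" "t \<le> 1"
    have g: "0 \<le> ?g t i \<and> ?g t i \<le> 1" if "0 \<le> t" "t \<le> 1" for t i
      using that b[of i] convex_bound_le[of "rho x i" 1 "rho y i" "1 - t" t] by auto
    have r: "rho (iota (?g t)) i = ?g t i" if "i < n" "0 \<le> t" "t \<le> 1" for t i
      using iota_point(3)[OF g] that by simp
    have "euclid n (rho (iota (?g s))) (rho (iota (?g t))) = euclid n (?g s) (?g t)"
      by (rule euclid_cong) (use r st in auto)
    also have "\<dots> = L2_set (\<lambda>i. (t - s) * (rho x i - rho y i)) {..<n}"
      unfolding euclid_def by (rule L2_set_cong) (auto simp: algebra_simps)
    also have "\<dots> = euclid n (rho x) (rho y) * (t - s)"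
      unfolding euclid_def using st by (simp add: mult.commute flip: L2_set_right_distrib)
    finally show "euclid n (rho (iota (?g s))) (rho (iota (?g t))) \<le> euclid n (rho x) (rho y) * (t - s)"
      by simp
  qed
  finally have "complex_dist N x y \<le> enn2real (ennreal (euclid n (rho x) (rho y)))"
    unfolding complex_dist_def by (rule enn2real_mono) simp
  then show "complex_dist N x y \<le> euclid n (rho x) (rho y)" by simp
qed

end

section \<open>Comparing several retractions onto one apartment\<close>

context retraction
begin

lemma chain_greatest:
  assumes "chain_in N C" "C \<noteq> {}"
  obtains p where "p \<in> C" "\<And>p'. p' \<in> C \<Longrightarrow> p' \<sqsubseteq>\<^bsub>N\<^esub> p"
proof -
  let ?K = "(\<lambda>p. card (J p)) ` C"
  have K: "finite ?K" "?K \<noteq> {}" using chain_card(1) assms by auto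
  from Max_in[OF this] obtain p where "Max ?K = card (J p)" "p \<in> C" by (rule imageE)
  moreover have "p' \<sqsubseteq>\<^bsub>N\<^esub> p" if "p' \<in> C" for p'
    using chain_card_J[OF assms(1) that \<open>p \<in> C\<close>] Max_ge[OF K(1)] that calculation by simp
  ultimately show thesis using that by blast
qed

text \<open>Retractions from different chambers agree on dimensions, which are positions in maximal
  chains.\<close>

lemma card_J_unique:
  assumes "retraction N n J' e" "p \<in> carrier N"
  shows "card (J' p) = card (J p)"
proof -
  have "chain_in N {p}" using assms(2) refl by (simp add: chain_in_def)
  then obtain ps where ps: "maximal_chain N ps" "p \<in> set ps" by (rule extend_chain) auto
  then obtain k where "k \<le> n" "ps ! k = p"
    using max_length_card(1) by (metis in_set_conv_nth less_Suc_eq_le)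
  then show ?thesis
    using max_length_card(2)[OF ps(1)] retraction.max_length_card(2)[OF assms(1) ps(1)] by metis
qed

text \<open>Pushing the weights of \<open>x\<close> forward along the retraction gives a point
  \<open>w\<close> of the apartment with the coordinates of \<open>x\<close>, hence
  \<open>w = y\<close>. Nonnegative weights cannot cancel, so each member of the support of
  \<open>x\<close> lands in the support of \<open>y\<close>.\<close>

lemma retracted_support:
  assumes x: "x \<in> orthoscheme_complex N"
    and y: "y \<in> orthoscheme_complex N" "support y \<subseteq> apartment"
    and eq: "\<And>i. i < n \<Longrightarrow> rho x i = rho y i"
    and p: "p \<in> support x"
  shows "e (J p) \<in> support y"
proof -
  let ?C = "support x"
  have fin: "finite ?C" and ch: "chain_in N ?C" and nn: "\<And>p. 0 \<le> x p"
    using K_finite K_chain K_nonneg x by auto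
  have J: "J q \<subseteq> {..<n}" if "q \<in> ?C" for q using that K_carrier[OF x] J_sub by blast
  define w where "w q = (\<Sum>p\<in>?C. if e (J p) = q then x p else 0)" for q
  let ?D = "(\<lambda>p. e (J p)) ` ?C"
  have w0: "w q = 0" if "q \<notin> ?D" for q unfolding w_def using that by (intro sum.neutral) auto
  have wsub: "support w \<subseteq> ?D" using w0 by (auto simp: support_def)
  have sum_w: "(\<Sum>q\<in>?D. if P q then w q else 0) = (\<Sum>p\<in>?C. if P (e (J p)) then x p else 0)" for P
  proof -
    have "(\<Sum>q\<in>?D. if P q then w q else 0) = (\<Sum>q\<in>?D. \<Sum>p\<in>?C. if e (J p) = q then (if P q then x p else 0) else 0)"
      by (rule sum.cong) (auto simp: w_def intro!: sum.cong)
    also have "\<dots> = (\<Sum>p\<in>?C. \<Sum>q\<in>?D. if e (J p) = q then (if P q then x p else 0) else 0)"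
      by (rule sum.swap)
    also have "\<dots> = (\<Sum>p\<in>?C. if P (e (J p)) then x p else 0)"
      by (rule sum.cong) (use fin in auto)
    finally show ?thesis .
  qed
  have "w \<in> orthoscheme_complex N"
    unfolding orthoscheme_complex_def
  proof (intro CollectI conjI allI)
    show "finite (support w)" using fin wsub finite_subset by blast
    have "chain_in N ?D"
      unfolding chain_in_def
    proof (intro conjI ballI)
      fix q r assume "q \<in> ?D" "r \<in> ?D"
      then obtain p p' where p: "p \<in> ?C" "q = e (J p)" "p' \<in> ?C" "r = e (J p')" by blast
      show "q \<sqsubseteq>\<^bsub>N\<^esub> r \<or> r \<sqsubseteq>\<^bsub>N\<^esub> q"
        using chain_J_total[OF ch p(1,3)] e_mono[OF _ J[OF p(1)]] e_mono[OF _ J[OF p(3)]] p(2,4) by auto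
    qed (use e_carrier[OF J] in auto)
    then show "chain_in N (support w)" using wsub by (rule chain_in_subset)
    show "0 \<le> w q" for q unfolding w_def using nn by (intro sum_nonneg) auto
    have "sum w (support w) = (\<Sum>q\<in>?D. if True then w q else 0)"
      using sum_support[of ?D w "\<lambda>_. True"] wsub fin by simp
    also have "\<dots> = 1" unfolding sum_w using K_sum[OF x] by simp
    finally show "sum w (support w) = 1" .
  qed
  moreover have "support w \<subseteq> apartment" using wsub J by (auto simp: apartment_def)
  moreover have "rho w i = rho y i" if "i < n" for i
  proof -
    have "rho w i = (\<Sum>q\<in>?D. if i \<in> J q then w q else 0)" using wsub fin by (intro rho_eq_sum) auto
    also have "\<dots> = (\<Sum>p\<in>?C. if i \<in> J (e (J p)) then x p else 0)" by (rule sum_w)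
    also have "\<dots> = rho x i" unfolding rho_def by (rule sum.cong) (use J J_e in auto)
    finally show ?thesis using eq that by simp
  qed
  ultimately have "w = y" using y by (intro apartment_eqI)
  have "x p \<le> w (e (J p))"
    unfolding w_def using member_le_sum[of p ?C "\<lambda>q. if e (J q) = e (J p) then x q else 0"] p fin nn by simp
  moreover have "0 < x p" using p nn[of p] by (simp add: support_def)
  ultimately show ?thesis using \<open>w = y\<close> by (auto simp: support_def)
qed

end

text \<open>Both images of \<open>p\<close> lie in the chain \<open>support y\<close>, so the two
  pivot sets are comparable; being of the same cardinality, they coincide. This transfers pivots
  from one order to another for a hypothetical second minimiser.\<close>

lemma retracted_eq:
  assumes r: "retraction N n J e" and r': "retraction N n J' e"
    and x: "x \<in> orthoscheme_complex N"
    and y: "y \<in> orthoscheme_complex N" "support y \<subseteq> retraction.apartment n e"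
    and eq: "\<And>i. i < n \<Longrightarrow> retraction.rho J x i = retraction.rho J y i"
      "\<And>i. i < n \<Longrightarrow> retraction.rho J' x i = retraction.rho J' y i"
    and p: "p \<in> support x"
  shows "J' p = J p"
proof -
  interpret r: retraction N n J e by (rule r)
  interpret r': retraction N n J' e by (rule r')
  have pc: "p \<in> carrier N" using r.K_carrier x p by blast
  have in_y: "e (J p) \<in> support y" "e (J' p) \<in> support y"
    using r.retracted_support r'.retracted_support x y eq p by blast+
  have "J p \<subseteq> J' p \<or> J' p \<subseteq> J p"
    using r.chain_J_total[OF r.K_chain[OF y(1)] in_y] r.J_e r.J_sub r'.J_sub pc by auto
  then show ?thesis
    using r.card_J_unique[OF r' pc] r.finite_J r'.finite_J pc by (metis card_subset_eq)
qed

section \<open>The Lovasz extension on the product of two complexes\<close>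

lemma prod_gorder_simps [simp]:
  "carrier (prod_gorder L M) = carrier L \<times> carrier M"
  "(p, q) \<sqsubseteq>\<^bsub>prod_gorder L M\<^esub> (p', q') \<longleftrightarrow> p \<sqsubseteq>\<^bsub>L\<^esub> p' \<and> q \<sqsubseteq>\<^bsub>M\<^esub> q'"
  by (simp_all add: prod_gorder_def)

lemma marginal_sums:
  assumes "finite (support z)" "marginals z = (x, y)"
  shows "(\<Sum>p\<in>support x. if P p then x p else 0) = (\<Sum>v\<in>support z. if P (fst v) then z v else 0)"
    and "(\<Sum>q\<in>support y. if Q q then y q else 0) = (\<Sum>v\<in>support z. if Q (snd v) then z v else 0)"
proof -
  let ?S = "support z"
  have fin: "finite (fst ` ?S)" "finite (snd ` ?S)" using assms(1) by auto
  have x: "x p = (\<Sum>v\<in>?S. if fst v = p then z v else 0)" for p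
  proof -
    have "x p = (\<Sum>q | z (p, q) \<noteq> 0. z (p, q))" using assms(2) by (auto simp: marginals_def)
    also have "\<dots> = (\<Sum>v\<in>(\<lambda>q. (p, q)) ` {q. z (p, q) \<noteq> 0}. z v)"
      by (subst sum.reindex) (auto simp: inj_on_def)
    also have "(\<lambda>q. (p, q)) ` {q. z (p, q) \<noteq> 0} = {v \<in> ?S. fst v = p}" by (auto simp: support_def)
    finally show ?thesis using assms(1) by (simp add: sum.inter_filter)
  qed
  have y: "y q = (\<Sum>v\<in>?S. if snd v = q then z v else 0)" for q
  proof -
    have "y q = (\<Sum>p | z (p, q) \<noteq> 0. z (p, q))" using assms(2) by (auto simp: marginals_def)
    also have "\<dots> = (\<Sum>v\<in>(\<lambda>p. (p, q)) ` {p. z (p, q) \<noteq> 0}. z v)"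
      by (subst sum.reindex) (auto simp: inj_on_def)
    also have "(\<lambda>p. (p, q)) ` {p. z (p, q) \<noteq> 0} = {v \<in> ?S. snd v = q}" by (auto simp: support_def)
    finally show ?thesis using assms(1) by (simp add: sum.inter_filter)
  qed
  have sx: "support x \<subseteq> fst ` ?S"
  proof
    fix p assume "p \<in> support x"
    then have "x p \<noteq> 0" by (simp add: support_def)
    then show "p \<in> fst ` ?S" unfolding x by (rule contrapos_np) (force intro!: sum.neutral)
  qed
  have sy: "support y \<subseteq> snd ` ?S"
  proof
    fix p assume "p \<in> support y"
    then have "y p \<noteq> 0" by (simp add: support_def)
    then show "p \<in> snd ` ?S" unfolding y by (rule contrapos_np) (force intro!: sum.neutral)
  qed
  show "(\<Sum>p\<in>support x. if P p then x p else 0) = (\<Sum>v\<in>?S. if P (fst v) then z v else 0)"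
  proof -
    have "(\<Sum>p\<in>support x. if P p then x p else 0) = (\<Sum>p\<in>fst ` ?S. if P p then x p else 0)"
      using fin(1) sx by (rule sum_support)
    also have "\<dots> = (\<Sum>p\<in>fst ` ?S. \<Sum>v\<in>?S. if fst v = p then (if P p then z v else 0) else 0)"
      by (rule sum.cong) (auto simp: x intro!: sum.cong)
    also have "\<dots> = (\<Sum>v\<in>?S. \<Sum>p\<in>fst ` ?S. if fst v = p then (if P p then z v else 0) else 0)"
      by (rule sum.swap)
    also have "\<dots> = (\<Sum>v\<in>?S. if P (fst v) then z v else 0)"
      by (rule sum.cong) (use fin in auto)
    finally show ?thesis .
  qed
  show "(\<Sum>q\<in>support y. if Q q then y q else 0) = (\<Sum>v\<in>?S. if Q (snd v) then z v else 0)"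
  proof -
    have "(\<Sum>p\<in>support y. if Q p then y p else 0) = (\<Sum>p\<in>snd ` ?S. if Q p then y p else 0)"
      using fin(2) sy by (rule sum_support)
    also have "\<dots> = (\<Sum>p\<in>snd ` ?S. \<Sum>v\<in>?S. if snd v = p then (if Q p then z v else 0) else 0)"
      by (rule sum.cong) (auto simp: y intro!: sum.cong)
    also have "\<dots> = (\<Sum>v\<in>?S. \<Sum>p\<in>snd ` ?S. if snd v = p then (if Q p then z v else 0) else 0)"
      by (rule sum.swap)
    also have "\<dots> = (\<Sum>v\<in>?S. if Q (snd v) then z v else 0)"
      by (rule sum.cong) (use fin in auto)
    finally show ?thesis .
  qed
qed

lemma marginal_support:
  assumes "finite (support z)" "\<And>v. 0 \<le> z v" "marginals z = (x, y)" "v \<in> support z"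
  shows "fst v \<in> support x" "snd v \<in> support y"
proof -
  have pos: "0 < z v" using assms(2)[of v] assms(4) by (simp add: support_def)
  have "0 < (\<Sum>u\<in>support z. if fst u = fst v then z u else 0)"
    using assms pos by (intro sum_pos2[of _ v]) auto
  then have "(\<Sum>p\<in>support x. if p = fst v then x p else 0) \<noteq> 0"
    using marginal_sums(1)[OF assms(1,3), of "\<lambda>p. p = fst v"] by simp
  then show "fst v \<in> support x" by (rule contrapos_np) (auto intro!: sum.neutral)
  have "0 < (\<Sum>u\<in>support z. if snd u = snd v then z u else 0)"
    using assms pos by (intro sum_pos2[of _ v]) auto
  then have "(\<Sum>p\<in>support y. if p = snd v then y p else 0) \<noteq> 0"
    using marginal_sums(2)[OF assms(1,3), of "\<lambda>p. p = snd v"] by simp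
  then show "snd v \<in> support y" by (rule contrapos_np) (auto intro!: sum.neutral)
qed

text \<open>Two upward closed parts of a finite chain are nested, which determines the weight of their
  difference.\<close>

lemma nested_difference:
  fixes z :: "'a \<Rightarrow> real"
  assumes "finite C" "\<And>v. 0 \<le> z v" and "(\<forall>v\<in>C. P v \<longrightarrow> Q v) \<or> (\<forall>v\<in>C. Q v \<longrightarrow> P v)"
  shows "(\<Sum>v\<in>C. if P v \<and> \<not> Q v then z v else 0) =
    max 0 ((\<Sum>v\<in>C. if P v then z v else 0) - (\<Sum>v\<in>C. if Q v then z v else 0))"
  using assms(3)
proof
  assume PQ: "\<forall>v\<in>C. P v \<longrightarrow> Q v"
  then have "(\<Sum>v\<in>C. if P v then z v else 0) \<le> (\<Sum>v\<in>C. if Q v then z v else 0)"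
    using assms(2) by (intro sum_mono) auto
  moreover have "(\<Sum>v\<in>C. if P v \<and> \<not> Q v then z v else 0) = 0"
    using PQ by (intro sum.neutral) auto
  ultimately show ?thesis by simp
next
  assume QP: "\<forall>v\<in>C. Q v \<longrightarrow> P v"
  have "(\<Sum>v\<in>C. if P v then z v else 0) =
      (\<Sum>v\<in>C. if P v \<and> \<not> Q v then z v else 0) + (\<Sum>v\<in>C. if Q v then z v else 0)"
    unfolding sum.distrib[symmetric] using QP by (intro sum.cong) auto
  moreover have "0 \<le> (\<Sum>v\<in>C. if P v \<and> \<not> Q v then z v else 0)"
    using assms(2) by (intro sum_nonneg) auto
  ultimately show ?thesis by simp
qed

locale retraction_pair =
  L: retraction L n JL eL + M: retraction M n JM eM
  for L :: "'p gorder" and M :: "'q gorder" and n JL eL JM eM +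
  fixes I :: "nat set" and \<mu> :: "nat \<Rightarrow> nat"
  assumes I: "finite I"
begin

text \<open>\<open>JM\<close> will be the complement of the pivots, so \<open>\<mu> i\<close>
  outside \<open>JM\<close> says that \<open>\<mu> i\<close> is a pivot on the second side: matched
  pairs of pivots are counted, and for coordinate subspaces this is the rank.\<close>

definition crossing :: "'p \<times> 'q \<Rightarrow> nat" where
  "crossing v = card {i \<in> I. i \<in> JL (fst v) \<and> \<mu> i \<notin> JM (snd v)}"

text \<open>Along a chain of the product both memberships are upward closed, hence nested, so the
  weight where the first holds without the second is the positive part of a difference of
  coordinates. In particular the sum depends on \<open>z\<close> only through its marginals.\<close>

lemma crossing_sum:
  assumes z: "z \<in> orthoscheme_complex (prod_gorder L M)" and m: "marginals z = (x, y)"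
  shows "(\<Sum>v\<in>support z. z v * real (crossing v)) = (\<Sum>i\<in>I. max 0 (L.rho x i - M.rho y (\<mu> i)))"
proof -
  let ?S = "support z"
  have fin: "finite ?S" and nn: "\<And>v. 0 \<le> z v" and ch: "chain_in (prod_gorder L M) ?S"
    using z by (auto simp: orthoscheme_complex_def)
  have real_crossing: "real (crossing v) = (\<Sum>i\<in>I. if i \<in> JL (fst v) \<and> \<mu> i \<notin> JM (snd v) then 1 else 0)" for v
    unfolding crossing_def using I by (simp flip: sum.inter_filter)
  have "(\<Sum>v\<in>?S. z v * real (crossing v)) =
      (\<Sum>v\<in>?S. \<Sum>i\<in>I. if i \<in> JL (fst v) \<and> \<mu> i \<notin> JM (snd v) then z v else 0)"
    unfolding real_crossing by (rule sum.cong) (auto simp: sum_distrib_left intro!: sum.cong)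
  also have "\<dots> = (\<Sum>i\<in>I. \<Sum>v\<in>?S. if i \<in> JL (fst v) \<and> \<mu> i \<notin> JM (snd v) then z v else 0)"
    by (rule sum.swap)
  also have "\<dots> = (\<Sum>i\<in>I. max 0 (L.rho x i - M.rho y (\<mu> i)))"
  proof (rule sum.cong, simp)
    fix i assume "i \<in> I"
    have rho: "L.rho x i = (\<Sum>v\<in>?S. if i \<in> JL (fst v) then z v else 0)"
      "M.rho y (\<mu> i) = (\<Sum>v\<in>?S. if \<mu> i \<in> JM (snd v) then z v else 0)"
      unfolding L.rho_def M.rho_def
      using marginal_sums(1)[OF fin m, of "\<lambda>p. i \<in> JL p"] marginal_sums(2)[OF fin m, of "\<lambda>q. \<mu> i \<in> JM q"]
      by simp_all
    have "(JL (fst u) \<subseteq> JL (fst v) \<and> JM (snd u) \<subseteq> JM (snd v)) \<or>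
        (JL (fst v) \<subseteq> JL (fst u) \<and> JM (snd v) \<subseteq> JM (snd u))" if "u \<in> ?S" "v \<in> ?S" for u v
    proof -
      have "fst u \<in> carrier L" "snd u \<in> carrier M" "fst v \<in> carrier L" "snd v \<in> carrier M"
        using ch that by (auto simp: chain_in_def mem_Times_iff)
      moreover have "u \<sqsubseteq>\<^bsub>prod_gorder L M\<^esub> v \<or> v \<sqsubseteq>\<^bsub>prod_gorder L M\<^esub> u"
        using ch that by (auto simp: chain_in_def)
      ultimately show ?thesis
        using L.J_mono[of "fst u" "fst v"] L.J_mono[of "fst v" "fst u"]
          M.J_mono[of "snd u" "snd v"] M.J_mono[of "snd v" "snd u"]
        by (cases u; cases v; simp; blast)
    qed
    then have "(\<forall>v\<in>?S. i \<in> JL (fst v) \<longrightarrow> \<mu> i \<in> JM (snd v)) \<or> (\<forall>v\<in>?S. \<mu> i \<in> JM (snd v) \<longrightarrow> i \<in> JL (fst v))"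
      by blast
    then show "(\<Sum>v\<in>?S. if i \<in> JL (fst v) \<and> \<mu> i \<notin> JM (snd v) then z v else 0) = max 0 (L.rho x i - M.rho y (\<mu> i))"
      unfolding rho by (rule nested_difference[OF fin nn])
  qed
  finally show ?thesis .
qed


text \<open>Greedy transport from the top: the pair of greatest elements receives the smaller of the
  two weights, and the exhausted element is removed. This pair is above all pairs chosen later, so
  the support stays a chain of the product.\<close>

lemma coupling:
  assumes "chain_in L C" "chain_in M D" "\<And>p. 0 \<le> u p" "\<And>q. 0 \<le> v q"
    and "(\<Sum>p\<in>C. u p) = (\<Sum>q\<in>D. v q :: real)"
  shows "\<exists>z. (\<forall>w. 0 \<le> z w) \<and> support z \<subseteq> C \<times> D \<and> chain_in (prod_gorder L M) (support z) \<and>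
    (\<forall>p\<in>C. (\<Sum>q\<in>D. z (p, q)) = u p) \<and> (\<forall>q\<in>D. (\<Sum>p\<in>C. z (p, q)) = v q)"
  using assms
proof (induction "card C + card D" arbitrary: C D u v rule: less_induct)
  case less
  have fin: "finite C" "finite D" using L.chain_card M.chain_card less.prems by auto
  show ?case
  proof (cases "C = {} \<or> D = {}")
    case True
    then have "(\<Sum>p\<in>C. u p) = 0" "(\<Sum>q\<in>D. v q) = 0" using less.prems(5) by auto
    then have "\<forall>p\<in>C. u p = 0" "\<forall>q\<in>D. v q = 0"
      using less.prems fin by (simp_all add: sum_nonneg_eq_0_iff)
    then show ?thesis by (intro exI[of _ "\<lambda>_. 0"]) (auto simp: support_def chain_in_def)
  next
    case False
    obtain p where p: "p \<in> C" "\<And>p'. p' \<in> C \<Longrightarrow> p' \<sqsubseteq>\<^bsub>L\<^esub> p"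
      using L.chain_greatest[OF less.prems(1)] False by blast
    obtain q where q: "q \<in> D" "\<And>q'. q' \<in> D \<Longrightarrow> q' \<sqsubseteq>\<^bsub>M\<^esub> q"
      using M.chain_greatest[OF less.prems(2)] False by blast
    have pc: "p \<in> carrier L" "q \<in> carrier M" using less.prems p q by (auto simp: chain_in_def)
    have chain: "chain_in (prod_gorder L M) (support (z((p, q) := c)))"
      if "chain_in (prod_gorder L M) (support z)" "support z \<subseteq> C \<times> D" for z c
    proof -
      have "chain_in (prod_gorder L M) (insert (p, q) (support z))"
        using that pc p q L.refl M.refl by (auto simp: chain_in_def)
      then show ?thesis by (rule chain_in_subset) (auto simp: support_def)
    qed
    show ?thesis
    proof (cases "u p \<le> v q")
      case True
      let ?C = "C - {p}" and ?v = "v(q := v q - u p)"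
      have Cp: "(\<Sum>p\<in>C. f p) = f p + (\<Sum>p\<in>?C. f p)" for f :: "'p \<Rightarrow> real"
        using fin p by (simp add: sum.remove)
      have Dq: "(\<Sum>q\<in>D. f q) = f q + (\<Sum>q\<in>D - {q}. f q)" for f :: "'q \<Rightarrow> real"
        using fin q by (simp add: sum.remove)
      have lt: "card ?C + card D < card C + card D" using card_Diff1_less[OF fin(1) p(1)] by linarith
      have nn: "0 \<le> ?v q'" for q' using less.prems(4) True by simp
      have eq: "(\<Sum>p\<in>?C. u p) = (\<Sum>q\<in>D. ?v q)"
        using less.prems(5) Cp[of u] Dq[of v] Dq[of ?v] by simp
      obtain z where z: "\<forall>w. 0 \<le> z w" "support z \<subseteq> ?C \<times> D"
        "chain_in (prod_gorder L M) (support z)" "\<forall>p\<in>?C. (\<Sum>q\<in>D. z (p, q)) = u p"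
        "\<forall>q\<in>D. (\<Sum>p\<in>?C. z (p, q)) = ?v q"
        using less.hyps[OF lt chain_in_subset[OF less.prems(1)] less.prems(2) less.prems(3) nn eq] by auto
      let ?z = "z((p, q) := u p)"
      have z0: "z (p, q') = 0" for q' using z(2) by (auto simp: support_def)
      have "(\<Sum>q\<in>D. ?z (p', q)) = u p'" if "p' \<in> C" for p'
      proof (cases "p' = p")
        case True
        then show ?thesis using Dq[of "\<lambda>q'. ?z (p, q')"] z0 by simp
      qed (use z(4) that in simp)
      moreover have "(\<Sum>p\<in>C. ?z (p, q')) = v q'" if "q' \<in> D" for q'
        using Cp[of "\<lambda>p. ?z (p, q')"] z(5) z0 that by (cases "q' = q") auto
      moreover have "\<forall>w. 0 \<le> ?z w" using z(1) less.prems by simp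
      moreover have "support ?z \<subseteq> C \<times> D" using z(2) p q by (auto simp: support_def split: if_splits)
      moreover have "chain_in (prod_gorder L M) (support ?z)" using z by (intro chain) auto
      ultimately show ?thesis by blast
    next
      case False
      let ?D = "D - {q}" and ?u = "u(p := u p - v q)"
      have Cp: "(\<Sum>p\<in>C. f p) = f p + (\<Sum>p\<in>C - {p}. f p)" for f :: "'p \<Rightarrow> real"
        using fin p by (simp add: sum.remove)
      have Dq: "(\<Sum>q\<in>D. f q) = f q + (\<Sum>q\<in>?D. f q)" for f :: "'q \<Rightarrow> real"
        using fin q by (simp add: sum.remove)
      have lt: "card C + card ?D < card C + card D" using card_Diff1_less[OF fin(2) q(1)] by linarith
      have nn: "0 \<le> ?u p'" for p' using less.prems(3) False by simp
      have eq: "(\<Sum>p\<in>C. ?u p) = (\<Sum>q\<in>?D. v q)"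
        using less.prems(5) Cp[of u] Cp[of ?u] Dq[of v] by simp
      obtain z where z: "\<forall>w. 0 \<le> z w" "support z \<subseteq> C \<times> ?D"
        "chain_in (prod_gorder L M) (support z)" "\<forall>p\<in>C. (\<Sum>q\<in>?D. z (p, q)) = ?u p"
        "\<forall>q\<in>?D. (\<Sum>p\<in>C. z (p, q)) = v q"
        using less.hyps[OF lt less.prems(1) chain_in_subset[OF less.prems(2)] nn less.prems(4) eq] by auto
      let ?z = "z((p, q) := v q)"
      have z0: "z (p', q) = 0" for p' using z(2) by (auto simp: support_def)
      have "(\<Sum>p\<in>C. ?z (p, q')) = v q'" if "q' \<in> D" for q'
      proof (cases "q' = q")
        case True
        then show ?thesis using Cp[of "\<lambda>p'. ?z (p', q)"] z0 by simp
      qed (use z(5) that in simp)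
      moreover have "(\<Sum>q\<in>D. ?z (p', q)) = u p'" if "p' \<in> C" for p'
        using Dq[of "\<lambda>q. ?z (p', q)"] z(4) z0 that by (cases "p' = p") auto
      moreover have "\<forall>w. 0 \<le> ?z w" using z(1) less.prems by simp
      moreover have "support ?z \<subseteq> C \<times> D" using z(2) p q by (auto simp: support_def split: if_splits)
      moreover have "chain_in (prod_gorder L M) (support ?z)" using z by (intro chain) auto
      ultimately show ?thesis by blast
    qed
  qed
qed

text \<open>The extension to the product is defined through \<open>inv_into\<close>, which is
  meaningful only on the image of \<open>marginals\<close>.\<close>

lemma marginals_surj:
  assumes x: "x \<in> orthoscheme_complex L" and y: "y \<in> orthoscheme_complex M"
  shows "(x, y) \<in> marginals ` orthoscheme_complex (prod_gorder L M)"
proof -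
  let ?C = "support x" and ?D = "support y"
  have fin: "finite ?C" "finite ?D" using L.K_finite x M.K_finite y by auto
  obtain z where z: "\<forall>w. 0 \<le> z w" "support z \<subseteq> ?C \<times> ?D" "chain_in (prod_gorder L M) (support z)"
    "\<forall>p\<in>?C. (\<Sum>q\<in>?D. z (p, q)) = x p" "\<forall>q\<in>?D. (\<Sum>p\<in>?C. z (p, q)) = y q"
    using coupling[OF L.K_chain[OF x] M.K_chain[OF y], of x y] L.K_nonneg[OF x] M.K_nonneg[OF y]
      L.K_sum[OF x] M.K_sum[OF y] by auto
  have z0: "z (p, q) = 0" if "p \<notin> ?C \<or> q \<notin> ?D" for p q using z(2) that by (auto simp: support_def)
  have "(\<Sum>q | z (p, q) \<noteq> 0. z (p, q)) = x p" for p
  proof (cases "p \<in> ?C")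
    case True
    have "(\<Sum>q | z (p, q) \<noteq> 0. z (p, q)) = (\<Sum>q\<in>?D. z (p, q))"
      using fin z0 by (intro sum.mono_neutral_left) auto
    then show ?thesis using z(4) True by simp
  next
    case False
    then show ?thesis using z0 by (simp add: support_def)
  qed
  moreover have "(\<Sum>p | z (p, q) \<noteq> 0. z (p, q)) = y q" for q
  proof (cases "q \<in> ?D")
    case True
    have "(\<Sum>p | z (p, q) \<noteq> 0. z (p, q)) = (\<Sum>p\<in>?C. z (p, q))"
      using fin z0 by (intro sum.mono_neutral_left) auto
    then show ?thesis using z(5) True by simp
  next
    case False
    then show ?thesis using z0 by (simp add: support_def)
  qed
  ultimately have "marginals z = (x, y)" by (auto simp: marginals_def)
  moreover have "z \<in> orthoscheme_complex (prod_gorder L M)"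
    unfolding orthoscheme_complex_def
  proof (intro CollectI conjI allI)
    show "finite (support z)" using z(2) fin finite_subset by blast
    have "sum z (support z) = sum z (?C \<times> ?D)"
      using z(2) fin by (intro sum.mono_neutral_left) (auto simp: support_def)
    also have "\<dots> = (\<Sum>p\<in>?C. \<Sum>q\<in>?D. z (p, q))" by (simp add: sum.cartesian_product)
    also have "\<dots> = (\<Sum>p\<in>?C. x p)" using z(4) by simp
    also have "\<dots> = 1" using L.K_sum[OF x] .
    finally show "sum z (support z) = 1" .
  qed (use z in auto)
  ultimately show ?thesis by (metis image_eqI)
qed

definition cut :: "(nat \<Rightarrow> real) \<Rightarrow> (nat \<Rightarrow> real) \<Rightarrow> real" where
  "cut a b = (\<Sum>i\<in>I. max 0 (a i - b (\<mu> i)))"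

text \<open>Whichever preimage \<open>inv_into\<close> selects, its crossing sum is determined by
  the marginals; comparing \<open>R\<close> with the crossing number member by member gives both
  claims.\<close>

lemma lovasz_extension_prod_bounds:
  assumes x: "x \<in> orthoscheme_complex L" and y: "y \<in> orthoscheme_complex M"
  shows "(\<And>p q. p \<in> carrier L \<Longrightarrow> q \<in> carrier M \<Longrightarrow> real (crossing (p, q)) \<le> R (p, q)) \<Longrightarrow>
      cut (L.rho x) (M.rho y) \<le> lovasz_extension_prod L M R (x, y)"
    and "(\<And>p q. p \<in> support x \<Longrightarrow> q \<in> support y \<Longrightarrow> R (p, q) = real (crossing (p, q))) \<Longrightarrow>
      lovasz_extension_prod L M R (x, y) = cut (L.rho x) (M.rho y)"
proof -
  define z where "z = inv_into (orthoscheme_complex (prod_gorder L M)) marginals (x, y)"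
  have z: "z \<in> orthoscheme_complex (prod_gorder L M)" and m: "marginals z = (x, y)"
    unfolding z_def using marginals_surj[OF x y] by (rule inv_into_into, rule f_inv_into_f)
  have fin: "finite (support z)" and nn: "\<And>v. 0 \<le> z v" and car: "support z \<subseteq> carrier L \<times> carrier M"
    using z by (auto simp: orthoscheme_complex_def chain_in_def)
  have lov: "lovasz_extension_prod L M R (x, y) = (\<Sum>v\<in>support z. z v * R v)"
    by (simp add: lovasz_extension_prod_def lovasz_extension_def z_def)
  have cut: "cut (L.rho x) (M.rho y) = (\<Sum>v\<in>support z. z v * real (crossing v))"
    using crossing_sum[OF z m] by (simp add: cut_def)
  show "cut (L.rho x) (M.rho y) \<le> lovasz_extension_prod L M R (x, y)"
    if "\<And>p q. p \<in> carrier L \<Longrightarrow> q \<in> carrier M \<Longrightarrow> real (crossing (p, q)) \<le> R (p, q)"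
    unfolding lov cut using nn car that by (intro sum_mono mult_left_mono) auto
  show "lovasz_extension_prod L M R (x, y) = cut (L.rho x) (M.rho y)"
    if "\<And>p q. p \<in> support x \<Longrightarrow> q \<in> support y \<Longrightarrow> R (p, q) = real (crossing (p, q))"
    unfolding lov cut using marginal_support[OF fin nn m] that by (intro sum.cong) auto
qed

end

section \<open>Coordinates on subspaces\<close>

text \<open>Vectors are functions read on \<open>{..<n}\<close> only, so that rows of a memory array
  can be used without conversion to \<open>vec\<close>.\<close>

definition dot :: "nat \<Rightarrow> (nat \<Rightarrow> 'k::field) \<Rightarrow> (nat \<Rightarrow> 'k) \<Rightarrow> 'k" where
  "dot n u v = (\<Sum>k<n. u k * v k)"

lemma dot_commute: "dot n u v = dot n v u"
  by (simp add: dot_def mult.commute)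

lemma dot_add_right: "dot n u (\<lambda>k. v k + w k) = dot n u v + dot n u w"
  and dot_diff_right: "dot n u (\<lambda>k. v k - w k) = dot n u v - dot n u w"
  and dot_mult_right: "dot n u (\<lambda>k. c * v k) = c * dot n u v"
  and dot_add_left: "dot n (\<lambda>k. v k + w k) u = dot n v u + dot n w u"
  and dot_diff_left: "dot n (\<lambda>k. v k - w k) u = dot n v u - dot n w u"
  and dot_mult_left: "dot n (\<lambda>k. c * v k) u = c * dot n v u"
  by (simp_all add: dot_def algebra_simps sum.distrib sum_subtractf sum_distrib_left)

lemma dot_cong: "(\<And>k. k < n \<Longrightarrow> u k = u' k) \<Longrightarrow> (\<And>k. k < n \<Longrightarrow> v k = v' k) \<Longrightarrow> dot n u v = dot n u' v'"
  by (simp add: dot_def)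

lemma dot_sum_right: "dot n u (\<lambda>k. \<Sum>i\<in>A. v i k) = (\<Sum>i\<in>A. dot n u (v i))"
  unfolding dot_def sum_distrib_left by (rule sum.swap)

lemma dot_index_add [simp]:
  "v \<in> carrier_vec n \<Longrightarrow> w \<in> carrier_vec n \<Longrightarrow> dot n u (($) (v + w)) = dot n u (($) v) + dot n u (($) w)"
  by (simp add: dot_def algebra_simps sum.distrib)

lemma dot_index_smult [simp]: "v \<in> carrier_vec n \<Longrightarrow> dot n u (($) (c \<cdot>\<^sub>v v)) = c * dot n u (($) v)"
  by (simp add: dot_def algebra_simps sum_distrib_left)

lemma dot_index_zero [simp]: "dot n u (($) (0\<^sub>v n)) = 0"
  by (simp add: dot_def)

lemma dot_index_vec [simp]: "dot n u (($) (vec n f)) = dot n u f"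
  by (simp add: dot_def)

text \<open>\<open>U\<close> consists of the coordinate functionals of the basis \<open>E\<close>.
  Carrying both along avoids inverting matrices, in the proofs and in the program.\<close>

definition dual_bases :: "nat \<Rightarrow> (nat \<Rightarrow> nat \<Rightarrow> 'k::field) \<Rightarrow> (nat \<Rightarrow> nat \<Rightarrow> 'k) \<Rightarrow> bool" where
  "dual_bases n U E \<longleftrightarrow> (\<forall>i<n. \<forall>j<n. dot n (U i) (E j) = (if i = j then 1 else 0))"

lemma dual_basesD: "dual_bases n U E \<Longrightarrow> i < n \<Longrightarrow> j < n \<Longrightarrow> dot n (U i) (E j) = (if i = j then 1 else 0)"
  by (simp add: dual_bases_def)

lemma dual_bases_swap: "dual_bases n U E \<Longrightarrow> dual_bases n E U"
  by (auto simp: dual_bases_def dot_commute)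

text \<open>A one-sided inverse of a square matrix is two-sided; this turns duality into the
  expansion of vectors in the basis.\<close>

lemma dual_bases_resolution:
  fixes U :: "nat \<Rightarrow> nat \<Rightarrow> 'k::field"
  assumes "dual_bases n U E" "k < n" "l < n"
  shows "(\<Sum>i<n. E i k * U i l) = (if k = l then 1 else 0)"
proof -
  let ?U = "mat n n (\<lambda>(i, k). U i k)" and ?E = "mat n n (\<lambda>(k, i). E i k)"
  have "?U * ?E = 1\<^sub>m n"
    using assms(1) by (intro eq_matI) (auto simp: scalar_prod_def dual_bases_def dot_def atLeast0LessThan)
  then have "?E * ?U = 1\<^sub>m n"
    by (intro mat_mult_left_right_inverse[of ?U n ?E]) auto
  then have "(?E * ?U) $$ (k, l) = (1\<^sub>m n :: 'k mat) $$ (k, l)" by simp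
  then show ?thesis using assms(2,3) by (simp add: scalar_prod_def atLeast0LessThan)
qed

lemma dual_bases_expansion:
  fixes U :: "nat \<Rightarrow> nat \<Rightarrow> 'k::field"
  assumes "dual_bases n U E" "k < n"
  shows "v k = (\<Sum>i<n. dot n (U i) v * E i k)"
proof -
  have "(\<Sum>i<n. dot n (U i) v * E i k) = (\<Sum>i<n. \<Sum>l<n. E i k * U i l * v l)"
    unfolding dot_def sum_distrib_right by (intro sum.cong) (auto simp: mult_ac)
  also have "\<dots> = (\<Sum>l<n. (\<Sum>i<n. E i k * U i l) * v l)"
    unfolding sum_distrib_right by (rule sum.swap)
  also have "\<dots> = (\<Sum>l<n. (if k = l then 1 else 0) * v l)"
    by (rule sum.cong) (simp_all add: dual_bases_resolution[OF assms])
  also have "\<dots> = (\<Sum>l<n. if k = l then v l else 0)" by (rule sum.cong) auto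
  also have "\<dots> = v k" using assms(2) by simp
  finally show ?thesis by simp
qed

section \<open>Subspaces, coordinate subspaces and pivots\<close>

definition linear_subspace :: "nat \<Rightarrow> 'k::field vec set \<Rightarrow> bool" where
  "linear_subspace n X \<longleftrightarrow> X \<subseteq> carrier_vec n \<and> 0\<^sub>v n \<in> X \<and>
    (\<forall>v\<in>X. \<forall>w\<in>X. v + w \<in> X) \<and> (\<forall>c. \<forall>v\<in>X. c \<cdot>\<^sub>v v \<in> X)"

lemma subspace_iff:
  "VectorSpace.subspace class_ring X (module_vec TYPE('k::field) n) \<longleftrightarrow> linear_subspace n X"
  using vec_vs vec_module
  by (auto simp: VectorSpace.subspace_def submodule_def linear_subspace_def module_vec_simps class_ring_simps)

lemma carrier_subspace_lattice [simp]:
  "carrier (subspace_lattice n) = {X. linear_subspace n X}"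
  "carrier (reverse_subspace_lattice n) = {X. linear_subspace n X}"
  by (simp_all add: subspace_lattice_def reverse_subspace_lattice_def subspace_iff)

lemma subspace_lattice_simps [simp]:
  "p \<sqsubseteq>\<^bsub>subspace_lattice n\<^esub> q \<longleftrightarrow> p \<subseteq> q"
  "p \<sqsubseteq>\<^bsub>reverse_subspace_lattice n\<^esub> q \<longleftrightarrow> q \<subseteq> p"
  "eq (subspace_lattice n) = (=)"
  "eq (reverse_subspace_lattice n) = (=)"
  by (auto simp: subspace_lattice_def reverse_subspace_lattice_def)

text \<open>With \<open>U\<close> dual to a basis \<open>E\<close>, this is the span of the
  \<open>E i\<close> with \<open>i\<close> in \<open>S\<close>. The description by equations keeps
  \<open>E\<close> out, and it is the one suited to kernels.\<close>

definition coord_subspace :: "nat \<Rightarrow> (nat \<Rightarrow> nat \<Rightarrow> 'k::field) \<Rightarrow> nat set \<Rightarrow> 'k vec set" where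
  "coord_subspace n U S = {v \<in> carrier_vec n. \<forall>i<n. i \<notin> S \<longrightarrow> dot n (U i) (($) v) = 0}"

text \<open>The pivot positions of a subspace when the coordinates are read in descending order of
  \<open>\<tau>\<close>.\<close>

definition pivots :: "nat \<Rightarrow> (nat \<Rightarrow> nat \<Rightarrow> 'k::field) \<Rightarrow> (nat \<Rightarrow> int) \<Rightarrow> 'k vec set \<Rightarrow> nat set" where
  "pivots n U \<tau> Z = {i. i < n \<and> (\<exists>z\<in>Z. dot n (U i) (($) z) \<noteq> 0 \<and>
     (\<forall>k<n. \<tau> i < \<tau> k \<longrightarrow> dot n (U k) (($) z) = 0))}"

lemma linear_subspace_coord [simp]: "linear_subspace n (coord_subspace n U S)"
  by (auto simp: linear_subspace_def coord_subspace_def)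

lemma linear_subspaceD:
  assumes "linear_subspace n X"
  shows "v \<in> X \<Longrightarrow> v \<in> carrier_vec n" "0\<^sub>v n \<in> X" "v \<in> X \<Longrightarrow> w \<in> X \<Longrightarrow> v + w \<in> X" "v \<in> X \<Longrightarrow> c \<cdot>\<^sub>v v \<in> X"
  using assms by (auto simp: linear_subspace_def)

context
  fixes n :: nat and U E :: "nat \<Rightarrow> nat \<Rightarrow> 'k::field" and \<tau> :: "nat \<Rightarrow> int"
  assumes dual: "dual_bases n U E" and inj: "inj_on \<tau> {..<n}"
begin

lemma dot_zero_imp_zero:
  assumes "v \<in> carrier_vec n" "\<And>i. i < n \<Longrightarrow> dot n (U i) (($) v) = 0"
  shows "v = 0\<^sub>v n"
proof (rule eq_vecI)
  fix k assume "k < dim_vec (0\<^sub>v n :: 'k vec)"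
  then have "k < n" by simp
  then have "v $ k = (\<Sum>i<n. dot n (U i) (($) v) * E i k)" by (rule dual_bases_expansion[OF dual])
  then show "v $ k = 0\<^sub>v n $ k" using assms(2) \<open>k < n\<close> by simp
qed (use assms in auto)

text \<open>Gaussian elimination: the leading position of a vector of \<open>Z'\<close> is a pivot
  of \<open>Z\<close> too, so a multiple of a vector of \<open>Z\<close> removes that coordinate.
  Repetition ends in \<open>0\<close> and exhibits the vector as a member of
  \<open>Z\<close>.\<close>

lemma pivots_strict:
  assumes Z: "linear_subspace n Z" and Z': "linear_subspace n Z'" and le: "Z \<subseteq> Z'"
    and eq: "pivots n U \<tau> Z = pivots n U \<tau> Z'"
  shows "Z = Z'"
proof -
  \<comment> \<open>All positions up to the leading one in the order \<open>\<tau>\<close>. This set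
    shrinks with each elimination, whereas the set of nonzero coordinates may grow below the leading
    one.\<close>
  define A where "A z = {k. k < n \<and> (\<exists>i<n. dot n (U i) (($) z) \<noteq> 0 \<and> \<tau> k \<le> \<tau> i)}" for z
  have "z \<in> Z" if "z \<in> Z'" for z
    using that
  proof (induction "card (A z)" arbitrary: z rule: less_induct)
    case less
    have zc: "z \<in> carrier_vec n" using linear_subspaceD[OF Z'] less.prems by blast
    let ?C = "{i. i < n \<and> dot n (U i) (($) z) \<noteq> 0}"
    show ?case
    proof (cases "?C = {}")
      case True
      then have "z = 0\<^sub>v n" using zc by (intro dot_zero_imp_zero) auto
      then show ?thesis using linear_subspaceD(2)[OF Z] by simp
    next
      case False
      have fin: "finite (\<tau> ` ?C)" by simp
      from Max_in[OF fin] False obtain i where i: "Max (\<tau> ` ?C) = \<tau> i" "i \<in> ?C" by blast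
      have top: "dot n (U k) (($) z) = 0" if "k < n" "\<tau> i < \<tau> k" for k
        using Max_ge[OF fin, of "\<tau> k"] i that by force
      then have "i \<in> pivots n U \<tau> Z'" using i less.prems by (auto simp: pivots_def)
      then obtain y where y: "y \<in> Z" "dot n (U i) (($) y) \<noteq> 0"
        "\<And>k. k < n \<Longrightarrow> \<tau> i < \<tau> k \<Longrightarrow> dot n (U k) (($) y) = 0"
        unfolding eq[symmetric] by (auto simp: pivots_def)
      define c where "c = dot n (U i) (($) z) / dot n (U i) (($) y)"
      have yc: "y \<in> carrier_vec n" using linear_subspaceD[OF Z] y by blast
      let ?w = "z + (- c) \<cdot>\<^sub>v y"
      have w: "?w \<in> Z'" using linear_subspaceD[OF Z'] less.prems y le by blast
      have dw: "dot n (U k) (($) ?w) = dot n (U k) (($) z) - c * dot n (U k) (($) y)" for k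
        using zc yc by simp
      have w0: "dot n (U k) (($) ?w) = 0" if "k < n" "\<tau> i \<le> \<tau> k" for k
      proof (cases "k = i")
        case True
        then show ?thesis unfolding dw using y(2) by (simp add: c_def)
      next
        case False
        then have "\<tau> k \<noteq> \<tau> i" using inj that i by (auto simp: inj_on_def)
        then show ?thesis unfolding dw using top y(3) that by simp
      qed
      have "A ?w \<subseteq> A z" "i \<notin> A ?w" "i \<in> A z"
      proof -
        show "i \<notin> A ?w" using w0 by (force simp: A_def)
        show "i \<in> A z" using i by (auto simp: A_def)
        show "A ?w \<subseteq> A z"
        proof
          fix k assume "k \<in> A ?w"
          then obtain j where "k < n" "j < n" "dot n (U j) (($) ?w) \<noteq> 0" "\<tau> k \<le> \<tau> j" by (auto simp: A_def)
          then have "k < n \<and> \<tau> k \<le> \<tau> i" using w0[of j] by force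
          then show "k \<in> A z" using i by (auto simp: A_def)
        qed
      qed
      then have "card (A ?w) < card (A z)"
        by (intro psubset_card_mono) (auto simp: A_def)
      then have "?w \<in> Z" using less.hyps w by blast
      then have "?w + c \<cdot>\<^sub>v y \<in> Z" using y linear_subspaceD[OF Z] by blast
      moreover have "?w + c \<cdot>\<^sub>v y = z" using zc yc by (intro eq_vecI) auto
      ultimately show ?thesis by simp
    qed
  qed
  then show ?thesis using le by blast
qed

text \<open>Adding to \<open>p\<close> the vectors of \<open>q\<close> that vanish above position
  \<open>i\<close> gains the pivot \<open>i\<close>, but not \<open>j\<close>, which is higher in
  the order; so the sum lies strictly between.\<close>

lemma pivots_gap:
  assumes p: "linear_subspace n p" and q: "linear_subspace n q" and le: "p \<subseteq> q"
    and i: "i \<in> pivots n U \<tau> q - pivots n U \<tau> p" and j: "j \<in> pivots n U \<tau> q - pivots n U \<tau> p"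
    and ij: "\<tau> i < \<tau> j"
  shows "\<exists>w. linear_subspace n w \<and> p \<subseteq> w \<and> w \<subseteq> q \<and> w \<noteq> p \<and> w \<noteq> q"
proof -
  let ?X = "{b \<in> q. \<forall>k<n. \<tau> i < \<tau> k \<longrightarrow> dot n (U k) (($) b) = 0}"
  let ?w = "{a + b | a b. a \<in> p \<and> b \<in> ?X}"
  note pD = linear_subspaceD[OF p] and qD = linear_subspaceD[OF q]
  have X0: "0\<^sub>v n \<in> ?X" using qD by simp
  have pw: "p \<subseteq> ?w"
  proof
    fix a assume "a \<in> p"
    then have "a = a + 0\<^sub>v n" using pD by simp
    then show "a \<in> ?w" using X0 \<open>a \<in> p\<close> by blast
  qed
  have Xw: "?X \<subseteq> ?w"
  proof
    fix b assume b: "b \<in> ?X"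
    then have "b = 0\<^sub>v n + b" using qD by simp
    then show "b \<in> ?w" using b pD by blast
  qed
  have wq: "?w \<subseteq> q" using le qD by blast
  have "linear_subspace n ?w"
    unfolding linear_subspace_def
  proof (intro conjI ballI allI)
    show "?w \<subseteq> carrier_vec n" using wq qD by blast
    show "0\<^sub>v n \<in> ?w" using pw pD by blast
    fix v assume "v \<in> ?w"
    then obtain a b where v: "v = a + b" "a \<in> p" "b \<in> ?X" by blast
    then have c: "a \<in> carrier_vec n" "b \<in> carrier_vec n" using pD qD by auto
    show "c \<cdot>\<^sub>v v \<in> ?w" for c
    proof -
      have "c \<cdot>\<^sub>v v = c \<cdot>\<^sub>v a + c \<cdot>\<^sub>v b" unfolding v using c by (rule smult_add_distrib_vec)
      moreover have "c \<cdot>\<^sub>v b \<in> ?X" using v qD c by simp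
      ultimately show ?thesis using pD v by blast
    qed
    fix v' assume "v' \<in> ?w"
    then obtain a' b' where v': "v' = a' + b'" "a' \<in> p" "b' \<in> ?X" by blast
    then have c': "a' \<in> carrier_vec n" "b' \<in> carrier_vec n" using pD qD by auto
    have "v + v' = (a + a') + (b + b')" unfolding v v' using c c' by (intro eq_vecI) auto
    moreover have "b + b' \<in> ?X" using v v' qD c c' by simp
    ultimately show "v + v' \<in> ?w" using pD v v' by blast
  qed
  moreover have "?w \<noteq> p"
  proof
    assume wp: "?w = p"
    obtain z where z: "z \<in> q" "dot n (U i) (($) z) \<noteq> 0" "\<forall>k<n. \<tau> i < \<tau> k \<longrightarrow> dot n (U k) (($) z) = 0"
      using i by (auto simp: pivots_def)
    then have "z \<in> ?X" by simp
    then have "z \<in> p" using Xw wp by blast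
    then have "i \<in> pivots n U \<tau> p" using z i unfolding pivots_def by blast
    then show False using i by simp
  qed
  moreover have "?w \<noteq> q"
  proof
    assume wq: "?w = q"
    obtain z where z: "z \<in> q" "dot n (U j) (($) z) \<noteq> 0" "\<forall>k<n. \<tau> j < \<tau> k \<longrightarrow> dot n (U k) (($) z) = 0"
      using j by (auto simp: pivots_def)
    then have "z \<in> ?w" using wq by simp
    then obtain a b where ab: "z = a + b" "a \<in> p" "b \<in> ?X" by blast
    have d: "dot n (U k) (($) z) = dot n (U k) (($) a)" if "k < n" "\<tau> j \<le> \<tau> k" for k
      using ab pD(1)[of a] qD(1)[of b] that ij by simp
    have jn: "j < n" using j by (auto simp: pivots_def)
    then have "j \<in> pivots n U \<tau> p" using z d ab(2) unfolding pivots_def by force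
    then show False using j by simp
  qed
  ultimately show ?thesis using pw wq by blast
qed

lemma pivots_coord:
  assumes "S \<subseteq> {..<n}"
  shows "pivots n U \<tau> (coord_subspace n U S) = S"
proof
  show "pivots n U \<tau> (coord_subspace n U S) \<subseteq> S" by (auto simp: pivots_def coord_subspace_def)
  show "S \<subseteq> pivots n U \<tau> (coord_subspace n U S)"
  proof
    fix i assume i: "i \<in> S"
    then have "i < n" using assms by auto
    then have d: "dot n (U k) (($) (vec n (E i))) = (if k = i then 1 else 0)" if "k < n" for k
      using dual_basesD[OF dual] that by simp
    have "vec n (E i) \<in> coord_subspace n U S" using d i by (auto simp: coord_subspace_def)
    then show "i \<in> pivots n U \<tau> (coord_subspace n U S)"
      using d \<open>i < n\<close> unfolding pivots_def by force
  qed
qed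

lemma pivots_mono: "Z \<subseteq> Z' \<Longrightarrow> pivots n U \<tau> Z \<subseteq> pivots n U \<tau> Z'"
  by (auto simp: pivots_def)

lemma pivots_subset: "pivots n U \<tau> Z \<subseteq> {..<n}"
  by (auto simp: pivots_def)

lemma coord_subspace_bounds:
  assumes "linear_subspace n Z"
  shows "coord_subspace n U {} \<subseteq> Z" "Z \<subseteq> coord_subspace n U {..<n}"
proof -
  show "coord_subspace n U {} \<subseteq> Z"
  proof
    fix v assume "v \<in> coord_subspace n U {}"
    then have "v = 0\<^sub>v n" by (intro dot_zero_imp_zero) (auto simp: coord_subspace_def)
    then show "v \<in> Z" using linear_subspaceD[OF assms] by simp
  qed
  show "Z \<subseteq> coord_subspace n U {..<n}"
    using linear_subspaceD(1)[OF assms] by (auto simp: coord_subspace_def)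
qed

lemma coord_subspace_mono: "S \<subseteq> T \<Longrightarrow> coord_subspace n U S \<subseteq> coord_subspace n U T"
  by (auto simp: coord_subspace_def)

lemma retraction_subspaces:
  "retraction (subspace_lattice n) n (pivots n U \<tau>) (coord_subspace n U)"
proof
  fix p q :: "'k vec set" and i j
  assume a: "p \<in> carrier (subspace_lattice n)" "q \<in> carrier (subspace_lattice n)"
    "p \<sqsubseteq>\<^bsub>subspace_lattice n\<^esub> q" "i \<in> pivots n U \<tau> q - pivots n U \<tau> p"
    "j \<in> pivots n U \<tau> q - pivots n U \<tau> p" "i \<noteq> j"
  then have "i < n" "j < n" by (auto simp: pivots_def)
  then have "\<tau> i \<noteq> \<tau> j" using inj a(6) by (auto simp: inj_on_def)
  then consider "\<tau> i < \<tau> j" | "\<tau> j < \<tau> i" by linarith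
  then show "\<exists>w\<in>carrier (subspace_lattice n). p \<sqsubseteq>\<^bsub>subspace_lattice n\<^esub> w \<and> w \<sqsubseteq>\<^bsub>subspace_lattice n\<^esub> q \<and> w \<noteq> p \<and> w \<noteq> q"
    using pivots_gap[of p q i j] pivots_gap[of p q j i] a by cases auto
qed (use pivots_strict pivots_mono pivots_subset pivots_coord coord_subspace_bounds coord_subspace_mono in auto)

text \<open>Reversing inclusion makes pivot sets shrink along the order, so \<open>J\<close> is
  their complement, and the embedding of the Boolean lattice is complemented accordingly.\<close>

lemma retraction_reverse_subspaces:
  "retraction (reverse_subspace_lattice n) n (\<lambda>Z. {..<n} - pivots n U \<tau> Z)
     (\<lambda>S. coord_subspace n U ({..<n} - S))"
proof
  fix p q :: "'k vec set" and i j
  assume a: "p \<in> carrier (reverse_subspace_lattice n)" "q \<in> carrier (reverse_subspace_lattice n)"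
    "p \<sqsubseteq>\<^bsub>reverse_subspace_lattice n\<^esub> q"
    "i \<in> {..<n} - pivots n U \<tau> q - ({..<n} - pivots n U \<tau> p)"
    "j \<in> {..<n} - pivots n U \<tau> q - ({..<n} - pivots n U \<tau> p)" "i \<noteq> j"
  then have "i < n" "j < n" by (auto simp: pivots_def)
  then have "\<tau> i \<noteq> \<tau> j" using inj a(6) by (auto simp: inj_on_def)
  then consider "\<tau> i < \<tau> j" | "\<tau> j < \<tau> i" by linarith
  then show "\<exists>w\<in>carrier (reverse_subspace_lattice n). p \<sqsubseteq>\<^bsub>reverse_subspace_lattice n\<^esub> w \<and>
      w \<sqsubseteq>\<^bsub>reverse_subspace_lattice n\<^esub> q \<and> w \<noteq> p \<and> w \<noteq> q"
    using pivots_gap[of q p i j] pivots_gap[of q p j i] a by cases auto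
next
  fix p q :: "'k vec set"
  assume a: "p \<in> carrier (reverse_subspace_lattice n)" "q \<in> carrier (reverse_subspace_lattice n)"
    "p \<sqsubseteq>\<^bsub>reverse_subspace_lattice n\<^esub> q" "{..<n} - pivots n U \<tau> p = {..<n} - pivots n U \<tau> q"
  then have "pivots n U \<tau> q = pivots n U \<tau> p" using pivots_subset by (metis double_diff subset_refl)
  then show "p = q" using pivots_strict[of q p] a by simp
next
  fix S :: "nat set" assume S: "S \<subseteq> {..<n}"
  show "{..<n} - pivots n U \<tau> (coord_subspace n U ({..<n} - S)) = S"
    using pivots_coord[of "{..<n} - S"] S by (simp add: double_diff)
next
  fix S T :: "nat set" assume "S \<subseteq> T"
  then show "coord_subspace n U ({..<n} - S) \<sqsubseteq>\<^bsub>reverse_subspace_lattice n\<^esub> coord_subspace n U ({..<n} - T)"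
    by (simp add: coord_subspace_mono Diff_mono)
next
  fix p q :: "'k vec set"
  assume "p \<sqsubseteq>\<^bsub>reverse_subspace_lattice n\<^esub> q"
  then show "{..<n} - pivots n U \<tau> p \<subseteq> {..<n} - pivots n U \<tau> q" using pivots_mono[of q p] by auto
qed (use coord_subspace_bounds in auto)

end

text \<open>If \<open>i\<close> is the highest position of an order, it is a pivot as soon as some
  vector has a nonzero coordinate there. Varying the order therefore controls all coordinates, not
  just leading ones.\<close>

lemma subset_coord_subspaceI:
  assumes "linear_subspace n Z"
    and "\<And>i. i < n \<Longrightarrow> \<exists>\<tau>. (\<forall>k<n. \<tau> k \<le> \<tau> i) \<and> pivots n U \<tau> Z \<subseteq> S"
  shows "Z \<subseteq> coord_subspace n U S"
proof
  fix z assume z: "z \<in> Z"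
  have "dot n (U i) (($) z) = 0" if i: "i < n" "i \<notin> S" for i
  proof (rule ccontr)
    assume nz: "dot n (U i) (($) z) \<noteq> 0"
    obtain \<tau> where \<tau>: "\<And>k. k < n \<Longrightarrow> \<tau> k \<le> \<tau> i" "pivots n U \<tau> Z \<subseteq> S" using assms(2)[OF i(1)] by blast
    then have "i \<in> pivots n U \<tau> Z" using z nz i unfolding pivots_def by (auto dest: leD)
    then show False using \<tau> i by blast
  qed
  then show "z \<in> coord_subspace n U S"
    using z linear_subspaceD(1)[OF assms(1)] by (auto simp: coord_subspace_def)
qed

section \<open>The rank of a bilinear form on a pair of subspaces\<close>

text \<open>The factorisation puts all columns in the span of \<open>r\<close> vectors, and Steinitz
  replacement bounds an independent set of columns by \<open>r\<close>.\<close>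

lemma (in vec_space) rank_le_factor:
  assumes A: "A \<in> carrier_mat n m"
    and f: "\<And>i j. i < n \<Longrightarrow> j < m \<Longrightarrow> A $$ (i, j) = (\<Sum>t<r. f i t * g t j)"
  shows "rank A \<le> r"
proof -
  obtain T where T: "finite T" "maximal T (\<lambda>T. T \<subseteq> set (cols A) \<and> lin_indpt T)"
    using maximal_exists_superset[of "set (cols A)" "\<lambda>T. T \<subseteq> set (cols A) \<and> lin_indpt T" "{}"]
    by (auto simp: lin_dep_def)
  then have Tli: "lin_indpt T" "T \<subseteq> set (cols A)" by (auto simp: maximal_def)
  have Tc: "T \<subseteq> carrier_vec n" using Tli A cols_dim by blast
  define B where "B = (\<lambda>t. vec n (\<lambda>i. f i t)) ` {..<r}"
  have B: "finite B" "B \<subseteq> carrier_vec n" by (auto simp: B_def)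
  have "T \<subseteq> span B"
  proof
    fix v assume "v \<in> T"
    then obtain j where j: "j < m" "v = col A j" using Tli(2) A by (auto simp: cols_def)
    have lin: "linear_subspace n (span B)"
      using span_is_subspace[of B] B(2) by (simp add: subspace_iff)
    have "vec n (\<lambda>i. \<Sum>t<r'. f i t * g t j) \<in> span B" if "r' \<le> r" for r'
      using that
    proof (induction r')
      case 0
      have "vec n (\<lambda>i. \<Sum>t<0. f i t * g t j) = 0\<^sub>v n" by (intro eq_vecI) auto
      then show ?case using linear_subspaceD(2)[OF lin] by simp
    next
      case (Suc r')
      have "vec n (\<lambda>i. f i r') \<in> B" using Suc.prems by (auto simp: B_def)
      then have "vec n (\<lambda>i. f i r') \<in> span B" using in_own_span B(2) by auto
      then have "vec n (\<lambda>i. \<Sum>t<r'. f i t * g t j) + g r' j \<cdot>\<^sub>v vec n (\<lambda>i. f i r') \<in> span B"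
        using linear_subspaceD(3,4)[OF lin] Suc by simp
      moreover have "vec n (\<lambda>i. \<Sum>t<r'. f i t * g t j) + g r' j \<cdot>\<^sub>v vec n (\<lambda>i. f i r') =
          vec n (\<lambda>i. \<Sum>t<Suc r'. f i t * g t j)" by (intro eq_vecI) (auto simp: mult.commute)
      ultimately show ?case by simp
    qed
    moreover have "v = vec n (\<lambda>i. \<Sum>t<r. f i t * g t j)"
      using j A by (intro eq_vecI) (auto simp: f)
    ultimately show "v \<in> span B" by simp
  qed
  then obtain C where "C \<subseteq> span B" "int (card C) \<le> int (card B) - int (card T)"
    using replacement[of T B] T B Tc Tli by auto
  then have "card T \<le> card B" by simp
  also have "\<dots> \<le> r" unfolding B_def using card_image_le[of "{..<r}"] by force
  finally show ?thesis using rank_card_indpt[OF A T(2)] by simp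
qed

text \<open>A maximal independent set of columns spans all of them; its members and the coefficients
  are the two factors.\<close>

lemma (in vec_space) rank_factor:
  assumes A: "A \<in> carrier_mat n m"
  obtains f g where "\<And>i j. i < n \<Longrightarrow> j < m \<Longrightarrow> A $$ (i, j) = (\<Sum>t<rank A. f i t * g t j)"
proof -
  obtain T where T: "finite T" "maximal T (\<lambda>T. T \<subseteq> set (cols A) \<and> lin_indpt T)"
    using maximal_exists_superset[of "set (cols A)" "\<lambda>T. T \<subseteq> set (cols A) \<and> lin_indpt T" "{}"]
    by (auto simp: lin_dep_def)
  then have Tli: "lin_indpt T" "T \<subseteq> set (cols A)" by (auto simp: maximal_def)
  have cA: "set (cols A) \<subseteq> carrier_vec n" using A cols_dim by blast
  have Tc: "T \<subseteq> carrier_vec n" using Tli cA by blast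
  have r: "rank A = card T" by (rule rank_card_indpt[OF A T(2)])
  have "\<exists>a. \<forall>i<n. A $$ (i, j) = (\<Sum>x\<in>T. a x * x $ i)" if j: "j < m" for j
  proof -
    have cj: "col A j \<in> set (cols A)" using j A by (auto simp: cols_def)
    have "col A j \<in> span T"
    proof (cases "col A j \<in> T")
      case True
      then show ?thesis using Tc in_own_span by auto
    next
      case False
      then have "\<not> lin_indpt (insert (col A j) T)"
        using T(2) Tli cj unfolding maximal_def by (metis insert_subset insertI1 subset_insertI)
      then show ?thesis using lin_dep_iff_in_span[of T "col A j"] False Tli Tc cA cj by auto
    qed
    then obtain a where "col A j = lincomb a T"
      using finite_in_span[OF T(1)] Tc by (metis module_vec_simps(3))
    then have "A $$ (i, j) = (\<Sum>x\<in>T. a x * x $ i)" if "i < n" for i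
    proof -
      have "A $$ (i, j) = col A j $ i" using that j A by simp
      then show ?thesis using lincomb_index[OF that Tc, of a] \<open>col A j = lincomb a T\<close> by simp
    qed
    then show ?thesis by blast
  qed
  then obtain a where a: "\<And>i j. i < n \<Longrightarrow> j < m \<Longrightarrow> A $$ (i, j) = (\<Sum>x\<in>T. a j x * x $ i)" by metis
  obtain h where h: "bij_betw h {..<card T} T"
    using ex_bij_betw_nat_finite[OF T(1)] by (auto simp: atLeast0LessThan)
  have "A $$ (i, j) = (\<Sum>t<rank A. h t $ i * a j (h t))" if "i < n" "j < m" for i j
    using a[OF that] sum.reindex_bij_betw[OF h, of "\<lambda>x. a j x * x $ i"] by (simp add: r mult.commute)
  then show thesis using that[of "\<lambda>i t. h t $ i" "\<lambda>t j. a j (h t)"] by blast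
qed

text \<open>Multiplying a rank factorisation from both sides keeps its inner dimension.\<close>

lemma rank_compress_le:
  assumes A: "A \<in> carrier_mat c d" and B: "B \<in> carrier_mat a b"
    and eq: "\<And>i j. i < a \<Longrightarrow> j < b \<Longrightarrow> B $$ (i, j) = (\<Sum>k<c. \<Sum>l<d. p i k * A $$ (k, l) * q l j)"
  shows "vec_space.rank a B \<le> vec_space.rank c (A :: 'k::field mat)"
proof -
  obtain f g where fg: "\<And>i j. i < c \<Longrightarrow> j < d \<Longrightarrow> A $$ (i, j) = (\<Sum>t<vec_space.rank c A. f i t * g t j)"
    using vec_space.rank_factor[OF A] by blast
  let ?r = "vec_space.rank c A"
  have "B $$ (i, j) = (\<Sum>t<?r. (\<Sum>k<c. p i k * f k t) * (\<Sum>l<d. g t l * q l j))" if "i < a" "j < b" for i j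
  proof -
    have "B $$ (i, j) = (\<Sum>k<c. \<Sum>l<d. \<Sum>t<?r. (p i k * f k t) * (g t l * q l j))"
      unfolding eq[OF that] by (intro sum.cong) (auto simp: fg sum_distrib_left sum_distrib_right mult_ac)
    also have "\<dots> = (\<Sum>k<c. \<Sum>t<?r. \<Sum>l<d. (p i k * f k t) * (g t l * q l j))"
      by (intro sum.cong refl sum.swap)
    also have "\<dots> = (\<Sum>t<?r. \<Sum>k<c. \<Sum>l<d. (p i k * f k t) * (g t l * q l j))"
      by (rule sum.swap)
    also have "\<dots> = (\<Sum>t<?r. (\<Sum>k<c. p i k * f k t) * (\<Sum>l<d. g t l * q l j))"
      by (simp add: sum_product)
    finally show ?thesis .
  qed
  then show ?thesis by (rule vec_space.rank_le_factor[OF B])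
qed

section \<open>Gram matrices of spanning lists\<close>

definition spanning :: "nat \<Rightarrow> 'k::field vec set \<Rightarrow> 'k vec list \<Rightarrow> bool" where
  "spanning n X bs \<longleftrightarrow> set bs \<subseteq> X \<and>
    (\<forall>x\<in>X. \<exists>c. \<forall>l<n. x $ l = (\<Sum>k<length bs. c k * (bs ! k) $ l))"

lemma subspace_basis_spanning:
  assumes X: "linear_subspace n X" and bs: "subspace_basis n X (bs :: 'k::field vec list)"
  shows "spanning n X bs"
proof -
  interpret vec_space "TYPE('k)" n .
  have sub: "VectorSpace.subspace class_ring X V" using X by (simp add: subspace_iff)
  then have subm: "submodule class_ring X V" by (simp add: VectorSpace.subspace_def)
  interpret X: vectorspace class_ring "V\<lparr>carrier := X\<rparr>" by (rule subspace_is_vs[OF sub])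
  have b: "set bs \<subseteq> X" "LinearCombinations.module.span class_ring (V\<lparr>carrier := X\<rparr>) (set bs) = X" "distinct bs"
    using bs by (auto simp: subspace_basis_def X.basis_def)
  have sp: "span (set bs) = X" using span_li_not_depend(1)[OF b(1) subm] b(2) by simp
  have Xc: "X \<subseteq> carrier_vec n" using linear_subspaceD(1)[OF X] by blast
  have "\<exists>c. \<forall>l<n. x $ l = (\<Sum>k<length bs. c k * (bs ! k) $ l)" if x: "x \<in> X" for x
  proof -
    obtain a where a: "x = lincomb a (set bs)"
      using finite_in_span[of "set bs" x] b(1) Xc x sp by auto
    have "x $ l = (\<Sum>k<length bs. a (bs ! k) * (bs ! k) $ l)" if "l < n" for l
    proof -
      have "x $ l = (\<Sum>y\<in>set bs. a y * y $ l)" unfolding a using b Xc that by (intro lincomb_index) auto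
      also have "\<dots> = (\<Sum>k<length bs. a (bs ! k) * (bs ! k) $ l)"
        using sum.reindex_bij_betw[OF bij_betw_nth[OF b(3), of "{..<length bs}" "set bs"], of "\<lambda>y. a y * y $ l"] by simp
      finally show ?thesis .
    qed
    then show ?thesis by (intro exI[of _ "\<lambda>k. a (bs ! k)"]) simp
  qed
  then show ?thesis using b by (auto simp: spanning_def)
qed

lemma ex_subspace_basis:
  assumes X: "linear_subspace n (X :: 'k::field vec set)"
  obtains bs where "subspace_basis n X bs"
proof -
  interpret vec_space "TYPE('k)" n .
  have sub: "VectorSpace.subspace class_ring X V" using X by (simp add: subspace_iff)
  then have subm: "submodule class_ring X V" by (simp add: VectorSpace.subspace_def)
  interpret X: vectorspace class_ring "V\<lparr>carrier := X\<rparr>" by (rule subspace_is_vs[OF sub])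
  have Xc: "X \<subseteq> carrier_vec n" using linear_subspaceD(1)[OF X] by blast
  have small: "finite S \<and> card S \<le> n" if "S \<subseteq> X \<and> X.lin_indpt S" for S
    using that span_li_not_depend(2)[of S X] subm li_le_dim[of S] Xc dim_is_n by auto
  have "\<exists>S. finite S \<and> maximal S (\<lambda>S. S \<subseteq> X \<and> X.lin_indpt S)"
  proof (rule maximal_exists[where B = "{}" and N = n])
    show "finite S \<and> card S \<le> n" if "S \<subseteq> X \<and> X.lin_indpt S" for S using that by (rule small)
    show "{} \<subseteq> X \<and> X.lin_indpt {}" by (simp add: X.lin_dep_def)
  qed
  then obtain S where S: "finite S" "maximal S (\<lambda>S. S \<subseteq> X \<and> X.lin_indpt S)" by blast
  then have "X.basis S" by (intro X.max_li_is_basis) simp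
  moreover obtain bs where "set bs = S" "distinct bs" using finite_distinct_list[OF S(1)] by blast
  ultimately show thesis using that unfolding subspace_basis_def by blast
qed

lemma bilinear_expansion:
  fixes A :: "'k::field mat"
  assumes "A \<in> carrier_mat n n" "v \<in> carrier_vec n" "w \<in> carrier_vec n"
  shows "v \<bullet> (A *\<^sub>v w) = (\<Sum>a<n. \<Sum>b<n. v $ a * A $$ (a, b) * w $ b)"
  using assms by (auto simp: scalar_prod_def atLeast0LessThan sum_distrib_left mult_ac intro!: sum.cong)

lemma bilinear_sums:
  fixes A :: "'k::field mat"
  assumes A: "A \<in> carrier_mat n n" and v: "v \<in> carrier_vec n" and w: "w \<in> carrier_vec n"
    and bs: "\<And>k. k < r \<Longrightarrow> b k \<in> carrier_vec n" and cs: "\<And>k. k < s \<Longrightarrow> c k \<in> carrier_vec n"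
    and veq: "\<And>l. l < n \<Longrightarrow> v $ l = (\<Sum>k<r. p k * b k $ l)"
    and weq: "\<And>l. l < n \<Longrightarrow> w $ l = (\<Sum>k<s. q k * c k $ l)"
  shows "v \<bullet> (A *\<^sub>v w) = (\<Sum>k<r. \<Sum>l<s. p k * (b k \<bullet> (A *\<^sub>v c l)) * q l)"
proof -
  have "v \<bullet> (A *\<^sub>v w) = (\<Sum>x<n. \<Sum>y<n. (\<Sum>k<r. p k * b k $ x) * A $$ (x, y) * (\<Sum>l<s. q l * c l $ y))"
    unfolding bilinear_expansion[OF A v w] by (intro sum.cong) (auto simp: veq weq)
  also have "\<dots> = (\<Sum>x<n. \<Sum>y<n. \<Sum>k<r. \<Sum>l<s. p k * (b k $ x * A $$ (x, y) * c l $ y) * q l)"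
  proof (intro sum.cong refl)
    fix x y
    have "(\<Sum>k<r. p k * b k $ x) * A $$ (x, y) * (\<Sum>l<s. q l * c l $ y) =
        (\<Sum>k<r. \<Sum>l<s. (p k * b k $ x * A $$ (x, y)) * (q l * c l $ y))"
      by (simp only: sum_distrib_right[of _ _ "A $$ (x, y)"] sum_product)
    then show "(\<Sum>k<r. p k * b k $ x) * A $$ (x, y) * (\<Sum>l<s. q l * c l $ y) =
        (\<Sum>k<r. \<Sum>l<s. p k * (b k $ x * A $$ (x, y) * c l $ y) * q l)"
      by (simp only: mult_ac)
  qed
  also have "\<dots> = (\<Sum>x<n. \<Sum>k<r. \<Sum>y<n. \<Sum>l<s. p k * (b k $ x * A $$ (x, y) * c l $ y) * q l)"
    by (intro sum.cong refl sum.swap)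
  also have "\<dots> = (\<Sum>k<r. \<Sum>x<n. \<Sum>y<n. \<Sum>l<s. p k * (b k $ x * A $$ (x, y) * c l $ y) * q l)"
    by (rule sum.swap)
  also have "\<dots> = (\<Sum>k<r. \<Sum>x<n. \<Sum>l<s. \<Sum>y<n. p k * (b k $ x * A $$ (x, y) * c l $ y) * q l)"
    by (intro sum.cong refl sum.swap)
  also have "\<dots> = (\<Sum>k<r. \<Sum>l<s. \<Sum>x<n. \<Sum>y<n. p k * (b k $ x * A $$ (x, y) * c l $ y) * q l)"
    by (intro sum.cong refl sum.swap)
  also have "\<dots> = (\<Sum>k<r. \<Sum>l<s. p k * (b k \<bullet> (A *\<^sub>v c l)) * q l)"
    by (intro sum.cong refl) (simp add: bilinear_expansion[OF A bs cs] sum_distrib_left sum_distrib_right)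
  finally show ?thesis .
qed

text \<open>Coefficients in the spanning lists express the Gram matrix of arbitrary vectors of
  \<open>X\<close> and \<open>Y\<close> as a compression of the Gram matrix of the lists.\<close>

lemma rank_spanned_le:
  fixes A :: "'k::field mat"
  assumes A: "A \<in> carrier_mat n n" and X: "linear_subspace n X" and Y: "linear_subspace n Y"
    and bs: "spanning n X bs" and cs: "spanning n Y cs"
    and z: "\<And>i. i < r \<Longrightarrow> z i \<in> X" and w: "\<And>i. i < s \<Longrightarrow> w i \<in> Y"
  shows "vec_space.rank r (mat r s (\<lambda>(i, j). z i \<bullet> (A *\<^sub>v w j))) \<le> vec_space.rank (length bs) (gram_matrix A bs cs)"
proof -
  have "\<exists>c. \<forall>l<n. z i $ l = (\<Sum>k<length bs. c k * (bs ! k) $ l)" if "i < r" for i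
    using bs z that by (auto simp: spanning_def)
  then obtain p where p: "\<And>i l. i < r \<Longrightarrow> l < n \<Longrightarrow> z i $ l = (\<Sum>k<length bs. p i k * (bs ! k) $ l)" by metis
  have "\<exists>c. \<forall>l<n. w i $ l = (\<Sum>k<length cs. c k * (cs ! k) $ l)" if "i < s" for i
    using cs w that by (auto simp: spanning_def)
  then obtain q where q: "\<And>i l. i < s \<Longrightarrow> l < n \<Longrightarrow> w i $ l = (\<Sum>k<length cs. q i k * (cs ! k) $ l)" by metis
  have c: "k < length bs \<Longrightarrow> bs ! k \<in> carrier_vec n" "k < length cs \<Longrightarrow> cs ! k \<in> carrier_vec n" for k
    using bs cs linear_subspaceD(1)[OF X] linear_subspaceD(1)[OF Y] nth_mem
    unfolding spanning_def by blast+
  show ?thesis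
  proof (rule rank_compress_le[where c = "length bs" and d = "length cs" and b = s and p = p and q = "\<lambda>l j. q j l"])
    show "gram_matrix A bs cs \<in> carrier_mat (length bs) (length cs)" by (simp add: gram_matrix_def)
    fix i j assume ij: "i < r" "j < s"
    have "z i \<bullet> (A *\<^sub>v w j) = (\<Sum>k<length bs. \<Sum>l<length cs. p i k * (bs ! k \<bullet> (A *\<^sub>v cs ! l)) * q j l)"
      using z[OF ij(1)] w[OF ij(2)] linear_subspaceD(1)[OF X] linear_subspaceD(1)[OF Y] p q ij
      by (intro bilinear_sums[OF A] c) auto
    then show "mat r s (\<lambda>(i, j). z i \<bullet> (A *\<^sub>v w j)) $$ (i, j) =
        (\<Sum>k<length bs. \<Sum>l<length cs. p i k * gram_matrix A bs cs $$ (k, l) * q j l)"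
      using ij by (simp add: gram_matrix_def)
  qed simp
qed

text \<open>Compression in both directions shows that all bases give the same rank, so the definite
  description in \<open>rank_function\<close> is proper.\<close>

lemma rank_function_eq:
  fixes A :: "'k::field mat"
  assumes A: "A \<in> carrier_mat n n" and X: "linear_subspace n X" and Y: "linear_subspace n Y"
  obtains bs cs where "spanning n X bs" "spanning n Y cs"
    "rank_function n A (X, Y) = int (vec_space.rank (length bs) (gram_matrix A bs cs))"
proof -
  have le: "vec_space.rank (length bs) (gram_matrix A bs cs) \<le> vec_space.rank (length bs') (gram_matrix A bs' cs')"
    if "spanning n X bs" "spanning n Y cs" "spanning n X bs'" "spanning n Y cs'" for bs cs bs' cs'
  proof -
    have "vec_space.rank (length bs) (mat (length bs) (length cs) (\<lambda>(i, j). bs ! i \<bullet> (A *\<^sub>v cs ! j))) \<le>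
        vec_space.rank (length bs') (gram_matrix A bs' cs')"
      using that by (intro rank_spanned_le[OF A X Y]) (auto simp: spanning_def)
    then show ?thesis by (simp add: gram_matrix_def)
  qed
  obtain bs cs where b: "subspace_basis n X bs" "subspace_basis n Y cs"
    using ex_subspace_basis X Y by metis
  note sp = subspace_basis_spanning[OF X] subspace_basis_spanning[OF Y]
  have "rank_function n A (X, Y) = int (vec_space.rank (length bs) (gram_matrix A bs cs))"
    unfolding rank_function_def prod.case
  proof (rule the_equality)
    show "\<exists>bs' cs'. subspace_basis n X bs' \<and> subspace_basis n Y cs' \<and>
        int (vec_space.rank (length bs) (gram_matrix A bs cs)) = int (vec_space.rank (length bs') (gram_matrix A bs' cs'))"
      using b by blast
    fix r assume "\<exists>bs' cs'. subspace_basis n X bs' \<and> subspace_basis n Y cs' \<and>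
        r = int (vec_space.rank (length bs') (gram_matrix A bs' cs'))"
    then obtain bs' cs' where b': "subspace_basis n X bs'" "subspace_basis n Y cs'"
      "r = int (vec_space.rank (length bs') (gram_matrix A bs' cs'))" by blast
    then show "r = int (vec_space.rank (length bs) (gram_matrix A bs cs))"
      using le[of bs cs bs' cs'] le[of bs' cs' bs cs] sp b by simp
  qed
  then show thesis using that sp b by blast
qed

text \<open>In the two bases the form is a partial permutation matrix with ones at
  \<open>(i, \<mu> i)\<close> for \<open>i\<close> in \<open>I\<close>. \<open>\<mu>\<close>
  permutes all positions, so that an order on one side can be transported to the other.\<close>

locale diagonalisation =
  fixes n :: nat and A :: "'k::field mat" and U E V F :: "nat \<Rightarrow> nat \<Rightarrow> 'k" and I :: "nat set" and \<mu> :: "nat \<Rightarrow> nat"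
  assumes A: "A \<in> carrier_mat n n" and dualU: "dual_bases n U E" and dualV: "dual_bases n V F"
    and I: "I \<subseteq> {..<n}" and \<mu>: "bij_betw \<mu> {..<n} {..<n}"
    and diag: "\<And>v w. v \<in> carrier_vec n \<Longrightarrow> w \<in> carrier_vec n \<Longrightarrow>
      v \<bullet> (A *\<^sub>v w) = (\<Sum>i\<in>I. dot n (U i) (($) v) * dot n (V (\<mu> i)) (($) w))"
begin

lemma \<mu>_less: "i \<in> I \<Longrightarrow> \<mu> i < n"
  using \<mu> I by (auto simp: bij_betw_def)

text \<open>On coordinate subspaces only the summands with \<open>i\<close> in \<open>S\<close> and
  \<open>\<mu> i\<close> in \<open>T\<close> survive, and what remains is a factorisation of that
  size.\<close>

lemma rank_function_coord_le:
  "rank_function n A (coord_subspace n U S, coord_subspace n V T) \<le> int (card {i \<in> I. i \<in> S \<and> \<mu> i \<in> T})"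
proof -
  let ?X = "coord_subspace n U S" and ?Y = "coord_subspace n V T" and ?K = "{i \<in> I. i \<in> S \<and> \<mu> i \<in> T}"
  obtain bs cs where sp: "spanning n ?X bs" "spanning n ?Y cs"
    and R: "rank_function n A (?X, ?Y) = int (vec_space.rank (length bs) (gram_matrix A bs cs))"
    using rank_function_eq[OF A, of ?X ?Y] by auto
  have fin: "finite I" using I finite_subset by auto
  obtain h where h: "bij_betw h {..<card ?K} ?K"
    using ex_bij_betw_nat_finite[of ?K] fin by (auto simp: atLeast0LessThan)
  have "gram_matrix A bs cs $$ (i, j) =
      (\<Sum>t<card ?K. dot n (U (h t)) (($) (bs ! i)) * dot n (V (\<mu> (h t))) (($) (cs ! j)))"
    if "i < length bs" "j < length cs" for i j
  proof -
    have X: "bs ! i \<in> ?X" and Y: "cs ! j \<in> ?Y" using sp that by (auto simp: spanning_def)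
    have "gram_matrix A bs cs $$ (i, j) = bs ! i \<bullet> (A *\<^sub>v cs ! j)"
      using that by (simp add: gram_matrix_def)
    also have "\<dots> = (\<Sum>l\<in>I. dot n (U l) (($) (bs ! i)) * dot n (V (\<mu> l)) (($) (cs ! j)))"
      using X Y by (intro diag) (auto simp: coord_subspace_def)
    also have "\<dots> = (\<Sum>l\<in>?K. dot n (U l) (($) (bs ! i)) * dot n (V (\<mu> l)) (($) (cs ! j)))"
      by (rule sum.mono_neutral_right) (use X Y fin I \<mu>_less in \<open>auto simp: coord_subspace_def\<close>)
    also have "\<dots> = (\<Sum>t<card ?K. dot n (U (h t)) (($) (bs ! i)) * dot n (V (\<mu> (h t))) (($) (cs ! j)))"
      by (rule sum.reindex_bij_betw[OF h, symmetric])
    finally show ?thesis .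
  qed
  then have "vec_space.rank (length bs) (gram_matrix A bs cs) \<le> card ?K"
    by (intro vec_space.rank_le_factor[where m = "length cs"]) (auto simp: gram_matrix_def)
  then show ?thesis using R by simp
qed

text \<open>Reading the coordinates on the two sides in opposite orders makes the Gram matrix of vectors
  with matched pivots triangular.\<close>

lemma rank_function_ge:
  fixes \<tau> \<tau>' :: "nat \<Rightarrow> int"
  assumes X: "linear_subspace n X" and Y: "linear_subspace n Y"
    and inj: "inj_on \<tau> {..<n}" and opp: "\<And>i. i < n \<Longrightarrow> \<tau>' (\<mu> i) = - \<tau> i"
  shows "int (card {i \<in> I. i \<in> pivots n U \<tau> X \<and> \<mu> i \<in> pivots n V \<tau>' Y}) \<le> rank_function n A (X, Y)"
proof -
  let ?K = "{i \<in> I. i \<in> pivots n U \<tau> X \<and> \<mu> i \<in> pivots n V \<tau>' Y}"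
  have fin: "finite I" using I finite_subset by auto
  then have finK: "finite ?K" by simp
  obtain ls where ls: "set ls = ?K" "distinct ls" using finite_distinct_list[OF finK] by blast
  define xs where "xs = sort_key \<tau> ls"
  have xs: "set xs = ?K" "distinct xs" "sorted (map \<tau> xs)" using ls by (simp_all add: xs_def)
  let ?r = "length xs"
  have r: "?r = card ?K" using distinct_card[OF xs(2)] xs(1) by simp
  have xK: "xs ! a \<in> ?K" if "a < ?r" for a using that xs(1) nth_mem by blast
  have xn: "xs ! a < n" if "a < ?r" for a using xK[OF that] I by auto
  have \<tau>_less: "\<tau> (xs ! a) < \<tau> (xs ! b)" if "a < b" "b < ?r" for a b
  proof -
    have "\<tau> (xs ! a) \<le> \<tau> (xs ! b)" using sorted_nth_mono[OF xs(3), of a b] that by simp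
    moreover have "xs ! a \<noteq> xs ! b" using xs(2) that by (simp add: nth_eq_iff_index_eq)
    ultimately show ?thesis using inj xn that by (metis inj_onD lessThan_iff less_trans order_le_less)
  qed
  have "\<exists>z. z \<in> X \<and> dot n (U (xs ! a)) (($) z) \<noteq> 0 \<and>
      (\<forall>k<n. \<tau> (xs ! a) < \<tau> k \<longrightarrow> dot n (U k) (($) z) = 0)" if "a < ?r" for a
    using xK[OF that] by (auto simp: pivots_def)
  then obtain z where z: "\<And>a. a < ?r \<Longrightarrow> z a \<in> X \<and> dot n (U (xs ! a)) (($) (z a)) \<noteq> 0 \<and>
      (\<forall>k<n. \<tau> (xs ! a) < \<tau> k \<longrightarrow> dot n (U k) (($) (z a)) = 0)" by metis
  have "\<exists>w. w \<in> Y \<and> dot n (V (\<mu> (xs ! a))) (($) w) \<noteq> 0 \<and>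
      (\<forall>k<n. \<tau>' (\<mu> (xs ! a)) < \<tau>' k \<longrightarrow> dot n (V k) (($) w) = 0)" if "a < ?r" for a
    using xK[OF that] by (auto simp: pivots_def)
  then obtain w where w: "\<And>a. a < ?r \<Longrightarrow> w a \<in> Y \<and> dot n (V (\<mu> (xs ! a))) (($) (w a)) \<noteq> 0 \<and>
      (\<forall>k<n. \<tau>' (\<mu> (xs ! a)) < \<tau>' k \<longrightarrow> dot n (V k) (($) (w a)) = 0)" by metis
  define M where "M = mat ?r ?r (\<lambda>(a, b). z a \<bullet> (A *\<^sub>v w b))"
  \<comment> \<open>Each vector vanishes above its pivot. Opposite orders turn the two vanishing
    conditions into a lower and an upper bound for \<open>\<tau> l\<close>, so entries with
    \<open>a < b\<close> are empty sums and diagonal entries keep one summand.\<close>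
  have entry: "M $$ (a, b) = (\<Sum>l\<in>I. if \<tau> (xs ! b) \<le> \<tau> l \<and> \<tau> l \<le> \<tau> (xs ! a)
      then dot n (U l) (($) (z a)) * dot n (V (\<mu> l)) (($) (w b)) else 0)" if ab: "a < ?r" "b < ?r" for a b
  proof -
    have "M $$ (a, b) = z a \<bullet> (A *\<^sub>v w b)" using ab by (simp add: M_def)
    also have "\<dots> = (\<Sum>l\<in>I. dot n (U l) (($) (z a)) * dot n (V (\<mu> l)) (($) (w b)))"
      using z[OF ab(1)] w[OF ab(2)] linear_subspaceD(1)[OF X] linear_subspaceD(1)[OF Y] by (intro diag) auto
    also have "\<dots> = (\<Sum>l\<in>I. if \<tau> (xs ! b) \<le> \<tau> l \<and> \<tau> l \<le> \<tau> (xs ! a)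
      then dot n (U l) (($) (z a)) * dot n (V (\<mu> l)) (($) (w b)) else 0)"
    proof (rule sum.cong, simp)
      fix l assume l: "l \<in> I"
      have "dot n (U l) (($) (z a)) = 0" if "\<tau> (xs ! a) < \<tau> l" using z[OF ab(1)] l I that by auto
      moreover have "dot n (V (\<mu> l)) (($) (w b)) = 0" if "\<tau> l < \<tau> (xs ! b)"
        using w[OF ab(2)] \<mu>_less[OF l] opp[of l] opp[OF xn[OF ab(2)]] l I that by auto
      ultimately show "dot n (U l) (($) (z a)) * dot n (V (\<mu> l)) (($) (w b)) =
          (if \<tau> (xs ! b) \<le> \<tau> l \<and> \<tau> l \<le> \<tau> (xs ! a)
            then dot n (U l) (($) (z a)) * dot n (V (\<mu> l)) (($) (w b)) else 0)"
        by (auto simp: not_le)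
    qed
    finally show ?thesis .
  qed
  have M: "M \<in> carrier_mat ?r ?r" by (simp add: M_def)
  have low: "M $$ (a, b) = 0" if "a < b" "b < ?r" for a b
    using entry[of a b] \<tau>_less[OF that] that by (auto intro!: sum.neutral)
  have diag_nz: "M $$ (a, a) \<noteq> 0" if a: "a < ?r" for a
  proof -
    have "M $$ (a, a) = (\<Sum>l\<in>I. if l = xs ! a then dot n (U l) (($) (z a)) * dot n (V (\<mu> l)) (($) (w a)) else 0)"
      unfolding entry[OF a a]
    proof (rule sum.cong, simp)
      fix l assume "l \<in> I"
      then have "\<tau> (xs ! a) \<le> \<tau> l \<and> \<tau> l \<le> \<tau> (xs ! a) \<longleftrightarrow> l = xs ! a"
        using inj xn[OF a] I by (auto simp: inj_on_def)
      then show "(if \<tau> (xs ! a) \<le> \<tau> l \<and> \<tau> l \<le> \<tau> (xs ! a) then dot n (U l) (($) (z a)) * dot n (V (\<mu> l)) (($) (w a)) else 0) =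
          (if l = xs ! a then dot n (U l) (($) (z a)) * dot n (V (\<mu> l)) (($) (w a)) else 0)" by simp
    qed
    also have "\<dots> = dot n (U (xs ! a)) (($) (z a)) * dot n (V (\<mu> (xs ! a))) (($) (w a))"
      using xK[OF a] fin by simp
    finally show ?thesis using z[OF a] w[OF a] by simp
  qed
  have "det M = prod_list (diag_mat M)" using low M by (intro det_lower_triangular) auto
  also have "\<dots> \<noteq> 0" using diag_nz M by (auto simp: prod_list_zero_iff diag_mat_def)
  finally have rM: "vec_space.rank ?r M = ?r" using vec_space.det_rank_iff[OF M] by simp
  obtain bs cs where sp: "spanning n X bs" "spanning n Y cs"
    and R: "rank_function n A (X, Y) = int (vec_space.rank (length bs) (gram_matrix A bs cs))"
    using rank_function_eq[OF A X Y] by auto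
  have "vec_space.rank ?r M \<le> vec_space.rank (length bs) (gram_matrix A bs cs)"
    unfolding M_def using z w by (intro rank_spanned_le[OF A X Y sp]) auto
  then show ?thesis using rM R r by simp
qed

end

section \<open>The resolvent in coordinates\<close>

text \<open>If \<open>b < a\<close>, the two coordinates are pulled together with force
  \<open>\<kappa>\<close>: each is displaced by \<open>\<kappa> * lam\<close>, capped at half the
  gap, where they meet and the force ceases.\<close>

definition step_size :: "real \<Rightarrow> real \<Rightarrow> real \<Rightarrow> real \<Rightarrow> real" where
  "step_size \<kappa> lam a b = (if b < a then min (\<kappa> * lam) ((a - b) / 2) else 0)"

text \<open>The second quadratic term on the left expresses strong convexity; it yields minimality
  and uniqueness at once. The proof combines the subgradient inequality for the positive part with
  an exact expansion of squares.\<close>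

lemma step_size_minimises:
  fixes a b s t :: real
  assumes lam: "0 < lam" and \<kappa>: "0 \<le> \<kappa>"
  defines "\<delta> \<equiv> step_size \<kappa> lam a b"
  shows "\<kappa> * max 0 ((a - \<delta>) - (b + \<delta>)) + 1 / (2 * lam) * ((a - (a - \<delta>))\<^sup>2 + (b - (b + \<delta>))\<^sup>2)
      + 1 / (2 * lam) * ((s - (a - \<delta>))\<^sup>2 + (t - (b + \<delta>))\<^sup>2)
    \<le> \<kappa> * max 0 (s - t) + 1 / (2 * lam) * ((a - s)\<^sup>2 + (b - t)\<^sup>2)"
proof -
  \<comment> \<open>The subgradient at the new gap that the optimality condition singles out:
    \<open>\<kappa>\<close> if the gap stays positive, a value between \<open>0\<close> and
    \<open>\<kappa>\<close> if the coordinates meet, and \<open>0\<close> if they do not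
    move.\<close>
  define u where "u = \<delta> / lam"
  have \<delta>u: "\<delta> = u * lam" using lam by (simp add: u_def)
  have "0 \<le> \<delta>" "\<delta> \<le> \<kappa> * lam" using lam \<kappa> by (auto simp: \<delta>_def step_size_def)
  then have u: "0 \<le> u" "u \<le> \<kappa>" using lam by (auto simp: \<delta>u zero_le_mult_iff)
  let ?g = "(a - \<delta>) - (b + \<delta>)"
  have key: "\<kappa> * max 0 ?g + u * ((s - t) - ?g) \<le> \<kappa> * max 0 (s - t)"
  proof -
    have low: "u * (s - t) \<le> \<kappa> * max 0 (s - t)"
    proof (cases "0 \<le> s - t")
      case True
      then show ?thesis using u by (simp add: mult_right_mono)
    next
      case False
      then show ?thesis using u by (simp add: mult_nonneg_nonpos max_def)
    qed
    consider "a \<le> b" | "b < a" "\<kappa> * lam \<le> (a - b) / 2" | "b < a" "(a - b) / 2 \<le> \<kappa> * lam" by linarith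
    then show ?thesis
    proof cases
      case 1
      then have "\<delta> = 0" by (simp add: \<delta>_def step_size_def)
      then show ?thesis using 1 \<kappa> by (simp add: u_def)
    next
      case 2
      then have "\<delta> = \<kappa> * lam" by (simp add: \<delta>_def step_size_def)
      then have "u = \<kappa>" "0 \<le> ?g" using lam 2 by (auto simp: u_def)
      then show ?thesis using low by (simp add: algebra_simps)
    next
      case 3
      then have "\<delta> = (a - b) / 2" by (simp add: \<delta>_def step_size_def)
      then have "?g = 0" by (simp add: field_simps)
      then show ?thesis using low by simp
    qed
  qed
  have "1 / (2 * lam) * ((a - s)\<^sup>2 + (b - t)\<^sup>2) =
      1 / (2 * lam) * ((a - (a - \<delta>))\<^sup>2 + (b - (b + \<delta>))\<^sup>2)
      + 1 / (2 * lam) * ((s - (a - \<delta>))\<^sup>2 + (t - (b + \<delta>))\<^sup>2) - u * ((s - t) - ?g)"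
    using lam by (simp add: \<delta>u field_simps power2_eq_square)
  then show ?thesis using key by linarith
qed

section \<open>Minimality and uniqueness for a diagonalised form\<close>

context diagonalisation
begin

abbreviation "LL \<equiv> subspace_lattice n :: 'k vec set gorder"
abbreviation "MM \<equiv> reverse_subspace_lattice n :: 'k vec set gorder"

definition coords_L :: "('k vec set \<Rightarrow> real) \<Rightarrow> nat \<Rightarrow> real" where
  "coords_L = retraction.rho (pivots n U int)"

definition coords_M :: "('k vec set \<Rightarrow> real) \<Rightarrow> nat \<Rightarrow> real" where
  "coords_M = retraction.rho (\<lambda>Z. {..<n} - pivots n V int Z)"

definition points_L :: "('k vec set \<Rightarrow> real) set" where
  "points_L = {x \<in> orthoscheme_complex LL. support x \<subseteq> coord_subspace n U ` Pow {..<n}}"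

definition points_M :: "('k vec set \<Rightarrow> real) set" where
  "points_M = {y \<in> orthoscheme_complex MM. support y \<subseteq> coord_subspace n V ` Pow {..<n}}"

lemma retraction_L: "inj_on \<tau> {..<n} \<Longrightarrow> retraction LL n (pivots n U \<tau>) (coord_subspace n U)"
  by (rule retraction_subspaces[OF dualU])

lemma retraction_M: "inj_on \<tau> {..<n} \<Longrightarrow>
    retraction MM n (\<lambda>Z. {..<n} - pivots n V \<tau> Z) (\<lambda>S. coord_subspace n V ({..<n} - S))"
  by (rule retraction_reverse_subspaces[OF dualV])

lemma inj_int: "inj_on int B"
  by (simp add: inj_on_def)

lemma apartment_L: "retraction.apartment n (coord_subspace n U) = coord_subspace n U ` Pow {..<n}"
  by (rule retraction.apartment_def[OF retraction_L[OF inj_int]])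

lemma apartment_M:
  "retraction.apartment n (\<lambda>S. coord_subspace n V ({..<n} - S)) = coord_subspace n V ` Pow {..<n}"
proof -
  have "(\<lambda>S. {..<n} - S) ` Pow {..<n} = Pow {..<n}"
    by (auto simp: image_iff intro!: bexI[of _ "{..<n} - _"])
  then show ?thesis
    unfolding retraction.apartment_def[OF retraction_M[OF inj_int]]
    by (metis (no_types, lifting) image_cong image_image)
qed

text \<open>Coordinate subspaces have the same pivots in every order, so points of the apartment
  have coordinates independent of \<open>\<tau>\<close>.\<close>

lemma rho_points_L:
  assumes "x \<in> points_L" "inj_on \<tau> {..<n}"
  shows "retraction.rho (pivots n U \<tau>) x = coords_L x"
proof
  fix i
  have "pivots n U \<tau> p = pivots n U int p" if "p \<in> support x" for p
    using assms that pivots_coord[OF dualU] inj_int by (auto simp: points_L_def)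
  then show "retraction.rho (pivots n U \<tau>) x i = coords_L x i"
    unfolding coords_L_def retraction.rho_def[OF retraction_L[OF assms(2)]]
      retraction.rho_def[OF retraction_L[OF inj_int]] by (intro sum.cong) auto
qed

lemma rho_points_M:
  assumes "y \<in> points_M" "inj_on \<tau> {..<n}"
  shows "retraction.rho (\<lambda>Z. {..<n} - pivots n V \<tau> Z) y = coords_M y"
proof
  fix i
  have "pivots n V \<tau> p = pivots n V int p" if "p \<in> support y" for p
    using assms that pivots_coord[OF dualV] inj_int by (auto simp: points_M_def)
  then show "retraction.rho (\<lambda>Z. {..<n} - pivots n V \<tau> Z) y i = coords_M y i"
    unfolding coords_M_def retraction.rho_def[OF retraction_M[OF assms(2)]]
      retraction.rho_def[OF retraction_M[OF inj_int]] by (intro sum.cong) auto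
qed

text \<open>The reversed order transported along the matching, as \<open>rank_function_ge\<close>
  demands.\<close>

definition opposite :: "(nat \<Rightarrow> int) \<Rightarrow> nat \<Rightarrow> int" where
  "opposite \<tau> j = - \<tau> (inv_into {..<n} \<mu> j)"

lemma opposite_\<mu>: "i < n \<Longrightarrow> opposite \<tau> (\<mu> i) = - \<tau> i"
  using \<mu> by (simp add: opposite_def bij_betw_def inv_into_f_f)

lemma inj_opposite: "inj_on \<tau> {..<n} \<Longrightarrow> inj_on (opposite \<tau>) {..<n}"
proof -
  assume i: "inj_on \<tau> {..<n}"
  have b: "bij_betw (inv_into {..<n} \<mu>) {..<n} {..<n}" using \<mu> by (rule bij_betw_inv_into)
  then have "inj_on (\<tau> \<circ> inv_into {..<n} \<mu>) {..<n}" using i by (auto simp: bij_betw_def intro!: comp_inj_on)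
  then show ?thesis by (simp add: inj_on_def opposite_def)
qed

lemma rank_pair:
  assumes "inj_on \<tau> {..<n}"
  shows "retraction_pair LL MM n (pivots n U \<tau>) (coord_subspace n U)
    (\<lambda>Z. {..<n} - pivots n V (opposite \<tau>) Z) (\<lambda>S. coord_subspace n V ({..<n} - S)) I"
proof -
  have "finite I" using I finite_subset by auto
  then show ?thesis
    using retraction_L[OF assms] retraction_M[OF inj_opposite[OF assms]]
    by (simp add: retraction_pair_def retraction_pair_axioms_def)
qed

definition coord_cut :: "(nat \<Rightarrow> real) \<Rightarrow> (nat \<Rightarrow> real) \<Rightarrow> real" where
  "coord_cut a b = (\<Sum>i\<in>I. max 0 (a i - b (\<mu> i)))"

abbreviation "RR \<equiv> \<lambda>P. real_of_int (rank_function n A P)"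

lemma crossing_eq:
  assumes "inj_on \<tau> {..<n}"
  shows "retraction_pair.crossing (pivots n U \<tau>) (\<lambda>Z. {..<n} - pivots n V (opposite \<tau>) Z) I \<mu> (p, q) =
    card {i \<in> I. i \<in> pivots n U \<tau> p \<and> \<mu> i \<in> pivots n V (opposite \<tau>) q}"
  unfolding retraction_pair.crossing_def[OF rank_pair[OF assms]]
  by (rule arg_cong[where f = card]) (use \<mu>_less in auto)

text \<open>At every pair of subspaces the triangular Gram matrix bounds the rank from below by the
  crossing number, and the extension inherits the bound.\<close>

lemma lovasz_ge:
  assumes x: "x \<in> orthoscheme_complex LL" and y: "y \<in> orthoscheme_complex MM" and i: "inj_on \<tau> {..<n}"
  shows "coord_cut (retraction.rho (pivots n U \<tau>) x) (retraction.rho (\<lambda>Z. {..<n} - pivots n V (opposite \<tau>) Z) y)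
    \<le> lovasz_extension_prod LL MM RR (x, y)"
proof -
  interpret P: retraction_pair LL MM n "pivots n U \<tau>" "coord_subspace n U"
    "\<lambda>Z. {..<n} - pivots n V (opposite \<tau>) Z" "\<lambda>S. coord_subspace n V ({..<n} - S)" I \<mu>
    by (rule rank_pair[OF i])
  have "real (P.crossing (p, q)) \<le> RR (p, q)" if "p \<in> carrier LL" "q \<in> carrier MM" for p q
    using rank_function_ge[of p q \<tau> "opposite \<tau>"] that i opposite_\<mu> by (simp add: crossing_eq[OF i])
  then show ?thesis
    using P.lovasz_extension_prod_bounds(1)[OF x y] by (simp add: coord_cut_def P.cut_def)
qed

text \<open>On coordinate subspaces the lower bound by triangularity and the upper bound by
  surviving summands coincide.\<close>

lemma lovasz_points:
  assumes x: "x \<in> points_L" and y: "y \<in> points_M"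
  shows "lovasz_extension_prod LL MM RR (x, y) = coord_cut (coords_L x) (coords_M y)"
proof -
  interpret P: retraction_pair LL MM n "pivots n U int" "coord_subspace n U"
    "\<lambda>Z. {..<n} - pivots n V (opposite int) Z" "\<lambda>S. coord_subspace n V ({..<n} - S)" I \<mu>
    by (rule rank_pair[OF inj_int])
  have K: "x \<in> orthoscheme_complex LL" "y \<in> orthoscheme_complex MM"
    using x y by (auto simp: points_L_def points_M_def)
  have "RR (p, q) = real (P.crossing (p, q))" if p: "p \<in> support x" "q \<in> support y" for p q
  proof -
    obtain S where S: "S \<subseteq> {..<n}" "p = coord_subspace n U S" using x p by (auto simp: points_L_def)
    obtain T where T: "T \<subseteq> {..<n}" "q = coord_subspace n V T" using y p by (auto simp: points_M_def)
    have "pivots n U int p = S" "pivots n V (opposite int) q = T"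
      using S T pivots_coord[OF dualU] pivots_coord[OF dualV] inj_int inj_opposite by auto
    then have c: "P.crossing (p, q) = card {i \<in> I. i \<in> S \<and> \<mu> i \<in> T}" by (simp add: crossing_eq[OF inj_int])
    have "rank_function n A (p, q) \<le> int (card {i \<in> I. i \<in> S \<and> \<mu> i \<in> T})"
      unfolding S(2) T(2) by (rule rank_function_coord_le)
    moreover have "int (P.crossing (p, q)) \<le> rank_function n A (p, q)"
      using rank_function_ge[of p q int "opposite int"] S T inj_int opposite_\<mu>
      by (simp add: crossing_eq[OF inj_int])
    ultimately show ?thesis using c by simp
  qed
  then have "lovasz_extension_prod LL MM RR (x, y) = P.cut (P.L.rho x) (P.M.rho y)"
    by (rule P.lovasz_extension_prod_bounds(2)[OF K])
  then show ?thesis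
    using rho_points_L[OF x inj_int] rho_points_M[OF y inj_opposite[OF inj_int]]
    by (simp add: coord_cut_def P.cut_def)
qed

text \<open>Each retraction is nonexpansive, does not increase the extension and fixes the
  apartment. Hence the separable problem in coordinates bounds the objective from below everywhere,
  with equality at \<open>(x, y)\<close>, whose coordinates solve it.\<close>

theorem is_resolvent_coords:
  assumes x0: "x0 \<in> points_L" and y0: "y0 \<in> points_M" and x: "x \<in> points_L" and y: "y \<in> points_M"
    and lam: "0 < lam" and \<kappa>: "0 \<le> \<kappa>"
    and cx: "\<And>i. i < n \<Longrightarrow> coords_L x i = coords_L x0 i - \<delta> i"
    and cy: "\<And>i. i < n \<Longrightarrow> coords_M y (\<mu> i) = coords_M y0 (\<mu> i) + \<delta> i"
    and \<delta>: "\<And>i. i < n \<Longrightarrow> \<delta> i = (if i \<in> I then step_size \<kappa> lam (coords_L x0 i) (coords_M y0 (\<mu> i)) else 0)"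
  shows "is_resolvent (orthoscheme_complex LL \<times> orthoscheme_complex MM)
    (prod_dist (complex_dist LL) (complex_dist MM)) (\<lambda>z. \<kappa> * lovasz_extension_prod LL MM RR z) lam (x0, y0) (x, y)"
proof -
  define F where "F z = \<kappa> * lovasz_extension_prod LL MM RR z
    + 1 / (2 * lam) * (prod_dist (complex_dist LL) (complex_dist MM) (x0, y0) z)\<^sup>2" for z
  define a b a0 b0 where "a = coords_L x" and "b = coords_M y" and "a0 = coords_L x0" and "b0 = coords_M y0"
  define h where "h i s t = (if i \<in> I then \<kappa> * max 0 (s - t) else 0)
    + 1 / (2 * lam) * ((a0 i - s)\<^sup>2 + (b0 (\<mu> i) - t)\<^sup>2)" for i s t
  have K: "x0 \<in> orthoscheme_complex LL" "y0 \<in> orthoscheme_complex MM" "x \<in> orthoscheme_complex LL" "y \<in> orthoscheme_complex MM"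
    using x0 y0 x y by (auto simp: points_L_def points_M_def)
  have sum_\<mu>: "(\<Sum>j<n. f j) = (\<Sum>i<n. f (\<mu> i))" for f :: "nat \<Rightarrow> real"
    using sum.reindex_bij_betw[OF \<mu>, of f] by simp
  \<comment> \<open>Positions of the second side are renamed along \<open>\<mu>\<close>, so that
    matched coordinates share a summand and each summand can be minimised alone.\<close>
  have G: "\<kappa> * coord_cut s t + 1 / (2 * lam) * ((euclid n a0 s)\<^sup>2 + (euclid n b0 t)\<^sup>2) = (\<Sum>i<n. h i (s i) (t (\<mu> i)))" for s t
  proof -
    have "coord_cut s t = (\<Sum>i<n. if i \<in> I then max 0 (s i - t (\<mu> i)) else 0)"
      unfolding coord_cut_def using I by (intro sum.mono_neutral_cong_left) auto
    then have "\<kappa> * coord_cut s t = (\<Sum>i<n. if i \<in> I then \<kappa> * max 0 (s i - t (\<mu> i)) else 0)"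
      by (simp add: sum_distrib_left if_distrib cong: if_cong)
    then show ?thesis
      unfolding h_def euclid_square sum_\<mu>[of "\<lambda>j. (b0 j - t j)\<^sup>2"]
      by (simp only: sum.distrib sum_distrib_left distrib_left)
  qed
  have sq: "(prod_dist d d' (u, v) (u', v'))\<^sup>2 = (d u u')\<^sup>2 + (d' v v')\<^sup>2" for d :: "'x \<Rightarrow> 'x \<Rightarrow> real" and d' :: "'y \<Rightarrow> 'y \<Rightarrow> real" and u v u' v'
    by (simp add: prod_dist_def)
  have opt: "h i (a i) (b (\<mu> i)) + 1 / (2 * lam) * ((s - a i)\<^sup>2 + (t - b (\<mu> i))\<^sup>2) \<le> h i s t" if i: "i < n" for i s t
  proof (cases "i \<in> I")
    case True
    then have "a i = a0 i - step_size \<kappa> lam (a0 i) (b0 (\<mu> i))" "b (\<mu> i) = b0 (\<mu> i) + step_size \<kappa> lam (a0 i) (b0 (\<mu> i))"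
      using cx[OF i] cy[OF i] \<delta>[OF i] by (simp_all add: a_def b_def a0_def b0_def)
    then show ?thesis using step_size_minimises[OF lam \<kappa>, of "a0 i" "b0 (\<mu> i)" s t] True by (simp add: h_def)
  next
    case False
    then have "a i = a0 i" "b (\<mu> i) = b0 (\<mu> i)"
      using cx[OF i] cy[OF i] \<delta>[OF i] by (simp_all add: a_def b_def a0_def b0_def)
    then show ?thesis using False by (simp add: h_def power2_commute)
  qed
  have Fxy: "F (x, y) = (\<Sum>i<n. h i (a i) (b (\<mu> i)))"
  proof -
    interpret L: retraction LL n "pivots n U int" "coord_subspace n U" by (rule retraction_L[OF inj_int])
    interpret M: retraction MM n "\<lambda>Z. {..<n} - pivots n V int Z" "\<lambda>S. coord_subspace n V ({..<n} - S)"
      by (rule retraction_M[OF inj_int])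
    have "complex_dist LL x0 x = euclid n a0 a"
      using L.complex_dist_apartment[of x0 x] x0 x apartment_L
      by (simp add: points_L_def a0_def a_def coords_L_def)
    moreover have "complex_dist MM y0 y = euclid n b0 b"
      using M.complex_dist_apartment[of y0 y] y0 y apartment_M
      by (simp add: points_M_def b0_def b_def coords_M_def)
    ultimately show ?thesis
      unfolding F_def lovasz_points[OF x y] sq G[symmetric] by (simp add: a_def b_def)
  qed
  \<comment> \<open>The same estimate holds for every order \<open>\<tau>\<close>, because the
    points \<open>x0\<close>, \<open>y0\<close>, \<open>x\<close> and \<open>y\<close> have the same
    coordinates in all of them.\<close>
  have bound: "F (x, y) + 1 / (2 * lam) * (\<Sum>i<n. (retraction.rho (pivots n U \<tau>) x' i - a i)\<^sup>2 +
      (retraction.rho (\<lambda>Z. {..<n} - pivots n V (opposite \<tau>) Z) y' (\<mu> i) - b (\<mu> i))\<^sup>2) \<le> F (x', y')"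
    if x': "x' \<in> orthoscheme_complex LL" and y': "y' \<in> orthoscheme_complex MM" and inj: "inj_on \<tau> {..<n}" for x' y' \<tau>
  proof -
    interpret L: retraction LL n "pivots n U \<tau>" "coord_subspace n U" by (rule retraction_L[OF inj])
    interpret M: retraction MM n "\<lambda>Z. {..<n} - pivots n V (opposite \<tau>) Z" "\<lambda>S. coord_subspace n V ({..<n} - S)"
      by (rule retraction_M[OF inj_opposite[OF inj]])
    let ?s = "L.rho x'" and ?t = "M.rho y'"
    have "F (x, y) + 1 / (2 * lam) * (\<Sum>i<n. (?s i - a i)\<^sup>2 + (?t (\<mu> i) - b (\<mu> i))\<^sup>2) =
        (\<Sum>i<n. h i (a i) (b (\<mu> i)) + 1 / (2 * lam) * ((?s i - a i)\<^sup>2 + (?t (\<mu> i) - b (\<mu> i))\<^sup>2))"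
      unfolding Fxy sum_distrib_left by (rule sum.distrib[symmetric])
    also have "\<dots> \<le> (\<Sum>i<n. h i (?s i) (?t (\<mu> i)))" using opt by (intro sum_mono) auto
    also have "\<dots> = \<kappa> * coord_cut ?s ?t + 1 / (2 * lam) * ((euclid n a0 ?s)\<^sup>2 + (euclid n b0 ?t)\<^sup>2)"
      by (rule G[symmetric])
    also have "\<dots> \<le> F (x', y')"
      unfolding F_def sq
    proof (intro add_mono mult_left_mono power_mono)
      show "coord_cut ?s ?t \<le> lovasz_extension_prod LL MM RR (x', y')" by (rule lovasz_ge[OF x' y' inj])
      show "euclid n a0 ?s \<le> complex_dist LL x0 x'"
        using L.euclid_le_complex_dist[OF K(1) x'] rho_points_L[OF x0 inj] by (simp add: a0_def)
      show "euclid n b0 ?t \<le> complex_dist MM y0 y'"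
        using M.euclid_le_complex_dist[OF K(2) y'] rho_points_M[OF y0 inj_opposite[OF inj]] by (simp add: b0_def)
    qed (use lam \<kappa> in auto)
    finally show ?thesis .
  qed
  have min: "F (x, y) \<le> F (x', y')" if "x' \<in> orthoscheme_complex LL" "y' \<in> orthoscheme_complex MM" for x' y'
  proof -
    have "0 \<le> 1 / (2 * lam) * (\<Sum>i<n. (retraction.rho (pivots n U int) x' i - a i)\<^sup>2 +
      (retraction.rho (\<lambda>Z. {..<n} - pivots n V (opposite int) Z) y' (\<mu> i) - b (\<mu> i))\<^sup>2)"
      using lam by (intro mult_nonneg_nonneg sum_nonneg) auto
    then show ?thesis using bound[OF that inj_int] by linarith
  qed
  have unique: "x' = x \<and> y' = y"
    if x': "x' \<in> orthoscheme_complex LL" and y': "y' \<in> orthoscheme_complex MM" and le: "F (x', y') \<le> F (x, y)" for x' y'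
  proof -
    have eq: "retraction.rho (pivots n U \<tau>) x' i = a i"
      "retraction.rho (\<lambda>Z. {..<n} - pivots n V (opposite \<tau>) Z) y' (\<mu> i) = b (\<mu> i)"
      if inj: "inj_on \<tau> {..<n}" and i: "i < n" for \<tau> i
    proof -
      let ?q = "\<lambda>i. (retraction.rho (pivots n U \<tau>) x' i - a i)\<^sup>2 +
        (retraction.rho (\<lambda>Z. {..<n} - pivots n V (opposite \<tau>) Z) y' (\<mu> i) - b (\<mu> i))\<^sup>2"
      have "1 / (2 * lam) * (\<Sum>i<n. ?q i) \<le> 0" using bound[OF x' y' inj] le by linarith
      then have "(\<Sum>i<n. ?q i) \<le> 0" using lam by (simp add: mult_le_0_iff divide_le_0_iff)
      moreover have "?q i \<le> (\<Sum>i<n. ?q i)" using i by (intro member_le_sum) auto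
      ultimately have "?q i \<le> 0" by linarith
      then show "retraction.rho (pivots n U \<tau>) x' i = a i"
        "retraction.rho (\<lambda>Z. {..<n} - pivots n V (opposite \<tau>) Z) y' (\<mu> i) = b (\<mu> i)"
        by (simp_all add: sum_power2_le_zero_iff)
    qed
    have eqM: "retraction.rho (\<lambda>Z. {..<n} - pivots n V (opposite \<tau>) Z) y' j = b j"
      if inj: "inj_on \<tau> {..<n}" and j: "j < n" for \<tau> j
    proof -
      obtain i where "i < n" "j = \<mu> i" using \<mu> j by (auto simp: bij_betw_def)
      then show ?thesis using eq(2)[OF inj] by simp
    qed
    have "support x' \<subseteq> coord_subspace n U ` Pow {..<n}"
    proof
      fix p assume p: "p \<in> support x'"
      have pc: "linear_subspace n p" using retraction.K_carrier[OF retraction_L[OF inj_int] x' p] by simp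
      let ?S = "pivots n U int p"
      have "p \<subseteq> coord_subspace n U ?S"
      proof (rule subset_coord_subspaceI[OF pc])
        fix i assume i: "i < n"
        \<comment> \<open>The value \<open>int n\<close> exceeds all others on
          \<open>{..<n}\<close>, so \<open>i\<close> is the highest position and its coordinate is
          tested directly.\<close>
        define \<tau> where "\<tau> k = (if k = i then int n else int k)" for k
        have inj: "inj_on \<tau> {..<n}" by (auto simp: inj_on_def \<tau>_def)
        have "pivots n U \<tau> p = ?S"
        proof (rule retracted_eq[OF retraction_L[OF inj_int] retraction_L[OF inj] x' K(3) _ _ _ p])
          show "support x \<subseteq> retraction.apartment n (coord_subspace n U)"
            using x apartment_L by (simp add: points_L_def)
          show "retraction.rho (pivots n U int) x' i = retraction.rho (pivots n U int) x i" if "i < n" for i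
            using eq(1)[OF inj_int that] rho_points_L[OF x inj_int] by (simp add: a_def)
          show "retraction.rho (pivots n U \<tau>) x' i = retraction.rho (pivots n U \<tau>) x i" if "i < n" for i
            using eq(1)[OF inj that] rho_points_L[OF x inj] by (simp add: a_def)
        qed
        then show "\<exists>\<tau>. (\<forall>k<n. \<tau> k \<le> \<tau> i) \<and> pivots n U \<tau> p \<subseteq> ?S"
          by (intro exI[of _ \<tau>]) (auto simp: \<tau>_def)
      qed
      then have "p = coord_subspace n U ?S"
        using pivots_strict[OF dualU inj_int pc, of "coord_subspace n U ?S"] pivots_coord[OF dualU inj_int pivots_subset[OF dualU inj_int]]
        by simp
      then show "p \<in> coord_subspace n U ` Pow {..<n}" using pivots_subset[OF dualU inj_int] by blast
    qed
    then have "x' = x"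
      using retraction.apartment_eqI[OF retraction_L[OF inj_int] x' _ K(3)] x apartment_L
        eq(1)[OF inj_int] rho_points_L[OF x inj_int] by (simp add: points_L_def a_def)
    have inv_less: "inv_into {..<n} \<mu> j < n" if "j < n" for j
      using bij_betw_inv_into[OF \<mu>] that by (auto simp: bij_betw_def)
    have "support y' \<subseteq> coord_subspace n V ` Pow {..<n}"
    proof
      fix p assume p: "p \<in> support y'"
      let ?\<tau> = "opposite int"
      note inj0 = inj_opposite[OF inj_int]
      have pc: "linear_subspace n p" using retraction.K_carrier[OF retraction_M[OF inj0] y' p] by simp
      let ?S = "pivots n V ?\<tau> p"
      have "p \<subseteq> coord_subspace n V ?S"
      proof (rule subset_coord_subspaceI[OF pc])
        fix j assume j: "j < n"
        \<comment> \<open>The value \<open>- 1\<close> is the least one; \<open>opposite\<close>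
          turns it into the greatest, which makes \<open>j\<close> the highest position on the
          second side.\<close>
        define \<tau> where "\<tau> k = (if k = inv_into {..<n} \<mu> j then - 1 else int k)" for k
        have inj: "inj_on \<tau> {..<n}" by (auto simp: inj_on_def \<tau>_def)
        have "{..<n} - pivots n V (opposite \<tau>) p = {..<n} - ?S"
        proof (rule retracted_eq[OF retraction_M[OF inj0] retraction_M[OF inj_opposite[OF inj]] y' K(4) _ _ _ p])
          show "support y \<subseteq> retraction.apartment n (\<lambda>S. coord_subspace n V ({..<n} - S))"
            using y apartment_M by (simp add: points_M_def)
          show "retraction.rho (\<lambda>Z. {..<n} - pivots n V ?\<tau> Z) y' i = retraction.rho (\<lambda>Z. {..<n} - pivots n V ?\<tau> Z) y i" if "i < n" for i
            using eqM[OF inj_int that] rho_points_M[OF y inj0] by (simp add: b_def)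
          show "retraction.rho (\<lambda>Z. {..<n} - pivots n V (opposite \<tau>) Z) y' i = retraction.rho (\<lambda>Z. {..<n} - pivots n V (opposite \<tau>) Z) y i" if "i < n" for i
            using eqM[OF inj that] rho_points_M[OF y inj_opposite[OF inj]] by (simp add: b_def)
        qed
        then have "pivots n V (opposite \<tau>) p = ?S"
          using pivots_subset[OF dualV inj0] pivots_subset[OF dualV inj_opposite[OF inj]] by (metis double_diff subset_refl)
        moreover have "opposite \<tau> k \<le> opposite \<tau> j" for k by (simp add: opposite_def \<tau>_def)
        ultimately show "\<exists>\<tau>. (\<forall>k<n. \<tau> k \<le> \<tau> j) \<and> pivots n V \<tau> p \<subseteq> ?S"
          by (intro exI[of _ "opposite \<tau>"]) auto
      qed
      then have "p = coord_subspace n V ?S"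
        using pivots_strict[OF dualV inj0 pc, of "coord_subspace n V ?S"] pivots_coord[OF dualV inj0 pivots_subset[OF dualV inj0]]
        by simp
      then show "p \<in> coord_subspace n V ` Pow {..<n}" using pivots_subset[OF dualV inj0] by blast
    qed
    then have "y' = y"
      using retraction.apartment_eqI[OF retraction_M[OF inj_opposite[OF inj_int]] y' _ K(4)] y apartment_M
        eqM[OF inj_int] rho_points_M[OF y inj_opposite[OF inj_int]] by (simp add: points_M_def b_def)
    with \<open>x' = x\<close> show ?thesis by simp
  qed
  show ?thesis
    unfolding is_resolvent_def Let_def F_def[symmetric] is_arg_min_def
    using min unique K by (auto simp: not_less)
qed

end

section \<open>Programs with bounded loops\<close>

text \<open>In \<open>FFor v k p\<close> the counter \<open>v\<close> runs from \<open>0\<close> to \<open>n + k - 1\<close>, where \<open>n\<close> is the content of the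
  cell of that name.\<close>

datatype fprog = FSkip
  | FI string "iexp list" iexp
  | FK string "iexp list" kexp
  | FC string "iexp list" cexp
  | FSeq fprog fprog (infixr \<open>;;\<close> 60)
  | FIf bexp fprog fprog
  | FFor string nat fprog

fun compile :: "fprog \<Rightarrow> com" where
  "compile FSkip = Skip"
| "compile (FI a es e) = IAssign a es e"
| "compile (FK a es e) = KAssign a es e"
| "compile (FC a es e) = CAssign a es e"
| "compile (p ;; q) = Seq (compile p) (compile q)"
| "compile (FIf b p q) = Cond b (compile p) (compile q)"
| "compile (FFor v k p) = Seq (IAssign v [] (INum 0))
     (While (ILess (IRead v []) (IAdd (IRead ''n'' []) (INum k)))
       (Seq (compile p) (IAssign v [] (IAdd (IRead v []) (INum 1)))))"

section \<open>State transformers and the names they write\<close>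

definition seti :: "string \<Rightarrow> nat \<Rightarrow> 'k state \<Rightarrow> 'k state" where
  "seti v x s = s\<lparr>imem := store (imem s) v [] x\<rparr>"

text \<open>The states seen by the loop test: the counter is already set to \<open>i\<close>, so the
  exit state carries the bound as counter value.\<close>

fun iter :: "string \<Rightarrow> ('k state \<Rightarrow> 'k state) \<Rightarrow> nat \<Rightarrow> 'k state \<Rightarrow> 'k state" where
  "iter v f 0 s = seti v 0 s"
| "iter v f (Suc i) s = seti v (Suc i) (f (iter v f i s))"

fun sem :: "fprog \<Rightarrow> 'k::field state \<Rightarrow> 'k state" where
  "sem FSkip s = s"
| "sem (FI a es e) s = s\<lparr>imem := store (imem s) a (map (ival s) es) (ival s e)\<rparr>"
| "sem (FK a es e) s = s\<lparr>kmem := store (kmem s) a (map (ival s) es) (kval s e)\<rparr>"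
| "sem (FC a es e) s = s\<lparr>cmem := store (cmem s) a (map (ival s) es) (cval s e)\<rparr>"
| "sem (p ;; q) s = sem q (sem p s)"
| "sem (FIf b p q) s = (if bval s b then sem p s else sem q s)"
| "sem (FFor v k p) s = iter v (sem p) (imem s ''n'' [] + k) s"

fun iwrites :: "fprog \<Rightarrow> string set" where
  "iwrites FSkip = {}"
| "iwrites (FI a es e) = {a}"
| "iwrites (FK a es e) = {}"
| "iwrites (FC a es e) = {}"
| "iwrites (p ;; q) = iwrites p \<union> iwrites q"
| "iwrites (FIf b p q) = iwrites p \<union> iwrites q"
| "iwrites (FFor v k p) = insert v (iwrites p)"

fun kwrites :: "fprog \<Rightarrow> string set" where
  "kwrites FSkip = {}"
| "kwrites (FI a es e) = {}"
| "kwrites (FK a es e) = {a}"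
| "kwrites (FC a es e) = {}"
| "kwrites (p ;; q) = kwrites p \<union> kwrites q"
| "kwrites (FIf b p q) = kwrites p \<union> kwrites q"
| "kwrites (FFor v k p) = kwrites p"

fun cwrites :: "fprog \<Rightarrow> string set" where
  "cwrites FSkip = {}"
| "cwrites (FI a es e) = {}"
| "cwrites (FK a es e) = {}"
| "cwrites (FC a es e) = {a}"
| "cwrites (p ;; q) = cwrites p \<union> cwrites q"
| "cwrites (FIf b p q) = cwrites p \<union> cwrites q"
| "cwrites (FFor v k p) = cwrites p"

text \<open>A loop body may change neither its counter nor \<open>n\<close>; the number of rounds is
  then fixed on entry, and the while loop agrees with \<open>sem\<close>.\<close>

fun wf_prog :: "fprog \<Rightarrow> bool" where
  "wf_prog (p ;; q) \<longleftrightarrow> wf_prog p \<and> wf_prog q"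
| "wf_prog (FIf b p q) \<longleftrightarrow> wf_prog p \<and> wf_prog q"
| "wf_prog (FFor v k p) \<longleftrightarrow> wf_prog p \<and> v \<noteq> ''n'' \<and> v \<notin> iwrites p \<and> ''n'' \<notin> iwrites p"
| "wf_prog _ \<longleftrightarrow> True"

lemma seti_simps [simp]:
  "kmem (seti v x s) = kmem s" "cmem (seti v x s) = cmem s"
  "imem (seti v x s) a = (if a = v then (imem s v)([] := x) else imem s a)"
  by (auto simp: seti_def store_def fun_eq_iff)

lemma store_apply: "store m a is v b = (if b = a then (m a)(is := v) else m b)"
  by (simp add: store_def)

lemma sem_frame_i: "a \<notin> iwrites p \<Longrightarrow> imem (sem p s) a = imem s a"
proof (induction p arbitrary: s)
  case (FFor v k p)
  have "imem (iter v (sem p) i s) a = imem s a" for i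
    by (induction i) (use FFor in auto)
  then show ?case by simp
qed (auto simp: store_apply)

lemma sem_frame_k: "a \<notin> kwrites p \<Longrightarrow> kmem (sem p s) a = kmem s a"
proof (induction p arbitrary: s)
  case (FFor v k p)
  have "kmem (iter v (sem p) i s) a = kmem s a" for i
    by (induction i) (use FFor in auto)
  then show ?case by simp
qed (auto simp: store_apply)

lemma sem_frame_c: "a \<notin> cwrites p \<Longrightarrow> cmem (sem p s) a = cmem s a"
proof (induction p arbitrary: s)
  case (FFor v k p)
  have "cmem (iter v (sem p) i s) a = cmem s a" for i
    by (induction i) (use FFor in auto)
  then show ?case by simp
qed (auto simp: store_apply)

lemma iter_frame:
  "a \<notin> insert v (iwrites p) \<Longrightarrow> imem (iter v (sem p) i s) a = imem s a"
  "a \<notin> kwrites p \<Longrightarrow> kmem (iter v (sem p) i s) a = kmem s a"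
  "a \<notin> cwrites p \<Longrightarrow> cmem (iter v (sem p) i s) a = cmem s a"
  by (induction i) (auto simp: sem_frame_i sem_frame_k sem_frame_c)

lemma iter_counter: "imem (iter v f i s) v [] = i"
  by (induction i) auto

text \<open>Downward induction from the exit. Besides the body, a round costs \<open>5\<close> for
  the test and \<open>4\<close> for the increment; the failing test at the end costs another
  \<open>5\<close>.\<close>

lemma runs_loop:
  fixes s :: "'k::field state"
  assumes body: "\<And>s :: 'k state. \<exists>t \<le> B (imem s ''n'' []). runs (compile p) s t (sem p s)"
    and wf: "v \<noteq> ''n''" "v \<notin> iwrites p" "''n'' \<notin> iwrites p"
    and i: "i \<le> N" and N: "N = imem s ''n'' [] + k"
  shows "\<exists>t \<le> (N - i) * (B (imem s ''n'' []) + 9) + 5.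
    runs (While (ILess (IRead v []) (IAdd (IRead ''n'' []) (INum k)))
       (Seq (compile p) (IAssign v [] (IAdd (IRead v []) (INum 1)))))
      (iter v (sem p) i s) t (iter v (sem p) N s)"
  using i
proof (induction i rule: inc_induct)
  case base
  let ?b = "ILess (IRead v []) (IAdd (IRead ''n'' []) (INum k))"
  have "\<not> bval (iter v (sem p) N s) ?b"
    using iter_frame(1)[of "''n''" v p N s] wf N by (simp add: iter_counter)
  from runs_WhileFalse[OF this] show ?case by (intro exI[of _ "bcost ?b"]) auto
next
  case (step i)
  let ?s = "iter v (sem p) i s" and ?b = "ILess (IRead v []) (IAdd (IRead ''n'' []) (INum k))"
  have n: "imem ?s ''n'' [] = imem s ''n'' []" using iter_frame(1)[of "''n''" v p i s] wf by simp
  have b: "bval ?s ?b" using n step.hyps N by (simp add: iter_counter)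
  obtain t1 where t1: "t1 \<le> B (imem s ''n'' [])" "runs (compile p) ?s t1 (sem p ?s)"
    using body[of ?s] n by auto
  have "imem (sem p ?s) v [] = i" using sem_frame_i[OF wf(2), of ?s] by (simp add: iter_counter)
  then have inc: "runs (IAssign v [] (IAdd (IRead v []) (INum 1))) (sem p ?s) 4 (iter v (sem p) (Suc i) s)"
    using runs_IAssign[of v "[]" "IAdd (IRead v []) (INum 1)" "sem p ?s"]
    by (simp add: seti_def access_cost_def eval_nat_numeral)
  obtain t2 where t2: "t2 \<le> (N - Suc i) * (B (imem s ''n'' []) + 9) + 5"
    "runs (While ?b (Seq (compile p) (IAssign v [] (IAdd (IRead v []) (INum 1)))))
      (iter v (sem p) (Suc i) s) t2 (iter v (sem p) N s)"
    using step.IH by blast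
  have r: "runs (While ?b (Seq (compile p) (IAssign v [] (IAdd (IRead v []) (INum 1))))) ?s (bcost ?b + (t1 + 4) + t2) (iter v (sem p) N s)"
    by (rule runs_WhileTrue[OF b runs_Seq[OF t1(2) inc] t2(2)])
  have "N - i = Suc (N - Suc i)" using step.hyps by simp
  then have "bcost ?b + (t1 + 4) + t2 \<le> (N - i) * (B (imem s ''n'' []) + 9) + 5"
    using t1(1) t2(1) by simp
  then show ?case using r by blast
qed

text \<open>Every construct acts on cost bounds by an operation on polynomials, loops by
  multiplication with \<open>n + k\<close>, and \<open>n\<close> never changes. So well-formed
  programs run in polynomial time, and only their meaning remains to be studied.\<close>

theorem compile_runs:
  assumes "wf_prog p" "''n'' \<notin> iwrites p"
  shows "\<exists>T :: nat poly. \<forall>s :: 'k::field state. \<exists>t \<le> poly T (imem s ''n'' []). runs (compile p) s t (sem p s)"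
  using assms
proof (induction p)
  case FSkip
  show ?case by (rule exI[of _ "[:1:]"]) (use runs_Skip in force)
next
  case (FI a es e)
  show ?case by (rule exI[of _ "[:access_cost es + icost e:]"]) (use runs_IAssign in force)
next
  case (FK a es e)
  show ?case by (rule exI[of _ "[:access_cost es + kcost e:]"]) (use runs_KAssign in force)
next
  case (FC a es e)
  show ?case by (rule exI[of _ "[:access_cost es + ccost e:]"]) (use runs_CAssign in force)
next
  case (FSeq p q)
  obtain T where T: "\<And>s :: 'k state. \<exists>t \<le> poly T (imem s ''n'' []). runs (compile p) s t (sem p s)" using FSeq by auto
  obtain S where S: "\<And>s :: 'k state. \<exists>t \<le> poly S (imem s ''n'' []). runs (compile q) s t (sem q s)" using FSeq by auto
  show ?case
  proof (intro exI[of _ "T + S"] allI)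
    fix s :: "'k state"
    obtain t1 where t1: "t1 \<le> poly T (imem s ''n'' [])" "runs (compile p) s t1 (sem p s)" using T by blast
    have "imem (sem p s) ''n'' [] = imem s ''n'' []" using FSeq.prems by (simp add: sem_frame_i)
    then obtain t2 where t2: "t2 \<le> poly S (imem s ''n'' [])" "runs (compile q) (sem p s) t2 (sem q (sem p s))"
      using S[of "sem p s"] by auto
    then show "\<exists>t \<le> poly (T + S) (imem s ''n'' []). runs (compile (p ;; q)) s t (sem (p ;; q) s)"
      using t1 runs_Seq[OF t1(2) t2(2)] by (intro exI[of _ "t1 + t2"]) simp
  qed
next
  case (FIf b p q)
  obtain T where T: "\<And>s :: 'k state. \<exists>t \<le> poly T (imem s ''n'' []). runs (compile p) s t (sem p s)" using FIf by auto
  obtain S where S: "\<And>s :: 'k state. \<exists>t \<le> poly S (imem s ''n'' []). runs (compile q) s t (sem q s)" using FIf by auto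
  show ?case
  proof (intro exI[of _ "[:bcost b:] + T + S"] allI)
    fix s :: "'k state"
    obtain t1 where t1: "t1 \<le> poly T (imem s ''n'' [])" "runs (compile p) s t1 (sem p s)" using T by blast
    obtain t2 where t2: "t2 \<le> poly S (imem s ''n'' [])" "runs (compile q) s t2 (sem q s)" using S by blast
    show "\<exists>t \<le> poly ([:bcost b:] + T + S) (imem s ''n'' []). runs (compile (FIf b p q)) s t (sem (FIf b p q) s)"
    proof (cases "bval s b")
      case True
      then show ?thesis using t1 runs_CondTrue[OF True t1(2)] by (intro exI[of _ "bcost b + t1"]) simp
    next
      case False
      then show ?thesis using t2 runs_CondFalse[OF False t2(2)] by (intro exI[of _ "bcost b + t2"]) simp
    qed
  qed
next
  case (FFor v k p)
  obtain T where T: "\<And>s :: 'k state. \<exists>t \<le> poly T (imem s ''n'' []). runs (compile p) s t (sem p s)" using FFor by auto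
  show ?case
  \<comment> \<open>\<open>[:k, 1:]\<close> is the number of rounds; \<open>7\<close> is the cost
    \<open>2\<close> of the initial assignment plus the \<open>5\<close> of the exit test.\<close>
  proof (intro exI[of _ "[:k, 1:] * (T + [:9:]) + [:7:]"] allI)
    fix s :: "'k state"
    let ?N = "imem s ''n'' [] + k"
    let ?c = "access_cost ([] :: iexp list) + icost (INum 0)"
    have init: "runs (IAssign v [] (INum 0)) s ?c (iter v (sem p) 0 s)"
      using runs_IAssign[of v "[]" "INum 0" s] by (simp add: seti_def)
    obtain t where t: "t \<le> ?N * (poly T (imem s ''n'' []) + 9) + 5"
      "runs (While (ILess (IRead v []) (IAdd (IRead ''n'' []) (INum k)))
       (Seq (compile p) (IAssign v [] (IAdd (IRead v []) (INum 1))))) (iter v (sem p) 0 s) t (iter v (sem p) ?N s)"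
      using runs_loop[of "poly T" p v 0 ?N s k] T FFor.prems by auto
    show "\<exists>t \<le> poly ([:k, 1:] * (T + [:9:]) + [:7:]) (imem s ''n'' []). runs (compile (FFor v k p)) s t (sem (FFor v k p) s)"
      using runs_Seq[OF init t(2)] t(1) by (intro exI[of _ "?c + t"]) (simp add: algebra_simps access_cost_def)
  qed
qed

subsection \<open>Reasoning about loops\<close>

definition frame :: "fprog \<Rightarrow> 'k state \<Rightarrow> 'k state \<Rightarrow> bool" where
  "frame p s s' \<longleftrightarrow> (\<forall>a. a \<notin> iwrites p \<longrightarrow> imem s' a = imem s a) \<and>
     (\<forall>a. a \<notin> kwrites p \<longrightarrow> kmem s' a = kmem s a) \<and> (\<forall>a. a \<notin> cwrites p \<longrightarrow> cmem s' a = cmem s a)"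

lemma frameD:
  "frame p s s' \<Longrightarrow> a \<notin> iwrites p \<Longrightarrow> imem s' a = imem s a"
  "frame p s s' \<Longrightarrow> a \<notin> kwrites p \<Longrightarrow> kmem s' a = kmem s a"
  "frame p s s' \<Longrightarrow> a \<notin> cwrites p \<Longrightarrow> cmem s' a = cmem s a"
  by (simp_all add: frame_def)

lemma frame_iter: "frame (FFor v k p) s (iter v (sem p) i s)"
  by (simp add: frame_def iter_frame)

lemma sem_for:
  assumes "imem s ''n'' [] = n" "Q 0 (seti v 0 s)"
    and "\<And>i s'. i < n + k \<Longrightarrow> imem s' v [] = i \<Longrightarrow> frame (FFor v k p) s s' \<Longrightarrow> Q i s' \<Longrightarrow>
      Q (Suc i) (seti v (Suc i) (sem p s'))"
  shows "Q (n + k) (sem (FFor v k p) s)"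
proof -
  have "i \<le> n + k \<Longrightarrow> Q i (iter v (sem p) i s)" for i
  proof (induction i)
    case (Suc i)
    then show ?case using assms(3)[of i "iter v (sem p) i s", OF _ iter_counter frame_iter] by simp
  qed (use assms in simp)
  then show ?thesis using assms(1) by simp
qed

text \<open>For loops in which round \<open>i\<close> writes values prescribed in advance on the
  cells \<open>Bl i\<close>. A round may assume that cells outside the earlier blocks still have
  their initial contents, which covers updates in place.\<close>

lemma sem_for_block:
  fixes sel :: "'k::field state \<Rightarrow> nat list \<Rightarrow> 'v"
  assumes "imem s ''n'' [] = n" "\<And>x s. sel (seti v x s) = sel s"
    and "\<And>i s' js. i < n + k \<Longrightarrow> imem s' v [] = i \<Longrightarrow> frame (FFor v k p) s s' \<Longrightarrow>
      (\<And>js. (\<And>j. j < i \<Longrightarrow> js \<notin> Bl j) \<Longrightarrow> sel s' js = sel s js) \<Longrightarrow>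
      sel (sem p s') js = (if js \<in> Bl i then val js else sel s' js)"
  shows "sel (sem (FFor v k p) s) js = (if \<exists>i<n + k. js \<in> Bl i then val js else sel s js)"
proof -
  have "\<forall>js. sel (sem (FFor v k p) s) js = (if \<exists>i<n + k. js \<in> Bl i then val js else sel s js)"
  proof (rule sem_for[where Q = "\<lambda>m s'. \<forall>js. sel s' js = (if \<exists>i<m. js \<in> Bl i then val js else sel s js)"])
    fix i s' assume a: "i < n + k" "imem s' v [] = i" "frame (FFor v k p) s s'"
      and Q: "\<forall>js. sel s' js = (if \<exists>j<i. js \<in> Bl j then val js else sel s js)"
    show "\<forall>js. sel (seti v (Suc i) (sem p s')) js = (if \<exists>j<Suc i. js \<in> Bl j then val js else sel s js)"
    proof
      fix js
      have "sel (sem p s') js = (if js \<in> Bl i then val js else sel s' js)"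
        by (rule assms(3)[OF a]) (use Q in auto)
      then show "sel (seti v (Suc i) (sem p s')) js = (if \<exists>j<Suc i. js \<in> Bl j then val js else sel s js)"
        using Q assms(2) by (auto simp: less_Suc_eq)
    qed
  qed (use assms in auto)
  then show ?thesis by blast
qed

section \<open>Adapting and diagonalising by exchange steps\<close>

lemma dual_bases_cong:
  assumes "\<And>k l. k < n \<Longrightarrow> l < n \<Longrightarrow> U k l = U' k l" "\<And>k l. k < n \<Longrightarrow> l < n \<Longrightarrow> E k l = E' k l"
  shows "dual_bases n U E = dual_bases n U' E'"
proof -
  have "dot n (U i) (E j) = dot n (U' i) (E' j)" if "i < n" "j < n" for i j
    using assms that by (intro dot_cong) auto
  then show ?thesis by (auto simp: dual_bases_def)
qed

lemma coord_subspace_cong: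
  assumes "\<And>k l. k < n \<Longrightarrow> l < n \<Longrightarrow> U k l = U' k l"
  shows "coord_subspace n U S = coord_subspace n U' S"
proof -
  have "dot n (U i) v = dot n (U' i) v" if "i < n" for i v
    using assms that by (intro dot_cong) auto
  then show ?thesis by (auto simp: coord_subspace_def)
qed

subsection \<open>Exchange\<close>

text \<open>The basis vector \<open>P i\<close> is replaced by \<open>g\<close>, whose coordinates are \<open>c\<close>.\<close>

locale exchange =
  fixes n :: nat and Q P :: "nat \<Rightarrow> nat \<Rightarrow> 'k::field" and g c :: "nat \<Rightarrow> 'k" and i :: nat
    and Q' P' :: "nat \<Rightarrow> nat \<Rightarrow> 'k"
  assumes dual: "dual_bases n Q P" and i: "i < n" and c: "\<And>k. k < n \<Longrightarrow> c k = dot n (Q k) g" and ci: "c i \<noteq> 0"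
    and Q': "\<And>k l. k < n \<Longrightarrow> l < n \<Longrightarrow> Q' k l = Q k l - (if k = i then c i - 1 else c k) * (Q i l / c i)"
    and P': "\<And>k l. k < n \<Longrightarrow> l < n \<Longrightarrow> P' k l = (if k = i then g l else P k l)"
begin

lemma dot_Q':
  assumes "k < n"
  shows "dot n (Q' k) h = dot n (Q k) h - (if k = i then c i - 1 else c k) * (dot n (Q i) h / c i)"
proof -
  let ?f = "if k = i then c i - 1 else c k"
  have "dot n (Q' k) h = dot n (\<lambda>l. Q k l - ?f / c i * Q i l) h"
    using assms Q' by (intro dot_cong) auto
  also have "\<dots> = dot n (Q k) h - ?f / c i * dot n (Q i) h"
    unfolding dot_diff_left dot_mult_left ..
  finally show ?thesis by simp
qed

lemma dot_Q'_zero: "dot n (Q i) h = 0 \<Longrightarrow> k < n \<Longrightarrow> dot n (Q' k) h = (if k = i then 0 else dot n (Q k) h)"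
  by (auto simp: dot_Q')

lemma dot_Q'_g: "k < n \<Longrightarrow> dot n (Q' k) g = (if k = i then 1 else 0)"
  using ci i by (simp add: dot_Q' flip: c)

lemma dual': "dual_bases n Q' P'"
  unfolding dual_bases_def
proof (intro allI impI)
  fix k j assume k: "k < n" and j: "j < n"
  show "dot n (Q' k) (P' j) = (if k = j then 1 else 0)"
  proof (cases "j = i")
    case True
    have "dot n (Q' k) (P' j) = dot n (Q' k) g" using P' j True by (intro dot_cong) auto
    then show ?thesis using dot_Q'_g[OF k] True by simp
  next
    case False
    have "dot n (Q' k) (P' j) = dot n (Q' k) (P j)" using P' j False by (intro dot_cong) auto
    then show ?thesis using dual_basesD[OF dual i j] dual_basesD[OF dual k j] False k by (simp add: dot_Q')
  qed
qed

text \<open>The subspace is cut out by the \<open>P k\<close> with \<open>k\<close> outside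
  \<open>S\<close>. If \<open>i\<close> is outside \<open>S\<close>, then by assumption so are all
  terms of \<open>g\<close>, among which \<open>P i\<close> has the nonzero coefficient
  \<open>c i\<close>; the new equations span the same space.\<close>

lemma coord_subspace_P':
  assumes "\<And>k. k < n \<Longrightarrow> c k \<noteq> 0 \<Longrightarrow> i \<notin> S \<Longrightarrow> k \<notin> S"
  shows "coord_subspace n P' S = coord_subspace n P S"
proof -
  have P'k: "dot n (P' k) h = (if k = i then dot n g h else dot n (P k) h)" if "k < n" for k h
    using P' that by (auto intro!: dot_cong)
  have g: "dot n g h = (\<Sum>k<n. c k * dot n (P k) h)" for h
  proof -
    have "dot n h g = dot n h (\<lambda>l. \<Sum>k<n. c k * P k l)"
      using dual_bases_expansion[OF dual, of _ g] c by (intro dot_cong) auto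
    also have "\<dots> = (\<Sum>k<n. c k * dot n h (P k))" by (simp add: dot_sum_right dot_mult_right)
    finally show ?thesis by (simp add: dot_commute)
  qed
  show ?thesis
  proof (cases "i \<in> S")
    case True
    then have "(\<forall>k<n. k \<notin> S \<longrightarrow> dot n (P' k) h = 0) \<longleftrightarrow> (\<forall>k<n. k \<notin> S \<longrightarrow> dot n (P k) h = 0)" for h
      using P'k by metis
    then show ?thesis by (simp add: coord_subspace_def)
  next
    case False
    have eq: "dot n g h = c i * dot n (P i) h" if "\<And>k. k < n \<Longrightarrow> k \<noteq> i \<Longrightarrow> k \<notin> S \<Longrightarrow> dot n (P k) h = 0" for h
    proof -
      have "dot n g h = (\<Sum>k<n. if k = i then c k * dot n (P k) h else 0)"
        unfolding g using assms False that by (intro sum.cong) auto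
      then show ?thesis using i by simp
    qed
    have "(\<forall>k<n. k \<notin> S \<longrightarrow> dot n (P' k) h = 0) \<longleftrightarrow> (\<forall>k<n. k \<notin> S \<longrightarrow> dot n (P k) h = 0)" for h
      using eq[of h] ci i False P'k by (metis mult_eq_0_iff)
    then show ?thesis by (simp add: coord_subspace_def)
  qed
qed

end

subsection \<open>Bases adapted to a flag\<close>

text \<open>\<open>st i\<close> is the first stage whose span contains \<open>P i\<close>, and \<open>m\<close> if there is none.\<close>

definition adapt_inv ::
  "nat \<Rightarrow> nat \<Rightarrow> (nat \<Rightarrow> nat \<Rightarrow> nat \<Rightarrow> 'k::field) \<Rightarrow> (nat \<times> nat) set \<Rightarrow> (nat \<Rightarrow> nat) \<Rightarrow>
    (nat \<Rightarrow> nat \<Rightarrow> 'k) \<Rightarrow> (nat \<Rightarrow> nat \<Rightarrow> 'k) \<Rightarrow> bool" where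
  "adapt_inv n m C Vis st P Q \<longleftrightarrow> dual_bases n Q P \<and> (\<forall>i<n. st i \<le> m) \<and>
    (\<forall>i<n. st i < m \<longrightarrow> (\<exists>j<n. \<forall>l<n. P i l = C (st i) j l)) \<and>
    (\<forall>t j k. (t, j) \<in> Vis \<longrightarrow> k < n \<longrightarrow> t < st k \<longrightarrow> dot n (Q k) (C t j) = 0)"

text \<open>An unassigned position at which the new generator has a nonzero coordinate takes it as
  basis vector. The generators in \<open>Vis\<close> have coordinate zero at unassigned positions,
  so the exchange leaves their other coordinates alone.\<close>

lemma adapt_step:
  assumes inv: "adapt_inv n m C Vis st P Q" and Vis: "\<And>t' j'. (t', j') \<in> Vis \<Longrightarrow> t' \<le> t" and t: "t < m" and j: "j < n"
    and ist: "i < n" "st i = m" and c: "\<And>k. k < n \<Longrightarrow> c k = dot n (Q k) (C t j)" and ci: "c i \<noteq> 0"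
    and Q': "\<And>k l. k < n \<Longrightarrow> l < n \<Longrightarrow> Q' k l = Q k l - (if k = i then c i - 1 else c k) * (Q i l / c i)"
    and P': "\<And>k l. k < n \<Longrightarrow> l < n \<Longrightarrow> P' k l = (if k = i then C t j l else P k l)"
    and st': "\<And>k. k < n \<Longrightarrow> st' k = (if k = i then t else st k)"
  shows "adapt_inv n m C Vis st' P' Q'" "k < n \<Longrightarrow> k \<noteq> i \<Longrightarrow> dot n (Q' k) (C t j) = 0"
proof -
  interpret exchange n Q P "C t j" c i Q' P'
    by standard (use inv assms in \<open>auto simp: adapt_inv_def\<close>)
  show "k < n \<Longrightarrow> k \<noteq> i \<Longrightarrow> dot n (Q' k) (C t j) = 0" using dot_Q'_g by simp
  have "dot n (Q' k) (C t' j') = 0" if v: "(t', j') \<in> Vis" "k < n" "t' < st' k" for t' j' k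
  proof -
    have "dot n (Q i) (C t' j') = 0" using inv v Vis[OF v(1)] t ist by (auto simp: adapt_inv_def)
    then have "dot n (Q' k) (C t' j') = (if k = i then 0 else dot n (Q k) (C t' j'))" using v(2) by (rule dot_Q'_zero)
    then show ?thesis using inv v st' by (auto simp: adapt_inv_def split: if_splits)
  qed
  moreover have "\<exists>j<n. \<forall>l<n. P' k l = C (st' k) j l" if k: "k < n" "st' k < m" for k
  proof (cases "k = i")
    case True
    then show ?thesis using P' st' j k by auto
  next
    case False
    then obtain j where "j < n" "\<forall>l<n. P k l = C (st k) j l" using inv st' k by (auto simp: adapt_inv_def)
    then show ?thesis using P' st' k False by auto
  qed
  ultimately show "adapt_inv n m C Vis st' P' Q'"
    unfolding adapt_inv_def using inv dual' st' t by (auto simp: adapt_inv_def)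
qed

text \<open>Visited generators have no coordinates at later stages, which gives one inclusion. For
  the other, each basis vector of stage at most \<open>t\<close> is itself a generator of a subspace
  of the chain contained in \<open>W t\<close>.\<close>

lemma adapted_image:
  assumes inv: "adapt_inv n m C {(t, j). t < m \<and> j < n} st P Q"
    and W: "\<And>t. t < m \<Longrightarrow> W t = {v \<in> carrier_vec n. \<exists>a. \<forall>l<n. v $ l = (\<Sum>j<n. a j * C t j l)}"
    and mono: "\<And>t u. t \<le> u \<Longrightarrow> u < m \<Longrightarrow> W t \<subseteq> W u" and t: "t < m"
  shows "W t = coord_subspace n Q {i. st i \<le> t}"
proof
  have dual: "dual_bases n Q P" using inv by (simp add: adapt_inv_def)
  show "W t \<subseteq> coord_subspace n Q {i. st i \<le> t}"
  proof
    fix v assume "v \<in> W t"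
    then obtain a where v: "v \<in> carrier_vec n" and a: "\<And>l. l < n \<Longrightarrow> v $ l = (\<Sum>j<n. a j * C t j l)"
      using W[OF t] by auto
    have "dot n (Q k) (($) v) = 0" if "k < n" "t < st k" for k
    proof -
      have "dot n (Q k) (($) v) = dot n (Q k) (\<lambda>l. \<Sum>j<n. a j * C t j l)" using a by (intro dot_cong) auto
      also have "\<dots> = (\<Sum>j<n. a j * dot n (Q k) (C t j))" by (simp add: dot_sum_right dot_mult_right)
      also have "\<dots> = 0" using inv that t by (intro sum.neutral) (auto simp: adapt_inv_def)
      finally show ?thesis .
    qed
    then show "v \<in> coord_subspace n Q {i. st i \<le> t}" using v by (auto simp: coord_subspace_def not_le)
  qed
  show "coord_subspace n Q {i. st i \<le> t} \<subseteq> W t"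
  proof
    fix v assume v: "v \<in> coord_subspace n Q {i. st i \<le> t}"
    have "\<exists>a. \<forall>l<n. P i l = (\<Sum>j<n. a j * C t j l)" if i: "i < n" "st i \<le> t" for i
    proof -
      obtain j where j: "j < n" "\<forall>l<n. P i l = C (st i) j l" using inv i t by (auto simp: adapt_inv_def)
      have "\<forall>l<n. P i l = (\<Sum>j'<n. (if j' = j then 1 else 0) * C (st i) j' l)"
        using j by (simp add: if_distrib[of "\<lambda>x. x * _"] cong: if_cong)
      then have "vec n (P i) \<in> W (st i)" using W[of "st i"] i t by auto
      then have "vec n (P i) \<in> W t" using mono[of "st i" t] i t by blast
      then show ?thesis using W[OF t] by auto
    qed
    then obtain a where a: "\<And>i l. i < n \<Longrightarrow> st i \<le> t \<Longrightarrow> l < n \<Longrightarrow> P i l = (\<Sum>j<n. a i j * C t j l)" by metis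
    let ?b = "\<lambda>j. \<Sum>i<n. dot n (Q i) (($) v) * a i j"
    have "v $ l = (\<Sum>j<n. ?b j * C t j l)" if l: "l < n" for l
    proof -
      have "v $ l = (\<Sum>i<n. dot n (Q i) (($) v) * P i l)" by (rule dual_bases_expansion[OF dual l])
      also have "\<dots> = (\<Sum>i<n. dot n (Q i) (($) v) * (\<Sum>j<n. a i j * C t j l))"
      proof (rule sum.cong, simp)
        fix i assume "i \<in> {..<n}"
        then show "dot n (Q i) (($) v) * P i l = dot n (Q i) (($) v) * (\<Sum>j<n. a i j * C t j l)"
          using v a[of i l] l by (cases "st i \<le> t") (auto simp: coord_subspace_def)
      qed
      also have "\<dots> = (\<Sum>i<n. \<Sum>j<n. dot n (Q i) (($) v) * a i j * C t j l)"
        by (simp add: sum_distrib_left mult.assoc)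
      also have "\<dots> = (\<Sum>j<n. ?b j * C t j l)" unfolding sum_distrib_right by (rule sum.swap)
      finally show ?thesis .
    qed
    then show "v \<in> W t" using W[OF t] v by (auto simp: coord_subspace_def)
  qed
qed

text \<open>Larger kernels satisfy fewer equations, so the row spaces ascend in the reversed
  numbering \<open>m - 1 - t\<close>. The adapted basis \<open>P\<close> of the row spaces plays the
  part of the coordinate functionals, whence \<open>P\<close> in place of \<open>Q\<close> and
  \<open>m - st i\<close> in place of \<open>st i\<close>.\<close>

lemma adapted_kernel:
  assumes inv: "adapt_inv n m C {(t, j). t < m \<and> j < n} st P Q"
    and W: "\<And>t. t < m \<Longrightarrow> W t = {v \<in> carrier_vec n. \<forall>j<n. dot n (C (m - 1 - t) j) (($) v) = 0}"
    and mono: "\<And>t u. t \<le> u \<Longrightarrow> u < m \<Longrightarrow> W t \<subseteq> W u" and t: "t < m"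
  shows "W t = coord_subspace n P {i. m - st i \<le> t}"
proof -
  have dual: "dual_bases n Q P" using inv by (simp add: adapt_inv_def)
  let ?t = "m - 1 - t"
  have st: "m - st i \<le> t \<longleftrightarrow> ?t < st i" if "i < n" for i using t by auto
  have "(\<forall>j<n. dot n (C ?t j) (($) v) = 0) \<longleftrightarrow> (\<forall>i<n. st i \<le> ?t \<longrightarrow> dot n (P i) (($) v) = 0)"
    if v: "v \<in> carrier_vec n" for v
  proof
    assume "\<forall>j<n. dot n (C ?t j) (($) v) = 0"
    then have vW: "v \<in> W t" using W[OF t] v by simp
    show "\<forall>i<n. st i \<le> ?t \<longrightarrow> dot n (P i) (($) v) = 0"
    proof (intro allI impI)
      fix i assume i: "i < n" "st i \<le> ?t"
      then obtain j where j: "j < n" "\<forall>l<n. P i l = C (st i) j l" using inv t by (auto simp: adapt_inv_def)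
      have le: "t \<le> m - 1 - st i" "m - 1 - st i < m" "m - 1 - (m - 1 - st i) = st i" using i t by auto
      have "v \<in> W (m - 1 - st i)" using mono[OF le(1,2)] vW by blast
      then have "dot n (C (st i) j) (($) v) = 0" using W[OF le(2)] le(3) j by auto
      then show "dot n (P i) (($) v) = 0" using dot_cong[of n "P i" "C (st i) j" "($) v" "($) v"] j by auto
    qed
  next
    assume z: "\<forall>i<n. st i \<le> ?t \<longrightarrow> dot n (P i) (($) v) = 0"
    show "\<forall>j<n. dot n (C ?t j) (($) v) = 0"
    proof (intro allI impI)
      fix j assume j: "j < n"
      have "dot n (($) v) (C ?t j) = dot n (($) v) (\<lambda>l. \<Sum>i<n. dot n (Q i) (C ?t j) * P i l)"
        using dual_bases_expansion[OF dual, of _ "C ?t j"] by (intro dot_cong) auto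
      also have "\<dots> = (\<Sum>i<n. dot n (Q i) (C ?t j) * dot n (($) v) (P i))"
        by (simp add: dot_sum_right dot_mult_right)
      also have "\<dots> = 0"
      proof (rule sum.neutral, rule ballI)
        fix i assume "i \<in> {..<n}"
        then show "dot n (Q i) (C ?t j) * dot n (($) v) (P i) = 0"
          using z inv j t by (cases "st i \<le> ?t") (auto simp: adapt_inv_def dot_commute not_le)
      qed
      finally show "dot n (C ?t j) (($) v) = 0" by (simp add: dot_commute)
    qed
  qed
  then show ?thesis unfolding W[OF t] coord_subspace_def using st by (auto simp: not_less)
qed

subsection \<open>Diagonalisation\<close>

definition app :: "nat \<Rightarrow> (nat \<Rightarrow> nat \<Rightarrow> 'k::field) \<Rightarrow> (nat \<Rightarrow> 'k) \<Rightarrow> nat \<Rightarrow> 'k" where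
  "app n A f l = (\<Sum>k<n. A l k * f k)"

lemma app_diff: "app n A (\<lambda>k. f k - c * g k) l = app n A f l - c * app n A g l"
  by (simp add: app_def algebra_simps sum_subtractf sum_distrib_left)

lemma app_cong: "(\<And>k. k < n \<Longrightarrow> f k = f' k) \<Longrightarrow> app n A f = app n A f'"
  by (rule ext) (simp add: app_def)

text \<open>\<open>D\<close> holds the processed columns. A nonzero \<open>used k\<close> marks a
  row whose functional \<open>U k\<close> is the image under \<open>A\<close> of the basis vector
  \<open>F (mt k)\<close>; every processed column is matched in this way or annihilated by
  \<open>A\<close>. Once \<open>D\<close> is everything, this is the partial permutation
  form.\<close>

definition diag_inv ::
  "nat \<Rightarrow> (nat \<Rightarrow> nat \<Rightarrow> 'k::field) \<Rightarrow> (nat \<Rightarrow> nat \<Rightarrow> 'k) \<Rightarrow> (nat \<Rightarrow> nat \<Rightarrow> 'k) \<Rightarrow> (nat \<Rightarrow> nat \<Rightarrow> 'k) \<Rightarrow> (nat \<Rightarrow> nat \<Rightarrow> 'k) \<Rightarrow>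
    (nat \<Rightarrow> nat) \<Rightarrow> (nat \<Rightarrow> nat) \<Rightarrow> nat set \<Rightarrow> bool" where
  "diag_inv n A U E V F used mt D \<longleftrightarrow> dual_bases n U E \<and> dual_bases n V F \<and> D \<subseteq> {..<n} \<and>
    (\<forall>k<n. used k \<noteq> 0 \<longrightarrow> mt k < n \<and> mt k \<in> D \<and> (\<forall>l<n. app n A (F (mt k)) l = U k l)) \<and>
    (\<forall>j\<in>D. (\<exists>k<n. used k \<noteq> 0 \<and> mt k = j) \<or> (\<forall>l<n. app n A (F j) l = 0))"

lemma dot_used:
  assumes "diag_inv n A U E V F used mt D" "k < n" "used k \<noteq> 0" "i < n"
  shows "dot n (E i) (app n A (F (mt k))) = (if i = k then 1 else 0)"
proof -
  have "dot n (E i) (app n A (F (mt k))) = dot n (E i) (U k)"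
    using assms by (intro dot_cong) (auto simp: diag_inv_def)
  also have "\<dots> = (if i = k then 1 else 0)"
    using assms dual_basesD[OF dual_bases_swap, of n U E] by (auto simp: diag_inv_def)
  finally show ?thesis .
qed

text \<open>The image of \<open>F (mt k)\<close> is \<open>U k\<close>, so subtracting a multiple of
  it from \<open>F j\<close> changes the coordinate of the image at \<open>k\<close> only;
  \<open>V\<close> is changed dually. A coordinate subspace is kept if it contains
  \<open>F (mt k)\<close> whenever it contains \<open>F j\<close>.\<close>

lemma clear_step:
  assumes inv: "diag_inv n A U E V F used mt D" and j: "j < n" "j \<notin> D" and k: "k < n" "used k \<noteq> 0"
    and c: "c = dot n (E k) (app n A (F j))"
    and F': "\<And>i l. i < n \<Longrightarrow> l < n \<Longrightarrow> F' i l = (if i = j then F j l - c * F (mt k) l else F i l)"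
    and V': "\<And>i l. i < n \<Longrightarrow> l < n \<Longrightarrow> V' i l = (if i = mt k then V (mt k) l + c * V j l else V i l)"
  shows "diag_inv n A U E V' F' used mt D"
    and "\<And>i. i < n \<Longrightarrow> dot n (E i) (app n A (F' j)) = dot n (E i) (app n A (F j)) - c * (if i = k then 1 else 0)"
    and "\<And>S. (j \<in> S \<Longrightarrow> mt k \<in> S) \<Longrightarrow> coord_subspace n V' S = coord_subspace n V S"
proof -
  let ?p = "mt k"
  have p: "?p < n" "?p \<noteq> j" using inv j k by (auto simp: diag_inv_def)
  have dual: "dual_bases n V F" using inv by (simp add: diag_inv_def)
  have V'dot: "dot n (V' i) h = (if i = ?p then dot n (V ?p) h + c * dot n (V j) h else dot n (V i) h)" if "i < n" for i h
  proof (cases "i = ?p")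
    case True
    then have "dot n (V' i) h = dot n (\<lambda>l. V ?p l + c * V j l) h" using V' that by (intro dot_cong) auto
    then show ?thesis using True by (simp add: dot_add_left dot_mult_left)
  next
    case False
    then show ?thesis using V' that by (auto intro!: dot_cong)
  qed
  have F'dot: "dot n h (F' i) = (if i = j then dot n h (F j) - c * dot n h (F ?p) else dot n h (F i))" if "i < n" for i h
  proof (cases "i = j")
    case True
    then have "dot n h (F' i) = dot n h (\<lambda>l. F j l - c * F ?p l)" using F' that by (intro dot_cong) auto
    then show ?thesis using True by (simp add: dot_diff_right dot_mult_right)
  next
    case False
    then show ?thesis using F' that by (auto intro!: dot_cong)
  qed
  have dual': "dual_bases n V' F'"
    unfolding dual_bases_def
    using p j by (auto simp: V'dot F'dot dual_basesD[OF dual])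
  have app_same: "app n A (F' i) = app n A (F i)" if "i < n" "i \<noteq> j" for i
    using F' that by (intro app_cong) auto
  have app_j: "app n A (F' j) l = app n A (F j) l - c * app n A (F ?p) l" for l
  proof -
    have "app n A (F' j) = app n A (\<lambda>l. F j l - c * F ?p l)" using F' j by (intro app_cong) auto
    then show ?thesis by (simp add: app_diff)
  qed
  have same: "app n A (F' i) = app n A (F i)" if "i \<in> D" for i
    using inv that j app_same by (auto simp: diag_inv_def)
  show "diag_inv n A U E V' F' used mt D"
    using inv dual' same by (auto simp: diag_inv_def)
  show "dot n (E i) (app n A (F' j)) = dot n (E i) (app n A (F j)) - c * (if i = k then 1 else 0)" if "i < n" for i
    using dot_used[OF inv k that]
    by (simp add: app_j[abs_def] dot_diff_right dot_mult_right)
  show "coord_subspace n V' S = coord_subspace n V S" if S: "j \<in> S \<Longrightarrow> mt k \<in> S" for S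
  proof -
    have "(\<forall>i<n. i \<notin> S \<longrightarrow> dot n (V' i) h = 0) \<longleftrightarrow> (\<forall>i<n. i \<notin> S \<longrightarrow> dot n (V i) h = 0)" for h
    proof (cases "mt k \<in> S")
      case True
      then show ?thesis using V'dot by metis
    next
      case False
      then have "j \<notin> S" using S by blast
      then show ?thesis using V'dot p j(1) by (metis add.right_neutral mult_zero_right)
    qed
    then show ?thesis by (simp add: coord_subspace_def)
  qed
qed

text \<open>The functional \<open>U i\<close> is replaced by the image of \<open>F j\<close> under
  \<open>A\<close>. Subspaces are cut out by functionals with positions outside \<open>S\<close>, so
  one is kept if \<open>i\<close> outside \<open>S\<close> forces all functionals occurring in that
  image outside as well: for a flag, \<open>i\<close> must have the earliest stage among
  them.\<close>

lemma match_step: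
  assumes inv: "diag_inv n A U E V F used mt D" and jD: "j < n" "j \<notin> D" and ij: "i < n" "used i = 0"
    and c: "\<And>k. k < n \<Longrightarrow> c k = dot n (E k) (app n A (F j))" and ci: "c i \<noteq> 0"
    and used_c: "\<And>k. k < n \<Longrightarrow> used k \<noteq> 0 \<Longrightarrow> c k = 0"
    and E': "\<And>k l. k < n \<Longrightarrow> l < n \<Longrightarrow> E' k l = E k l - (if k = i then c i - 1 else c k) * (E i l / c i)"
    and U': "\<And>k l. k < n \<Longrightarrow> l < n \<Longrightarrow> U' k l = (if k = i then app n A (F j) l else U k l)"
    and used': "\<And>k. k < n \<Longrightarrow> used' k = (if k = i then 1 else used k)"
    and mt': "\<And>k. k < n \<Longrightarrow> mt' k = (if k = i then j else mt k)"
  shows "diag_inv n A U' E' V F used' mt' (insert j D)"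
    and "\<And>S. (\<And>k. k < n \<Longrightarrow> c k \<noteq> 0 \<Longrightarrow> k \<in> S \<Longrightarrow> i \<in> S) \<Longrightarrow> coord_subspace n U' S = coord_subspace n U S"
proof -
  have dual: "dual_bases n E U" using inv dual_bases_swap by (auto simp: diag_inv_def)
  interpret exchange n E U "app n A (F j)" c i E' U'
    by standard (use dual ij c ci E' U' in auto)
  show "coord_subspace n U' S = coord_subspace n U S" if "\<And>k. k < n \<Longrightarrow> c k \<noteq> 0 \<Longrightarrow> k \<in> S \<Longrightarrow> i \<in> S" for S
    using that by (intro coord_subspace_P') blast
  have "mt' k < n \<and> mt' k \<in> insert j D \<and> (\<forall>l<n. app n A (F (mt' k)) l = U' k l)" if "k < n" "used' k \<noteq> 0" for k
    using that inv U' used' mt' jD by (cases "k = i") (auto simp: diag_inv_def)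
  moreover have "(\<exists>k<n. used' k \<noteq> 0 \<and> mt' k = d) \<or> (\<forall>l<n. app n A (F d) l = 0)" if d: "d \<in> insert j D" for d
  proof (cases "d = j")
    case True
    then show ?thesis using used'[OF ij(1)] mt'[OF ij(1)] ij by (intro disjI1 exI[of _ i]) auto
  next
    case False
    then have "(\<exists>k<n. used k \<noteq> 0 \<and> mt k = d) \<or> (\<forall>l<n. app n A (F d) l = 0)" using d inv by (auto simp: diag_inv_def)
    then show ?thesis
    proof
      assume "\<exists>k<n. used k \<noteq> 0 \<and> mt k = d"
      then obtain k where k: "k < n" "used k \<noteq> 0" "mt k = d" by blast
      then have "k \<noteq> i" using ij by auto
      then show ?thesis using k used'[OF k(1)] mt'[OF k(1)] by auto
    qed simp
  qed
  ultimately show "diag_inv n A U' E' V F used' mt' (insert j D)"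
    using inv jD dual_bases_swap[OF dual'] by (auto simp: diag_inv_def)
qed

lemma unmatched_step:
  assumes inv: "diag_inv n A U E V F used mt D" and j: "j < n"
    and z: "\<And>k. k < n \<Longrightarrow> dot n (E k) (app n A (F j)) = 0"
  shows "diag_inv n A U E V F used mt (insert j D)"
proof -
  have dual: "dual_bases n E U" using inv dual_bases_swap by (auto simp: diag_inv_def)
  have "app n A (F j) l = 0" if "l < n" for l
    using dual_bases_expansion[OF dual that, of "app n A (F j)"] z by simp
  then show ?thesis using inv j by (auto simp: diag_inv_def)
qed

lemma diag_inv_mt_inj:
  assumes "diag_inv n A U E V F used mt D" "i < n" "used i \<noteq> 0" "k < n" "used k \<noteq> 0" "mt i = mt k"
  shows "i = k"
  using dot_used[OF assms(1-3) assms(2)] dot_used[OF assms(1,4,5,2)] assms(6) by (auto split: if_splits)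

text \<open>The matching is injective on used rows, and the complements have equal cardinality, so
  it extends to a permutation in some way. Expanding \<open>w\<close> in the basis \<open>F\<close>
  leaves only matched columns, the others being annihilated.\<close>

lemma diagonalisationI:
  fixes A :: "'k::field mat"
  assumes A: "A \<in> carrier_mat n n" and B: "\<And>l k. l < n \<Longrightarrow> k < n \<Longrightarrow> B l k = A $$ (l, k)"
    and inv: "diag_inv n B U E V F used mt {..<n}"
  obtains \<mu> where "diagonalisation n A U E V F {i. i < n \<and> used i \<noteq> 0} \<mu>"
    "\<And>i. i < n \<Longrightarrow> used i \<noteq> 0 \<Longrightarrow> \<mu> i = mt i"
proof -
  let ?I = "{i. i < n \<and> used i \<noteq> 0}"
  have inj: "inj_on mt ?I" using diag_inv_mt_inj[OF inv] by (auto simp: inj_on_def)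
  have img: "mt ` ?I \<subseteq> {..<n}" using inv by (auto simp: diag_inv_def)
  have "card ({..<n} - ?I) = card ({..<n} - mt ` ?I)"
    using card_image[OF inj] img by (subst (1 2) card_Diff_subset) (auto intro: finite_subset)
  then obtain f where f: "bij_betw f ({..<n} - ?I) ({..<n} - mt ` ?I)"
    using finite_same_card_bij[of "{..<n} - ?I" "{..<n} - mt ` ?I"] by auto
  define \<mu> where "\<mu> i = (if i \<in> ?I then mt i else f i)" for i
  have "bij_betw \<mu> ?I (mt ` ?I)"
    using inj by (auto simp: bij_betw_def \<mu>_def inj_on_def)
  moreover have "bij_betw \<mu> ({..<n} - ?I) ({..<n} - mt ` ?I)"
    using f by (subst bij_betw_cong[of _ _ f]) (auto simp: \<mu>_def)
  ultimately have "bij_betw \<mu> (?I \<union> ({..<n} - ?I)) (mt ` ?I \<union> ({..<n} - mt ` ?I))"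
    by (rule bij_betw_combine) auto
  moreover have "?I \<union> ({..<n} - ?I) = {..<n}" "mt ` ?I \<union> ({..<n} - mt ` ?I) = {..<n}" using img by auto
  ultimately have \<mu>: "bij_betw \<mu> {..<n} {..<n}" by simp
  have dual: "dual_bases n U E" "dual_bases n V F" using inv by (auto simp: diag_inv_def)
  have "v \<bullet> (A *\<^sub>v w) = (\<Sum>i\<in>?I. dot n (U i) (($) v) * dot n (V (\<mu> i)) (($) w))"
    if v: "v \<in> carrier_vec n" and w: "w \<in> carrier_vec n" for v w
  proof -
    have "(A *\<^sub>v w) $ l = (\<Sum>i\<in>?I. dot n (V (\<mu> i)) (($) w) * U i l)" if l: "l < n" for l
    proof -
      have "(A *\<^sub>v w) $ l = (\<Sum>k<n. B l k * w $ k)"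
        using A w l B by (simp add: scalar_prod_def atLeast0LessThan)
      also have "\<dots> = (\<Sum>k<n. \<Sum>j<n. dot n (V j) (($) w) * (B l k * F j k))"
      proof (rule sum.cong, simp)
        fix k assume "k \<in> {..<n}"
        then have "w $ k = (\<Sum>j<n. dot n (V j) (($) w) * F j k)" using dual_bases_expansion[OF dual(2), of k "($) w"] by simp
        then have "B l k * w $ k = B l k * (\<Sum>j<n. dot n (V j) (($) w) * F j k)" by (rule arg_cong)
        then show "B l k * w $ k = (\<Sum>j<n. dot n (V j) (($) w) * (B l k * F j k))"
          unfolding sum_distrib_left by (simp only: mult.left_commute)
      qed
      also have "\<dots> = (\<Sum>j<n. dot n (V j) (($) w) * app n B (F j) l)"
        unfolding app_def sum_distrib_left by (rule sum.swap)
      also have "\<dots> = (\<Sum>j\<in>mt ` ?I. dot n (V j) (($) w) * app n B (F j) l)"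
      proof (rule sum.mono_neutral_right)
        show "\<forall>j\<in>{..<n} - mt ` ?I. dot n (V j) (($) w) * app n B (F j) l = 0"
        proof
          fix j assume j: "j \<in> {..<n} - mt ` ?I"
          then have "(\<exists>k<n. used k \<noteq> 0 \<and> mt k = j) \<or> (\<forall>l<n. app n B (F j) l = 0)"
            using inv unfolding diag_inv_def by (elim conjE) simp
          moreover have "\<not> (\<exists>k<n. used k \<noteq> 0 \<and> mt k = j)" using j by auto
          ultimately have "app n B (F j) l = 0" using l by blast
          then show "dot n (V j) (($) w) * app n B (F j) l = 0" by simp
        qed
      qed (use img in auto)
      also have "\<dots> = (\<Sum>i\<in>?I. dot n (V (mt i)) (($) w) * app n B (F (mt i)) l)"
        by (rule sum.reindex_cong[OF inj]) auto
      also have "\<dots> = (\<Sum>i\<in>?I. dot n (V (\<mu> i)) (($) w) * U i l)"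
        using inv l by (intro sum.cong) (auto simp: \<mu>_def diag_inv_def)
      finally show ?thesis .
    qed
    then have "v \<bullet> (A *\<^sub>v w) = dot n (($) v) (\<lambda>l. \<Sum>i\<in>?I. dot n (V (\<mu> i)) (($) w) * U i l)"
      using A by (auto simp: scalar_prod_def dot_def atLeast0LessThan intro!: sum.cong)
    then show ?thesis
      unfolding dot_sum_right dot_mult_right by (simp only: dot_commute[of n "($) v"] mult.commute)
  qed
  then have "diagonalisation n A U E V F ?I \<mu>"
    by unfold_locales (use A dual \<mu> in auto)
  then show thesis using that by (simp add: \<mu>_def)
qed

section \<open>The program\<close>

abbreviation iv :: "string \<Rightarrow> iexp" where
  "iv v \<equiv> IRead v []"

definition matvec :: "string \<Rightarrow> string \<Rightarrow> string \<Rightarrow> fprog" where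
  "matvec out M x = FFor ''u'' 0 (FK out [iv ''u''] KZero ;;
     FFor ''w'' 0 (FK out [iv ''u''] (KAdd (KRead out [iv ''u''])
       (KMul (KRead M [iv ''u'', iv ''w'']) (KRead x [iv ''w''])))))"

definition copyvec :: "string \<Rightarrow> string \<Rightarrow> iexp list \<Rightarrow> fprog" where
  "copyvec out src es = FFor ''u'' 0 (FK out [iv ''u''] (KRead src (es @ [iv ''u''])))"

text \<open>Row \<open>i\<close> of \<open>Q\<close>, divided by the pivot, is saved in
  \<open>q\<close> before rows are overwritten. Lowering \<open>c i\<close> by \<open>1\<close> lets
  row \<open>i\<close> obey the same update as the others: removing \<open>(c i - 1) / c i\<close>
  of it leaves the row divided by \<open>c i\<close>.\<close>

definition exchange_prog :: "string \<Rightarrow> string \<Rightarrow> fprog" where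
  "exchange_prog P Q =
     FFor ''u'' 0 (FK ''q'' [iv ''u''] (KDiv (KRead Q [iv ''i'', iv ''u'']) (KRead ''c'' [iv ''i'']))) ;;
     FK ''c'' [iv ''i''] (KSub (KRead ''c'' [iv ''i'']) KOne) ;;
     FFor ''u'' 0 (FFor ''w'' 0 (FK Q [iv ''u'', iv ''w''] (KSub (KRead Q [iv ''u'', iv ''w''])
       (KMul (KRead ''c'' [iv ''u'']) (KRead ''q'' [iv ''w'']))))) ;;
     FFor ''u'' 0 (FK P [iv ''i'', iv ''u''] (KRead ''g'' [iv ''u'']))"

lemma writes_matvec [simp]:
  "iwrites (matvec out M x) = {''u'', ''w''}" "kwrites (matvec out M x) = {out}" "cwrites (matvec out M x) = {}"
  "wf_prog (matvec out M x)"
  by (auto simp: matvec_def)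

lemma writes_copyvec [simp]:
  "iwrites (copyvec out src es) = {''u''}" "kwrites (copyvec out src es) = {out}" "cwrites (copyvec out src es) = {}"
  "wf_prog (copyvec out src es)"
  by (auto simp: copyvec_def)

lemma writes_exchange_prog [simp]:
  "iwrites (exchange_prog P Q) = {''u'', ''w''}" "kwrites (exchange_prog P Q) = {''q'', ''c'', P, Q}"
  "cwrites (exchange_prog P Q) = {}" "wf_prog (exchange_prog P Q)"
  by (auto simp: exchange_prog_def)

lemmas sem_frame = sem_frame_i sem_frame_k sem_frame_c

lemma sem_matvec:
  assumes n: "imem s ''n'' [] = n" and ne: "out \<noteq> M" "out \<noteq> x" and k: "k < n"
  shows "kmem (sem (matvec out M x) s) out [k] = dot n (\<lambda>l. kmem s M [k, l]) (\<lambda>l. kmem s x [l])"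
proof -
  let ?in = "FFor ''w'' 0 (FK out [iv ''u''] (KAdd (KRead out [iv ''u''])
       (KMul (KRead M [iv ''u'', iv ''w'']) (KRead x [iv ''w'']))))"
  have inner: "kmem (sem ?in s) out = (kmem s out)([u] := kmem s out [u] + dot n (\<lambda>l. kmem s M [u, l]) (\<lambda>l. kmem s x [l]))"
    if n: "imem s ''n'' [] = n" and u: "imem s ''u'' [] = u" for s u
  proof -
    have "kmem (sem ?in s) out = (kmem s out)([u] := kmem s out [u] + (\<Sum>l<n + 0. kmem s M [u, l] * kmem s x [l]))"
    proof (rule sem_for[OF n, where Q = "\<lambda>i s'. kmem s' out = (kmem s out)([u] := kmem s out [u] + (\<Sum>l<i. kmem s M [u, l] * kmem s x [l]))"])
      fix i s' assume "imem s' ''w'' [] = i" and fr: "frame ?in s s'"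
        and Q: "kmem s' out = (kmem s out)([u] := kmem s out [u] + (\<Sum>l<i. kmem s M [u, l] * kmem s x [l]))"
      then show "kmem (seti ''w'' (Suc i) (sem (FK out [iv ''u''] (KAdd (KRead out [iv ''u''])
          (KMul (KRead M [iv ''u'', iv ''w'']) (KRead x [iv ''w''])))) s')) out =
          (kmem s out)([u] := kmem s out [u] + (\<Sum>l<Suc i. kmem s M [u, l] * kmem s x [l]))"
        using ne u by (simp add: store_apply frameD[OF fr] algebra_simps)
    qed simp
    then show ?thesis by (simp add: dot_def)
  qed
  have "kmem (sem (matvec out M x) s) out [k] =
    (if \<exists>i<n + 0. [k] \<in> {[i]} then dot n (\<lambda>l. kmem s M [hd [k], l]) (\<lambda>l. kmem s x [l]) else kmem s out [k])"
    unfolding matvec_def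
  proof (rule sem_for_block[OF n, where sel = "\<lambda>s. kmem s out"])
    fix i s' js
    assume "imem s' ''u'' [] = i" and fr: "frame (FFor ''u'' 0 (FK out [iv ''u''] KZero ;; ?in)) s s'"
    then show "kmem (sem (FK out [iv ''u''] KZero ;; ?in) s') out js =
        (if js \<in> {[i]} then dot n (\<lambda>l. kmem s M [hd js, l]) (\<lambda>l. kmem s x [l]) else kmem s' out js)"
      using ne n by (simp add: inner[of _ i] store_apply frameD[OF fr] del: sem.simps(7))
  qed simp
  then show ?thesis using k by simp
qed

lemma sem_copyvec:
  assumes n: "imem s ''n'' [] = n" and ne: "out \<noteq> src" and k: "k < n"
    and es: "\<And>s'. frame (copyvec out src es) s s' \<Longrightarrow> map (ival s') es = idx"
  shows "kmem (sem (copyvec out src es) s) out [k] = kmem s src (idx @ [k])"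
proof -
  have "kmem (sem (copyvec out src es) s) out [k] =
    (if \<exists>i<n + 0. [k] \<in> {[i]} then kmem s src (idx @ [k]) else kmem s out [k])"
    unfolding copyvec_def
  proof (rule sem_for_block[OF n, where sel = "\<lambda>s. kmem s out" and val = "\<lambda>js. kmem s src (idx @ js)"])
    fix i s' js
    assume "imem s' ''u'' [] = i" and fr: "frame (FFor ''u'' 0 (FK out [iv ''u''] (KRead src (es @ [iv ''u''])))) s s'"
    then show "kmem (sem (FK out [iv ''u''] (KRead src (es @ [iv ''u'']))) s') out js =
        (if js \<in> {[i]} then kmem s src (idx @ js) else kmem s' out js)"
      using ne es[of s'] by (simp add: store_apply frameD[OF fr] copyvec_def)
  qed simp
  then show ?thesis using k by simp
qed

lemma sem_exchange_prog:
  fixes s :: "'k::field state"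
  assumes n: "imem s ''n'' [] = n" and i: "imem s ''i'' [] = i" "i < n"
    and ne: "P \<noteq> Q" "P \<notin> {''q'', ''c'', ''g''}" "Q \<notin> {''q'', ''c'', ''g''}" and kl: "k < n" "l < n"
  defines "s' \<equiv> sem (exchange_prog P Q) s"
  shows "kmem s' Q [k, l] = kmem s Q [k, l] -
      (if k = i then kmem s ''c'' [i] - 1 else kmem s ''c'' [k]) * (kmem s Q [i, l] / kmem s ''c'' [i])"
    and "kmem s' P [k, l] = (if k = i then kmem s ''g'' [l] else kmem s P [k, l])"
proof -
  let ?p1 = "FFor ''u'' 0 (FK ''q'' [iv ''u''] (KDiv (KRead Q [iv ''i'', iv ''u'']) (KRead ''c'' [iv ''i''])))"
  let ?p2 = "FK ''c'' [iv ''i''] (KSub (KRead ''c'' [iv ''i'']) KOne)"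
  let ?p4 = "FFor ''w'' 0 (FK Q [iv ''u'', iv ''w''] (KSub (KRead Q [iv ''u'', iv ''w''])
       (KMul (KRead ''c'' [iv ''u'']) (KRead ''q'' [iv ''w'']))))"
  let ?p3 = "FFor ''u'' 0 ?p4"
  let ?p5 = "FFor ''u'' 0 (FK P [iv ''i'', iv ''u''] (KRead ''g'' [iv ''u'']))"
  define s1 s2 s3 where "s1 = sem ?p1 s" and "s2 = sem ?p2 s1" and "s3 = sem ?p3 s2"
  have s': "s' = sem ?p5 s3" by (simp add: s'_def exchange_prog_def s1_def s2_def s3_def)
  note fr1 = sem_frame[of _ ?p1 s, folded s1_def] and fr2 = sem_frame[of _ ?p2 s1, folded s2_def]
    and fr3 = sem_frame[of _ ?p3 s2, folded s3_def] and fr5 = sem_frame[of _ ?p5 s3, folded s']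
  have q: "kmem s1 ''q'' [l] = kmem s Q [i, l] / kmem s ''c'' [i]" if "l < n" for l
  proof -
    have "kmem s1 ''q'' [l] = (if \<exists>i<n + 0. [l] \<in> {[i]} then kmem s Q [i, hd [l]] / kmem s ''c'' [i] else kmem s ''q'' [l])"
      unfolding s1_def
      by (rule sem_for_block[OF n, where sel = "\<lambda>s. kmem s ''q''"])
        (use ne i in \<open>auto simp: store_apply frameD\<close>)
    then show ?thesis using that by simp
  qed
  have c: "kmem s2 ''c'' [k] = (if k = i then kmem s ''c'' [i] - 1 else kmem s ''c'' [k])" for k
    using i by (simp add: s2_def store_apply fr1)
  have q2: "kmem s2 ''q'' = kmem s1 ''q''" using fr2 by simp
  have Q2: "kmem s2 Q = kmem s Q" using fr2 fr1 ne by simp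
  have n2: "imem s2 ''n'' [] = n" using fr2 fr1 n by simp
  have inner: "kmem (sem ?p4 r) Q js = (if \<exists>w<n + 0. js \<in> {[u, w]}
      then kmem r Q js - kmem r ''c'' [u] * kmem r ''q'' [js ! 1] else kmem r Q js)"
    if "imem r ''n'' [] = n" "imem r ''u'' [] = u" for r :: "'k state" and u js
    by (rule sem_for_block[OF that(1), where sel = "\<lambda>s. kmem s Q"])
      (use ne that(2) in \<open>auto simp: store_apply frameD\<close>)
  have "kmem s3 Q [k, l] = (if \<exists>u<n + 0. [k, l] \<in> {[u, w] | w. w < n}
      then kmem s2 Q [k, l] - kmem s2 ''c'' [[k, l] ! 0] * kmem s2 ''q'' [[k, l] ! 1] else kmem s2 Q [k, l])"
    unfolding s3_def
  proof (rule sem_for_block[OF n2, where sel = "\<lambda>s. kmem s Q" and val = "\<lambda>js. kmem s2 Q js - kmem s2 ''c'' [js ! 0] * kmem s2 ''q'' [js ! 1]"])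
    fix u r js assume r: "imem r ''u'' [] = u" "frame ?p3 s2 r"
      and same: "\<And>js. (\<And>j. j < u \<Longrightarrow> js \<notin> {[j, w] | w. w < n}) \<Longrightarrow> kmem r Q js = kmem s2 Q js"
    have "kmem r Q [u, w] = kmem s2 Q [u, w]" for w by (rule same) auto
    then show "kmem (sem ?p4 r) Q js = (if js \<in> {[u, w] | w. w < n}
        then kmem s2 Q js - kmem s2 ''c'' [js ! 0] * kmem s2 ''q'' [js ! 1] else kmem r Q js)"
      using inner[of r u js] r n2 ne by (auto simp: frameD)
  qed simp
  then have Q3: "kmem s3 Q [k, l] = kmem s2 Q [k, l] - kmem s2 ''c'' [k] * kmem s2 ''q'' [l]" using kl by simp
  then show "kmem s' Q [k, l] = kmem s Q [k, l] -
      (if k = i then kmem s ''c'' [i] - 1 else kmem s ''c'' [k]) * (kmem s Q [i, l] / kmem s ''c'' [i])"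
    using fr5 ne c q[OF kl(2)] by (simp add: q2 Q2)
  have n3: "imem s3 ''n'' [] = n" "imem s3 ''i'' [] = i" using fr3 fr2 fr1 n i by simp_all
  have "kmem s' P [k, l] = (if \<exists>u<n + 0. [k, l] \<in> {[i, u]} then kmem s3 ''g'' [[k, l] ! 1] else kmem s3 P [k, l])"
    unfolding s'
    by (rule sem_for_block[OF n3(1), where sel = "\<lambda>s. kmem s P"])
      (use ne n3 in \<open>auto simp: store_apply frameD\<close>)
  moreover have "kmem s3 ''g'' = kmem s ''g''" "kmem s3 P = kmem s P"
    using fr3(2)[of "''g''"] fr2(2)[of "''g''"] fr1(2)[of "''g''"] fr3(2)[of P] fr2(2)[of P] fr1(2)[of P] ne by auto
  ultimately show "kmem s' P [k, l] = (if k = i then kmem s ''g'' [l] else kmem s P [k, l])"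
    using kl by auto
qed

section \<open>Nested counted loops\<close>

fun nest :: "(string \<times> nat) list \<Rightarrow> fprog \<Rightarrow> fprog" where
  "nest [] p = p"
| "nest ((v, k) # vs) p = FFor v k (nest vs p)"

lemma writes_nest [simp]:
  "iwrites (nest vs p) = fst ` set vs \<union> iwrites p" "kwrites (nest vs p) = kwrites p" "cwrites (nest vs p) = cwrites p"
  by (induction vs) force+

text \<open>All rounds prescribe the same value \<open>val x\<close> at a cell, so blocks may
  overlap and the order of the rounds is immaterial.\<close>

lemma sem_nest:
  fixes sel :: "'k::field state \<Rightarrow> nat list \<Rightarrow> 'v"
  assumes "imem s ''n'' [] = n" "\<And>v x s. v \<in> fst ` set vs \<Longrightarrow> sel (seti v x s) = sel s"
    and "wf_prog (nest vs p)" "''n'' \<notin> fst ` set vs \<union> iwrites p"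
    and "\<And>js r x. list_all2 (\<lambda>vk j. j < n + snd vk) vs js \<Longrightarrow> frame (nest vs p) s r \<Longrightarrow>
      map (\<lambda>vk. imem r (fst vk) []) vs = js \<Longrightarrow>
      sel (sem p r) x = (if x \<in> Bl js then val x else sel r x)"
  shows "sel (sem (nest vs p) s) x = (if \<exists>js. list_all2 (\<lambda>vk j. j < n + snd vk) vs js \<and> x \<in> Bl js then val x else sel s x)"
  using assms
proof (induction vs arbitrary: s Bl x)
  case Nil
  then show ?case by (simp add: frame_def)
next
  case (Cons vk vs)
  obtain v k where vk: "vk = (v, k)" by (cases vk)
  let ?B = "\<lambda>i. {x. \<exists>js. list_all2 (\<lambda>vk j. j < n + snd vk) vs js \<and> x \<in> Bl (i # js)}"
  have "sel (sem (FFor v k (nest vs p)) s) x = (if \<exists>i<n + k. x \<in> ?B i then val x else sel s x)"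
  proof (rule sem_for_block[OF Cons.prems(1)])
    fix i r y assume i: "i < n + k" and ri: "imem r v [] = i" and fr: "frame (FFor v k (nest vs p)) s r"
    have "sel (sem (nest vs p) r) y = (if \<exists>js. list_all2 (\<lambda>vk j. j < n + snd vk) vs js \<and> y \<in> Bl (i # js) then val y else sel r y)"
    proof (rule Cons.IH[where Bl = "\<lambda>js. Bl (i # js)"])
      show "imem r ''n'' [] = n" using fr Cons.prems(1,4) vk by (simp add: frameD)
      fix js r' x
      assume js: "list_all2 (\<lambda>vk j. j < n + snd vk) vs js" "frame (nest vs p) r r'" "map (\<lambda>vk. imem r' (fst vk) []) vs = js"
      have "imem r' v [] = i" using js(2) Cons.prems(3) ri vk by (simp add: frameD)
      moreover have "frame (nest (vk # vs) p) s r'"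
        using fr js(2) vk by (auto simp: frame_def)
      ultimately show "sel (sem p r') x = (if x \<in> Bl (i # js) then val x else sel r' x)"
        using Cons.prems(5)[of "i # js" r' x] js i vk by simp
    qed (use Cons.prems vk in auto)
    then show "sel (sem (nest vs p) r) y = (if y \<in> ?B i then val y else sel r y)" by simp
  qed (use Cons.prems vk in auto)
  moreover have "(\<exists>i<n + k. x \<in> ?B i) \<longleftrightarrow> (\<exists>js. list_all2 (\<lambda>vk j. j < n + snd vk) (vk # vs) js \<and> x \<in> Bl js)"
    unfolding list_all2_Cons1 vk by auto
  ultimately show ?case using vk by simp
qed

lemma list_all2_1: "list_all2 Q [a] js \<longleftrightarrow> (\<exists>x. js = [x] \<and> Q a x)"
  and list_all2_2: "list_all2 Q [a, b] js \<longleftrightarrow> (\<exists>x y. js = [x, y] \<and> Q a x \<and> Q b y)"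
  and list_all2_3: "list_all2 Q [a, b, c] js \<longleftrightarrow> (\<exists>x y z. js = [x, y, z] \<and> Q a x \<and> Q b y \<and> Q c z)"
  by (auto simp: list_all2_Cons1)

definition ieq :: "iexp \<Rightarrow> iexp \<Rightarrow> bexp" where
  "ieq d e = BAnd (BNot (ILess d e)) (BNot (ILess e d))"

lemma bval_ieq [simp]: "bval s (ieq d e) \<longleftrightarrow> ival s d = ival s e"
  by (auto simp: ieq_def)

subsection \<open>Flags to adapted bases\<close>

text \<open>Chains of the second lattice are stored with decreasing subspaces; reading them
  backwards makes both sides ascend by inclusion.\<close>

definition chain_index :: "bool \<Rightarrow> nat \<Rightarrow> nat \<Rightarrow> nat" where
  "chain_index rv m t = (if rv then m - 1 - t else t)"

definition chain_index_exp :: "bool \<Rightarrow> iexp" where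
  "chain_index_exp rv = (if rv then ISub (ISub (iv ''m'') (INum 1)) (iv ''t'') else iv ''t'')"

lemma ival_chain_index [simp]: "ival s (chain_index_exp rv) = chain_index rv (imem s ''m'' []) (imem s ''t'' [])"
  by (simp add: chain_index_exp_def chain_index_def)

text \<open>\<open>C\<close> receives generators of an ascending flag: columns for images, rows for
  kernels. Row spaces descend as kernels ascend, so kernels are read in the opposite direction. The
  \<open>n + 1\<close> slots are the greatest length of a chain; surplus slots are skipped by guards
  later.\<close>

definition copy_in :: "subspace_format \<Rightarrow> bool \<Rightarrow> string \<Rightarrow> fprog" where
  "copy_in fmt rv src = FI ''m'' [] (iv src) ;;
     nest [(''t'', 1), (''j'', 0), (''u'', 0)] (FK ''C'' [iv ''t'', iv ''j'', iv ''u'']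
       (KRead src (if fmt = Image then [chain_index_exp rv, iv ''u'', iv ''j'']
         else [chain_index_exp (\<not> rv), iv ''j'', iv ''u''])))"

definition init_bases :: fprog where
  "init_bases =
     nest [(''j'', 0), (''u'', 0)] (FK ''P'' [iv ''j'', iv ''u''] KZero) ;;
     nest [(''j'', 0), (''u'', 0)] (FK ''Q'' [iv ''j'', iv ''u''] KZero) ;;
     nest [(''j'', 0)] (FK ''P'' [iv ''j'', iv ''j''] KOne) ;;
     nest [(''j'', 0)] (FK ''Q'' [iv ''j'', iv ''j''] KOne) ;;
     nest [(''j'', 0)] (FI ''st'' [iv ''j''] (iv ''m''))"

text \<open>Coordinates of the current generator are recomputed for every \<open>i\<close>, as an
  exchange changes them; afterwards all but that of \<open>i\<close> vanish, so at most one exchange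
  happens per generator.\<close>

definition adapt_body :: fprog where
  "adapt_body = matvec ''c'' ''Q'' ''g'' ;;
     FIf (BAnd (BNot (ILess (IRead ''st'' [iv ''i'']) (iv ''m''))) (BNot (KEq (KRead ''c'' [iv ''i'']) KZero)))
       (exchange_prog ''P'' ''Q'' ;; FI ''st'' [iv ''i''] (iv ''t'')) FSkip"

definition adapt_inner :: fprog where
  "adapt_inner = copyvec ''g'' ''C'' [iv ''t'', iv ''j''] ;; FFor ''i'' 0 adapt_body"

definition adapt_prog :: fprog where
  "adapt_prog = FFor ''t'' 1 (FIf (ILess (iv ''t'') (iv ''m'')) (FFor ''j'' 0 adapt_inner) FSkip)"

text \<open>For kernels the adapted basis consists of equations, so the two arrays change roles and
  stages are counted from the other end.\<close>

definition copy_out :: "subspace_format \<Rightarrow> string \<Rightarrow> string \<Rightarrow> string \<Rightarrow> fprog" where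
  "copy_out fmt E U sE =
     nest [(''j'', 0), (''u'', 0)] (FK E [iv ''j'', iv ''u''] (KRead (if fmt = Image then ''P'' else ''Q'') [iv ''j'', iv ''u''])) ;;
     nest [(''j'', 0), (''u'', 0)] (FK U [iv ''j'', iv ''u''] (KRead (if fmt = Image then ''Q'' else ''P'') [iv ''j'', iv ''u''])) ;;
     nest [(''j'', 0)] (FI sE [iv ''j''] (if fmt = Image then IRead ''st'' [iv ''j''] else ISub (iv ''m'') (IRead ''st'' [iv ''j''])))"

definition coords_prog :: "bool \<Rightarrow> string \<Rightarrow> string \<Rightarrow> string \<Rightarrow> fprog" where
  "coords_prog rv src sE a = nest [(''j'', 0)] (FC a [iv ''j''] CZero ;;
     FFor ''t'' 1 (FIf (BAnd (ILess (iv ''t'') (iv ''m'')) (BNot (ILess (iv ''t'') (IRead sE [iv ''j'']))))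
       (FC a [iv ''j''] (CAdd (CRead a [iv ''j'']) (CRead src [chain_index_exp rv]))) FSkip))"

lemma writes_phases [simp]:
  "iwrites (copy_in fmt rv src) = {''m'', ''t'', ''j'', ''u''}" "kwrites (copy_in fmt rv src) = {''C''}" "cwrites (copy_in fmt rv src) = {}"
  "iwrites init_bases = {''j'', ''u'', ''st''}" "kwrites init_bases = {''P'', ''Q''}" "cwrites init_bases = {}"
  "iwrites adapt_body = {''u'', ''w'', ''st''}" "kwrites adapt_body = {''c'', ''q'', ''P'', ''Q''}" "cwrites adapt_body = {}"
  "iwrites adapt_inner = {''i'', ''u'', ''w'', ''st''}" "kwrites adapt_inner = {''g'', ''c'', ''q'', ''P'', ''Q''}" "cwrites adapt_inner = {}"
  "iwrites adapt_prog = {''t'', ''j'', ''i'', ''u'', ''w'', ''st''}" "kwrites adapt_prog = {''g'', ''c'', ''q'', ''P'', ''Q''}" "cwrites adapt_prog = {}"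
  "iwrites (copy_out fmt E U sE) = {''j'', ''u'', sE}" "kwrites (copy_out fmt E U sE) = {E, U}" "cwrites (copy_out fmt E U sE) = {}"
  "iwrites (coords_prog rv src sE a) = {''j'', ''t''}" "kwrites (coords_prog rv src sE a) = {}" "cwrites (coords_prog rv src sE a) = {a}"
  by (auto simp: copy_in_def init_bases_def adapt_body_def adapt_inner_def adapt_prog_def copy_out_def coords_prog_def)

lemma wf_phases [simp]:
  "wf_prog (copy_in fmt rv src)" "wf_prog init_bases" "wf_prog adapt_prog"
  "sE \<noteq> ''j'' \<Longrightarrow> ''n'' \<noteq> sE \<Longrightarrow> wf_prog (copy_out fmt E U sE)" "wf_prog (coords_prog rv src sE a)"
  by (simp_all add: copy_in_def init_bases_def adapt_prog_def copy_out_def coords_prog_def)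
    (simp_all add: adapt_body_def adapt_inner_def)

lemma sem_copy_in:
  fixes s :: "'k::field state" and fmt :: subspace_format and rv :: bool
  assumes n: "imem s ''n'' [] = n" and ne: "src \<noteq> ''C''" "src \<notin> {''m'', ''t'', ''j'', ''u''}" and t: "t < n + 1" "j < n" "l < n"
  defines "s' \<equiv> sem (copy_in fmt rv src) s" and "m \<equiv> imem s src []"
  shows "imem s' ''m'' [] = m"
    and "kmem s' ''C'' [t, j, l] = kmem s src (if fmt = Image then [chain_index rv m t, l, j] else [chain_index (\<not> rv) m t, j, l])"
proof -
  let ?p = "FK ''C'' [iv ''t'', iv ''j'', iv ''u'']
       (KRead src (if fmt = Image then [chain_index_exp rv, iv ''u'', iv ''j'']
         else [chain_index_exp (\<not> rv), iv ''j'', iv ''u'']))"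
  let ?vs = "[(''t'', 1), (''j'', 0), (''u'', 0)]"
  define s1 where "s1 = sem (FI ''m'' [] (iv src)) s"
  have s1: "imem s1 ''m'' [] = m" "imem s1 ''n'' [] = n" "kmem s1 = kmem s"
    using n ne by (auto simp: s1_def m_def store_apply)
  have s': "s' = sem (nest ?vs ?p) s1" by (simp add: s'_def s1_def copy_in_def del: nest.simps)
  show "imem s' ''m'' [] = m" unfolding s' using s1 by (subst sem_frame_i) auto
  let ?F = "\<lambda>x. if fmt = Image then [chain_index rv m (x ! 0), x ! 2, x ! 1] else [chain_index (\<not> rv) m (x ! 0), x ! 1, x ! 2]"
  have "kmem s' ''C'' [t, j, l] = (if \<exists>js. list_all2 (\<lambda>vk j. j < n + snd vk) ?vs js \<and> [t, j, l] \<in> {js}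
      then kmem s src (?F [t, j, l]) else kmem s1 ''C'' [t, j, l])"
    unfolding s'
  proof (rule sem_nest[OF s1(2), where sel = "\<lambda>s. kmem s ''C''" and val = "\<lambda>x. kmem s src (?F x)"])
    fix js r x assume fr: "frame (nest ?vs ?p) s1 r" and js: "map (\<lambda>vk. imem r (fst vk) []) ?vs = js"
    have "imem r ''m'' [] = m" "kmem r src = kmem s src" using frameD[OF fr] s1 ne by (simp_all del: nest.simps)
    then show "kmem (sem ?p r) ''C'' x = (if x \<in> {js} then kmem s src (?F x) else kmem r ''C'' x)"
      using js by (auto simp: store_apply)
  qed auto
  then show "kmem s' ''C'' [t, j, l] = kmem s src (if fmt = Image then [chain_index rv m t, l, j] else [chain_index (\<not> rv) m t, j, l])"
    using t by (auto simp: list_all2_3)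
qed

lemma sem_init_bases:
  fixes s :: "'k::field state"
  assumes n: "imem s ''n'' [] = n" and k: "k < n"
  defines "s' \<equiv> sem init_bases s"
  shows "imem s' ''st'' [k] = imem s ''m'' []"
    and "l < n \<Longrightarrow> kmem s' ''P'' [k, l] = (if k = l then 1 else 0)" "l < n \<Longrightarrow> kmem s' ''Q'' [k, l] = (if k = l then 1 else 0)"
proof -
  let ?p1 = "nest [(''j'', 0), (''u'', 0)] (FK ''P'' [iv ''j'', iv ''u''] KZero)"
  let ?p2 = "nest [(''j'', 0), (''u'', 0)] (FK ''Q'' [iv ''j'', iv ''u''] KZero)"
  let ?p3 = "nest [(''j'', 0)] (FK ''P'' [iv ''j'', iv ''j''] KOne)"
  let ?p4 = "nest [(''j'', 0)] (FK ''Q'' [iv ''j'', iv ''j''] KOne)"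
  let ?p5 = "nest [(''j'', 0)] (FI ''st'' [iv ''j''] (iv ''m''))"
  have zero: "kmem (sem (nest [(''j'', 0), (''u'', 0)] (FK b [iv ''j'', iv ''u''] KZero)) r) b [k, l] = 0"
    if "imem r ''n'' [] = n" "l < n" for r :: "'k state" and b l
  proof -
    have "kmem (sem (nest [(''j'', 0), (''u'', 0)] (FK b [iv ''j'', iv ''u''] KZero)) r) b [k, l] =
        (if \<exists>js. list_all2 (\<lambda>vk j. j < n + snd vk) [(''j'', 0), (''u'', 0)] js \<and> [k, l] \<in> {js} then 0 else kmem r b [k, l])"
      by (rule sem_nest[OF that(1), where sel = "\<lambda>s. kmem s b" and Bl = "\<lambda>js. {js}"]) (auto simp: store_apply)
    then show ?thesis using k that by (auto simp: list_all2_2)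
  qed
  have one: "kmem (sem (nest [(''j'', 0)] (FK b [iv ''j'', iv ''j''] KOne)) r) b [k, l] = (if k = l then 1 else kmem r b [k, l])"
    if "imem r ''n'' [] = n" for r :: "'k state" and b l
  proof -
    have "kmem (sem (nest [(''j'', 0)] (FK b [iv ''j'', iv ''j''] KOne)) r) b [k, l] =
        (if \<exists>js. list_all2 (\<lambda>vk j. j < n + snd vk) [(''j'', 0)] js \<and> [k, l] \<in> {[hd js, hd js]} then 1 else kmem r b [k, l])"
      by (rule sem_nest[OF that(1), where sel = "\<lambda>s. kmem s b" and Bl = "\<lambda>js. {[hd js, hd js]}"]) (auto simp: store_apply)
    then show ?thesis using k by (auto simp: list_all2_1)
  qed
  define s1 s2 s3 s4 where "s1 = sem ?p1 s" and "s2 = sem ?p2 s1" and "s3 = sem ?p3 s2" and "s4 = sem ?p4 s3"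
  have s': "s' = sem ?p5 s4" by (simp add: s'_def init_bases_def s1_def s2_def s3_def s4_def del: nest.simps)
  have nn: "imem s1 ''n'' [] = n" "imem s2 ''n'' [] = n" "imem s3 ''n'' [] = n" "imem s4 ''n'' [] = n"
    using n by (simp_all add: s1_def s2_def s3_def s4_def sem_frame del: nest.simps)
  have m: "imem s4 ''m'' [] = imem s ''m'' []"
    by (simp add: s1_def s2_def s3_def s4_def sem_frame del: nest.simps)
  have "imem s' ''st'' [k] = (if \<exists>js. list_all2 (\<lambda>vk j. j < n + snd vk) [(''j'', 0)] js \<and> [k] \<in> {js} then imem s4 ''m'' [] else imem s4 ''st'' [k])"
    unfolding s'
    by (rule sem_nest[OF nn(4), where sel = "\<lambda>s. imem s ''st''" and Bl = "\<lambda>js. {js}"]) (auto simp: store_apply frameD)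
  then show "imem s' ''st'' [k] = imem s ''m'' []" using k m by (auto simp: list_all2_1)
  show "kmem s' ''P'' [k, l] = (if k = l then 1 else 0)" if l: "l < n"
  proof -
    have "kmem s' ''P'' [k, l] = kmem s3 ''P'' [k, l]" by (simp add: s' s4_def sem_frame del: nest.simps)
    also have "\<dots> = (if k = l then 1 else kmem s2 ''P'' [k, l])" unfolding s3_def by (rule one[OF nn(2)])
    also have "kmem s2 ''P'' [k, l] = kmem s1 ''P'' [k, l]" by (simp add: s2_def sem_frame del: nest.simps)
    also have "\<dots> = 0" unfolding s1_def by (rule zero[OF n l])
    finally show ?thesis .
  qed
  show "kmem s' ''Q'' [k, l] = (if k = l then 1 else 0)" if l: "l < n"
  proof -
    have "kmem s' ''Q'' [k, l] = kmem s4 ''Q'' [k, l]" by (simp add: s' sem_frame del: nest.simps)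
    also have "\<dots> = (if k = l then 1 else kmem s3 ''Q'' [k, l])" unfolding s4_def by (rule one[OF nn(3)])
    also have "kmem s3 ''Q'' [k, l] = kmem s2 ''Q'' [k, l]" by (simp add: s3_def sem_frame del: nest.simps)
    also have "\<dots> = 0" unfolding s2_def by (rule zero[OF nn(1) l])
    finally show ?thesis .
  qed
qed

lemma sem_copy_out:
  fixes s :: "'k::field state" and fmt :: subspace_format
  assumes n: "imem s ''n'' [] = n" and k: "k < n" and ne: "E \<noteq> U" "E \<notin> {''P'', ''Q''}" "U \<notin> {''P'', ''Q''}" "sE \<notin> {''j'', ''u'', ''m'', ''st'', ''n''}"
  defines "s' \<equiv> sem (copy_out fmt E U sE) s"
  shows "imem s' sE [k] = (if fmt = Image then imem s ''st'' [k] else imem s ''m'' [] - imem s ''st'' [k])"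
    and "l < n \<Longrightarrow> kmem s' E [k, l] = kmem s (if fmt = Image then ''P'' else ''Q'') [k, l]"
    and "l < n \<Longrightarrow> kmem s' U [k, l] = kmem s (if fmt = Image then ''Q'' else ''P'') [k, l]"
proof -
  let ?p1 = "nest [(''j'', 0), (''u'', 0)] (FK E [iv ''j'', iv ''u''] (KRead (if fmt = Image then ''P'' else ''Q'') [iv ''j'', iv ''u'']))"
  let ?p2 = "nest [(''j'', 0), (''u'', 0)] (FK U [iv ''j'', iv ''u''] (KRead (if fmt = Image then ''Q'' else ''P'') [iv ''j'', iv ''u'']))"
  let ?e = "if fmt = Image then IRead ''st'' [iv ''j''] else ISub (iv ''m'') (IRead ''st'' [iv ''j''])"
  let ?p3 = "nest [(''j'', 0)] (FI sE [iv ''j''] ?e)"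
  have copy: "kmem (sem (nest [(''j'', 0), (''u'', 0)] (FK b [iv ''j'', iv ''u''] (KRead b' [iv ''j'', iv ''u'']))) r) b [k, l] = kmem r b' [k, l]"
    if "imem r ''n'' [] = n" "l < n" "b \<noteq> b'" for r :: "'k state" and b b' l
  proof -
    let ?p = "FK b [iv ''j'', iv ''u''] (KRead b' [iv ''j'', iv ''u''])"
    have "kmem (sem (nest [(''j'', 0), (''u'', 0)] ?p) r) b [k, l] =
        (if \<exists>js. list_all2 (\<lambda>vk j. j < n + snd vk) [(''j'', 0), (''u'', 0)] js \<and> [k, l] \<in> {js} then kmem r b' [k, l] else kmem r b [k, l])"
    proof (rule sem_nest[OF that(1), where sel = "\<lambda>s. kmem s b" and Bl = "\<lambda>js. {js}" and val = "\<lambda>x. kmem r b' x"])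
      fix js r' x assume fr: "frame (nest [(''j'', 0), (''u'', 0)] ?p) r r'" and js: "map (\<lambda>vk. imem r' (fst vk) []) [(''j'', 0), (''u'', 0)] = js"
      have "kmem r' b' = kmem r b'" using frameD(2)[OF fr, of b'] that(3) by (simp del: nest.simps)
      then show "kmem (sem ?p r') b x = (if x \<in> {js} then kmem r b' x else kmem r' b x)"
        using js by (auto simp: store_apply)
    qed auto
    then show ?thesis using k that by (auto simp: list_all2_2)
  qed
  define s1 s2 where "s1 = sem ?p1 s" and "s2 = sem ?p2 s1"
  have s': "s' = sem ?p3 s2" by (simp only: s'_def copy_out_def s1_def s2_def sem.simps)
  have nn: "imem s1 ''n'' [] = n" "imem s2 ''n'' [] = n"
    using n by (simp_all add: s1_def s2_def sem_frame del: nest.simps)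
  have i2: "imem s2 ''m'' = imem s ''m''" "imem s2 ''st'' = imem s ''st''"
    by (simp_all add: s1_def s2_def sem_frame del: nest.simps)
  let ?v = "\<lambda>x. if fmt = Image then imem s ''st'' x else imem s ''m'' [] - imem s ''st'' x"
  have "imem s' sE [k] = (if \<exists>js. list_all2 (\<lambda>vk j. j < n + snd vk) [(''j'', 0)] js \<and> [k] \<in> {js} then ?v [k] else imem s2 sE [k])"
    unfolding s'
  proof (rule sem_nest[OF nn(2), where sel = "\<lambda>s. imem s sE" and Bl = "\<lambda>js. {js}" and val = ?v])
    fix js r' x assume fr: "frame ?p3 s2 r'" and js: "map (\<lambda>vk. imem r' (fst vk) []) [(''j'', 0)] = js"
    have "imem r' ''st'' = imem s ''st''" "imem r' ''m'' = imem s ''m''"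
      using frameD(1)[OF fr, of "''st''"] frameD(1)[OF fr, of "''m''"] ne(4) i2 by (auto simp del: nest.simps)
    then show "imem (sem (FI sE [iv ''j''] ?e) r') sE x = (if x \<in> {js} then ?v x else imem r' sE x)"
      using js by (auto simp: store_apply)
  qed (use ne in auto)
  then show "imem s' sE [k] = (if fmt = Image then imem s ''st'' [k] else imem s ''m'' [] - imem s ''st'' [k])"
    using k by (auto simp: list_all2_1)
  have "kmem s' E = kmem s1 E" using ne by (simp add: s' s2_def sem_frame del: nest.simps)
  moreover have "kmem s1 (if fmt = Image then ''Q'' else ''P'') = kmem s (if fmt = Image then ''Q'' else ''P'')"
    using ne unfolding s1_def by (subst sem_frame_k) auto
  moreover have "kmem s' U = kmem s2 U" by (simp add: s' sem_frame del: nest.simps)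
  ultimately show "l < n \<Longrightarrow> kmem s' E [k, l] = kmem s (if fmt = Image then ''P'' else ''Q'') [k, l]"
    "l < n \<Longrightarrow> kmem s' U [k, l] = kmem s (if fmt = Image then ''Q'' else ''P'') [k, l]"
    using copy[OF n, of l E "if fmt = Image then ''P'' else ''Q''"] copy[OF nn(1), of l U "if fmt = Image then ''Q'' else ''P''"] ne
    by (auto simp: s1_def s2_def simp del: nest.simps)
qed

lemma sem_coords_prog:
  fixes s :: "'k::field state"
  assumes n: "imem s ''n'' [] = n" and k: "k < n" and ne: "a \<noteq> src" "sE \<notin> {''j'', ''t''}"
  defines "m \<equiv> imem s ''m'' []"
  shows "cmem (sem (coords_prog rv src sE a) s) a [k] =
    (\<Sum>t<n + 1. if t < m \<and> imem s sE [k] \<le> t then cmem s src [chain_index rv m t] else 0)"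
proof -
  let ?b = "FIf (BAnd (ILess (iv ''t'') (iv ''m'')) (BNot (ILess (iv ''t'') (IRead sE [iv ''j'']))))
       (FC a [iv ''j''] (CAdd (CRead a [iv ''j'']) (CRead src [chain_index_exp rv]))) FSkip"
  let ?in = "FFor ''t'' 1 ?b"
  let ?p = "FC a [iv ''j''] CZero ;; ?in"
  let ?g = "\<lambda>k t. if t < m \<and> imem s sE [k] \<le> t then cmem s src [chain_index rv m t] else 0"
  have "cmem (sem (nest [(''j'', 0)] ?p) s) a [k] =
    (if \<exists>js. list_all2 (\<lambda>vk j. j < n + snd vk) [(''j'', 0)] js \<and> [k] \<in> {js} then \<Sum>t<n + 1. ?g (hd [k]) t else cmem s a [k])"
  proof (rule sem_nest[OF n, where sel = "\<lambda>s. cmem s a" and Bl = "\<lambda>js. {js}" and val = "\<lambda>x. \<Sum>t<n + 1. ?g (hd x) t"])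
    fix js r x assume fr: "frame (nest [(''j'', 0)] ?p) s r" and js: "map (\<lambda>vk. imem r (fst vk) []) [(''j'', 0)] = js"
    obtain j where j: "js = [j]" "imem r ''j'' [] = j" using js by auto
    define r1 where "r1 = sem (FC a [iv ''j''] CZero) r"
    have r1: "cmem r1 a = (cmem r a)([j] := 0)" "imem r1 ''n'' [] = n" "imem r1 ''j'' [] = j" "imem r1 ''m'' [] = m"
      "imem r1 sE = imem s sE" "cmem r1 src = cmem s src"
      using j frameD[OF fr] n ne by (auto simp: r1_def store_apply m_def)
    have "cmem (sem ?in r1) a = (cmem r a)([j] := (\<Sum>t<n + 1. ?g j t))"
    proof (rule sem_for[OF r1(2), where Q = "\<lambda>t r'. cmem r' a = (cmem r a)([j] := (\<Sum>t<t. ?g j t))"])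
      fix i r' assume i: "imem r' ''t'' [] = i" and fr': "frame ?in r1 r'" and Q: "cmem r' a = (cmem r a)([j] := (\<Sum>t<i. ?g j t))"
      have "imem r' ''m'' [] = m" "imem r' ''j'' [] = j" "imem r' sE = imem s sE" "cmem r' src = cmem s src"
        using frameD[OF fr'] r1 ne by auto
      then show "cmem (seti ''t'' (Suc i) (sem ?b r')) a = (cmem r a)([j] := (\<Sum>t<Suc i. ?g j t))"
        using Q i by (auto simp: store_apply not_less)
    qed (use r1 in simp)
    then show "cmem (sem ?p r) a x = (if x \<in> {js} then \<Sum>t<n + 1. ?g (hd x) t else cmem r a x)"
      using j by (simp add: r1_def)
  qed (auto simp: chain_index_def)
  then show ?thesis using k by (auto simp: coords_prog_def list_all2_1 simp del: nest.simps sum.lessThan_Suc)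
qed

section \<open>Correctness of the adaptation to a flag\<close>

abbreviation vecs :: "'k state \<Rightarrow> string \<Rightarrow> nat \<Rightarrow> nat \<Rightarrow> 'k" where
  "vecs s a \<equiv> \<lambda>i l. kmem s a [i, l]"

abbreviation nats :: "'k state \<Rightarrow> string \<Rightarrow> nat \<Rightarrow> nat" where
  "nats s a \<equiv> \<lambda>i. imem s a [i]"

abbreviation adapted_state :: "nat \<Rightarrow> nat \<Rightarrow> (nat \<Rightarrow> nat \<Rightarrow> nat \<Rightarrow> 'k::field) \<Rightarrow> (nat \<times> nat) set \<Rightarrow> 'k state \<Rightarrow> bool" where
  "adapted_state n m C Vis s \<equiv> adapt_inv n m C Vis (nats s ''st'') (vecs s ''P'') (vecs s ''Q'')"

text \<open>Unassigned positions already passed have coordinate zero in the current generator. An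
  exchange preserves this, since it makes all coordinates zero except at the position just
  assigned.\<close>

lemma sem_adapt_body:
  fixes s :: "'k::field state"
  assumes n: "imem s ''n'' [] = n" "imem s ''i'' [] = i" "i < n" "imem s ''m'' [] = m" "imem s ''t'' [] = t" "t < m" and j: "j < n"
    and g: "\<And>l. l < n \<Longrightarrow> kmem s ''g'' [l] = C t j l"
    and inv: "adapted_state n m C Vis s" and Vis: "\<And>t' j'. (t', j') \<in> Vis \<Longrightarrow> t' \<le> t"
    and bound: "\<And>k. k < n \<Longrightarrow> imem s ''st'' [k] = m \<or> imem s ''st'' [k] \<le> t"
    and seen: "\<And>k. k < i \<Longrightarrow> imem s ''st'' [k] = m \<Longrightarrow> dot n (vecs s ''Q'' k) (C t j) = 0"
  defines "s' \<equiv> sem adapt_body s"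
  shows "adapted_state n m C Vis s'"
    and "\<And>k. k < n \<Longrightarrow> imem s' ''st'' [k] = m \<or> imem s' ''st'' [k] \<le> t"
    and "\<And>k. k < Suc i \<Longrightarrow> imem s' ''st'' [k] = m \<Longrightarrow> dot n (vecs s' ''Q'' k) (C t j) = 0"
proof -
  define s1 where "s1 = sem (matvec ''c'' ''Q'' ''g'') s"
  have c: "kmem s1 ''c'' [k] = dot n (vecs s ''Q'' k) (C t j)" if "k < n" for k
  proof -
    have "kmem s1 ''c'' [k] = dot n (vecs s ''Q'' k) (\<lambda>l. kmem s ''g'' [l])"
      unfolding s1_def using n that by (intro sem_matvec) auto
    also have "\<dots> = dot n (vecs s ''Q'' k) (C t j)" using g by (intro dot_cong) auto
    finally show ?thesis .
  qed
  have f1: "kmem s1 ''P'' = kmem s ''P''" "kmem s1 ''Q'' = kmem s ''Q''" "kmem s1 ''g'' = kmem s ''g''" "imem s1 ''st'' = imem s ''st''"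
    "imem s1 ''i'' [] = i" "imem s1 ''n'' [] = n" "imem s1 ''m'' [] = m" "imem s1 ''t'' [] = t"
    using n by (simp_all add: s1_def sem_frame)
  have sti: "imem s ''st'' [i] \<le> m" using inv n(3) by (simp add: adapt_inv_def)
  let ?cond = "imem s ''st'' [i] = m \<and> dot n (vecs s ''Q'' i) (C t j) \<noteq> 0"
  have s': "s' = (if ?cond then sem (exchange_prog ''P'' ''Q'' ;; FI ''st'' [iv ''i''] (iv ''t'')) s1 else s1)"
    using sti n(3) by (auto simp: s'_def adapt_body_def s1_def[symmetric] f1 c)
  have "adapted_state n m C Vis s' \<and> (\<forall>k<n. imem s' ''st'' [k] = m \<or> imem s' ''st'' [k] \<le> t) \<and>
    (\<forall>k<Suc i. imem s' ''st'' [k] = m \<longrightarrow> dot n (vecs s' ''Q'' k) (C t j) = 0)"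
  proof (cases ?cond)
    case False
    then have "s' = s1" using s' by auto
    then show ?thesis using False inv bound seen by (simp add: f1 less_Suc_eq)
  next
    case True
    define s2 where "s2 = sem (exchange_prog ''P'' ''Q'') s1"
    have s2: "s' = sem (FI ''st'' [iv ''i''] (iv ''t'')) s2" using s' True by (simp add: s2_def)
    have f2: "imem s2 ''st'' = imem s ''st''" "imem s2 ''i'' [] = i" "imem s2 ''t'' [] = t"
      using f1 by (simp_all add: s2_def sem_frame)
    have st': "imem s' ''st'' [k] = (if k = i then t else imem s ''st'' [k])" for k
      by (simp add: s2 store_apply f2)
    have kk: "kmem s' = kmem s2" by (simp add: s2)
    have Q': "kmem s' ''Q'' [k, l] = kmem s ''Q'' [k, l] - (if k = i then kmem s1 ''c'' [i] - 1 else kmem s1 ''c'' [k]) * (kmem s ''Q'' [i, l] / kmem s1 ''c'' [i])"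
      and P': "kmem s' ''P'' [k, l] = (if k = i then C t j l else kmem s ''P'' [k, l])" if "k < n" "l < n" for k l
      using sem_exchange_prog[of s1 n i "''P''" "''Q''" k l] f1 n(3) that g by (auto simp: kk s2_def)
    have step: "adapted_state n m C Vis s'" "\<And>k. k < n \<Longrightarrow> k \<noteq> i \<Longrightarrow> dot n (vecs s' ''Q'' k) (C t j) = 0"
      using adapt_step[OF inv Vis n(6) j n(3), where c = "\<lambda>k. kmem s1 ''c'' [k]" and Q' = "vecs s' ''Q''" and P' = "vecs s' ''P''" and st' = "nats s' ''st''"]
        True c n(3) Q' P' st' by auto
    then show ?thesis using st' bound n(3,6) by (auto simp: less_Suc_eq)
  qed
  then show "adapted_state n m C Vis s'"
    and "\<And>k. k < n \<Longrightarrow> imem s' ''st'' [k] = m \<or> imem s' ''st'' [k] \<le> t"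
    and "\<And>k. k < Suc i \<Longrightarrow> imem s' ''st'' [k] = m \<Longrightarrow> dot n (vecs s' ''Q'' k) (C t j) = 0" by auto
qed

lemma sem_adapt_inner:
  fixes s :: "'k::field state"
  assumes n: "imem s ''n'' [] = n" "imem s ''m'' [] = m" "imem s ''t'' [] = t" "t < m" and j: "imem s ''j'' [] = j" "j < n"
    and C: "\<And>l. l < n \<Longrightarrow> kmem s ''C'' [t, j, l] = C t j l"
    and inv: "adapted_state n m C Vis s" and Vis: "\<And>t' j'. (t', j') \<in> Vis \<Longrightarrow> t' \<le> t"
    and bound: "\<And>k. k < n \<Longrightarrow> imem s ''st'' [k] = m \<or> imem s ''st'' [k] \<le> t"
  defines "s' \<equiv> sem adapt_inner s"
  shows "adapted_state n m C (insert (t, j) Vis) s'"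
    and "\<And>k. k < n \<Longrightarrow> imem s' ''st'' [k] = m \<or> imem s' ''st'' [k] \<le> t"
proof -
  define s1 where "s1 = sem (copyvec ''g'' ''C'' [iv ''t'', iv ''j'']) s"
  have g: "kmem s1 ''g'' [l] = C t j l" if "l < n" for l
  proof -
    have "kmem s1 ''g'' [l] = kmem s ''C'' ([t, j] @ [l])"
      unfolding s1_def using n j that by (intro sem_copyvec) (auto simp: frameD)
    then show ?thesis using C that by simp
  qed
  have f1: "kmem s1 ''P'' = kmem s ''P''" "kmem s1 ''Q'' = kmem s ''Q''" "imem s1 ''st'' = imem s ''st''"
    "imem s1 ''n'' [] = n" "imem s1 ''m'' [] = m" "imem s1 ''t'' [] = t"
    using n by (simp_all add: s1_def sem_frame)
  let ?Q = "\<lambda>i r. adapted_state n m C Vis r \<and> (\<forall>k<n. imem r ''st'' [k] = m \<or> imem r ''st'' [k] \<le> t) \<and>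
    (\<forall>k<i. imem r ''st'' [k] = m \<longrightarrow> dot n (vecs r ''Q'' k) (C t j) = 0)"
  have "?Q (n + 0) (sem (FFor ''i'' 0 adapt_body) s1)"
  proof (rule sem_for[OF f1(4), where Q = ?Q])
    show "?Q 0 (seti ''i'' 0 s1)" using inv bound f1 by simp
    fix i r assume i: "i < n + 0" "imem r ''i'' [] = i" and fr: "frame (FFor ''i'' 0 adapt_body) s1 r" and Q: "?Q i r"
    have fr': "imem r ''n'' [] = n" "imem r ''m'' [] = m" "imem r ''t'' [] = t" "kmem r ''g'' = kmem s1 ''g''"
      using frameD[OF fr] f1 by simp_all
    have i': "i < n" using i by simp
    have g': "kmem r ''g'' [l] = C t j l" if "l < n" for l using g[OF that] fr' by simp
    note b = sem_adapt_body[of r n i m t j C Vis, OF fr'(1) i(2) i' fr'(2,3) n(4) j(2) g']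
    show "?Q (Suc i) (seti ''i'' (Suc i) (sem adapt_body r))"
      using b Q Vis by simp
  qed
  then have Q: "?Q n s'" by (simp add: s'_def adapt_inner_def s1_def)
  then show "\<And>k. k < n \<Longrightarrow> imem s' ''st'' [k] = m \<or> imem s' ''st'' [k] \<le> t" by auto
  \<comment> \<open>A stage beyond \<open>t\<close> can only be the marker \<open>m\<close> of
    unassigned positions, and at these the completed pass has shown the coordinate of the generator
    to vanish.\<close>
  then show "adapted_state n m C (insert (t, j) Vis) s'"
    using Q n(4) unfolding adapt_inv_def by (metis (no_types, lifting) insertE leD prod.inject)
qed

text \<open>The loop has \<open>n + 1\<close> rounds whatever the length of the chain, and rounds
  from \<open>m\<close> on are idle; hence the invariant counts only stages below
  \<open>m\<close>.\<close>

lemma sem_adapt_prog: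
  fixes s :: "'k::field state"
  assumes n: "imem s ''n'' [] = n" "imem s ''m'' [] = m" "m \<le> n + 1"
    and C: "\<And>t j l. t < m \<Longrightarrow> j < n \<Longrightarrow> l < n \<Longrightarrow> kmem s ''C'' [t, j, l] = C t j l"
    and inv: "adapted_state n m C {} s" and st: "\<And>k. k < n \<Longrightarrow> imem s ''st'' [k] = m"
  shows "adapted_state n m C {(t, j). t < m \<and> j < n} (sem adapt_prog s)"
proof -
  let ?body = "FIf (ILess (iv ''t'') (iv ''m'')) (FFor ''j'' 0 adapt_inner) FSkip"
  let ?Q = "\<lambda>t r. adapted_state n m C {(t', j). t' < t \<and> t' < m \<and> j < n} r \<and>
    (\<forall>k<n. imem r ''st'' [k] = m \<or> imem r ''st'' [k] < t)"
  have "?Q (n + 1) (sem (FFor ''t'' 1 ?body) s)"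
  proof (rule sem_for[OF n(1), where Q = ?Q])
    show "?Q 0 (seti ''t'' 0 s)" using inv st by simp
    fix t r assume t: "t < n + 1" "imem r ''t'' [] = t" and fr: "frame (FFor ''t'' 1 ?body) s r" and Q: "?Q t r"
    have fr': "imem r ''n'' [] = n" "imem r ''m'' [] = m" "kmem r ''C'' = kmem s ''C''"
      using frameD[OF fr] n by simp_all
    show "?Q (Suc t) (seti ''t'' (Suc t) (sem ?body r))"
    proof (cases "t < m")
      case False
      then have "{(t', j). t' < Suc t \<and> t' < m \<and> j < n} = {(t', j). t' < t \<and> t' < m \<and> j < n}" by auto
      moreover have "sem ?body r = r" using False t fr' by simp
      ultimately show ?thesis using Q by (auto simp del: sem.simps)
    next
      case True
      let ?V = "\<lambda>j. {(t', j'). t' < t \<and> t' < m \<and> j' < n} \<union> {t} \<times> {..<j}"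
      let ?R = "\<lambda>j r'. adapted_state n m C (?V j) r' \<and> (\<forall>k<n. imem r' ''st'' [k] = m \<or> imem r' ''st'' [k] \<le> t)"
      have "?R (n + 0) (sem (FFor ''j'' 0 adapt_inner) r)"
      proof (rule sem_for[OF fr'(1), where Q = ?R])
        show "?R 0 (seti ''j'' 0 r)" using Q by (auto simp: less_imp_le)
        fix j r' assume j: "j < n + 0" "imem r' ''j'' [] = j" and fr2: "frame (FFor ''j'' 0 adapt_inner) r r'" and R: "?R j r'"
        have fr2': "imem r' ''n'' [] = n" "imem r' ''m'' [] = m" "imem r' ''t'' [] = t" "kmem r' ''C'' = kmem s ''C''"
          using frameD[OF fr2] fr' t by simp_all
        have j': "j < n" using j by simp
        have C': "kmem r' ''C'' [t, j, l] = C t j l" if "l < n" for l using C[OF True j' that] fr2' by simp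
        have vis: "t' \<le> t" if "(t', j') \<in> ?V j" for t' j' using that by auto
        note b = sem_adapt_inner[of r' n m t j C "?V j", OF fr2'(1,2,3) True j(2) j' C']
        have "insert (t, j) (?V j) = ?V (Suc j)" by auto
        then show "?R (Suc j) (seti ''j'' (Suc j) (sem adapt_inner r'))"
          using b[OF _ _ vis] R by (simp del: sem.simps)
      qed
      moreover have "?V n = {(t', j). t' < Suc t \<and> t' < m \<and> j < n}" using True by auto
      moreover have "sem ?body r = sem (FFor ''j'' 0 adapt_inner) r" using True t fr' by simp
      ultimately show ?thesis by (simp add: less_Suc_eq_le del: sem.simps)
    qed
  qed
  moreover have "{(t', j). t' < n + 1 \<and> t' < m \<and> j < n} = {(t, j). t < m \<and> j < n}" using n(3) by auto
  ultimately show ?thesis by (simp add: adapt_prog_def)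
qed

subsection \<open>One side of the input\<close>

definition side_prog :: "subspace_format \<Rightarrow> bool \<Rightarrow> string \<Rightarrow> string \<Rightarrow> string \<Rightarrow> string \<Rightarrow> string \<Rightarrow> fprog" where
  "side_prog fmt rv src E U sE a =
     copy_in fmt rv src ;; init_bases ;; adapt_prog ;; copy_out fmt E U sE ;; coords_prog rv src sE a"

lemma writes_side_prog [simp]:
  "iwrites (side_prog fmt rv src E U sE a) = {''m'', ''t'', ''j'', ''i'', ''u'', ''w'', ''st'', sE}"
  "kwrites (side_prog fmt rv src E U sE a) = {''C'', ''P'', ''Q'', ''g'', ''c'', ''q'', E, U}"
  "cwrites (side_prog fmt rv src E U sE a) = {a}"
  "sE \<noteq> ''j'' \<Longrightarrow> ''n'' \<noteq> sE \<Longrightarrow> wf_prog (side_prog fmt rv src E U sE a)"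
  by (auto simp: side_prog_def)

definition stored_subspace :: "subspace_format \<Rightarrow> bool \<Rightarrow> nat \<Rightarrow> string \<Rightarrow> 'k::field state \<Rightarrow> nat \<Rightarrow> 'k vec set" where
  "stored_subspace fmt rv n src s t =
     subspace_of fmt (mat n n (\<lambda>(i, j). kmem s src [chain_index rv (imem s src []) t, i, j]))"

lemma subspace_of_image:
  "subspace_of Image (mat n n (\<lambda>(i, j). B i j)) = {v \<in> carrier_vec n. \<exists>a. \<forall>l<n. v $ l = (\<Sum>j<n. a j * B l j)}"
  (is "?L = ?R")
proof
  show "?L \<subseteq> ?R"
  proof
    fix v assume "v \<in> ?L"
    then obtain w where w: "w \<in> carrier_vec n" "v = mat n n (\<lambda>(i, j). B i j) *\<^sub>v w" by auto
    then have "v $ l = (\<Sum>j<n. w $ j * B l j)" if "l < n" for l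
      using that by (auto simp: scalar_prod_def atLeast0LessThan mult.commute intro!: sum.cong)
    moreover have "v \<in> carrier_vec n" unfolding w(2) by (rule carrier_vecI) simp
    ultimately show "v \<in> ?R" by auto
  qed
  show "?R \<subseteq> ?L"
  proof
    fix v assume "v \<in> ?R"
    then obtain a where a: "v \<in> carrier_vec n" "\<And>l. l < n \<Longrightarrow> v $ l = (\<Sum>j<n. a j * B l j)" by auto
    then have "v = mat n n (\<lambda>(i, j). B i j) *\<^sub>v vec n a"
      by (intro eq_vecI) (auto simp: scalar_prod_def atLeast0LessThan mult.commute intro!: sum.cong)
    then show "v \<in> ?L" by auto
  qed
qed

lemma subspace_of_kernel:
  "subspace_of Kernel (mat n n (\<lambda>(i, j). B i j)) = {v \<in> carrier_vec n. \<forall>i<n. dot n (B i) (($) v) = 0}"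
proof -
  have "mat n n (\<lambda>(i, j). B i j) *\<^sub>v v = 0\<^sub>v n \<longleftrightarrow> (\<forall>i<n. dot n (B i) (($) v) = 0)" if "v \<in> carrier_vec n" for v
    using that by (auto simp: vec_eq_iff scalar_prod_def dot_def atLeast0LessThan)
  then show ?thesis by (auto simp: mat_kernel_def)
qed

text \<open>Both formats end in the same description: a basis with its functionals and a stage for
  each position, such that the stored chain consists of the coordinate subspaces of stages up to
  \<open>t\<close>. The diagonalisation need not know the format of the input.\<close>

lemma sem_side_prog:
  fixes s :: "'k::field state" and fmt :: subspace_format and rv :: bool
  assumes n: "imem s ''n'' [] = n" and m: "imem s src [] \<le> n + 1"
    and mono: "\<And>t u. t \<le> u \<Longrightarrow> u < imem s src [] \<Longrightarrow> stored_subspace fmt rv n src s t \<subseteq> stored_subspace fmt rv n src s u"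
    and src: "src \<notin> {''C'', ''P'', ''Q'', ''g'', ''c'', ''q'', ''m'', ''t'', ''j'', ''i'', ''u'', ''w'', ''st'', ''n'', a}"
    and ne: "E \<noteq> U" "E \<notin> {''P'', ''Q'', ''C''}" "U \<notin> {''P'', ''Q'', ''C''}" "sE \<notin> {''j'', ''u'', ''m'', ''st'', ''n'', ''t''}"
  defines "s' \<equiv> sem (side_prog fmt rv src E U sE a) s" and "m \<equiv> imem s src []"
  shows "dual_bases n (vecs s' U) (vecs s' E)"
    and "\<And>i. i < n \<Longrightarrow> imem s' sE [i] \<le> n + 1"
    and "\<And>t. t < m \<Longrightarrow> stored_subspace fmt rv n src s t = coord_subspace n (vecs s' U) {i. imem s' sE [i] \<le> t}"
    and "\<And>i. i < n \<Longrightarrow> cmem s' a [i] = (\<Sum>t<m. if imem s' sE [i] \<le> t then cmem s src [chain_index rv m t] else 0)"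
proof -
  define s1 s2 s3 s4 where "s1 = sem (copy_in fmt rv src) s" and "s2 = sem init_bases s1"
    and "s3 = sem adapt_prog s2" and "s4 = sem (copy_out fmt E U sE) s3"
  have s': "s' = sem (coords_prog rv src sE a) s4"
    by (simp add: s'_def side_prog_def s1_def s2_def s3_def s4_def)
  have nn: "imem s1 ''n'' [] = n" "imem s2 ''n'' [] = n" "imem s3 ''n'' [] = n" "imem s4 ''n'' [] = n"
    using n ne(4) not_sym[of sE "''n''"] by (simp_all add: s1_def s2_def s3_def s4_def sem_frame)
  have msrc: "src \<noteq> ''C''" "src \<notin> {''m'', ''t'', ''j'', ''u''}" using src by auto
  define C where "C t j l = kmem s src (if fmt = Image then [chain_index rv m t, l, j] else [chain_index (\<not> rv) m t, j, l])" for t j l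
  have C: "kmem s1 ''C'' [t, j, l] = C t j l" if "t < n + 1" "j < n" "l < n" for t j l
    using sem_copy_in(2)[OF n msrc that] by (simp add: s1_def C_def m_def)
  have m1: "imem s1 ''m'' [] = m"
  proof -
    have "imem s1 ''m'' [] = imem (sem (FI ''m'' [] (iv src)) s) ''m'' []"
      by (simp add: s1_def copy_in_def sem_frame del: nest.simps sem.simps(2))
    then show ?thesis by (simp add: store_apply m_def)
  qed
  have mm: "imem s2 ''m'' [] = m" "imem s3 ''m'' [] = m" "imem s4 ''m'' [] = m"
    using m1 ne(4) not_sym[of sE "''m''"] by (simp_all add: s2_def s3_def s4_def sem_frame)
  have st2: "imem s2 ''st'' [k] = m" if "k < n" for k
    using sem_init_bases(1)[OF nn(1) that] m1 by (simp add: s2_def)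
  have inv2: "adapted_state n m C {} s2"
  proof -
    have "dual_bases n (vecs s2 ''Q'') (vecs s2 ''P'')"
      unfolding dual_bases_def
    proof (intro allI impI)
      fix i j assume ij: "i < n" "j < n"
      have "dot n (vecs s2 ''Q'' i) (vecs s2 ''P'' j) = (\<Sum>l<n. if l = i then (if j = l then 1 else 0) else 0)"
        unfolding dot_def
        using sem_init_bases(2,3)[OF nn(1)] ij by (intro sum.cong) (auto simp: s2_def)
      then show "dot n (vecs s2 ''Q'' i) (vecs s2 ''P'' j) = (if i = j then 1 else 0)" using ij by simp
    qed
    then show ?thesis using st2 by (simp add: adapt_inv_def)
  qed
  have C2: "kmem s2 ''C'' [t, j, l] = C t j l" if "t < m" "j < n" "l < n" for t j l
    using C[of t j l] that m by (simp add: s2_def sem_frame m_def)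
  have inv3: "adapted_state n m C {(t, j). t < m \<and> j < n} s3"
    unfolding s3_def using m C2 inv2 st2 by (intro sem_adapt_prog[OF nn(2) mm(1)]) (auto simp: m_def)
  have out: "imem s4 sE [k] = (if fmt = Image then imem s3 ''st'' [k] else m - imem s3 ''st'' [k])"
    "l < n \<Longrightarrow> kmem s4 E [k, l] = kmem s3 (if fmt = Image then ''P'' else ''Q'') [k, l]"
    "l < n \<Longrightarrow> kmem s4 U [k, l] = kmem s3 (if fmt = Image then ''Q'' else ''P'') [k, l]" if "k < n" for k l
    using sem_copy_out[OF nn(3) that, where E = E and U = U and sE = sE and fmt = fmt] ne mm by (auto simp: s4_def)
  have s'4: "kmem s' = kmem s4" "imem s' sE = imem s4 sE"
    using ne unfolding s' by (auto simp: sem_frame)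
  have dual3: "dual_bases n (vecs s3 ''Q'') (vecs s3 ''P'')" and st3: "\<And>k. k < n \<Longrightarrow> imem s3 ''st'' [k] \<le> m"
    using inv3 by (auto simp: adapt_inv_def)
  have U4: "dual_bases n (vecs s' U) (vecs s' E) = dual_bases n (vecs s3 (if fmt = Image then ''Q'' else ''P'')) (vecs s3 (if fmt = Image then ''P'' else ''Q''))"
    using out unfolding s'4 by (intro dual_bases_cong) auto
  show "dual_bases n (vecs s' U) (vecs s' E)" unfolding U4 using dual3 dual_bases_swap by auto
  show "imem s' sE [i] \<le> n + 1" if "i < n" for i
    using out(1)[OF that] st3[OF that] m by (auto simp: s'4 m_def split: if_splits)
  show "stored_subspace fmt rv n src s t = coord_subspace n (vecs s' U) {i. imem s' sE [i] \<le> t}" if t: "t < m" for t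
  proof (cases fmt)
    case Image
    have "stored_subspace fmt rv n src s t = coord_subspace n (vecs s3 ''Q'') {i. imem s3 ''st'' [i] \<le> t}"
    proof (rule adapted_image[OF inv3 _ _ t])
      show "stored_subspace fmt rv n src s t = {v \<in> carrier_vec n. \<exists>a. \<forall>l<n. v $ l = (\<Sum>j<n. a j * C t j l)}" for t
        unfolding stored_subspace_def Image subspace_of_image by (simp add: C_def Image m_def)
    qed (use mono m_def in auto)
    also have "\<dots> = coord_subspace n (vecs s' U) {i. imem s3 ''st'' [i] \<le> t}"
      using out(3) Image unfolding s'4 by (intro coord_subspace_cong) auto
    also have "\<dots> = coord_subspace n (vecs s' U) {i. imem s' sE [i] \<le> t}"
      using out(1) Image unfolding s'4 by (auto simp: coord_subspace_def)
    finally show ?thesis .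
  next
    case Kernel
    have "stored_subspace fmt rv n src s t = coord_subspace n (vecs s3 ''P'') {i. m - imem s3 ''st'' [i] \<le> t}"
    proof (rule adapted_kernel[OF inv3 _ _ t])
      show "stored_subspace fmt rv n src s t = {v \<in> carrier_vec n. \<forall>j<n. dot n (C (m - 1 - t) j) (($) v) = 0}" if "t < m" for t
      proof -
        \<comment> \<open>The reversed reading direction for kernels and the reversed numbering of
          their equations cancel.\<close>
        have "chain_index (\<not> rv) m (m - 1 - t) = chain_index rv m t" using that by (auto simp: chain_index_def)
        then show ?thesis
          unfolding stored_subspace_def Kernel subspace_of_kernel by (simp add: C_def[abs_def] Kernel m_def)
      qed
    qed (use mono m_def in auto)
    also have "\<dots> = coord_subspace n (vecs s' U) {i. m - imem s3 ''st'' [i] \<le> t}"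
      using out(3) Kernel unfolding s'4 by (intro coord_subspace_cong) auto
    also have "\<dots> = coord_subspace n (vecs s' U) {i. imem s' sE [i] \<le> t}"
      using out(1) Kernel unfolding s'4 by (auto simp: coord_subspace_def)
    finally show ?thesis .
  qed
  have csrc: "cmem s4 src = cmem s src" by (simp add: s1_def s2_def s3_def s4_def sem_frame)
  show "cmem s' a [i] = (\<Sum>t<m. if imem s' sE [i] \<le> t then cmem s src [chain_index rv m t] else 0)" if i: "i < n" for i
  proof -
    have "cmem s' a [i] = (\<Sum>t<n + 1. if t < m \<and> imem s4 sE [i] \<le> t then cmem s src [chain_index rv m t] else 0)"
    proof -
      have "a \<noteq> src" "sE \<notin> {''j'', ''t''}" using src ne by auto
      from sem_coords_prog[OF nn(4) i this, where rv = rv] show ?thesis by (simp only: s' mm csrc)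
    qed
    also have "\<dots> = (\<Sum>t<m. if imem s' sE [i] \<le> t then cmem s src [chain_index rv m t] else 0)"
      using m by (intro sum.mono_neutral_cong_right) (auto simp: m_def s'4)
    finally show ?thesis .
  qed
qed

subsection \<open>The diagonalising program\<close>

text \<open>\<open>g\<close> becomes the image of \<open>F j\<close> under \<open>A\<close>, and
  \<open>c\<close> its coordinates with respect to \<open>U\<close>, read off by the dual basis
  \<open>E\<close>.\<close>

definition phi_prog :: fprog where
  "phi_prog = copyvec ''f'' ''F'' [iv ''j''] ;; matvec ''g'' ''A'' ''f'' ;; matvec ''c'' ''E'' ''g''"

definition subtract_prog :: fprog where
  "subtract_prog = FFor ''u'' 0
     (FK ''F'' [iv ''j'', iv ''u''] (KSub (KRead ''F'' [iv ''j'', iv ''u''])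
        (KMul (KRead ''c'' [iv ''k'']) (KRead ''F'' [IRead ''mt'' [iv ''k''], iv ''u'']))) ;;
      FK ''V'' [IRead ''mt'' [iv ''k''], iv ''u''] (KAdd (KRead ''V'' [IRead ''mt'' [iv ''k''], iv ''u''])
        (KMul (KRead ''c'' [iv ''k'']) (KRead ''V'' [iv ''j'', iv ''u'']))))"

definition clear_body :: fprog where
  "clear_body = phi_prog ;; FIf (ILess (INum 0) (IRead ''used'' [iv ''k''])) subtract_prog FSkip"

definition match_body :: fprog where
  "match_body = FIf (ieq (IRead ''sE'' [iv ''i'']) (iv ''r''))
     (phi_prog ;; FIf (BAnd (BNot (ILess (INum 0) (IRead ''used'' [iv ''i'']))) (BNot (KEq (KRead ''c'' [iv ''i'']) KZero)))
       (exchange_prog ''U'' ''E'' ;; FI ''used'' [iv ''i''] (INum 1) ;; FI ''mt'' [iv ''i''] (iv ''j'')) FSkip) FSkip"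

definition diag_body :: fprog where
  "diag_body = FIf (ieq (IRead ''sF'' [iv ''j'']) (iv ''s''))
     (FFor ''k'' 0 clear_body ;; FFor ''r'' 2 (FFor ''i'' 0 match_body)) FSkip"

text \<open>Columns are taken by increasing stage in the flag of \<open>y0\<close>, and for each a
  pivot row of least stage in the flag of \<open>x0\<close> is sought; this order makes both kinds
  of exchange respect the flags. Stages range from \<open>0\<close> to \<open>n + 1\<close>, hence
  loops over \<open>n + 2\<close> values.\<close>

definition diag_prog :: fprog where
  "diag_prog = nest [(''j'', 0)] (FI ''used'' [iv ''j''] (INum 0)) ;; FFor ''s'' 2 (FFor ''j'' 0 diag_body)"

lemma writes_diag [simp]:
  "iwrites phi_prog = {''u'', ''w''}" "kwrites phi_prog = {''f'', ''g'', ''c''}" "cwrites phi_prog = {}"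
  "iwrites subtract_prog = {''u''}" "kwrites subtract_prog = {''F'', ''V''}" "cwrites subtract_prog = {}"
  "iwrites clear_body = {''u'', ''w''}" "kwrites clear_body = {''f'', ''g'', ''c'', ''F'', ''V''}" "cwrites clear_body = {}"
  "iwrites match_body = {''u'', ''w'', ''used'', ''mt''}" "kwrites match_body = {''f'', ''g'', ''c'', ''q'', ''U'', ''E''}" "cwrites match_body = {}"
  "iwrites diag_body = {''k'', ''r'', ''i'', ''u'', ''w'', ''used'', ''mt''}"
  "kwrites diag_body = {''f'', ''g'', ''c'', ''q'', ''U'', ''E'', ''F'', ''V''}" "cwrites diag_body = {}"
  "iwrites diag_prog = {''s'', ''j'', ''k'', ''r'', ''i'', ''u'', ''w'', ''used'', ''mt''}"
  "kwrites diag_prog = {''f'', ''g'', ''c'', ''q'', ''U'', ''E'', ''F'', ''V''}" "cwrites diag_prog = {}"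
  by (auto simp: phi_prog_def subtract_prog_def clear_body_def match_body_def diag_body_def diag_prog_def)

lemma wf_diag [simp]: "wf_prog diag_prog"
  by (simp add: diag_prog_def diag_body_def)
    (simp add: clear_body_def match_body_def phi_prog_def subtract_prog_def)

section \<open>Invariants of the diagonalisation\<close>

abbreviation residual :: "nat \<Rightarrow> 'k::field state \<Rightarrow> nat \<Rightarrow> nat \<Rightarrow> 'k" where
  "residual n s j \<equiv> app n (vecs s ''A'') (vecs s ''F'' j)"

abbreviation diag_state :: "nat \<Rightarrow> nat set \<Rightarrow> 'k::field state \<Rightarrow> bool" where
  "diag_state n D s \<equiv> diag_inv n (vecs s ''A'') (vecs s ''U'') (vecs s ''E'') (vecs s ''V'') (vecs s ''F'')
     (nats s ''used'') (nats s ''mt'') D"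

definition flags_kept :: "nat \<Rightarrow> 'k::field state \<Rightarrow> 'k state \<Rightarrow> bool" where
  "flags_kept n s s' \<longleftrightarrow> (\<forall>t.
     coord_subspace n (vecs s' ''U'') {i. imem s ''sE'' [i] \<le> t} = coord_subspace n (vecs s ''U'') {i. imem s ''sE'' [i] \<le> t} \<and>
     coord_subspace n (vecs s' ''V'') {i. imem s ''sF'' [i] \<le> t} = coord_subspace n (vecs s ''V'') {i. imem s ''sF'' [i] \<le> t})"

lemma flags_kept_trans:
  assumes "flags_kept n s r" "flags_kept n r r'" "imem r ''sE'' = imem s ''sE''" "imem r ''sF'' = imem s ''sF''"
  shows "flags_kept n s r'"
  using assms by (simp add: flags_kept_def)

lemma sem_phi:
  fixes s :: "'k::field state"
  assumes n: "imem s ''n'' [] = n" and j: "imem s ''j'' [] = j" and k: "k < n"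
  shows "kmem (sem phi_prog s) ''c'' [k] = dot n (vecs s ''E'' k) (residual n s j)"
    and "kmem (sem phi_prog s) ''g'' [k] = residual n s j k"
proof -
  define s1 s2 where "s1 = sem (copyvec ''f'' ''F'' [iv ''j'']) s" and "s2 = sem (matvec ''g'' ''A'' ''f'') s1"
  have s': "sem phi_prog s = sem (matvec ''c'' ''E'' ''g'') s2" by (simp add: phi_prog_def s1_def s2_def)
  have f: "kmem s1 ''f'' [l] = vecs s ''F'' j l" if "l < n" for l
  proof -
    have "kmem s1 ''f'' [l] = kmem s ''F'' ([j] @ [l])"
      unfolding s1_def using n j that by (intro sem_copyvec) (auto simp: frameD)
    then show ?thesis by simp
  qed
  have nn: "imem s1 ''n'' [] = n" "imem s2 ''n'' [] = n" using n by (simp_all add: s1_def s2_def sem_frame)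
  have g: "kmem s2 ''g'' [l] = residual n s j l" if "l < n" for l
  proof -
    have "kmem s2 ''g'' [l] = dot n (vecs s1 ''A'' l) (\<lambda>l. kmem s1 ''f'' [l])"
      unfolding s2_def using nn that by (intro sem_matvec) auto
    also have "\<dots> = residual n s j l"
      using f by (simp add: dot_def app_def s1_def sem_frame)
    finally show ?thesis .
  qed
  show "kmem (sem phi_prog s) ''g'' [k] = residual n s j k" using g[OF k] by (simp add: s' sem_frame)
  have "kmem (sem phi_prog s) ''c'' [k] = dot n (vecs s2 ''E'' k) (\<lambda>l. kmem s2 ''g'' [l])"
    unfolding s' using nn k by (intro sem_matvec) auto
  also have "\<dots> = dot n (vecs s ''E'' k) (residual n s j)"
    using g by (intro dot_cong) (auto simp: s1_def s2_def sem_frame)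
  finally show "kmem (sem phi_prog s) ''c'' [k] = dot n (vecs s ''E'' k) (residual n s j)" .
qed

lemma sem_subtract:
  fixes s :: "'k::field state"
  assumes n: "imem s ''n'' [] = n" and j: "imem s ''j'' [] = j" and k: "imem s ''k'' [] = k"
    and p: "imem s ''mt'' [k] = p" "p \<noteq> j" and xl: "l < n"
  shows "kmem (sem subtract_prog s) ''F'' [x, l] =
      (if x = j then kmem s ''F'' [j, l] - kmem s ''c'' [k] * kmem s ''F'' [p, l] else kmem s ''F'' [x, l])"
    and "kmem (sem subtract_prog s) ''V'' [x, l] =
      (if x = p then kmem s ''V'' [p, l] + kmem s ''c'' [k] * kmem s ''V'' [j, l] else kmem s ''V'' [x, l])"
proof -
  let ?b = "FK ''F'' [iv ''j'', iv ''u''] (KSub (KRead ''F'' [iv ''j'', iv ''u''])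
        (KMul (KRead ''c'' [iv ''k'']) (KRead ''F'' [IRead ''mt'' [iv ''k''], iv ''u'']))) ;;
      FK ''V'' [IRead ''mt'' [iv ''k''], iv ''u''] (KAdd (KRead ''V'' [IRead ''mt'' [iv ''k''], iv ''u''])
        (KMul (KRead ''c'' [iv ''k'']) (KRead ''V'' [iv ''j'', iv ''u''])))"
  let ?Q = "\<lambda>i r. (\<forall>x l. kmem r ''F'' [x, l] = (if x = j \<and> l < i then kmem s ''F'' [j, l] - kmem s ''c'' [k] * kmem s ''F'' [p, l] else kmem s ''F'' [x, l])) \<and>
    (\<forall>x l. kmem r ''V'' [x, l] = (if x = p \<and> l < i then kmem s ''V'' [p, l] + kmem s ''c'' [k] * kmem s ''V'' [j, l] else kmem s ''V'' [x, l]))"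
  have "?Q (n + 0) (sem (FFor ''u'' 0 ?b) s)"
  proof (rule sem_for[OF n, where Q = ?Q])
    fix i r assume i: "imem r ''u'' [] = i" and fr: "frame (FFor ''u'' 0 ?b) s r" and Q: "?Q i r"
    have fr': "imem r ''j'' [] = j" "imem r ''k'' [] = k" "imem r ''mt'' [k] = p" "kmem r ''c'' = kmem s ''c''"
      using frameD[OF fr] j k p by simp_all
    show "?Q (Suc i) (seti ''u'' (Suc i) (sem ?b r))"
      using Q fr' i p(2) by (auto simp: store_apply less_Suc_eq)
  qed simp
  then show "kmem (sem subtract_prog s) ''F'' [x, l] =
      (if x = j then kmem s ''F'' [j, l] - kmem s ''c'' [k] * kmem s ''F'' [p, l] else kmem s ''F'' [x, l])"
    "kmem (sem subtract_prog s) ''V'' [x, l] =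
      (if x = p then kmem s ''V'' [p, l] + kmem s ''c'' [k] * kmem s ''V'' [j, l] else kmem s ''V'' [x, l])"
    using xl by (simp_all add: subtract_prog_def del: sem.simps)
qed

text \<open>Processed columns have stages at most that of \<open>j\<close>, so subtracting one of
  them from \<open>F j\<close> keeps every subspace of the flag. Clearing row \<open>k\<close>
  leaves the zeros obtained at earlier rows as they were.\<close>

lemma sem_clear_body:
  fixes s :: "'k::field state"
  assumes n: "imem s ''n'' [] = n" and j: "imem s ''j'' [] = j" "j < n" "j \<notin> D" and k: "imem s ''k'' [] = k" "k < n"
    and inv: "diag_state n D s" and ord: "\<And>d. d \<in> D \<Longrightarrow> imem s ''sF'' [d] \<le> imem s ''sF'' [j]"
    and seen: "\<And>i. i < k \<Longrightarrow> imem s ''used'' [i] \<noteq> 0 \<Longrightarrow> dot n (vecs s ''E'' i) (residual n s j) = 0"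
  defines "s' \<equiv> sem clear_body s"
  shows "diag_state n D s' \<and> flags_kept n s s' \<and>
    (\<forall>i<Suc k. imem s' ''used'' [i] \<noteq> 0 \<longrightarrow> dot n (vecs s' ''E'' i) (residual n s' j) = 0)"
proof -
  define s1 where "s1 = sem phi_prog s"
  have c: "kmem s1 ''c'' [i] = dot n (vecs s ''E'' i) (residual n s j)" if "i < n" for i
    using sem_phi(1)[OF n j(1) that] by (simp add: s1_def)
  have k1: "kmem s1 a = kmem s a" if "a \<notin> {''f'', ''g'', ''c''}" for a using that by (simp add: s1_def sem_frame)
  have i1: "imem s1 a = imem s a" if "a \<notin> {''u'', ''w''}" for a using that by (simp add: s1_def sem_frame)
  show ?thesis
  proof (cases "imem s ''used'' [k] = 0")
    case True
    then have "s' = s1" by (simp add: s'_def clear_body_def s1_def[symmetric] i1 k)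
    then show ?thesis using inv seen True by (simp add: k1 i1 flags_kept_def less_Suc_eq)
  next
    case False
    let ?p = "imem s ''mt'' [k]"
    have p: "?p < n" "?p \<in> D" using inv k False by (auto simp: diag_inv_def)
    then have "?p \<noteq> j" using j by auto
    have s': "s' = sem subtract_prog s1" using False by (simp add: s'_def clear_body_def s1_def[symmetric] i1 k)
    note sub = sem_subtract[of s1 n j k ?p, OF _ _ _ _ \<open>?p \<noteq> j\<close>]
    have F': "kmem s' ''F'' [x, l] = (if x = j then kmem s ''F'' [j, l] - kmem s1 ''c'' [k] * kmem s ''F'' [?p, l] else kmem s ''F'' [x, l])"
      and V': "kmem s' ''V'' [x, l] = (if x = ?p then kmem s ''V'' [?p, l] + kmem s1 ''c'' [k] * kmem s ''V'' [j, l] else kmem s ''V'' [x, l])"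
      if "l < n" for x l
      using sub[of l x] that n j k by (simp_all add: s' i1 k1)
    have same: "kmem s' ''A'' = kmem s ''A''" "kmem s' ''U'' = kmem s ''U''" "kmem s' ''E'' = kmem s ''E''"
      "imem s' ''used'' = imem s ''used''" "imem s' ''mt'' = imem s ''mt''"
      by (simp_all add: s' sem_frame k1 i1)
    note step = clear_step[OF inv j(2,3) k(2) False c[OF k(2)], of "vecs s' ''F''" "vecs s' ''V''"]
    have "diag_state n D s'" using step(1) F' V' by (simp add: same)
    moreover have "dot n (vecs s ''E'' i) (residual n s' j) = dot n (vecs s ''E'' i) (residual n s j) - kmem s1 ''c'' [k] * (if i = k then 1 else 0)"
      if "i < n" for i using step(2)[of i] F' V' that by (simp add: same)
    then have "dot n (vecs s' ''E'' i) (residual n s' j) = 0" if "i < Suc k" "imem s' ''used'' [i] \<noteq> 0" for i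
      using that c seen k by (auto simp: same less_Suc_eq)
    moreover have "coord_subspace n (vecs s' ''V'') {i. imem s ''sF'' [i] \<le> t} = coord_subspace n (vecs s ''V'') {i. imem s ''sF'' [i] \<le> t}" for t
      using step(3)[of "{i. imem s ''sF'' [i] \<le> t}"] F' V' ord[OF p(2)] by (simp add: le_trans)
    ultimately show ?thesis by (simp add: flags_kept_def same)
  qed
qed

definition matched :: "nat \<Rightarrow> nat \<Rightarrow> nat set \<Rightarrow> nat set \<Rightarrow> 'k::field state \<Rightarrow> bool" where
  "matched n j D Vis s \<longleftrightarrow>
    diag_state n (insert j D) s \<and> (\<exists>k<n. imem s ''used'' [k] \<noteq> 0 \<and> imem s ''mt'' [k] = j) \<or>
    diag_state n D s \<and> (\<forall>k<n. imem s ''used'' [k] \<noteq> 0 \<longrightarrow> dot n (vecs s ''E'' k) (residual n s j) = 0) \<and>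
      (\<forall>k<n. k \<in> Vis \<longrightarrow> dot n (vecs s ''E'' k) (residual n s j) = 0)"

lemma matched_seti [simp]: "v \<notin> {''used'', ''mt''} \<Longrightarrow> matched n j D Vis (seti v x s) = matched n j D Vis s"
  and flags_kept_seti [simp]: "flags_kept n s (seti v x q) = flags_kept n s q"
  by (auto simp: matched_def flags_kept_def)

lemma sem_match_body:
  fixes s :: "'k::field state"
  assumes n: "imem s ''n'' [] = n" and j: "imem s ''j'' [] = j" "j < n" "j \<notin> D" and i: "imem s ''i'' [] = i" "i < n"
    and r: "imem s ''r'' [] = r" and inv: "matched n j D {k. imem s ''sE'' [k] < r \<or> imem s ''sE'' [k] = r \<and> k < i} s"
  defines "s' \<equiv> sem match_body s"
  shows "matched n j D {k. imem s ''sE'' [k] < r \<or> imem s ''sE'' [k] = r \<and> k < Suc i} s' \<and> flags_kept n s s'"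
proof (cases "imem s ''sE'' [i] = r")
  case False
  then have "s' = s" by (simp add: s'_def match_body_def i r)
  moreover have "{k. imem s ''sE'' [k] < r \<or> imem s ''sE'' [k] = r \<and> k < i} = {k. imem s ''sE'' [k] < r \<or> imem s ''sE'' [k] = r \<and> k < Suc i}"
    using False by (auto simp: less_Suc_eq)
  ultimately show ?thesis using inv by (simp add: flags_kept_def)
next
  case True
  define s1 where "s1 = sem phi_prog s"
  have c: "kmem s1 ''c'' [k] = dot n (vecs s ''E'' k) (residual n s j)"
    and g: "kmem s1 ''g'' [k] = residual n s j k" if "k < n" for k
    using sem_phi[OF n j(1) that] by (simp_all add: s1_def)
  have k1: "kmem s1 a = kmem s a" if "a \<notin> {''f'', ''g'', ''c''}" for a using that by (simp add: s1_def sem_frame)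
  have i1: "imem s1 a = imem s a" if "a \<notin> {''u'', ''w''}" for a using that by (simp add: s1_def sem_frame)
  let ?cond = "imem s ''used'' [i] = 0 \<and> dot n (vecs s ''E'' i) (residual n s j) \<noteq> 0"
  have s': "s' = (if ?cond then sem (exchange_prog ''U'' ''E'' ;; FI ''used'' [iv ''i''] (INum 1) ;; FI ''mt'' [iv ''i''] (iv ''j'')) s1 else s1)"
    using True i(2) c by (simp add: s'_def match_body_def s1_def[symmetric] i r i1 k1)
  show ?thesis
  proof (cases ?cond)
    case False
    then have "s' = s1" using s' by auto
    moreover have "matched n j D {k. imem s ''sE'' [k] < r \<or> imem s ''sE'' [k] = r \<and> k < Suc i} s1"
      using inv False i(2) unfolding matched_def by (auto simp: k1 i1 less_Suc_eq)
    ultimately show ?thesis by (simp add: flags_kept_def k1)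
  next
    case True': True
    have notm: "\<not> (diag_state n (insert j D) s \<and> (\<exists>k<n. imem s ''used'' [k] \<noteq> 0 \<and> imem s ''mt'' [k] = j))"
    proof
      assume a: "diag_state n (insert j D) s \<and> (\<exists>k<n. imem s ''used'' [k] \<noteq> 0 \<and> imem s ''mt'' [k] = j)"
      then obtain k where k: "k < n" "imem s ''used'' [k] \<noteq> 0" "imem s ''mt'' [k] = j" by blast
      have "dot n (vecs s ''E'' i) (residual n s j) = (if i = k then 1 else 0)"
        using dot_used[of n "vecs s ''A''" "vecs s ''U''" "vecs s ''E''" "vecs s ''V''" "vecs s ''F''" "nats s ''used''" "nats s ''mt''" "insert j D" k i] a k i by simp
      then show False using True' k by (auto split: if_splits)
    qed
    then have inv': "diag_state n D s" "\<And>k. k < n \<Longrightarrow> imem s ''used'' [k] \<noteq> 0 \<Longrightarrow> dot n (vecs s ''E'' k) (residual n s j) = 0"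
      "\<And>k. k < n \<Longrightarrow> imem s ''sE'' [k] < r \<Longrightarrow> dot n (vecs s ''E'' k) (residual n s j) = 0"
      using inv unfolding matched_def by auto
    define s2 where "s2 = sem (exchange_prog ''U'' ''E'') s1"
    have s2: "s' = sem (FI ''used'' [iv ''i''] (INum 1) ;; FI ''mt'' [iv ''i''] (iv ''j'')) s2"
      using s' True' by (simp add: s2_def)
    have f2: "imem s2 a = imem s a" if "a \<notin> {''u'', ''w''}" for a using that by (simp add: s2_def sem_frame i1)
    have f2k: "kmem s2 a = kmem s a" if "a \<notin> {''f'', ''g'', ''c'', ''q'', ''U'', ''E''}" for a using that by (simp add: s2_def sem_frame k1)
    have used': "imem s' ''used'' [k] = (if k = i then 1 else imem s ''used'' [k])"
      and mt': "imem s' ''mt'' [k] = (if k = i then j else imem s ''mt'' [k])" for k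
      by (simp_all add: s2 store_apply f2 i j)
    have kk: "kmem s' = kmem s2" by (simp add: s2)
    have E': "kmem s' ''E'' [k, l] = kmem s ''E'' [k, l] - (if k = i then kmem s1 ''c'' [i] - 1 else kmem s1 ''c'' [k]) * (kmem s ''E'' [i, l] / kmem s1 ''c'' [i])"
      and U': "kmem s' ''U'' [k, l] = (if k = i then residual n s j l else kmem s ''U'' [k, l])" if "k < n" "l < n" for k l
      using sem_exchange_prog[of s1 n i "''U''" "''E''" k l] i1 k1 n i that g by (auto simp: kk s2_def)
    have same: "kmem s' ''A'' = kmem s ''A''" "kmem s' ''F'' = kmem s ''F''" "kmem s' ''V'' = kmem s ''V''"
      by (simp_all add: kk f2k)
    have ci: "kmem s1 ''c'' [i] \<noteq> 0" using True' c[OF i(2)] by simp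
    note step = match_step[OF inv'(1) j(2,3) i(2), where c = "\<lambda>k. kmem s1 ''c'' [k]" and E' = "vecs s' ''E''" and U' = "vecs s' ''U''"
        and used' = "nats s' ''used''" and mt' = "nats s' ''mt''"]
    have "diag_state n (insert j D) s'"
      using step(1) True' c ci inv'(2) E' U' used' mt' by (simp add: same)
    moreover have "\<exists>k<n. imem s' ''used'' [k] \<noteq> 0 \<and> imem s' ''mt'' [k] = j"
      using i(2) used' mt' by (intro exI[of _ i]) simp
    \<comment> \<open>Rows of smaller stage were passed with coefficient zero, so the chosen row has
      the least stage among those with a nonzero coefficient.\<close>
    moreover have "coord_subspace n (vecs s' ''U'') {i. imem s ''sE'' [i] \<le> t} = coord_subspace n (vecs s ''U'') {i. imem s ''sE'' [i] \<le> t}" for t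
    proof (rule step(2))
      fix k assume k: "k < n" "kmem s1 ''c'' [k] \<noteq> 0" "k \<in> {i. imem s ''sE'' [i] \<le> t}"
      then have "\<not> imem s ''sE'' [k] < r" using c inv'(3) by auto
      then show "i \<in> {i. imem s ''sE'' [i] \<le> t}" using k True by simp
    qed (use True' c ci inv'(2) E' U' used' mt' in auto)
    ultimately show ?thesis by (simp add: matched_def flags_kept_def same)
  qed
qed

text \<open>If all stages are passed without a match, every coordinate of the image of
  \<open>F j\<close> is zero and the column is annihilated; otherwise it is matched. Either way it
  counts as processed.\<close>

lemma sem_diag_body:
  fixes s :: "'k::field state"
  assumes n: "imem s ''n'' [] = n" and j: "imem s ''j'' [] = j" "j < n" "j \<notin> D" and js: "imem s ''sF'' [j] = imem s ''s'' []"
    and inv: "diag_state n D s" and ord: "\<And>d. d \<in> D \<Longrightarrow> imem s ''sF'' [d] \<le> imem s ''sF'' [j]"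
    and sE: "\<And>i. i < n \<Longrightarrow> imem s ''sE'' [i] \<le> n + 1"
  shows "diag_state n (insert j D) (sem diag_body s) \<and> flags_kept n s (sem diag_body s)"
proof -
  define s1 where "s1 = sem (FFor ''k'' 0 clear_body) s"
  have s': "sem diag_body s = sem (FFor ''r'' 2 (FFor ''i'' 0 match_body)) s1"
    using js by (simp add: diag_body_def s1_def j(1))
  let ?Q = "\<lambda>k r. diag_state n D r \<and> flags_kept n s r \<and>
    (\<forall>i<k. imem r ''used'' [i] \<noteq> 0 \<longrightarrow> dot n (vecs r ''E'' i) (residual n r j) = 0)"
  have "?Q (n + 0) s1"
    unfolding s1_def
  proof (rule sem_for[OF n, where Q = ?Q])
    show "?Q 0 (seti ''k'' 0 s)" using inv by (simp add: flags_kept_def)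
    fix k r assume k: "k < n + 0" "imem r ''k'' [] = k" and fr: "frame (FFor ''k'' 0 clear_body) s r" and Q: "?Q k r"
    have fr': "imem r ''n'' [] = n" "imem r ''j'' [] = j" "imem r ''sF'' = imem s ''sF''" "imem r ''sE'' = imem s ''sE''"
      using frameD[OF fr] n j by simp_all
    have k': "k < n" using k by simp
    have ord': "imem r ''sF'' [d] \<le> imem r ''sF'' [j]" if "d \<in> D" for d using ord that fr' by simp
    have dr: "diag_state n D r" and fk: "flags_kept n s r"
      and seen: "dot n (vecs r ''E'' i) (residual n r j) = 0" if "i < k" "imem r ''used'' [i] \<noteq> 0" for i
      using Q that by auto
    have "diag_state n D (sem clear_body r) \<and> flags_kept n r (sem clear_body r) \<and>
      (\<forall>i<Suc k. imem (sem clear_body r) ''used'' [i] \<noteq> 0 \<longrightarrow> dot n (vecs (sem clear_body r) ''E'' i) (residual n (sem clear_body r) j) = 0)"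
      using Q ord' by (intro sem_clear_body[OF fr'(1,2) j(2,3) k(2) k']) auto
    moreover from this have "flags_kept n s (sem clear_body r)" using Q flags_kept_trans[of n s r] fr' by blast
    ultimately show "?Q (Suc k) (seti ''k'' (Suc k) (sem clear_body r))" by (simp add: flags_kept_def)
  qed
  then have s1: "diag_state n D s1" "flags_kept n s s1" "\<And>i. i < n \<Longrightarrow> imem s1 ''used'' [i] \<noteq> 0 \<Longrightarrow> dot n (vecs s1 ''E'' i) (residual n s1 j) = 0"
    by auto
  have f1: "imem s1 ''n'' [] = n" "imem s1 ''j'' [] = j" "imem s1 ''sE'' = imem s ''sE''" "imem s1 ''sF'' = imem s ''sF''"
    using n j by (simp_all add: s1_def iter_frame)
  let ?R = "\<lambda>r q. matched n j D {k. imem s ''sE'' [k] < r} q \<and> flags_kept n s q"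
  have "?R (n + 2) (sem diag_body s)"
    unfolding s'
  proof (rule sem_for[OF f1(1), where Q = ?R])
    show "?R 0 (seti ''r'' 0 s1)" using s1 by (simp add: matched_def flags_kept_def)
    fix r q assume r: "imem q ''r'' [] = r" and fr: "frame (FFor ''r'' 2 (FFor ''i'' 0 match_body)) s1 q" and R: "?R r q"
    have fq: "imem q ''n'' [] = n" "imem q ''j'' [] = j" "imem q ''sE'' = imem s ''sE''" "imem q ''sF'' = imem s ''sF''"
      using frameD[OF fr] f1 by simp_all
    let ?S = "\<lambda>i q. matched n j D {k. imem s ''sE'' [k] < r \<or> imem s ''sE'' [k] = r \<and> k < i} q \<and> flags_kept n s q"
    have "?S (n + 0) (sem (FFor ''i'' 0 match_body) q)"
    proof (rule sem_for[OF fq(1), where Q = ?S])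
      show "?S 0 (seti ''i'' 0 q)" using R by (simp add: matched_def flags_kept_def)
      fix i p assume i: "i < n + 0" "imem p ''i'' [] = i" and fr2: "frame (FFor ''i'' 0 match_body) q p" and S: "?S i p"
      have fp: "imem p ''n'' [] = n" "imem p ''j'' [] = j" "imem p ''sE'' = imem s ''sE''" "imem p ''sF'' = imem s ''sF''" "imem p ''r'' [] = r"
        using frameD[OF fr2] fq r by simp_all
      have i': "i < n" using i by simp
      have "matched n j D {k. imem p ''sE'' [k] < r \<or> imem p ''sE'' [k] = r \<and> k < Suc i} (sem match_body p) \<and> flags_kept n p (sem match_body p)"
        using S fp by (intro sem_match_body[OF fp(1,2) j(2,3) i(2) i' fp(5)]) simp
      moreover from this have "flags_kept n s (sem match_body p)" using S flags_kept_trans[of n s p] fp by blast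
      ultimately show "?S (Suc i) (seti ''i'' (Suc i) (sem match_body p))" using fp by (simp add: matched_def flags_kept_def)
    qed
    moreover have "matched n j D {k. imem s ''sE'' [k] < r \<or> imem s ''sE'' [k] = r \<and> k < n} p = matched n j D {k. imem s ''sE'' [k] < Suc r} p" for p :: "'k state"
      unfolding matched_def by (auto simp: less_Suc_eq)
    ultimately show "?R (Suc r) (seti ''r'' (Suc r) (sem (FFor ''i'' 0 match_body) q))"
      by (simp del: sem.simps)
  qed
  then have fin: "matched n j D {k. imem s ''sE'' [k] < n + 2} (sem diag_body s)" "flags_kept n s (sem diag_body s)" by auto
  have "diag_state n (insert j D) (sem diag_body s)"
    using fin(1) unfolding matched_def
  proof (elim disjE conjE)
    assume a: "diag_state n D (sem diag_body s)"
      "\<forall>k<n. k \<in> {k. imem s ''sE'' [k] < n + 2} \<longrightarrow> dot n (vecs (sem diag_body s) ''E'' k) (residual n (sem diag_body s) j) = 0"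
    show ?thesis
      by (rule unmatched_step[OF a(1) j(2)]) (use a(2) sE in \<open>auto simp: less_Suc_eq_le\<close>)
  qed
  then show ?thesis using fin(2) by blast
qed

lemma sem_diag_prog:
  fixes s :: "'k::field state"
  assumes n: "imem s ''n'' [] = n" and dual: "dual_bases n (vecs s ''U'') (vecs s ''E'')" "dual_bases n (vecs s ''V'') (vecs s ''F'')"
    and sE: "\<And>i. i < n \<Longrightarrow> imem s ''sE'' [i] \<le> n + 1" and sF: "\<And>i. i < n \<Longrightarrow> imem s ''sF'' [i] \<le> n + 1"
  shows "diag_state n {..<n} (sem diag_prog s)" "flags_kept n s (sem diag_prog s)"
proof -
  define s1 where "s1 = sem (nest [(''j'', 0)] (FI ''used'' [iv ''j''] (INum 0))) s"
  have s': "sem diag_prog s = sem (FFor ''s'' 2 (FFor ''j'' 0 diag_body)) s1" by (simp add: diag_prog_def s1_def)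
  have used: "imem s1 ''used'' [k] = 0" if "k < n" for k
  proof -
    have "imem s1 ''used'' [k] = (if \<exists>js. list_all2 (\<lambda>vk j. j < n + snd vk) [(''j'', 0)] js \<and> [k] \<in> {js} then 0 else imem s ''used'' [k])"
      unfolding s1_def
      by (rule sem_nest[OF n, where sel = "\<lambda>s. imem s ''used''" and Bl = "\<lambda>js. {js}"]) (auto simp: store_apply)
    then show ?thesis using that by (auto simp: list_all2_1)
  qed
  have f1: "kmem s1 = kmem s" "imem s1 ''n'' [] = n" "imem s1 ''sE'' = imem s ''sE''" "imem s1 ''sF'' = imem s ''sF''"
    using n by (simp_all add: s1_def sem_frame fun_eq_iff del: nest.simps)
  let ?R = "\<lambda>t q. diag_state n {d. d < n \<and> imem s ''sF'' [d] < t} q \<and> flags_kept n s q"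
  have "?R (n + 2) (sem diag_prog s)"
    unfolding s'
  proof (rule sem_for[OF f1(2), where Q = ?R])
    show "?R 0 (seti ''s'' 0 s1)" using dual used f1 by (simp add: diag_inv_def flags_kept_def)
    fix t q assume t: "imem q ''s'' [] = t" and fr: "frame (FFor ''s'' 2 (FFor ''j'' 0 diag_body)) s1 q" and R: "?R t q"
    have fq: "imem q ''n'' [] = n" "imem q ''sE'' = imem s ''sE''" "imem q ''sF'' = imem s ''sF''"
      using frameD[OF fr] f1 by simp_all
    \<comment> \<open>Lexicographic order by stage and index; processed columns then have stages no
      greater than the current one, as clearing requires.\<close>
    let ?D = "\<lambda>j. {d. d < n \<and> (imem s ''sF'' [d] < t \<or> imem s ''sF'' [d] = t \<and> d < j)}"
    let ?S = "\<lambda>j q. diag_state n (?D j) q \<and> flags_kept n s q"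
    have "?S (n + 0) (sem (FFor ''j'' 0 diag_body) q)"
    proof (rule sem_for[OF fq(1), where Q = ?S])
      show "?S 0 (seti ''j'' 0 q)" using R by (simp add: flags_kept_def)
      fix j p assume j: "j < n + 0" "imem p ''j'' [] = j" and fr2: "frame (FFor ''j'' 0 diag_body) q p" and S: "?S j p"
      have fp: "imem p ''n'' [] = n" "imem p ''sE'' = imem s ''sE''" "imem p ''sF'' = imem s ''sF''" "imem p ''s'' [] = t"
        using frameD[OF fr2] fq t by simp_all
      show "?S (Suc j) (seti ''j'' (Suc j) (sem diag_body p))"
      proof (cases "imem s ''sF'' [j] = t")
        case False
        then have "sem diag_body p = p" by (simp add: diag_body_def j fp)
        moreover have "?D (Suc j) = ?D j" using False by (auto simp: less_Suc_eq)
        ultimately show ?thesis using S by (simp add: flags_kept_def)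
      next
        case True
        have "diag_state n (insert j (?D j)) (sem diag_body p) \<and> flags_kept n p (sem diag_body p)"
          by (rule sem_diag_body[OF fp(1) j(2)]) (use S fp j True sE in auto)
        moreover from this have "flags_kept n s (sem diag_body p)" using S flags_kept_trans[of n s p] fp by blast
        moreover have "insert j (?D j) = ?D (Suc j)" using True j by auto
        ultimately show ?thesis by (simp add: flags_kept_def)
      qed
    qed
    moreover have "?D n = {d. d < n \<and> imem s ''sF'' [d] < Suc t}" by auto
    ultimately show "?R (Suc t) (seti ''s'' (Suc t) (sem (FFor ''j'' 0 diag_body) q))"
      by (simp add: flags_kept_def del: sem.simps)
  qed
  moreover have "{d. d < n \<and> imem s ''sF'' [d] < n + 2} = {..<n}" using sF by (auto simp: less_Suc_eq_le)
  ultimately show "diag_state n {..<n} (sem diag_prog s)" "flags_kept n s (sem diag_prog s)" by auto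
qed

subsection \<open>The proximal step\<close>

text \<open>\<open>(2 * n + 1) * lambda\<close> by repeated addition, since naturals cannot be
  converted into coefficients and \<open>0\<close> and \<open>1\<close> are the only
  constants.\<close>

definition kappa_prog :: fprog where
  "kappa_prog = FC ''h'' [] (CRead ''lambda'' []) ;;
     FFor ''u'' 0 (FC ''h'' [] (CAdd (CRead ''h'' []) (CAdd (CRead ''lambda'' []) (CRead ''lambda'' []))))"

text \<open>With \<open>b\<close> standing for one minus the coordinate of the second point, the gap
  reads \<open>a + b - 1\<close>; the inner conditional takes the minimum in
  \<open>step_size\<close>.\<close>

definition step_body :: fprog where
  "step_body = FIf (ILess (INum 0) (IRead ''used'' [iv ''i'']))
     (FIf (CLess COne (CAdd (CRead ''a'' [iv ''i'']) (CRead ''b'' [IRead ''mt'' [iv ''i'']])))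
       (FC ''d'' [] (CDiv (CSub (CAdd (CRead ''a'' [iv ''i'']) (CRead ''b'' [IRead ''mt'' [iv ''i'']])) COne) (CAdd COne COne)) ;;
        FIf (CLess (CRead ''h'' []) (CRead ''d'' [])) (FC ''d'' [] (CRead ''h'' [])) FSkip ;;
        FC ''a'' [iv ''i''] (CSub (CRead ''a'' [iv ''i'']) (CRead ''d'' [])) ;;
        FC ''b'' [IRead ''mt'' [iv ''i'']] (CSub (CRead ''b'' [IRead ''mt'' [iv ''i'']]) (CRead ''d'' []))) FSkip) FSkip"

definition update_prog :: fprog where
  "update_prog = kappa_prog ;; FFor ''i'' 0 step_body"

lemma writes_update [simp]:
  "iwrites kappa_prog = {''u''}" "kwrites kappa_prog = {}" "cwrites kappa_prog = {''h''}"
  "iwrites step_body = {}" "kwrites step_body = {}" "cwrites step_body = {''d'', ''a'', ''b''}"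
  "iwrites update_prog = {''u'', ''i''}" "kwrites update_prog = {}" "cwrites update_prog = {''h'', ''d'', ''a'', ''b''}"
  "wf_prog update_prog"
proof -
  show "iwrites kappa_prog = {''u''}" "kwrites kappa_prog = {}" "cwrites kappa_prog = {''h''}"
    "iwrites step_body = {}" "kwrites step_body = {}" "cwrites step_body = {''d'', ''a'', ''b''}"
    by (auto simp: kappa_prog_def step_body_def)
  then show "iwrites update_prog = {''u'', ''i''}" "kwrites update_prog = {}" "cwrites update_prog = {''h'', ''d'', ''a'', ''b''}"
    by (auto simp: update_prog_def)
  show "wf_prog update_prog" by (simp add: update_prog_def kappa_prog_def step_body_def)
qed

text \<open>Injectivity of the matching keeps the updates of \<open>b\<close> apart, so each round
  sees the original values.\<close>

lemma sem_update:
  fixes s :: "'k::field state"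
  assumes n: "imem s ''n'' [] = n" and inj: "inj_on (nats s ''mt'') {i. i < n \<and> imem s ''used'' [i] \<noteq> 0}"
  defines "\<delta> \<equiv> \<lambda>i. if imem s ''used'' [i] \<noteq> 0 then step_size (2 * real n + 1) (cmem s ''lambda'' [])
      (cmem s ''a'' [i]) (1 - cmem s ''b'' [imem s ''mt'' [i]]) else 0"
  shows "i < n \<Longrightarrow> cmem (sem update_prog s) ''a'' [i] = cmem s ''a'' [i] - \<delta> i"
    and "i < n \<Longrightarrow> imem s ''used'' [i] \<noteq> 0 \<Longrightarrow>
      cmem (sem update_prog s) ''b'' [imem s ''mt'' [i]] = cmem s ''b'' [imem s ''mt'' [i]] - \<delta> i"
    and "(\<And>i. i < n \<Longrightarrow> imem s ''used'' [i] \<noteq> 0 \<Longrightarrow> imem s ''mt'' [i] \<noteq> j) \<Longrightarrow>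
      cmem (sem update_prog s) ''b'' [j] = cmem s ''b'' [j]"
proof -
  let ?lam = "cmem s ''lambda'' []"
  let ?kb = "FC ''h'' [] (CAdd (CRead ''h'' []) (CAdd (CRead ''lambda'' []) (CRead ''lambda'' [])))"
  define s0 s1 where "s0 = sem (FC ''h'' [] (CRead ''lambda'' [])) s" and "s1 = sem (FFor ''u'' 0 ?kb) s0"
  have s': "sem update_prog s = sem (FFor ''i'' 0 step_body) s1"
    by (simp add: update_prog_def kappa_prog_def s0_def s1_def)
  have f0: "imem s0 ''n'' [] = n" "cmem s0 ''h'' [] = ?lam" "cmem s0 ''lambda'' [] = ?lam"
    using n by (simp_all add: s0_def store_apply)
  have "cmem s1 ''h'' [] = (2 * real (n + 0) + 1) * ?lam"
    unfolding s1_def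
  proof (rule sem_for[OF f0(1), where Q = "\<lambda>i r. cmem r ''h'' [] = (2 * real i + 1) * ?lam"])
    fix i r assume fr: "frame (FFor ''u'' 0 ?kb) s0 r" and Q: "cmem r ''h'' [] = (2 * real i + 1) * ?lam"
    have "cmem r ''lambda'' [] = ?lam" using frameD(3)[OF fr, of "''lambda''"] f0 by simp
    then show "cmem (seti ''u'' (Suc i) (sem ?kb r)) ''h'' [] = (2 * real (Suc i) + 1) * ?lam"
      using Q by (simp add: store_apply algebra_simps)
  qed (use f0 in simp)
  then have h: "cmem s1 ''h'' [] = (2 * real n + 1) * ?lam" by simp
  have f1: "imem s1 ''n'' [] = n" "cmem s1 ''a'' = cmem s ''a''" "cmem s1 ''b'' = cmem s ''b''" "imem s1 ''used'' = imem s ''used''" "imem s1 ''mt'' = imem s ''mt''"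
    using f0 by (simp_all add: s1_def s0_def iter_frame store_apply)
  let ?mt = "nats s ''mt''" and ?used = "\<lambda>k. imem s ''used'' [k] \<noteq> 0"
  let ?Q = "\<lambda>i r. (\<forall>k. cmem r ''a'' [k] = (if k < i then cmem s ''a'' [k] - \<delta> k else cmem s ''a'' [k])) \<and>
    (\<forall>k<i. ?used k \<longrightarrow> cmem r ''b'' [?mt k] = cmem s ''b'' [?mt k] - \<delta> k) \<and>
    (\<forall>j. (\<forall>k<i. ?used k \<longrightarrow> ?mt k \<noteq> j) \<longrightarrow> cmem r ''b'' [j] = cmem s ''b'' [j])"
  have "?Q (n + 0) (sem update_prog s)"
    unfolding s'
  proof (rule sem_for[OF f1(1), where Q = ?Q])
    show "?Q 0 (seti ''i'' 0 s1)" using f1 by simp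
    fix i r assume i: "i < n + 0" "imem r ''i'' [] = i" and fr: "frame (FFor ''i'' 0 step_body) s1 r" and Q: "?Q i r"
    have fr': "imem r ''used'' = imem s ''used''" "imem r ''mt'' = imem s ''mt''" "cmem r ''h'' [] = (2 * real n + 1) * ?lam"
      using frameD[OF fr] f1 h by simp_all
    have a: "cmem r ''a'' [i] = cmem s ''a'' [i]" using Q by simp
    show "?Q (Suc i) (seti ''i'' (Suc i) (sem step_body r))"
    proof (cases "?used i")
      case False
      then have "sem step_body r = r" "\<delta> i = 0" using i fr' by (auto simp: step_body_def \<delta>_def)
      then show ?thesis using Q False by (auto simp: less_Suc_eq)
    next
      case True
      have ne: "?mt k \<noteq> ?mt i" if "k < i" "?used k" for k
        using inj_onD[OF inj, of k i] that i True by auto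
      then have b: "cmem r ''b'' [?mt i] = cmem s ''b'' [?mt i]" using Q by blast
      let ?g = "cmem s ''a'' [i] + cmem s ''b'' [?mt i]"
      have upd: "cmem (sem step_body r) ''a'' = (cmem r ''a'')([i] := cmem r ''a'' [i] - \<delta> i) \<and>
        cmem (sem step_body r) ''b'' = (cmem r ''b'')([?mt i] := cmem r ''b'' [?mt i] - \<delta> i)"
      proof (cases "1 < ?g")
        case False
        then have "\<delta> i = 0" by (simp add: \<delta>_def step_size_def)
        moreover have "sem step_body r = r" using False i fr' a b by (simp add: step_body_def)
        ultimately show ?thesis by simp
      next
        case g: True
        have d: "\<delta> i = (if (2 * real n + 1) * ?lam < (?g - 1) / 2 then (2 * real n + 1) * ?lam else (?g - 1) / 2)"
          using True g by (auto simp: \<delta>_def step_size_def min_def field_simps)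
        show ?thesis unfolding d using True g i fr' a b by (simp add: step_body_def store_apply)
      qed
      have "cmem (sem step_body r) ''b'' [?mt k] = cmem s ''b'' [?mt k] - \<delta> k" if "k < Suc i" "?used k" for k
        using upd Q ne[of k] b that by (cases "k = i") auto
      moreover have "cmem (sem step_body r) ''b'' [j] = cmem s ''b'' [j]" if "\<forall>k<Suc i. ?used k \<longrightarrow> ?mt k \<noteq> j" for j
        using upd Q that True by auto
      ultimately show ?thesis using upd Q by (auto simp: less_Suc_eq)
    qed
  qed
  then show "i < n \<Longrightarrow> cmem (sem update_prog s) ''a'' [i] = cmem s ''a'' [i] - \<delta> i"
    and "i < n \<Longrightarrow> imem s ''used'' [i] \<noteq> 0 \<Longrightarrow>
      cmem (sem update_prog s) ''b'' [imem s ''mt'' [i]] = cmem s ''b'' [imem s ''mt'' [i]] - \<delta> i"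
    and "(\<And>i. i < n \<Longrightarrow> imem s ''used'' [i] \<noteq> 0 \<Longrightarrow> imem s ''mt'' [i] \<noteq> j) \<Longrightarrow>
      cmem (sem update_prog s) ''b'' [j] = cmem s ''b'' [j]" by auto
qed

subsection \<open>Output\<close>

text \<open>The nested negations spell out the disjunction in \<open>rank_position\<close>; equality
  of coefficients amounts to two failed comparisons.\<close>

definition count_body :: "string \<Rightarrow> fprog" where
  "count_body a = FIf (BNot (BAnd (BNot (CLess (CRead a [iv ''i'']) (CRead a [iv ''k''])))
       (BNot (BAnd (BNot (CLess (CRead a [iv ''k'']) (CRead a [iv ''i'']))) (ILess (iv ''k'') (iv ''i''))))))
     (FI ''pos'' [iv ''i''] (IAdd (IRead ''pos'' [iv ''i'']) (INum 1))) FSkip"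

definition rank_prog :: "string \<Rightarrow> fprog" where
  "rank_prog a = FFor ''i'' 0 (FI ''pos'' [iv ''i''] (INum 0) ;; FFor ''k'' 0 (count_body a))"

text \<open>Scatters the coordinates to their sorted positions, between the sentinels
  \<open>1\<close> and \<open>0\<close> that \<open>sorted_point\<close> expects.\<close>

definition level_prog :: "string \<Rightarrow> fprog" where
  "level_prog a = FC ''v'' [INum 0] COne ;; FC ''v'' [IAdd (iv ''n'') (INum 1)] CZero ;;
     FFor ''i'' 0 (FC ''v'' [IAdd (IRead ''pos'' [iv ''i'']) (INum 1)] (CRead a [iv ''i'']))"

text \<open>Prefix chains ascend by inclusion, so on the reversed side level \<open>t\<close> goes
  to slot \<open>n - t\<close>. The map is an involution on levels, which lets slots and levels be
  exchanged.\<close>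

definition out_index :: "bool \<Rightarrow> nat \<Rightarrow> nat \<Rightarrow> nat" where
  "out_index rv n t = (if rv then n - t else t)"

definition out_index_exp :: "bool \<Rightarrow> iexp" where
  "out_index_exp rv = (if rv then ISub (iv ''n'') (iv ''t'') else iv ''t'')"

lemma ival_out_index [simp]: "ival s (out_index_exp rv) = out_index rv (imem s ''n'' []) (imem s ''t'' [])"
  by (simp add: out_index_exp_def out_index_def)

lemma out_index_idem [simp]: "t \<le> n \<Longrightarrow> out_index rv n (out_index rv n t) = t"
  by (simp add: out_index_def)

text \<open>The subspace of level \<open>t\<close> is spanned by the basis vectors at sorted
  positions below \<open>t\<close>, or cut out by the functionals at the remaining ones; zero
  columns or rows pad the matrix to size \<open>n\<close>.\<close>

definition matrix_body :: "subspace_format \<Rightarrow> bool \<Rightarrow> string \<Rightarrow> string \<Rightarrow> string \<Rightarrow> fprog" where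
  "matrix_body fmt rv E U x = (let ix = [out_index_exp rv, iv ''k'', iv ''u''] in
     if fmt = Image
     then FIf (ILess (IRead ''pos'' [iv ''u'']) (iv ''t'')) (FK x ix (KRead E [iv ''u'', iv ''k''])) (FK x ix KZero)
     else FIf (ILess (IRead ''pos'' [iv ''k'']) (iv ''t'')) (FK x ix KZero) (FK x ix (KRead U [iv ''k'', iv ''u''])))"

definition output_prog :: "subspace_format \<Rightarrow> bool \<Rightarrow> string \<Rightarrow> string \<Rightarrow> string \<Rightarrow> string \<Rightarrow> fprog" where
  "output_prog fmt rv a E U x = rank_prog a ;; level_prog a ;; FI x [] (IAdd (iv ''n'') (INum 1)) ;;
     nest [(''t'', 1)] (FC x [out_index_exp rv] (CSub (CRead ''v'' [iv ''t'']) (CRead ''v'' [IAdd (iv ''t'') (INum 1)]))) ;;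
     nest [(''t'', 1), (''k'', 0), (''u'', 0)] (matrix_body fmt rv E U x)"

lemma writes_output [simp]:
  "iwrites (count_body a) = {''pos''}" "kwrites (count_body a) = {}" "cwrites (count_body a) = {}"
  "iwrites (rank_prog a) = {''i'', ''k'', ''pos''}" "kwrites (rank_prog a) = {}" "cwrites (rank_prog a) = {}"
  "iwrites (level_prog a) = {''i''}" "kwrites (level_prog a) = {}" "cwrites (level_prog a) = {''v''}"
  "iwrites (matrix_body fmt rv E U x) = {}" "kwrites (matrix_body fmt rv E U x) = {x}" "cwrites (matrix_body fmt rv E U x) = {}"
  "iwrites (output_prog fmt rv a E U x) = {''i'', ''k'', ''pos'', ''t'', ''u'', x}" "kwrites (output_prog fmt rv a E U x) = {x}"
  "cwrites (output_prog fmt rv a E U x) = {''v'', x}" "wf_prog (matrix_body fmt rv E U x)" "wf_prog (output_prog fmt rv a E U x)"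
  by (auto simp: count_body_def rank_prog_def level_prog_def matrix_body_def Let_def output_prog_def)

lemma sem_rank_prog:
  fixes s :: "'k::field state"
  assumes n: "imem s ''n'' [] = n" and i: "i < n"
  shows "imem (sem (rank_prog a) s) ''pos'' [i] = rank_position n (\<lambda>i. cmem s a [i]) i"
proof -
  let ?a = "\<lambda>i. cmem s a [i]"
  let ?p = "FI ''pos'' [iv ''i''] (INum 0) ;; FFor ''k'' 0 (count_body a)"
  have "imem (sem (rank_prog a) s) ''pos'' [i] = (if \<exists>j<n + 0. [i] \<in> {[j]} then rank_position n ?a (hd [i]) else imem s ''pos'' [i])"
    unfolding rank_prog_def
  proof (rule sem_for_block[OF n, where sel = "\<lambda>s. imem s ''pos''"])
    fix i r x assume ri: "imem r ''i'' [] = i" and fr: "frame (FFor ''i'' 0 ?p) s r"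
    define r1 where "r1 = sem (FI ''pos'' [iv ''i''] (INum 0)) r"
    have f1: "imem r1 ''n'' [] = n" "imem r1 ''i'' [] = i" "cmem r1 a = cmem s a" "imem r1 ''pos'' = (imem r ''pos'')([i] := 0)"
      using frameD[OF fr] n ri by (auto simp: r1_def store_apply)
    let ?S = "\<lambda>m. {k. k < m \<and> (?a i < ?a k \<or> ?a k = ?a i \<and> k < i)}"
    have "imem (sem (FFor ''k'' 0 (count_body a)) r1) ''pos'' = (imem r ''pos'')([i] := card (?S (n + 0)))"
    proof (rule sem_for[OF f1(1), where Q = "\<lambda>m q. imem q ''pos'' = (imem r ''pos'')([i] := card (?S m))"])
      fix m q assume m: "imem q ''k'' [] = m" and fq: "frame (FFor ''k'' 0 (count_body a)) r1 q"
        and Q: "imem q ''pos'' = (imem r ''pos'')([i] := card (?S m))"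
      have fq': "imem q ''i'' [] = i" "cmem q a = cmem s a" using frameD[OF fq] f1 by simp_all
      have "?S (Suc m) = (if ?a i < ?a m \<or> ?a m = ?a i \<and> m < i then insert m (?S m) else ?S m)"
        by (auto simp: less_Suc_eq)
      then have "card (?S (Suc m)) = (if ?a i < ?a m \<or> ?a m = ?a i \<and> m < i then Suc (card (?S m)) else card (?S m))"
        by simp
      moreover have "imem (sem (count_body a) q) ''pos'' =
          (if ?a i < ?a m \<or> ?a m = ?a i \<and> m < i then (imem q ''pos'')([i] := Suc (imem q ''pos'' [i])) else imem q ''pos'')"
        using fq' m by (auto simp: count_body_def store_apply)
      ultimately show "imem (seti ''k'' (Suc m) (sem (count_body a) q)) ''pos'' = (imem r ''pos'')([i] := card (?S (Suc m)))"
        using Q by simp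
    qed (use f1 in simp)
    then show "imem (sem ?p r) ''pos'' x = (if x \<in> {[i]} then rank_position n ?a (hd x) else imem r ''pos'' x)"
      by (simp add: r1_def rank_position_def)
  qed simp
  then show ?thesis using i by simp
qed

lemma sem_level_prog:
  fixes s :: "'k::field state"
  assumes n: "imem s ''n'' [] = n" and pos: "bij_betw (nats s ''pos'') {..<n} {..<n}" and ne: "a \<noteq> ''v''"
  defines "v \<equiv> \<lambda>t. cmem (sem (level_prog a) s) ''v'' [t]"
  shows "v 0 = 1" "v (Suc n) = 0" "i < n \<Longrightarrow> v (Suc (imem s ''pos'' [i])) = cmem s a [i]"
proof -
  let ?b = "FC ''v'' [IAdd (IRead ''pos'' [iv ''i'']) (INum 1)] (CRead a [iv ''i''])"
  define s1 where "s1 = sem (FC ''v'' [INum 0] COne ;; FC ''v'' [IAdd (iv ''n'') (INum 1)] CZero) s"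
  have s': "sem (level_prog a) s = sem (FFor ''i'' 0 ?b) s1" by (simp add: level_prog_def s1_def)
  have f1: "imem s1 ''n'' [] = n" "imem s1 ''pos'' = imem s ''pos''" "cmem s1 a = cmem s a"
    "cmem s1 ''v'' [0] = 1" "cmem s1 ''v'' [Suc n] = 0"
    using n ne by (auto simp: s1_def store_apply)
  let ?inv = "inv_into {..<n} (nats s ''pos'')"
  have inv: "?inv (imem s ''pos'' [i]) = i" if "i < n" for i
    using pos that inv_into_f_f[of "nats s ''pos''" "{..<n}" i] by (simp add: bij_betw_def)
  have val: "v t = (if \<exists>i<n + 0. [t] \<in> {[Suc (imem s ''pos'' [i])]} then cmem s a [?inv (hd [t] - 1)] else cmem s1 ''v'' [t])" for t
    unfolding v_def s'
  proof (rule sem_for_block[OF f1(1), where sel = "\<lambda>s. cmem s ''v''"])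
    fix i r x assume i: "i < n + 0" "imem r ''i'' [] = i" and fr: "frame (FFor ''i'' 0 ?b) s1 r"
    have "imem r ''pos'' = imem s ''pos''" "cmem r a = cmem s a" using frameD[OF fr] f1 ne by simp_all
    then show "cmem (sem ?b r) ''v'' x = (if x \<in> {[Suc (imem s ''pos'' [i])]} then cmem s a [?inv (hd x - 1)] else cmem r ''v'' x)"
      using i inv[of i] by (auto simp: store_apply)
  qed simp
  have less: "imem s ''pos'' [i] < n" if "i < n" for i using pos that by (auto simp: bij_betw_def)
  show "v 0 = 1" using val[of 0] f1 by simp
  have "\<not> (\<exists>i<n + 0. [Suc n] \<in> {[Suc (imem s ''pos'' [i])]})" using less by force
  then show "v (Suc n) = 0" by (rule trans[OF val[of "Suc n"] trans[OF if_not_P f1(5)]])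
  show "i < n \<Longrightarrow> v (Suc (imem s ''pos'' [i])) = cmem s a [i]" using val[of "Suc (imem s ''pos'' [i])"] inv by auto
qed

lemma sem_output_prog:
  fixes s :: "'k::field state" and fmt :: subspace_format and rv :: bool
  assumes n: "imem s ''n'' [] = n" and ne: "a \<noteq> ''v''" "x \<noteq> a" "x \<noteq> ''v''" "x \<noteq> E" "x \<noteq> U" "x \<notin> {''n'', ''pos'', ''t'', ''k'', ''u''}"
  defines "s' \<equiv> sem (output_prog fmt rv a E U x) s" and "pos \<equiv> rank_position n (\<lambda>i. cmem s a [i])"
  obtains v where "v 0 = 1" "v (Suc n) = 0" "\<And>i. i < n \<Longrightarrow> v (Suc (pos i)) = cmem s a [i]"
    "imem s' x [] = Suc n" "\<And>t. t \<le> n \<Longrightarrow> cmem s' x [out_index rv n t] = v t - v (Suc t)"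
    "\<And>t k u. t \<le> n \<Longrightarrow> k < n \<Longrightarrow> u < n \<Longrightarrow> kmem s' x [out_index rv n t, k, u] =
      (if fmt = Image then if pos u < t then kmem s E [u, k] else 0 else if pos k < t then 0 else kmem s U [k, u])"
proof -
  let ?c = "FC x [out_index_exp rv] (CSub (CRead ''v'' [iv ''t'']) (CRead ''v'' [IAdd (iv ''t'') (INum 1)]))"
  let ?b = "matrix_body fmt rv E U x"
  let ?vs = "[(''t'', 1), (''k'', 0), (''u'', 0)]"
  define s1 s2 s3 s4 where "s1 = sem (rank_prog a) s" and "s2 = sem (level_prog a) s1"
    and "s3 = sem (FI x [] (IAdd (iv ''n'') (INum 1))) s2" and "s4 = sem (nest [(''t'', 1)] ?c) s3"
  have s': "s' = sem (nest ?vs ?b) s4"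
    by (simp only: s'_def output_prog_def s1_def s2_def s3_def s4_def sem.simps)
  have nn: "imem s1 ''n'' [] = n" "imem s2 ''n'' [] = n" "imem s3 ''n'' [] = n" "imem s4 ''n'' [] = n"
    using n ne(6) by (auto simp: s1_def s2_def s3_def s4_def sem_frame store_apply simp del: nest.simps)
  have pos1: "imem s1 ''pos'' [i] = pos i" if "i < n" for i
    using sem_rank_prog[OF n that] by (simp add: s1_def pos_def)
  have "bij_betw pos {..<n} {..<n}" using sorting_rank_position by (auto simp: pos_def sorting_def)
  then have "bij_betw (nats s1 ''pos'') {..<n} {..<n}" using pos1 by (subst bij_betw_cong) auto
  note lev = sem_level_prog[OF nn(1) this ne(1), folded s2_def]
  define v where "v t = cmem s2 ''v'' [t]" for t
  have v: "v 0 = 1" "v (Suc n) = 0" "i < n \<Longrightarrow> v (Suc (pos i)) = cmem s a [i]" for i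
    using lev(1,2) lev(3)[of i] pos1[of i] by (auto simp: v_def s1_def sem_frame)
  have pos4: "imem s4 ''pos'' [i] = pos i" if "i < n" for i
  proof -
    have "imem s4 ''pos'' = imem s1 ''pos''"
      using ne(6) by (auto simp: s4_def s3_def s2_def sem_frame store_apply simp del: nest.simps)
    then show ?thesis using pos1[OF that] by simp
  qed
  have v3: "cmem s3 ''v'' [t] = v t" for t by (simp add: s3_def v_def)
  have coef: "cmem s4 x [out_index rv n t] = v t - v (Suc t)" if t: "t \<le> n" for t
  proof -
    have "cmem s4 x [out_index rv n t] = (if \<exists>js. list_all2 (\<lambda>vk j. j < n + snd vk) [(''t'', 1)] js \<and> [out_index rv n t] \<in> {[out_index rv n (hd js)]}
        then v (out_index rv n (hd [out_index rv n t])) - v (Suc (out_index rv n (hd [out_index rv n t]))) else cmem s3 x [out_index rv n t])"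
      unfolding s4_def
    proof (rule sem_nest[OF nn(3), where sel = "\<lambda>s. cmem s x"])
      fix js r y assume b: "list_all2 (\<lambda>vk j. j < n + snd vk) [(''t'', 1)] js" and fr: "frame (nest [(''t'', 1)] ?c) s3 r"
        and js: "map (\<lambda>vk. imem r (fst vk) []) [(''t'', 1)] = js"
      have "imem r ''n'' [] = n" "cmem r ''v'' [t] = v t" for t
        using frameD(1)[OF fr, of "''n''"] frameD(3)[OF fr, of "''v''"] nn(3) v3 ne(3) by (auto simp del: nest.simps)
      then show "cmem (sem ?c r) x y = (if y \<in> {[out_index rv n (hd js)]}
          then v (out_index rv n (hd y)) - v (Suc (out_index rv n (hd y))) else cmem r x y)"
        using b js by (auto simp: store_apply)
    qed auto
    moreover have "\<exists>js. list_all2 (\<lambda>vk j. j < n + snd vk) [(''t'', 1)] js \<and> [out_index rv n t] \<in> {[out_index rv n (hd js)]}"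
      using t by (intro exI[of _ "[t]"]) auto
    ultimately show ?thesis using t by simp
  qed
  have EU: "kmem s4 E = kmem s E" "kmem s4 U = kmem s U"
    by (simp_all add: s1_def s2_def s3_def s4_def sem_frame del: nest.simps)
  let ?val = "\<lambda>y. let t = out_index rv n (y ! 0); k = y ! 1; u = y ! 2 in
      (if fmt = Image then if pos u < t then kmem s E [u, k] else 0 else if pos k < t then 0 else kmem s U [k, u])"
  have mat: "kmem s' x [out_index rv n t, k, u] = ?val [out_index rv n t, k, u]" if t: "t \<le> n" "k < n" "u < n" for t k u
  proof -
    have "kmem s' x [out_index rv n t, k, u] = (if \<exists>js. list_all2 (\<lambda>vk j. j < n + snd vk) ?vs js \<and>
        [out_index rv n t, k, u] \<in> {[out_index rv n (js ! 0), js ! 1, js ! 2]} then ?val [out_index rv n t, k, u] else kmem s4 x [out_index rv n t, k, u])"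
      unfolding s'
    proof (rule sem_nest[OF nn(4), where sel = "\<lambda>s. kmem s x" and val = ?val])
      fix js r y assume b: "list_all2 (\<lambda>vk j. j < n + snd vk) ?vs js" and fr: "frame (nest ?vs ?b) s4 r"
        and js: "map (\<lambda>vk. imem r (fst vk) []) ?vs = js"
      have fr': "imem r ''n'' [] = n" "imem r ''pos'' = imem s4 ''pos''" "kmem r E = kmem s E" "kmem r U = kmem s U"
        using frameD(1)[OF fr, of "''n''"] frameD(1)[OF fr, of "''pos''"] frameD(2)[OF fr, of E] frameD(2)[OF fr, of U] nn(4) EU ne
        by (auto simp del: nest.simps)
      obtain t k u where tku: "js = [t, k, u]" "t \<le> n" "k < n" "u < n" using b by (auto simp: list_all2_3)
      then have "imem r ''t'' [] = t" "imem r ''k'' [] = k" "imem r ''u'' [] = u" using js by auto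
      then show "kmem (sem ?b r) x y = (if y \<in> {[out_index rv n (js ! 0), js ! 1, js ! 2]} then ?val y else kmem r x y)"
        using tku fr' pos4 by (auto simp: matrix_body_def Let_def store_apply)
    qed auto
    moreover have "\<exists>js. list_all2 (\<lambda>vk j. j < n + snd vk) ?vs js \<and> [out_index rv n t, k, u] \<in> {[out_index rv n (js ! 0), js ! 1, js ! 2]}"
      using t by (intro exI[of _ "[t, k, u]"]) auto
    ultimately show ?thesis by simp
  qed
  show thesis
  proof (rule that[of v])
    show "imem s' x [] = Suc n"
    proof -
      have "imem s' x = imem s3 x" using ne(6) by (auto simp: s' s4_def sem_frame simp del: nest.simps)
      then show ?thesis using nn(2) by (simp add: s3_def store_apply)
    qed
    show "cmem s' x [out_index rv n t] = v t - v (Suc t)" if "t \<le> n" for t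
      using coef[OF that] by (simp add: s' sem_frame del: nest.simps)
    show "kmem s' x [out_index rv n t, k, u] =
      (if fmt = Image then if pos u < t then kmem s E [u, k] else 0 else if pos k < t then 0 else kmem s U [k, u])" if "t \<le> n" "k < n" "u < n" for t k u
      using mat[OF that] that by simp
  qed (use v in auto)
qed

section \<open>Stored points\<close>

abbreviation ordered_subspaces :: "bool \<Rightarrow> nat \<Rightarrow> 'k::field vec set gorder" where
  "ordered_subspaces rv n \<equiv> if rv then reverse_subspace_lattice n else subspace_lattice n"

lemma lless_subspaces:
  "p \<sqsubset>\<^bsub>ordered_subspaces rv n\<^esub> q \<longleftrightarrow> (if rv then q \<subset> p else p \<subset> q)"
  by (auto simp: lless_def)

lemma carrier_ordered_subspaces: "carrier (ordered_subspaces rv n) = {X. linear_subspace n X}"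
  by simp

lemma stored_point_cong:
  assumes "imem s' a [] = imem s a []" "cmem s' a = cmem s a" "kmem s' a = kmem s a"
  shows "stored_point N fmt n a s' x = stored_point N fmt n a s x"
  by (simp add: stored_point_def assms)

lemma dual_bases_unit: "dual_bases n (\<lambda>i j. if i = j then 1 else 0) (\<lambda>i j. if i = j then 1 else (0::'k::field))"
  unfolding dual_bases_def
proof (intro allI impI)
  fix i j assume "i < n" "j < n"
  have "dot n (\<lambda>k. if i = k then 1 else 0) (\<lambda>k. if j = k then 1 else (0::'k)) = (\<Sum>k<n. if k = i then (if j = k then 1 else 0) else 0)"
    unfolding dot_def by (intro sum.cong) auto
  then show "dot n (\<lambda>k. if i = k then 1 else 0) (\<lambda>k. if j = k then 1 else (0::'k)) = (if i = j then 1 else 0)"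
    using \<open>i < n\<close> by simp
qed

text \<open>The standard basis provides a retraction, and with it the general bound on chains. It
  makes the loops over \<open>n + 1\<close> stages exhaustive.\<close>

lemma subspace_chain_length:
  assumes W: "\<And>t. t < m \<Longrightarrow> linear_subspace n (W t :: 'k::field vec set)" and less: "\<And>t u. t < u \<Longrightarrow> u < m \<Longrightarrow> W t \<subset> W u"
  shows "m \<le> n + 1"
proof -
  interpret retraction "subspace_lattice n" n "pivots n (\<lambda>i j. if i = j then 1 else 0) int" "coord_subspace n (\<lambda>i j. if i = j then 1 else (0::'k))"
    by (rule retraction_subspaces[OF dual_bases_unit]) (simp add: inj_on_def)
  have "chain_in (subspace_lattice n) (W ` {..<m})"
    unfolding chain_in_def using W less by (auto, metis linorder_neqE_nat psubsetD)
  then have "card (W ` {..<m}) \<le> n + 1" using chain_card(2) by simp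
  moreover have "inj_on W {..<m}"
    by (rule inj_onI) (metis less lessThan_iff linorder_neqE_nat psubsetE subset_refl)
  ultimately show ?thesis by (simp add: card_image)
qed

text \<open>Reading the slots through \<open>chain_index\<close> turns either storage order into a
  strict flag by inclusion; the coefficients are renumbered along with it.\<close>

lemma stored_point_chain:
  fixes s :: "'k::field state" and fmt :: subspace_format and rv :: bool
  assumes st: "stored_point (ordered_subspaces rv n) fmt n src s x0"
  defines "m \<equiv> imem s src []" and "W \<equiv> stored_subspace fmt rv n src s"
  shows "\<And>t. t < m \<Longrightarrow> linear_subspace n (W t)" "\<And>t u. t < u \<Longrightarrow> u < m \<Longrightarrow> W t \<subset> W u"
    "x0 = (\<lambda>q. \<Sum>t<m. if W t = q then cmem s src [chain_index rv m t] else 0)" "m \<le> n + 1"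
proof -
  define p where "p t = subspace_of fmt (mat n n (\<lambda>(i, j). kmem s src [t, i, j]))" for t
  have p: "\<And>t. t < m \<Longrightarrow> linear_subspace n (p t)" "\<And>t u. t < u \<Longrightarrow> u < m \<Longrightarrow> p t \<sqsubset>\<^bsub>ordered_subspaces rv n\<^esub> p u"
    "x0 = (\<lambda>q. \<Sum>t<m. if p t = q then cmem s src [t] else 0)"
    using st unfolding stored_point_def Let_def p_def[symmetric] m_def carrier_ordered_subspaces by auto
  have Wp: "W t = p (chain_index rv m t)" for t by (simp add: W_def stored_subspace_def p_def m_def)
  have ci: "chain_index rv m t < m" if "t < m" for t using that by (auto simp: chain_index_def)
  show lin: "linear_subspace n (W t)" if "t < m" for t using p(1)[OF ci[OF that]] by (simp add: Wp)
  show less: "W t \<subset> W u" if "t < u" "u < m" for t u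
  proof (cases rv)
    case True
    then show ?thesis using p(2)[of "m - Suc u" "m - Suc t"] diff_less_mono2[of "Suc t" "Suc u" m] that by (auto simp: Wp chain_index_def lless_def psubset_eq)
  next
    case False
    then show ?thesis using p(2)[of t u] that by (simp add: Wp chain_index_def lless_def psubset_eq)
  qed
  show "x0 = (\<lambda>q. \<Sum>t<m. if W t = q then cmem s src [chain_index rv m t] else 0)"
  proof
    fix q
    have "(\<Sum>t<m. if W t = q then cmem s src [chain_index rv m t] else 0) = (\<Sum>t<m. if p t = q then cmem s src [t] else 0)"
    proof (cases rv)
      case True
      then show ?thesis
        using sum.nat_diff_reindex[of "\<lambda>t. if p t = q then cmem s src [t] else 0" m] by (simp add: Wp chain_index_def cong: if_cong)
    qed (simp add: Wp chain_index_def cong: if_cong)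
    then show "x0 q = (\<Sum>t<m. if W t = q then cmem s src [chain_index rv m t] else 0)" using p(3) by simp
  qed
  show "m \<le> n + 1" by (rule subspace_chain_length[OF lin less])
qed

lemma coord_subspace_Int: "coord_subspace n U S = coord_subspace n U (S \<inter> {..<n})"
  by (auto simp: coord_subspace_def)

text \<open>In a flag of coordinate subspaces \<open>i\<close> is a pivot of exactly the stages from
  \<open>st i\<close> on, so its coordinate is a partial sum of the weights, as computed by
  \<open>coords_prog\<close>.\<close>

lemma chain_point_coords:
  fixes W :: "nat \<Rightarrow> 'k::field vec set"
  assumes dual: "dual_bases n U E"
    and x0: "x0 = (\<lambda>q. \<Sum>t<m. if W t = q then c t else 0)"
    and W: "\<And>t. t < m \<Longrightarrow> W t = coord_subspace n U {i. st i \<le> t}"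
    and less: "\<And>t u. t < u \<Longrightarrow> u < m \<Longrightarrow> W t \<subset> W u"
  shows "support x0 \<subseteq> coord_subspace n U ` Pow {..<n}"
    and "i < n \<Longrightarrow> retraction.rho (pivots n U int) x0 i = (\<Sum>t<m. if st i \<le> t then c t else 0)"
proof -
  have inj: "inj_on int {..<n}" by (simp add: inj_on_def)
  have injW: "inj_on W {..<m}"
    by (rule inj_onI) (metis less lessThan_iff linorder_neqE_nat psubsetE subset_refl)
  have x0W: "x0 (W t) = c t" if "t < m" for t
  proof -
    have "x0 (W t) = (\<Sum>u<m. if u = t then c u else 0)"
      unfolding x0 using injW that by (intro sum.cong) (auto simp: inj_on_def)
    then show ?thesis using that by simp
  qed
  have sup: "support x0 \<subseteq> W ` {..<m}"
  proof
    fix q assume "q \<in> support x0"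
    then have "(\<Sum>t<m. if W t = q then c t else 0) \<noteq> 0" by (simp add: support_def x0)
    then show "q \<in> W ` {..<m}" by (rule contrapos_np) (auto intro!: sum.neutral)
  qed
  then show "support x0 \<subseteq> coord_subspace n U ` Pow {..<n}"
  proof (rule subset_trans, intro subsetI)
    fix q assume "q \<in> W ` {..<m}"
    then obtain t where "t < m" "q = W t" by auto
    then have "q = coord_subspace n U ({i. st i \<le> t} \<inter> {..<n})" using W coord_subspace_Int by metis
    then show "q \<in> coord_subspace n U ` Pow {..<n}" by blast
  qed
  have piv: "pivots n U int (W t) = {i. i < n \<and> st i \<le> t}" if "t < m" for t
    using pivots_coord[OF dual inj, of "{i. st i \<le> t} \<inter> {..<n}"] W[OF that] coord_subspace_Int[of n U "{i. st i \<le> t}"] by auto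
  show "retraction.rho (pivots n U int) x0 i = (\<Sum>t<m. if st i \<le> t then c t else 0)" if i: "i < n"
  proof -
    have "retraction.rho (pivots n U int) x0 i = (\<Sum>p\<in>W ` {..<m}. if i \<in> pivots n U int p then x0 p else 0)"
      by (rule retraction.rho_eq_sum[OF retraction_subspaces[OF dual inj] _ sup]) simp
    also have "\<dots> = (\<Sum>t<m. if i \<in> pivots n U int (W t) then x0 (W t) else 0)"
      by (rule sum.reindex_cong[OF injW]) auto
    also have "\<dots> = (\<Sum>t<m. if st i \<le> t then c t else 0)"
      using i by (intro sum.cong) (auto simp: piv x0W)
    finally show ?thesis .
  qed
qed

text \<open>Comparability is symmetric in the order.\<close>

lemma complex_reverse: "orthoscheme_complex (reverse_subspace_lattice n) = orthoscheme_complex (subspace_lattice n :: 'k::field vec set gorder)"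
proof -
  have "chain_in (reverse_subspace_lattice n) C = chain_in (subspace_lattice n) C" for C :: "'k vec set set"
    unfolding chain_in_def by auto
  then show ?thesis by (simp add: orthoscheme_complex_def)
qed

text \<open>Each member of the support counts for exactly one of the two coordinates, and the
  weights sum to \<open>1\<close>.\<close>

lemma rho_reverse:
  assumes dual: "dual_bases n V F" and y: "y \<in> orthoscheme_complex (subspace_lattice n)" and i: "i < n"
  shows "retraction.rho (\<lambda>Z. {..<n} - pivots n V int Z) y i = 1 - retraction.rho (pivots n V int) y i"
proof -
  have inj: "inj_on int {..<n}" by (simp add: inj_on_def)
  note R = retraction_subspaces[OF dual inj] and R' = retraction_reverse_subspaces[OF dual inj]
  have "retraction.rho (\<lambda>Z. {..<n} - pivots n V int Z) y i + retraction.rho (pivots n V int) y i = (\<Sum>p\<in>support y. y p)"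
    unfolding retraction.rho_def[OF R] retraction.rho_def[OF R'] sum.distrib[symmetric]
    using i by (intro sum.cong) auto
  then show ?thesis using retraction.K_sum[OF R y] by simp
qed

lemma coord_subspace_columns:
  assumes "dual_bases n U E"
  shows "{v \<in> carrier_vec n. \<exists>a. \<forall>l<n. v $ l = (\<Sum>u<n. a u * (if u \<in> S then E u l else 0))} = coord_subspace n U S"
proof (intro equalityI subsetI)
  fix v assume "v \<in> {v \<in> carrier_vec n. \<exists>a. \<forall>l<n. v $ l = (\<Sum>u<n. a u * (if u \<in> S then E u l else 0))}"
  then obtain a where v: "v \<in> carrier_vec n" and a: "\<And>l. l < n \<Longrightarrow> v $ l = (\<Sum>u<n. a u * (if u \<in> S then E u l else 0))" by auto
  have "dot n (U k) (($) v) = 0" if k: "k < n" "k \<notin> S" for k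
  proof -
    have "dot n (U k) (($) v) = dot n (U k) (\<lambda>l. \<Sum>u<n. (if u \<in> S then a u else 0) * E u l)"
      using a by (intro dot_cong) (auto intro!: sum.cong)
    also have "\<dots> = (\<Sum>u<n. (if u \<in> S then a u else 0) * dot n (U k) (E u))" by (simp add: dot_sum_right dot_mult_right)
    also have "\<dots> = 0" using dual_basesD[OF assms k(1)] k by (intro sum.neutral) auto
    finally show ?thesis .
  qed
  then show "v \<in> coord_subspace n U S" using v by (simp add: coord_subspace_def)
next
  fix v assume v: "v \<in> coord_subspace n U S"
  have "v $ l = (\<Sum>u<n. dot n (U u) (($) v) * (if u \<in> S then E u l else 0))" if "l < n" for l
  proof -
    have "v $ l = (\<Sum>u<n. dot n (U u) (($) v) * E u l)" by (rule dual_bases_expansion[OF assms that])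
    also have "\<dots> = (\<Sum>u<n. dot n (U u) (($) v) * (if u \<in> S then E u l else 0))"
      using v by (intro sum.cong) (auto simp: coord_subspace_def)
    finally show ?thesis .
  qed
  then show "v \<in> {v \<in> carrier_vec n. \<exists>a. \<forall>l<n. v $ l = (\<Sum>u<n. a u * (if u \<in> S then E u l else 0))}"
    using v by (auto simp: coord_subspace_def)
qed

text \<open>The array of sorted levels is an instance of \<open>v\<close> in
  \<open>sorted_point\<close>, which supplies the point and its coordinates; the rest matches slots
  with levels. Since stored coefficients may vanish, all \<open>n + 1\<close> levels are written
  without filtering.\<close>

lemma stored_output_side:
  fixes s :: "'k::field state" and fmt :: subspace_format and rv :: bool
  assumes n: "imem s ''n'' [] = n" and ne: "a \<noteq> ''v''" "x \<noteq> a" "x \<noteq> ''v''" "x \<noteq> E" "x \<noteq> U" "x \<notin> {''n'', ''pos'', ''t'', ''k'', ''u''}"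
    and dual: "dual_bases n (vecs s U) (vecs s E)" and a: "\<And>i. i < n \<Longrightarrow> 0 \<le> cmem s a [i] \<and> cmem s a [i] \<le> 1"
  obtains xx where "stored_point (ordered_subspaces rv n) fmt n x (sem (output_prog fmt rv a E U x) s) xx"
    "xx \<in> orthoscheme_complex (subspace_lattice n)" "support xx \<subseteq> coord_subspace n (vecs s U) ` Pow {..<n}"
    "\<And>i. i < n \<Longrightarrow> retraction.rho (pivots n (vecs s U) int) xx i = cmem s a [i]"
proof -
  let ?s = "sem (output_prog fmt rv a E U x) s"
  define pos where "pos = rank_position n (\<lambda>i. cmem s a [i])"
  obtain v where v: "v 0 = 1" "v (Suc n) = 0" "\<And>i. i < n \<Longrightarrow> v (Suc (pos i)) = cmem s a [i]"
    and len: "imem ?s x [] = Suc n" and coef: "\<And>t. t \<le> n \<Longrightarrow> cmem ?s x [out_index rv n t] = v t - v (Suc t)"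
    and mat: "\<And>t k u. t \<le> n \<Longrightarrow> k < n \<Longrightarrow> u < n \<Longrightarrow> kmem ?s x [out_index rv n t, k, u] =
      (if fmt = Image then if pos u < t then kmem s E [u, k] else 0 else if pos k < t then 0 else kmem s U [k, u])"
    using sem_output_prog[OF n ne, where fmt = fmt and rv = rv, folded pos_def] by blast
  have inj: "inj_on int {..<n}" by (simp add: inj_on_def)
  interpret R: retraction "subspace_lattice n" n "pivots n (vecs s U) int" "coord_subspace n (vecs s U)"
    by (rule retraction_subspaces[OF dual inj])
  have pos: "sorting n (\<lambda>i. cmem s a [i]) pos" unfolding pos_def by (rule sorting_rank_position)
  let ?L = "\<lambda>k. {i. i < n \<and> pos i < k}"
  let ?W = "\<lambda>k. coord_subspace n (vecs s U) (?L k)"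
  define xx where "xx = (\<lambda>q. \<Sum>k<Suc n. if ?W k = q then v k - v (Suc k) else 0)"
  note sp0 = R.sorted_point[OF pos a v]
  have sp: "xx \<in> simplex (subspace_lattice n) (map ?W [0..<Suc n])"
    "support xx \<subseteq> R.apartment" "\<And>i. i < n \<Longrightarrow> R.rho xx i = cmem s a [i]"
    "\<And>k. k < Suc n \<Longrightarrow> 0 \<le> v k - v (Suc k)"
    "\<And>k l. k < l \<Longrightarrow> l < Suc n \<Longrightarrow> ?W k \<subset> ?W l"
    unfolding xx_def by (rule sp0 | use sp0(6) in \<open>simp add: lless_def psubset_eq\<close>)+
  have sub: "subspace_of fmt (mat n n (\<lambda>(i, j). kmem ?s x [out_index rv n t, i, j])) = ?W t" if t: "t \<le> n" for t
  proof (cases fmt)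
    case Image
    have "(\<Sum>j<n. b j * kmem ?s x [out_index rv n t, l, j]) = (\<Sum>u<n. b u * (if u \<in> ?L t then kmem s E [u, l] else 0))" if "l < n" for l b
      using mat[OF t that] Image by (intro sum.cong) auto
    then show ?thesis
      unfolding Image subspace_of_image coord_subspace_columns[OF dual, of "?L t", symmetric] by auto
  next
    case Kernel
    have "dot n (\<lambda>j. kmem ?s x [out_index rv n t, k, j]) w = (if pos k < t then 0 else dot n (vecs s U k) w)" if "k < n" for k w
      using mat[OF t that] Kernel by (auto simp: dot_def)
    then show ?thesis unfolding Kernel subspace_of_kernel by (auto simp: coord_subspace_def)
  qed
  have out: "out_index rv n (out_index rv n t) = t" "out_index rv n t \<le> n" if "t \<le> n" for t using that by (auto simp: out_index_def)
  have sub': "subspace_of fmt (mat n n (\<lambda>(i, j). kmem ?s x [t, i, j])) = ?W (out_index rv n t)" if "t \<le> n" for t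
    using sub[OF out(2)[OF that]] unfolding out(1)[OF that] .
  have coef': "cmem ?s x [t] = v (out_index rv n t) - v (Suc (out_index rv n t))" if "t \<le> n" for t
    using coef[OF out(2)[OF that]] unfolding out(1)[OF that] .
  have reindex: "(\<Sum>t<Suc n. f (out_index rv n t)) = (\<Sum>t<Suc n. f t)" for f :: "nat \<Rightarrow> real"
    using sum.nat_diff_reindex[of f "Suc n"] by (cases rv) (simp_all add: out_index_def)
  have "stored_point (ordered_subspaces rv n) fmt n x ?s xx"
    unfolding stored_point_def Let_def len
  proof (intro conjI allI impI)
    fix t assume "t < Suc n"
    then show "subspace_of fmt (mat n n (\<lambda>(i, j). kmem ?s x [t, i, j])) \<in> carrier (ordered_subspaces rv n)"
      using sub'[of t] by (simp add: carrier_ordered_subspaces)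
    show "0 \<le> cmem ?s x [t]" using coef'[of t] sp(4)[of "out_index rv n t"] out(2)[of t] \<open>t < Suc n\<close> by (simp del: out_index_def)
  next
    fix t u assume tu: "t < u \<and> u < Suc n"
    then show "subspace_of fmt (mat n n (\<lambda>(i, j). kmem ?s x [t, i, j])) \<sqsubset>\<^bsub>ordered_subspaces rv n\<^esub>
        subspace_of fmt (mat n n (\<lambda>(i, j). kmem ?s x [u, i, j]))"
      using sub'[of t] sub'[of u] sp(5)[of t u] sp(5)[of "n - u" "n - t"] diff_less_mono2[of t u n]
      tu unfolding lless_subspaces by (cases rv) (auto simp: out_index_def)
  next
    have "(\<Sum>t<Suc n. cmem ?s x [t]) = (\<Sum>t<Suc n. v (out_index rv n t) - v (Suc (out_index rv n t)))"
      using coef' by (intro sum.cong) auto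
    also have "\<dots> = (\<Sum>t<Suc n. v t - v (Suc t))" by (rule reindex)
    also have "\<dots> = 1" unfolding sum_lessThan_telescope' using v by simp
    finally show "(\<Sum>t<Suc n. cmem ?s x [t]) = 1" .
    show "xx = (\<lambda>q. \<Sum>t<Suc n. if subspace_of fmt (mat n n (\<lambda>(i, j). kmem ?s x [t, i, j])) = q then cmem ?s x [t] else 0)"
    proof
      fix q
      have "(\<Sum>t<Suc n. if subspace_of fmt (mat n n (\<lambda>(i, j). kmem ?s x [t, i, j])) = q then cmem ?s x [t] else 0) =
        (\<Sum>t<Suc n. if ?W (out_index rv n t) = q then v (out_index rv n t) - v (Suc (out_index rv n t)) else 0)"
        using sub' coef' by (intro sum.cong) auto
      also have "\<dots> = xx q" unfolding xx_def by (rule reindex)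
      finally show "xx q = (\<Sum>t<Suc n. if subspace_of fmt (mat n n (\<lambda>(i, j). kmem ?s x [t, i, j])) = q then cmem ?s x [t] else 0)" by simp
    qed
  qed
  then show thesis using that sp R.apartment_def by (auto simp: simplex_def)
qed

section \<open>Computing the resolvent\<close>

text \<open>Rows of \<open>E\<close> and \<open>F\<close> are the adapted bases, rows of \<open>U\<close> and \<open>V\<close> the dual ones. The second
  lattice is ordered by reverse inclusion, but \<open>b\<close> holds coordinates with respect to inclusion, that
  is, one minus the coordinates of the point; hence \<open>a\<close> and \<open>b\<close> both decrease in the proximal
  step.\<close>

definition resolvent_prog :: "subspace_format \<Rightarrow> subspace_format \<Rightarrow> fprog" where
  "resolvent_prog fmtL fmtM =
     side_prog fmtL False ''x0'' ''E'' ''U'' ''sE'' ''a'' ;;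
     side_prog fmtM True ''y0'' ''F'' ''V'' ''sF'' ''b'' ;;
     diag_prog ;; update_prog ;;
     output_prog fmtL False ''a'' ''E'' ''U'' ''x'' ;;
     output_prog fmtM True ''b'' ''F'' ''V'' ''y''"

text \<open>The step must not leave the cube: as \<open>a\<close> and \<open>b\<close> are at most
  \<open>1\<close>, half of \<open>a + b - 1\<close> is at most either of them. So the updated
  coordinates are again those of a point.\<close>

lemma step_size_bounds:
  assumes "0 \<le> lam" "0 \<le> \<kappa>" and "0 \<le> a" "a \<le> 1" "0 \<le> b" "b \<le> 1"
  shows "0 \<le> step_size \<kappa> lam a (1 - b)" "step_size \<kappa> lam a (1 - b) \<le> a" "step_size \<kappa> lam a (1 - b) \<le> b"
  using assms mult_nonneg_nonneg[of \<kappa> lam] unfolding step_size_def by (auto simp: min_def field_simps)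

text \<open>The exchanges of the diagonalisation keep the flags, so its bases are adapted to both
  input chains and diagonalise the form at once. Hence \<open>x0\<close> and \<open>y0\<close> lie
  in its apartments, and \<open>is_resolvent_coords\<close> applies to the points with the updated
  coordinates.\<close>

lemma resolvent_prog_correct:
  fixes A :: "'k::field mat" and s :: "'k state"
  assumes A: "A \<in> carrier_mat n n" and lam: "0 < lam"
    and x0: "x0 \<in> orthoscheme_complex (subspace_lattice n)" and y0: "y0 \<in> orthoscheme_complex (reverse_subspace_lattice n)"
    and inp: "stored_input fmtL fmtM n A lam x0 y0 s"
  obtains z where "stored_output fmtL fmtM n z (sem (resolvent_prog fmtL fmtM) s)"
    "is_resolvent
          (orthoscheme_complex (subspace_lattice n) \<times>
           orthoscheme_complex (reverse_subspace_lattice n))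
          (prod_dist (complex_dist (subspace_lattice n)) (complex_dist (reverse_subspace_lattice n)))
          (\<lambda>z. (2 * real n + 1) *
            lovasz_extension_prod (subspace_lattice n) (reverse_subspace_lattice n)
              (\<lambda>P. real_of_int (rank_function n A P)) z)
          lam (x0, y0) z"
proof -
  have n: "imem s ''n'' [] = n" and As: "\<And>i j. i < n \<Longrightarrow> j < n \<Longrightarrow> kmem s ''A'' [i, j] = A $$ (i, j)"
    and lams: "cmem s ''lambda'' [] = lam"
    and sx: "stored_point (ordered_subspaces False n) fmtL n ''x0'' s x0"
    and sy: "stored_point (ordered_subspaces True n) fmtM n ''y0'' s y0"
    using inp by (auto simp: stored_input_def)
  define s1 s2 s3 s4 s5 s6 where "s1 = sem (side_prog fmtL False ''x0'' ''E'' ''U'' ''sE'' ''a'') s"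
    and "s2 = sem (side_prog fmtM True ''y0'' ''F'' ''V'' ''sF'' ''b'') s1"
    and "s3 = sem diag_prog s2" and "s4 = sem update_prog s3"
    and "s5 = sem (output_prog fmtL False ''a'' ''E'' ''U'' ''x'') s4"
    and "s6 = sem (output_prog fmtM True ''b'' ''F'' ''V'' ''y'') s5"
  have s6: "sem (resolvent_prog fmtL fmtM) s = s6"
    by (simp add: resolvent_prog_def s1_def s2_def s3_def s4_def s5_def s6_def)
  have nn: "imem s1 ''n'' [] = n" "imem s2 ''n'' [] = n" "imem s3 ''n'' [] = n" "imem s4 ''n'' [] = n" "imem s5 ''n'' [] = n"
    using n by (simp_all add: s1_def s2_def s3_def s4_def s5_def sem_frame)

  note cx = stored_point_chain[OF sx]
  let ?mx = "imem s ''x0'' []" and ?Wx = "stored_subspace fmtL False n ''x0'' s" and ?cx = "\<lambda>t. cmem s ''x0'' [chain_index False (imem s ''x0'' []) t]"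
  have monox: "?Wx t \<subseteq> ?Wx u" if "t \<le> u" "u < ?mx" for t u
    using cx(2)[of t u] that by (cases "t = u") auto
  have side1: "dual_bases n (vecs s1 ''U'') (vecs s1 ''E'')" "\<And>i. i < n \<Longrightarrow> imem s1 ''sE'' [i] \<le> n + 1"
    "\<And>t. t < ?mx \<Longrightarrow> ?Wx t = coord_subspace n (vecs s1 ''U'') {i. imem s1 ''sE'' [i] \<le> t}"
    "\<And>i. i < n \<Longrightarrow> cmem s1 ''a'' [i] = (\<Sum>t<?mx. if imem s1 ''sE'' [i] \<le> t then ?cx t else 0)"
    using sem_side_prog[OF n cx(4) monox, of "''a''" "''E''" "''U''" "''sE''"] by (simp_all add: s1_def)

  have sy1: "stored_point (ordered_subspaces True n) fmtM n ''y0'' s1 y0"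
    using sy stored_point_cong[of s1 "''y0''" s] by (simp add: s1_def sem_frame)
  note cy = stored_point_chain[OF sy1]
  let ?my = "imem s1 ''y0'' []" and ?Wy = "stored_subspace fmtM True n ''y0'' s1" and ?cy = "\<lambda>t. cmem s1 ''y0'' [chain_index True (imem s1 ''y0'' []) t]"
  have monoy: "?Wy t \<subseteq> ?Wy u" if "t \<le> u" "u < ?my" for t u
    using cy(2)[of t u] that by (cases "t = u") auto
  have side2: "dual_bases n (vecs s2 ''V'') (vecs s2 ''F'')" "\<And>i. i < n \<Longrightarrow> imem s2 ''sF'' [i] \<le> n + 1"
    "\<And>t. t < ?my \<Longrightarrow> ?Wy t = coord_subspace n (vecs s2 ''V'') {i. imem s2 ''sF'' [i] \<le> t}"
    "\<And>i. i < n \<Longrightarrow> cmem s2 ''b'' [i] = (\<Sum>t<?my. if imem s2 ''sF'' [i] \<le> t then ?cy t else 0)"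
    using sem_side_prog[OF nn(1) cy(4) monoy, of "''b''" "''F''" "''V''" "''sF''"] by (simp_all add: s2_def)
  have keep2: "kmem s2 ''U'' = kmem s1 ''U''" "kmem s2 ''E'' = kmem s1 ''E''" "imem s2 ''sE'' = imem s1 ''sE''" "cmem s2 ''a'' = cmem s1 ''a''"
    "kmem s2 ''A'' = kmem s ''A''" "cmem s2 ''lambda'' = cmem s ''lambda''"
    by (simp_all add: s1_def s2_def sem_frame)
  have diag: "diag_state n {..<n} s3" "flags_kept n s2 s3"
    using sem_diag_prog[OF nn(2)] side1 side2 unfolding s3_def keep2[symmetric] by auto
  have keep3: "imem s3 ''sE'' = imem s2 ''sE''" "imem s3 ''sF'' = imem s2 ''sF''" "cmem s3 = cmem s2" "kmem s3 ''A'' = kmem s2 ''A''"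
    by (simp_all add: s3_def sem_frame fun_eq_iff)
  let ?I = "{i. i < n \<and> imem s3 ''used'' [i] \<noteq> 0}"
  have A3: "kmem s3 ''A'' [i, j] = A $$ (i, j)" if "i < n" "j < n" for i j using As[OF that] by (simp add: keep2 keep3)
  obtain \<mu> where "diagonalisation n A (vecs s3 ''U'') (vecs s3 ''E'') (vecs s3 ''V'') (vecs s3 ''F'') ?I \<mu>"
    and \<mu>_mt: "\<And>i. i < n \<Longrightarrow> imem s3 ''used'' [i] \<noteq> 0 \<Longrightarrow> \<mu> i = imem s3 ''mt'' [i]"
    by (rule diagonalisationI[OF A A3 diag(1)]) (assumption | blast)+
  then interpret D: diagonalisation n A "vecs s3 ''U''" "vecs s3 ''E''" "vecs s3 ''V''" "vecs s3 ''F''" ?I \<mu> by blast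

  \<comment> \<open>The stages are those found before the diagonalisation; they stay valid for the
    functionals it produces.\<close>
  have Wx3: "?Wx t = coord_subspace n (vecs s3 ''U'') {i. imem s1 ''sE'' [i] \<le> t}" if "t < ?mx" for t
    using side1(3)[OF that] diag(2) by (simp add: flags_kept_def keep2)
  have Wy3: "?Wy t = coord_subspace n (vecs s3 ''V'') {i. imem s2 ''sF'' [i] \<le> t}" if "t < ?my" for t
    using side2(3)[OF that] diag(2) by (simp add: flags_kept_def)
  have px: "support x0 \<subseteq> coord_subspace n (vecs s3 ''U'') ` Pow {..<n}"
    "\<And>i. i < n \<Longrightarrow> retraction.rho (pivots n (vecs s3 ''U'') int) x0 i = (\<Sum>t<?mx. if imem s1 ''sE'' [i] \<le> t then ?cx t else 0)"
    by (rule chain_point_coords[OF D.dualU cx(3) Wx3 cx(2)]; assumption)+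
  have py: "support y0 \<subseteq> coord_subspace n (vecs s3 ''V'') ` Pow {..<n}"
    "\<And>i. i < n \<Longrightarrow> retraction.rho (pivots n (vecs s3 ''V'') int) y0 i = (\<Sum>t<?my. if imem s2 ''sF'' [i] \<le> t then ?cy t else 0)"
    by (rule chain_point_coords[OF D.dualV cy(3) Wy3 cy(2)]; assumption)+
  have y0': "y0 \<in> orthoscheme_complex (subspace_lattice n)" using y0 complex_reverse by blast
  have x0p: "x0 \<in> D.points_L" and y0p: "y0 \<in> D.points_M"
    using x0 y0 px(1) py(1) by (auto simp: D.points_L_def D.points_M_def)
  have ax: "D.coords_L x0 i = cmem s3 ''a'' [i]" if "i < n" for i
    using px(2)[OF that] side1(4)[OF that] by (simp add: D.coords_L_def keep3 keep2)
  have by0: "D.coords_M y0 i = 1 - cmem s3 ''b'' [i]" if "i < n" for i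
    using py(2)[OF that] side2(4)[OF that] rho_reverse[OF D.dualV y0' that] by (simp add: D.coords_M_def keep3)
  have inj: "inj_on int {..<n}" by (simp add: inj_on_def)
  have a01: "0 \<le> cmem s3 ''a'' [i]" "cmem s3 ''a'' [i] \<le> 1" if "i < n" for i
    using retraction.rho_bounds[OF D.retraction_L[OF inj] x0] ax[OF that] by (metis D.coords_L_def)+
  have b01: "0 \<le> cmem s3 ''b'' [i]" "cmem s3 ''b'' [i] \<le> 1" if "i < n" for i
    using retraction.rho_bounds[OF D.retraction_M[OF inj] y0, of i] by0[OF that] by (simp_all add: D.coords_M_def)

  let ?\<kappa> = "2 * real n + 1"
  define \<delta> where "\<delta> i = (if i \<in> ?I then step_size ?\<kappa> lam (cmem s3 ''a'' [i]) (1 - cmem s3 ''b'' [\<mu> i]) else 0)" for i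
  have injmt: "inj_on (nats s3 ''mt'') ?I"
    using diag_inv_mt_inj[OF diag(1)] by (auto simp: inj_on_def)
  have lam3: "cmem s3 ''lambda'' [] = lam" using lams by (simp add: keep3 keep2)
  note up = sem_update[OF nn(3) injmt, folded s4_def, unfolded lam3]
  have a4: "cmem s4 ''a'' [i] = cmem s3 ''a'' [i] - \<delta> i" if i: "i < n" for i
    using up(1)[OF i] i \<mu>_mt[OF i] by (simp add: \<delta>_def)
  have b4: "cmem s4 ''b'' [\<mu> i] = cmem s3 ''b'' [\<mu> i] - \<delta> i" if i: "i < n" for i
  proof (cases "imem s3 ''used'' [i] = 0")
    case False
    then show ?thesis using up(2)[OF i False] i \<mu>_mt[OF i False] by (simp add: \<delta>_def)
  next
    case True
    have "imem s3 ''mt'' [k] \<noteq> \<mu> i" if "k < n" "imem s3 ''used'' [k] \<noteq> 0" for k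
      using \<mu>_mt[OF that] that True i D.\<mu> by (metis bij_betw_def inj_onD lessThan_iff)
    then show ?thesis using up(3)[of "\<mu> i"] True by (simp add: \<delta>_def)
  qed
  have \<mu>n: "\<mu> i < n" if "i < n" for i using D.\<mu> that by (auto simp: bij_betw_def)
  have \<delta>: "0 \<le> \<delta> i" "\<delta> i \<le> cmem s3 ''a'' [i]" "\<delta> i \<le> cmem s3 ''b'' [\<mu> i]" if i: "i < n" for i
  proof -
    note step_size_bounds[OF less_imp_le[OF lam] _ a01[OF i] b01[OF \<mu>n[OF i]], of ?\<kappa>]
    then show "0 \<le> \<delta> i" "\<delta> i \<le> cmem s3 ''a'' [i]" "\<delta> i \<le> cmem s3 ''b'' [\<mu> i]"
      using a01[OF i] b01[OF \<mu>n[OF i]] by (auto simp: \<delta>_def)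
  qed
  have a4_01: "0 \<le> cmem s4 ''a'' [i] \<and> cmem s4 ''a'' [i] \<le> 1" if i: "i < n" for i
    using a4[OF i] \<delta>[OF i] a01[OF i] by linarith
  have b4_01: "0 \<le> cmem s4 ''b'' [j] \<and> cmem s4 ''b'' [j] \<le> 1" if j: "j < n" for j
  proof -
    obtain i where "i < n" "j = \<mu> i" using D.\<mu> j by (auto simp: bij_betw_def)
    then show ?thesis using b4[of i] \<delta>[of i] b01[OF j] by simp
  qed
  have keep4: "kmem s4 = kmem s3" by (simp add: s4_def sem_frame fun_eq_iff)
  have keep5: "kmem s5 ''F'' = kmem s3 ''F''" "kmem s5 ''V'' = kmem s3 ''V''" "cmem s5 ''b'' = cmem s4 ''b''"
    by (simp_all add: s5_def sem_frame keep4)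
  obtain x where x: "stored_point (ordered_subspaces False n) fmtL n ''x'' s5 x" "x \<in> orthoscheme_complex (subspace_lattice n)"
    "support x \<subseteq> coord_subspace n (vecs s3 ''U'') ` Pow {..<n}"
    "\<And>i. i < n \<Longrightarrow> retraction.rho (pivots n (vecs s3 ''U'') int) x i = cmem s4 ''a'' [i]"
    using stored_output_side[OF nn(4), of "''a''" "''x''" "''E''" "''U''" False fmtL] D.dualU a4_01
    unfolding s5_def keep4 by auto
  obtain y where y: "stored_point (ordered_subspaces True n) fmtM n ''y'' s6 y" "y \<in> orthoscheme_complex (subspace_lattice n)"
    "support y \<subseteq> coord_subspace n (vecs s3 ''V'') ` Pow {..<n}"
    "\<And>i. i < n \<Longrightarrow> retraction.rho (pivots n (vecs s3 ''V'') int) y i = cmem s4 ''b'' [i]"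
    using stored_output_side[OF nn(5), of "''b''" "''y''" "''F''" "''V''" True fmtM] D.dualV b4_01
    unfolding s6_def keep5 by auto
  have "stored_point (ordered_subspaces False n) fmtL n ''x'' s6 x"
    using x(1) stored_point_cong[of s6 "''x''" s5] by (simp add: s6_def sem_frame)
  then have "stored_output fmtL fmtM n (x, y) s6" using y(1) by (simp add: stored_output_def)
  moreover have "is_resolvent (orthoscheme_complex D.LL \<times> orthoscheme_complex D.MM)
    (prod_dist (complex_dist D.LL) (complex_dist D.MM)) (\<lambda>z. ?\<kappa> * lovasz_extension_prod D.LL D.MM D.RR z) lam (x0, y0) (x, y)"
  proof (rule D.is_resolvent_coords[OF x0p y0p _ _ lam, where \<delta> = \<delta>])
    have "y \<in> orthoscheme_complex D.MM" using y(2) complex_reverse by blast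
    then show "x \<in> D.points_L" "y \<in> D.points_M"
      using x(2,3) y(3) by (auto simp: D.points_L_def D.points_M_def)
    show "D.coords_L x i = D.coords_L x0 i - \<delta> i" if "i < n" for i
      using x(4)[OF that] ax[OF that] a4[OF that] by (simp add: D.coords_L_def)
    show "D.coords_M y (\<mu> i) = D.coords_M y0 (\<mu> i) + \<delta> i" if "i < n" for i
      using y(4)[OF \<mu>n[OF that]] by0[OF \<mu>n[OF that]] b4[OF that] rho_reverse[OF D.dualV y(2) \<mu>n[OF that]]
      by (simp add: D.coords_M_def)
    show "\<delta> i = (if i \<in> ?I then step_size ?\<kappa> lam (D.coords_L x0 i) (D.coords_M y0 (\<mu> i)) else 0)" if "i < n" for i
      using ax[OF that] by0[OF \<mu>n[OF that]] by (simp add: \<delta>_def)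
  qed simp
  ultimately show thesis using that s6 by blast
qed

theorem theorem3p9:
  fixes fmtL fmtM :: subspace_format
  shows "\<exists>(prog :: com) (T :: nat poly).
    \<forall>n \<ge> 1. \<forall>A \<in> carrier_mat n n. \<forall>lam > 0.
    \<forall>x0 \<in> orthoscheme_complex (subspace_lattice n).
    \<forall>y0 \<in> orthoscheme_complex (reverse_subspace_lattice n).
    \<forall>s :: 'k::field state. stored_input fmtL fmtM n A lam x0 y0 s \<longrightarrow>
      (\<exists>t s' z. runs prog s t s' \<and> t \<le> poly T n \<and> stored_output fmtL fmtM n z s' \<and>
        is_resolvent
          (orthoscheme_complex (subspace_lattice n) \<times>
           orthoscheme_complex (reverse_subspace_lattice n))
          (prod_dist (complex_dist (subspace_lattice n)) (complex_dist (reverse_subspace_lattice n)))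
          (\<lambda>z. (2 * real n + 1) *
            lovasz_extension_prod (subspace_lattice n) (reverse_subspace_lattice n)
              (\<lambda>P. real_of_int (rank_function n A P)) z)
          lam (x0, y0) z)"
proof -
  let ?p = "resolvent_prog fmtL fmtM"
  have "wf_prog ?p" "''n'' \<notin> iwrites ?p" by (simp_all add: resolvent_prog_def)
  \<comment> \<open>The bound depends on the state only through the cell \<open>n\<close>, so one
    polynomial serves all inputs.\<close>
  from compile_runs[OF this] obtain T :: "nat poly" where
    T: "\<And>s :: 'k state. \<exists>t \<le> poly T (imem s ''n'' []). runs (compile ?p) s t (sem ?p s)" by blast
  show ?thesis
  proof (intro exI[of _ "compile ?p"] exI[of _ T] allI impI ballI)
    fix n :: nat and A :: "'k mat" and lam :: real and x0 y0 :: "'k vec set \<Rightarrow> real" and s :: "'k state"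
    assume a: "A \<in> carrier_mat n n" "0 < lam" "x0 \<in> orthoscheme_complex (subspace_lattice n)"
      "y0 \<in> orthoscheme_complex (reverse_subspace_lattice n)" "stored_input fmtL fmtM n A lam x0 y0 s"
    have "imem s ''n'' [] = n" using a(5) by (simp add: stored_input_def)
    then obtain t where "t \<le> poly T n" "runs (compile ?p) s t (sem ?p s)" using T[of s] by auto
    then show "\<exists>t s' z. runs (compile ?p) s t s' \<and> t \<le> poly T n \<and> stored_output fmtL fmtM n z s' \<and>
        is_resolvent
          (orthoscheme_complex (subspace_lattice n) \<times>
           orthoscheme_complex (reverse_subspace_lattice n))
          (prod_dist (complex_dist (subspace_lattice n)) (complex_dist (reverse_subspace_lattice n)))
          (\<lambda>z. (2 * real n + 1) *
            lovasz_extension_prod (subspace_lattice n) (reverse_subspace_lattice n)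
              (\<lambda>P. real_of_int (rank_function n A P)) z)
          lam (x0, y0) z"
      using resolvent_prog_correct[OF a] by metis
  qed
qed

end
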